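(* Let $H$ be a seminormal $v$-noetherian weakly Krull monoid with $\emptyset \ne \mathfrak f = (H : \widehat H) \subsetneq H$. Set $\mathcal P^* = \{ \mathfrak p \in \mathfrak X(H) \mid \mathfrak p \supset \mathfrak f \}$ and $\mathcal P = \mathfrak X (H) \setminus \mathcal P^*$. 1. $\widehat H$ is Krull, $\mathcal P^*$ is finite and, for each $\mathfrak p \in \mathcal P$, $H_{\mathfrak p}$ is a discrete valuation monoid. For each $\mathfrak p \in \mathfrak X (H)$, $H_{\mathfrak p}$ is seminormal, $v$-noetherian and primary, and if $H$ is the multiplicative monoid of nonzero elements of a domain, then $H_{\mathfrak p}$ is even finitely primary for each $\mathfrak p\in\mathfrak X(H)$. 2. There is a monoid isomorphism $$\chi \colon \mathcal I_v^*(H) \to \mathcal F (\mathcal P) \times \prod_{\mathfrak p \in \mathcal P^*} (H_{\mathfrak p})_{\mathrm{red}} \quad\text{satisfying}\quad \chi|_{\mathcal P} = \mathrm{id}_{\mathcal P}.$$ Moreover, $\mathcal I_v^* (H)$ is seminormal, $v$-noetherian and weakly factorial, and the $v$-class group $\mathcal C_v (H)$ is isomorphic to the weak divisor class group $\mathcal C (H)$. 3. Suppose that $H_{\mathfrak p}$ is finitely primary for each $\mathfrak p \in \mathfrak X (H)$. (a) There is an exact sequence $$1\rightarrow \widehat{H}^\times/H^\times\rightarrow\coprod_{\mathfrak{p}\in \mathfrak{X}(H)}\widehat{H}_{\mathfrak{p}}^\times/H^\times_{\mathfrak{p}}\overset{\varepsilon}{\rightarrow} \mathcal{C}_v(H)\overset{\overline{\vartheta}}{\rightarrow}\mathcal{C}_v(\widehat{H})\rightarrow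 0 .$$ (b) Suppose that $\widehat H_{\mathfrak p}^{\times}/H_{\mathfrak p}^{\times}$ is finite for each $\mathfrak p \in \mathcal P^*$. Then $\mathcal I_v^* (H)$ is a C-monoid, and if $\mathcal C_v (H)$ is finite, then $H$ is a C-monoid.
   Context: A monoid is a commutative cancellative semigroup with unit element. For a monoid $H$: $H^\times$ is its group of units, $H_{\mathrm{red}}=H/H^\times=\{aH^\times\mid a\in H\}$, $\mathsf q(H)$ is its quotient group, $\mathcal F(P)$ is the free abelian monoid with basis $P$. The coproduct $\coprod_{i} D_i$ of monoids (or groups) consists of families $(a_i)$ with $a_i=1$ for almost all $i$. Ideals. An ideal ($s$-ideal) of $H$ is a subset $A\subset H$ with $AH=A$ (possibly empty); prime and radical ideals are defined as usual. $\mathfrak X(H)$ is the set of minimal non-empty prime $s$-ideals. For $A,B\subset \mathsf q(H)$, $(A:B)=\{x\in\mathsf q(H)\mid xB\subset A\}$, $A^{-1}=(H:A)$, $A_v=(A^{-1})^{-1}$; $A$ is a $v$-ideal of $H$ if $A \subset H$ and $A=A_v$. $H$ is $v$-noetherian if it satisfies the ascending chain condition on $v$-ideals. $\mathcal I_v^*(H)$ is the monoid of $v$-invertible $v$-ideals $\mathfrak a$ (i.e. $(\mathfrak a\mathfrak a^{-1})_v=H$) with multiplication $(\mathfrak a,\mathfrak b)\mapsto(\mathfrak a\mathfrak b)_v$; the $v$-class group $\mathcal C_v(H)$ is $\mathsf q(\mathcal I_v^*(H))$ modulo the subgroup of principal fractional ideals $aH$, $a\in\mathsf q(H)$. $H_{\mathfrak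 p}=(H\setminus\mathfrak p)^{-1}H$ is the localization. $\widehat H=\{x\in\mathsf q(H)\mid \exists c\in H\ \forall n\in\mathbb N:\ cx^n\in H\}$ is the complete integral closure, and $\widehat H_{\mathfrak p}=(H\setminus\mathfrak p)^{-1}\widehat H$ (which equals $\widehat{H_{\mathfrak p}}$). $H$ is seminormal if $x\in\mathsf q(H)$, $x^2,x^3\in H$ imply $x\in H$. $H$ is weakly Krull if $H=\bigcap_{\mathfrak p\in\mathfrak X(H)}H_{\mathfrak p}$ and $\{\mathfrak p\in\mathfrak X(H)\mid a\in\mathfrak p\}$ is finite for all $a\in H$. $\mathcal C(H)$, the weak divisor class group, is the cokernel of the map $\mathsf q(H)\to\coprod_{\mathfrak p\in\mathfrak X(H)}\mathsf q(H)/H_{\mathfrak p}^\times$, $x\mapsto(xH_{\mathfrak p}^\times)_{\mathfrak p}$. A discrete valuation monoid is a monoid $D$ with $D_{\mathrm{red}}\cong(\mathbb N_0,+)$. $H$ is Krull if it is weakly Krull and every $H_{\mathfrak p}$, $\mathfrak p\in\mathfrak X(H)$, is a discrete valuation monoid (equivalently, $v$-noetherian with $H=\widehat H$). A non-unit $q\in H$ is primary if $q\mid ab$ implies $q\mid a$ or $q\mid b^n$ for some $n\in\mathbb N$. $H$ is primary if $H\ne H^\times$ and every non-unit is primary; $H$ is weakly factorial if every non-unit is a finite product of primary elements. A monoid $D$ is finitely primary (of rank $s$ and exponent $\alpha$, $s,\alpha\in\mathbb N$) if it is a submonoid of a factorial monoid $F=F^\times\times[q_1,\ldots,q_s]$ with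 $s$ pairwise non-associated primes $q_1,\ldots,q_s$ such that $D\setminus D^\times\subset q_1\cdots q_sF$ and $(q_1\cdots q_s)^\alpha F\subset D$. C-monoid: let $F$ be a factorial monoid and $H\subset F$ a submonoid. Elements $y,y'\in F$ are $H$-equivalent if for all $x\in F$: $xy\in H\Leftrightarrow xy'\in H$. $H$ is a C-monoid if for some factorial monoid $F\supset H$ one has $H\cap F^\times=H^\times$ and the set of $H$-equivalence classes of elements of $(F\setminus F^\times)\cup\{1\}$ is finite. In 2., each $\mathfrak p\in\mathcal P$ is a $v$-invertible $v$-ideal of $H$, so $\mathcal P\subset\mathcal I_v^*(H)$. In 3.(a): $\varepsilon$ is induced by the inclusion $\coprod_{\mathfrak p}\widehat H_{\mathfrak p}^\times/H_{\mathfrak p}^\times\subset\coprod_{\mathfrak p}\mathsf q(H)/H_{\mathfrak p}^\times$, the canonical map onto $\mathcal C(H)$ and the isomorphism $\mathcal C_v(H)\cong\mathcal C(H)$ that is induced by $\mathfrak a\mapsto(a_{\mathfrak p}H_{\mathfrak p}^\times)_{\mathfrak p}$ for $\mathfrak a\in\mathcal I_v^*(H)$, where $\mathfrak a_{\mathfrak p}=a_{\mathfrak p}H_{\mathfrak p}$; and $\overline\vartheta([\mathfrak a])=[\mathfrak a_{v(\widehat H)}]$ with $\mathfrak a_{v(\widehat H)}=(\widehat H:(\widehat H:\mathfrak a))$. *)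

theory Defs
  imports
    "HOL-Algebra.Product_Groups"
    "HOL-Algebra.Multiplicative_Group"
    "HOL-Algebra.Divisibility"
begin

section \<open>Monoids inside their quotient groups\<close>

text \<open>A monoid is commutative and cancellative, so it embeds into its quotient group. As usual, we
regard a monoid as a subset \<open>H\<close> of its quotient group \<open>Q\<close>, and all
overmonoids of \<open>H\<close> occurring below (localizations, the complete integral closure) are subsets of
the same \<open>Q\<close>. The monoid \<open>H\<close> as a structure of its own is \<open>Q\<lparr>carrier := H\<rparr>\<close>.\<close>

locale quotient_group_of = comm_group Q + submonoid H Q
  for Q :: "('a, 'm) monoid_scheme" (structure) and H :: "'a set" +
  assumes quotient: "x \<in> carrier Q \<Longrightarrow> \<exists>a\<in>H. \<exists>b\<in>H. x = a \<otimes> inv b"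

text \<open>For a monoid that is not given as a subset of a group we construct the quotient group: the
fraction \<open>a/b\<close> is the set of all pairs \<open>(c, d)\<close> with \<open>ad = cb\<close>.\<close>

definition fraction :: "('a, 'm) monoid_scheme \<Rightarrow> 'a \<Rightarrow> 'a \<Rightarrow> ('a \<times> 'a) set" where
  "fraction M a b = {(c, d). c \<in> carrier M \<and> d \<in> carrier M \<and> a \<otimes>\<^bsub>M\<^esub> d = c \<otimes>\<^bsub>M\<^esub> b}"

definition quot_group :: "('a, 'm) monoid_scheme \<Rightarrow> ('a \<times> 'a) set monoid" where
  "quot_group M =
    \<lparr>carrier = {fraction M a b | a b. a \<in> carrier M \<and> b \<in> carrier M},
     monoid.mult = (\<lambda>X Y. \<Union>(a, b)\<in>X. \<Union>(c, d)\<in>Y. fraction M (a \<otimes>\<^bsub>M\<^esub> c) (b \<otimes>\<^bsub>M\<^esub> d)),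
     one = fraction M \<one>\<^bsub>M\<^esub> \<one>\<^bsub>M\<^esub>\<rparr>"

definition quot_embed :: "('a, 'm) monoid_scheme \<Rightarrow> 'a \<Rightarrow> ('a \<times> 'a) set" where
  "quot_embed M a = fraction M a \<one>\<^bsub>M\<^esub>"

definition monoid_red :: "('a, 'm) monoid_scheme \<Rightarrow> 'a set monoid" where
  "monoid_red M =
    \<lparr>carrier = (\<lambda>a. Units M #>\<^bsub>M\<^esub> a) ` carrier M, monoid.mult = set_mult M, one = Units M\<rparr>"

definition free_abelian_monoid :: "'p set \<Rightarrow> 'p multiset monoid" where
  "free_abelian_monoid P =
    \<lparr>carrier = {A. set_mset A \<subseteq> P}, monoid.mult = (+), one = {#}\<rparr>"

definition nat_add_monoid :: "nat monoid" where
  "nat_add_monoid = \<lparr>carrier = UNIV, monoid.mult = (+), one = 0\<rparr>"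

section \<open>Ideals\<close>

definition s_ideal :: "('a, 'm) monoid_scheme \<Rightarrow> 'a set \<Rightarrow> 'a set \<Rightarrow> bool" where
  "s_ideal Q H A \<longleftrightarrow> A \<subseteq> H \<and> A <#>\<^bsub>Q\<^esub> H = A"

definition prime_s_ideal :: "('a, 'm) monoid_scheme \<Rightarrow> 'a set \<Rightarrow> 'a set \<Rightarrow> bool" where
  "prime_s_ideal Q H p \<longleftrightarrow> s_ideal Q H p \<and> p \<noteq> H \<and>
    (\<forall>a\<in>H. \<forall>b\<in>H. a \<otimes>\<^bsub>Q\<^esub> b \<in> p \<longrightarrow> a \<in> p \<or> b \<in> p)"

definition min_primes :: "('a, 'm) monoid_scheme \<Rightarrow> 'a set \<Rightarrow> 'a set set" where
  "min_primes Q H = {p. prime_s_ideal Q H p \<and> p \<noteq> {} \<and>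
    (\<forall>p'. prime_s_ideal Q H p' \<and> p' \<noteq> {} \<and> p' \<subseteq> p \<longrightarrow> p' = p)}"

definition colon :: "('a, 'm) monoid_scheme \<Rightarrow> 'a set \<Rightarrow> 'a set \<Rightarrow> 'a set" where
  "colon Q A B = {x \<in> carrier Q. x <#\<^bsub>Q\<^esub> B \<subseteq> A}"

definition v_closure :: "('a, 'm) monoid_scheme \<Rightarrow> 'a set \<Rightarrow> 'a set \<Rightarrow> 'a set" where
  "v_closure Q H A = colon Q H (colon Q H A)"

definition v_ideal :: "('a, 'm) monoid_scheme \<Rightarrow> 'a set \<Rightarrow> 'a set \<Rightarrow> bool" where
  "v_ideal Q H A \<longleftrightarrow> A \<subseteq> H \<and> v_closure Q H A = A"

definition v_noetherian :: "('a, 'm) monoid_scheme \<Rightarrow> 'a set \<Rightarrow> bool" where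
  "v_noetherian Q H \<longleftrightarrow>
    (\<forall>A :: nat \<Rightarrow> 'a set. (\<forall>n. v_ideal Q H (A n)) \<and> (\<forall>n. A n \<subseteq> A (Suc n)) \<longrightarrow>
      (\<exists>n. \<forall>m\<ge>n. A m = A n))"

definition v_invertible :: "('a, 'm) monoid_scheme \<Rightarrow> 'a set \<Rightarrow> 'a set \<Rightarrow> bool" where
  "v_invertible Q H A \<longleftrightarrow> v_closure Q H (A <#>\<^bsub>Q\<^esub> colon Q H A) = H"

definition v_inv_monoid :: "('a, 'm) monoid_scheme \<Rightarrow> 'a set \<Rightarrow> 'a set monoid" where
  "v_inv_monoid Q H =
    \<lparr>carrier = {A. v_ideal Q H A \<and> v_invertible Q H A},
     monoid.mult = (\<lambda>A B. v_closure Q H (A <#>\<^bsub>Q\<^esub> B)), one = H\<rparr>"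

text \<open>In \<open>\<q>(\<I>\<^sub>v\<^sup>*(H))\<close>, the principal fractional ideal \<open>xH\<close> with \<open>x = b/c\<close>, \<open>b, c \<in> H\<close>, is the
fraction \<open>bH/cH\<close>.\<close>

definition principal_fracs :: "('a, 'm) monoid_scheme \<Rightarrow> 'a set \<Rightarrow> ('a set \<times> 'a set) set set" where
  "principal_fracs Q H =
    {fraction (v_inv_monoid Q H) (b <#\<^bsub>Q\<^esub> H) (c <#\<^bsub>Q\<^esub> H) | b c. b \<in> H \<and> c \<in> H}"

definition v_class_group :: "('a, 'm) monoid_scheme \<Rightarrow> 'a set \<Rightarrow> ('a set \<times> 'a set) set set monoid"
  where "v_class_group Q H = quot_group (v_inv_monoid Q H) Mod principal_fracs Q H"

definition v_class :: "('a, 'm) monoid_scheme \<Rightarrow> 'a set \<Rightarrow> 'a set \<Rightarrow> ('a set \<times> 'a set) set set"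
  where "v_class Q H A =
    principal_fracs Q H #>\<^bsub>quot_group (v_inv_monoid Q H)\<^esub> quot_embed (v_inv_monoid Q H) A"

section \<open>Localizations and classes of monoids\<close>

text \<open>\<open>(H - p)\<^sup>-\<^sup>1A\<close>; with \<open>A = H\<close>, with \<open>A\<close> the complete integral closure, and with \<open>A\<close> an ideal this
gives the localizations at \<open>p\<close> of the respective objects.\<close>

definition localize :: "('a, 'm) monoid_scheme \<Rightarrow> 'a set \<Rightarrow> 'a set \<Rightarrow> 'a set \<Rightarrow> 'a set" where
  "localize Q H p A = {inv\<^bsub>Q\<^esub> t \<otimes>\<^bsub>Q\<^esub> a | t a. t \<in> H - p \<and> a \<in> A}"

definition complete_int_closure :: "('a, 'm) monoid_scheme \<Rightarrow> 'a set \<Rightarrow> 'a set" where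
  "complete_int_closure Q H =
    {x \<in> carrier Q. \<exists>c\<in>H. \<forall>n::nat. c \<otimes>\<^bsub>Q\<^esub> x [^]\<^bsub>Q\<^esub> n \<in> H}"

definition seminormal :: "('a, 'm) monoid_scheme \<Rightarrow> 'a set \<Rightarrow> bool" where
  "seminormal Q H \<longleftrightarrow>
    (\<forall>x\<in>carrier Q. x [^]\<^bsub>Q\<^esub> (2::nat) \<in> H \<and> x [^]\<^bsub>Q\<^esub> (3::nat) \<in> H \<longrightarrow> x \<in> H)"

text \<open>The intersection is taken inside \<open>Q\<close>, so that a group, which has no non-empty prime ideals,
is weakly Krull.\<close>

definition weakly_krull :: "('a, 'm) monoid_scheme \<Rightarrow> 'a set \<Rightarrow> bool" where
  "weakly_krull Q H \<longleftrightarrow>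
    H = carrier Q \<inter> (\<Inter>p\<in>min_primes Q H. localize Q H p H) \<and>
    (\<forall>a\<in>H. finite {p \<in> min_primes Q H. a \<in> p})"

definition discrete_valuation_monoid :: "('a, 'm) monoid_scheme \<Rightarrow> bool" where
  "discrete_valuation_monoid D \<longleftrightarrow> comm_monoid_cancel D \<and> monoid_red D \<cong> nat_add_monoid"

definition krull :: "('a, 'm) monoid_scheme \<Rightarrow> 'a set \<Rightarrow> bool" where
  "krull Q H \<longleftrightarrow> weakly_krull Q H \<and>
    (\<forall>p\<in>min_primes Q H. discrete_valuation_monoid (Q\<lparr>carrier := localize Q H p H\<rparr>))"

definition primary_elem :: "('a, 'm) monoid_scheme \<Rightarrow> 'a \<Rightarrow> bool" where
  "primary_elem M q \<longleftrightarrow> q \<in> carrier M - Units M \<and>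
    (\<forall>a\<in>carrier M. \<forall>b\<in>carrier M. q divides\<^bsub>M\<^esub> (a \<otimes>\<^bsub>M\<^esub> b) \<longrightarrow>
      q divides\<^bsub>M\<^esub> a \<or> (\<exists>n::nat. q divides\<^bsub>M\<^esub> (b [^]\<^bsub>M\<^esub> n)))"

definition primary_monoid :: "('a, 'm) monoid_scheme \<Rightarrow> bool" where
  "primary_monoid M \<longleftrightarrow> comm_monoid_cancel M \<and> carrier M \<noteq> Units M \<and>
    (\<forall>q\<in>carrier M - Units M. primary_elem M q)"

definition weakly_factorial :: "('a, 'm) monoid_scheme \<Rightarrow> bool" where
  "weakly_factorial M \<longleftrightarrow> comm_monoid_cancel M \<and>
    (\<forall>a\<in>carrier M - Units M. \<exists>qs. (\<forall>q\<in>set qs. primary_elem M q) \<and>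
      a = foldr (\<otimes>\<^bsub>M\<^esub>) qs \<one>\<^bsub>M\<^esub>)"

text \<open>The factorial overmonoid \<open>F\<close> of a finitely primary monoid \<open>D\<close> may be looked for
inside the quotient group \<open>Q\<close> of \<open>D\<close>: for \<open>x \<in> F\<close>, both \<open>(q\<^sub>1 \<cdots> q\<^sub>s)\<^sup>\<alpha>\<close> and \<open>(q\<^sub>1 \<cdots> q\<^sub>s)\<^sup>\<alpha> x\<close> are in \<open>D\<close>.\<close>

definition finitely_primary :: "('a, 'm) monoid_scheme \<Rightarrow> 'a set \<Rightarrow> bool" where
  "finitely_primary Q D \<longleftrightarrow>
    (\<exists>F (s::nat) (\<alpha>::nat) q. let F' = Q\<lparr>carrier := F\<rparr>; q_prod = finprod Q q {..<s} in
      submonoid F Q \<and> submonoid D Q \<and> D \<subseteq> F \<and> factorial_monoid F' \<and> s \<ge> 1 \<and> \<alpha> \<ge> 1 \<and>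
      (\<forall>i<s. q i \<in> F \<and> Divisibility.prime F' (q i)) \<and>
      (\<forall>i<s. \<forall>j<s. i \<noteq> j \<longrightarrow> \<not> q i \<sim>\<^bsub>F'\<^esub> q j) \<and>
      (\<forall>x\<in>F. \<exists>u\<in>Units F'. \<exists>e :: nat \<Rightarrow> nat.
        x = u \<otimes>\<^bsub>Q\<^esub> finprod Q (\<lambda>i. q i [^]\<^bsub>Q\<^esub> e i) {..<s}) \<and>
      D - Units (Q\<lparr>carrier := D\<rparr>) \<subseteq> q_prod <#\<^bsub>Q\<^esub> F \<and>
      (q_prod [^]\<^bsub>Q\<^esub> \<alpha>) <#\<^bsub>Q\<^esub> F \<subseteq> D)"

definition equiv_in :: "('f, 'm) monoid_scheme \<Rightarrow> 'f set \<Rightarrow> ('f \<times> 'f) set" where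
  "equiv_in F K = {(y, y'). y \<in> carrier F \<and> y' \<in> carrier F \<and>
    (\<forall>x\<in>carrier F. x \<otimes>\<^bsub>F\<^esub> y \<in> K \<longleftrightarrow> x \<otimes>\<^bsub>F\<^esub> y' \<in> K)}"

text \<open>\<open>K\<close> is the copy of \<open>H\<close> in the factorial monoid \<open>F\<close>. As \<open>F\<close> only matters up to isomorphism, fixing
the type of its elements is no restriction. Write \<open>F = F\<^sup>\<times> \<times> \<F>(P)\<close> and let \<open>F'\<close> be generated by those \<open>p \<in> P\<close> that divide some
element of \<open>H\<close> and by the group generated by the \<open>F\<^sup>\<times>\<close>-components of the elements of \<open>H\<close>. Then
\<open>F'\<close> is factorial, contains \<open>H\<close>, has all required properties if \<open>F\<close> has them,
and has at most \<open>|H|\<close> elements if \<open>H\<close> is infinite. If \<open>H\<close> is finite, then it is a group, and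
\<open>F = H\<close> has all required properties.\<close>

definition c_monoid :: "('a, 'm) monoid_scheme \<Rightarrow> bool" where
  "c_monoid H \<longleftrightarrow>
    (\<exists>(F :: ('a \<times> 'a) set monoid) K.
      factorial_monoid F \<and> submonoid K F \<and> F\<lparr>carrier := K\<rparr> \<cong> H \<and>
      K \<inter> Units F = Units (F\<lparr>carrier := K\<rparr>) \<and>
      finite (((carrier F - Units F) \<union> {\<one>\<^bsub>F\<^esub>}) // equiv_in F K))"

section \<open>The weak divisor class group\<close>

definition weak_divisors :: "('a, 'm) monoid_scheme \<Rightarrow> 'a set \<Rightarrow> ('a set \<Rightarrow> 'a set) monoid" where
  "weak_divisors Q H = sum_group (min_primes Q H)
    (\<lambda>p. Q Mod Units (Q\<lparr>carrier := localize Q H p H\<rparr>))"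

definition local_unit_cosets :: "('a, 'm) monoid_scheme \<Rightarrow> 'a set \<Rightarrow> ('a set \<Rightarrow> 'a) \<Rightarrow> 'a set \<Rightarrow> 'a set"
  where "local_unit_cosets Q H x =
    (\<lambda>p\<in>min_primes Q H. Units (Q\<lparr>carrier := localize Q H p H\<rparr>) #>\<^bsub>Q\<^esub> x p)"

definition principal_weak_divisors ::
    "('a, 'm) monoid_scheme \<Rightarrow> 'a set \<Rightarrow> ('a set \<Rightarrow> 'a set) set" where
  "principal_weak_divisors Q H = (\<lambda>x. local_unit_cosets Q H (\<lambda>p. x)) ` carrier Q"

definition weak_class_group ::
    "('a, 'm) monoid_scheme \<Rightarrow> 'a set \<Rightarrow> ('a set \<Rightarrow> 'a set) set monoid" where
  "weak_class_group Q H = weak_divisors Q H Mod principal_weak_divisors Q H"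

definition weak_class ::
    "('a, 'm) monoid_scheme \<Rightarrow> 'a set \<Rightarrow> ('a set \<Rightarrow> 'a set) \<Rightarrow> ('a set \<Rightarrow> 'a set) set" where
  "weak_class Q H y = principal_weak_divisors Q H #>\<^bsub>weak_divisors Q H\<^esub> y"

text \<open>\<open>\<psi>\<close> is the isomorphism from the \<open>v\<close>-class group to the weak divisor class group induced by
\<open>A \<mapsto> (x\<^sub>p H\<^sub>p\<^sup>\<times>)\<^sub>p\<close>, where \<open>A\<^sub>p = x\<^sub>p H\<^sub>p\<close>. It is unique, since the classes of the elements of
\<open>\<I>\<^sub>v\<^sup>*(H)\<close> exhaust the \<open>v\<close>-class group and \<open>x\<^sub>p H\<^sub>p\<close> determines \<open>x\<^sub>p H\<^sub>p\<^sup>\<times>\<close>.\<close>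

definition canonical_class_iso ::
    "('a, 'm) monoid_scheme \<Rightarrow> 'a set \<Rightarrow>
     (('a set \<times> 'a set) set set \<Rightarrow> ('a set \<Rightarrow> 'a set) set) \<Rightarrow> bool" where
  "canonical_class_iso Q H \<psi> \<longleftrightarrow>
    \<psi> \<in> iso (v_class_group Q H) (weak_class_group Q H) \<and>
    (\<forall>A\<in>carrier (v_inv_monoid Q H). \<exists>x.
      (\<forall>p\<in>min_primes Q H. x p \<in> carrier Q \<and> localize Q H p A = x p <#\<^bsub>Q\<^esub> localize Q H p H) \<and>
      local_unit_cosets Q H x \<in> carrier (weak_divisors Q H) \<and>
      \<psi> (v_class Q H A) = weak_class Q H (local_unit_cosets Q H x))"

end

theory Submission
  imports Defs
begin

text \<open>Everything is read off the localizations. Because \<open>H\<close> is weakly Krull and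
\<open>v\<close>-noetherian, a \<open>v\<close>-invertible \<open>v\<close>-ideal is locally
principal, and a family of local generators \<open>x\<^sub>p\<close>, almost all of them units, can
be prescribed arbitrarily; hence, writing \<open>L p\<close> for the localization at
\<open>p\<close> and \<open>U p\<close> for its units, \<open>\<I>\<^sub>v\<^sup>*(H)\<close> is the
positive part of the coproduct of the groups \<open>\<q>(H)/U p\<close>, which gives the second
part.

Since \<open>H\<close> is seminormal, the non-units of the primary monoid \<open>L p\<close> are
exactly the elements that have positive value at all primes of the complete integral closure above
\<open>p\<close>; these primes give finitely many discrete valuations. So up to its units \<open>L
p\<close> is determined by these values. If \<open>L p\<close> is finitely primary, or in the case
of a domain, the values are independent, so that every divisor of the complete integral closure
lifts to a divisor of \<open>H\<close>; this is the surjectivity at the end of the exact sequence.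

For the C-monoid property the factorial overmonoid consists of the elements that are non-negative at
all these valuations: whether \<open>xy\<close> lies in the submonoid depends on \<open>y\<close>
only through the set of valuations above the conductor at which \<open>y\<close> is positive, a
class in a finite class group and, where \<open>y\<close> is a local unit, its coset modulo \<open>U
p\<close>.\<close>

text \<open>Two obstacles shape the argument. There is no addition, so the finitely many valuations
  above one \<open>p\<close> cannot in general be approximated independently; finite primariness
  supplies exactly this independence, and for a domain it has to be won from the addition of the
  ring, which survives on \<open>Q\<close> only as a partial operation. Secondly, every descent to a
  localization needs one denominator for infinitely many conditions; the chain condition provides
  it, because a subset of \<open>H\<close> has the same inverse as one of its finite subsets. The
  conductor works in the other direction: one of its elements is a denominator for the whole
  complete integral closure. For \<open>H\<close> itself the divisors of the closure do not suffice
  as a factorial overmonoid, since they forget units; the units of the closure are added as a direct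
  factor, and \<open>Q\<close> maps into it because \<open>Q\<close> modulo these units embeds in a
  free abelian group.\<close>

section \<open>Cancellation rules and the \<open>v\<close>-closure in an abelian group\<close>

context comm_group
begin

text \<open>AC rewriting sorts the factors of a product and may leave \<open>x\<close> and
  \<open>inv x\<close> several places apart; there is one rule for each small distance at which the
  pair can stand.\<close>

lemma cancel_simps:
  "\<lbrakk>x \<in> carrier G; y \<in> carrier G\<rbrakk> \<Longrightarrow> x \<otimes> (inv x \<otimes> y) = y"
  "\<lbrakk>x \<in> carrier G; y \<in> carrier G\<rbrakk> \<Longrightarrow> inv x \<otimes> (x \<otimes> y) = y"
  "\<lbrakk>x \<in> carrier G; y \<in> carrier G\<rbrakk> \<Longrightarrow> x \<otimes> (y \<otimes> inv x) = y"
  "\<lbrakk>x \<in> carrier G; y \<in> carrier G\<rbrakk> \<Longrightarrow> inv x \<otimes> (y \<otimes> x) = y"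
  "\<lbrakk>x \<in> carrier G; y \<in> carrier G; z \<in> carrier G\<rbrakk> \<Longrightarrow> x \<otimes> (y \<otimes> (inv x \<otimes> z)) = y \<otimes> z"
  "\<lbrakk>x \<in> carrier G; y \<in> carrier G; z \<in> carrier G\<rbrakk> \<Longrightarrow> inv x \<otimes> (y \<otimes> (x \<otimes> z)) = y \<otimes> z"
  "\<lbrakk>x \<in> carrier G; y \<in> carrier G; z \<in> carrier G\<rbrakk> \<Longrightarrow> x \<otimes> (y \<otimes> (z \<otimes> inv x)) = y \<otimes> z"
  "\<lbrakk>x \<in> carrier G; y \<in> carrier G; z \<in> carrier G\<rbrakk> \<Longrightarrow> inv x \<otimes> (y \<otimes> (z \<otimes> x)) = y \<otimes> z"
  "\<lbrakk>x \<in> carrier G; y \<in> carrier G; z \<in> carrier G; w \<in> carrier G\<rbrakk>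
    \<Longrightarrow> x \<otimes> (y \<otimes> (z \<otimes> (inv x \<otimes> w))) = y \<otimes> (z \<otimes> w)"
  "\<lbrakk>x \<in> carrier G; y \<in> carrier G; z \<in> carrier G; w \<in> carrier G\<rbrakk>
    \<Longrightarrow> x \<otimes> (y \<otimes> (z \<otimes> (w \<otimes> inv x))) = y \<otimes> (z \<otimes> w)"
  "\<lbrakk>x \<in> carrier G; y \<in> carrier G; z \<in> carrier G; w \<in> carrier G; v \<in> carrier G\<rbrakk>
    \<Longrightarrow> x \<otimes> (y \<otimes> (z \<otimes> (w \<otimes> (inv x \<otimes> v)))) = y \<otimes> (z \<otimes> (w \<otimes> v))"
proof -
  have c: "x \<otimes> (inv x \<otimes> y) = y" "inv x \<otimes> (x \<otimes> y) = y"
    if "x \<in> carrier G" "y \<in> carrier G" for x y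
    using that by (simp_all add: m_assoc[symmetric])
  then show "\<lbrakk>x \<in> carrier G; y \<in> carrier G\<rbrakk> \<Longrightarrow> x \<otimes> (inv x \<otimes> y) = y"
    "\<lbrakk>x \<in> carrier G; y \<in> carrier G\<rbrakk> \<Longrightarrow> inv x \<otimes> (x \<otimes> y) = y" by auto
  have l: "x \<otimes> (y \<otimes> z) = y \<otimes> (x \<otimes> z)"
    if "x \<in> carrier G" "y \<in> carrier G" "z \<in> carrier G" for x y z using that by (rule m_lcomm)
  show "\<lbrakk>x \<in> carrier G; y \<in> carrier G\<rbrakk> \<Longrightarrow> x \<otimes> (y \<otimes> inv x) = y"
    by (simp add: l[of "x"] c)
  show "\<lbrakk>x \<in> carrier G; y \<in> carrier G\<rbrakk> \<Longrightarrow> inv x \<otimes> (y \<otimes> x) = y"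
    by (simp add: l[of "inv x"] c)
  show "\<lbrakk>x \<in> carrier G; y \<in> carrier G; z \<in> carrier G\<rbrakk> \<Longrightarrow> x \<otimes> (y \<otimes> (inv x \<otimes> z)) = y \<otimes> z"
    by (simp add: l[of "x"] c)
  show "\<lbrakk>x \<in> carrier G; y \<in> carrier G; z \<in> carrier G\<rbrakk> \<Longrightarrow> inv x \<otimes> (y \<otimes> (x \<otimes> z)) = y \<otimes> z"
    by (simp add: l[of "inv x"] c)
  show "\<lbrakk>x \<in> carrier G; y \<in> carrier G; z \<in> carrier G\<rbrakk> \<Longrightarrow> x \<otimes> (y \<otimes> (z \<otimes> inv x)) = y \<otimes> z"
    by (simp add: l[of "x"] c)
  show "\<lbrakk>x \<in> carrier G; y \<in> carrier G; z \<in> carrier G\<rbrakk> \<Longrightarrow> inv x \<otimes> (y \<otimes> (z \<otimes> x)) = y \<otimes> z"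
    by (simp add: l[of "inv x"] c)
  show "\<lbrakk>x \<in> carrier G; y \<in> carrier G; z \<in> carrier G; w \<in> carrier G\<rbrakk> \<Longrightarrow> x \<otimes> (y \<otimes> (z \<otimes> (inv x \<otimes> w))) = y \<otimes> (z \<otimes> w)"
    by (simp add: l[of "x"] c)
  show "\<lbrakk>x \<in> carrier G; y \<in> carrier G; z \<in> carrier G; w \<in> carrier G\<rbrakk> \<Longrightarrow> x \<otimes> (y \<otimes> (z \<otimes> (w \<otimes> inv x))) = y \<otimes> (z \<otimes> w)"
    by (simp add: l[of "x"] c)
  show "\<lbrakk>x \<in> carrier G; y \<in> carrier G; z \<in> carrier G; w \<in> carrier G; v \<in> carrier G\<rbrakk> \<Longrightarrow> x \<otimes> (y \<otimes> (z \<otimes> (w \<otimes> (inv x \<otimes> v)))) = y \<otimes> (z \<otimes> (w \<otimes> v))"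
    by (simp add: l[of "x"] c)
qed

lemmas gsimps = m_assoc m_comm m_lcomm inv_mult cancel_simps

lemma Units_submonoid:
  assumes "submonoid S G" shows "Units (G\<lparr>carrier := S\<rparr>) = {x \<in> S. inv x \<in> S}"
proof -
  interpret submonoid S G by fact
  show ?thesis
  proof (rule Set.set_eqI)
    fix x
    have "inv x = y" if "x \<in> S" "y \<in> S" "x \<otimes> y = \<one>" for y
      using inv_equality[of y x] m_comm[of x y] subset that by auto
    moreover have "\<exists>y\<in>S. y \<otimes> x = \<one> \<and> x \<otimes> y = \<one>" if "x \<in> S" "inv x \<in> S"
      using that subset by (intro bexI[of _ "inv x"]) auto
    ultimately show "x \<in> Units (G\<lparr>carrier := S\<rparr>) \<longleftrightarrow> x \<in> {x \<in> S. inv x \<in> S}"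
      by (auto simp: Units_def)
  qed
qed

lemma Units_subgroup:
  assumes "submonoid S G" shows "subgroup (Units (G\<lparr>carrier := S\<rparr>)) G"
proof -
  interpret submonoid S G by fact
  show ?thesis
    unfolding Units_submonoid[OF assms]
    by (rule subgroup.intro) (use subset in \<open>auto simp: inv_mult subset_iff\<close>)
qed

lemma colon_iff: "x \<in> colon G A B \<longleftrightarrow> x \<in> carrier G \<and> (\<forall>b\<in>B. x \<otimes> b \<in> A)"
  by (auto simp: colon_def l_coset_def)

lemma colon_antimono: "B \<subseteq> B' \<Longrightarrow> colon G A B' \<subseteq> colon G A B"
  unfolding colon_iff subset_iff by blast

lemma colon_subset: "colon G A B \<subseteq> carrier G"
  by (auto simp: colon_iff)

lemma subset_v_closure: "B \<subseteq> carrier G \<Longrightarrow> B \<subseteq> v_closure G A B"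
proof
  fix b assume "B \<subseteq> carrier G" "b \<in> B"
  then show "b \<in> v_closure G A B"
    by (auto simp: colon_iff v_closure_def m_comm[of b])
qed

text \<open>\<open>colon G A\<close> reverses inclusions and \<open>B\<close> lies in its double
  colon, so this is an antitone Galois connection: three applications collapse to one.\<close>

lemma colon_v_closure: "B \<subseteq> carrier G \<Longrightarrow> colon G A (v_closure G A B) = colon G A B"
proof
  assume "B \<subseteq> carrier G"
  then show "colon G A (v_closure G A B) \<subseteq> colon G A B"
    by (intro colon_antimono subset_v_closure)
  show "colon G A B \<subseteq> colon G A (v_closure G A B)"
    using subset_v_closure[OF colon_subset] unfolding v_closure_def by blast
qed

lemma v_closure_colon: "B \<subseteq> carrier G \<Longrightarrow> v_closure G A (colon G A B) = colon G A B"
  using colon_v_closure unfolding v_closure_def by blast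

lemma v_closure_mono: "B \<subseteq> B' \<Longrightarrow> v_closure G A B \<subseteq> v_closure G A B'"
  unfolding v_closure_def by (intro colon_antimono)

lemma v_closure_idem: "B \<subseteq> carrier G \<Longrightarrow> v_closure G A (v_closure G A B) = v_closure G A B"
  by (simp add: v_closure_def[of _ _ "v_closure G A B"] colon_v_closure) (simp add: v_closure_def)

end

section \<open>Localizations\<close>

context quotient_group_of
begin

abbreviation "L p \<equiv> localize Q H p H"
abbreviation "U p \<equiv> Units (Q\<lparr>carrier := localize Q H p H\<rparr>)"

lemma in_carrier [simp, intro]: "x \<in> H \<Longrightarrow> x \<in> carrier Q"
  using subset by blast

lemma H_closed [simp, intro]: "x \<in> H \<Longrightarrow> y \<in> H \<Longrightarrow> x \<otimes> y \<in> H"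
  using submonoid.m_closed[OF is_submonoid] .

lemma H_one [simp, intro]: "\<one> \<in> H"
  using submonoid.one_closed[OF is_submonoid] .

lemma H_pow [simp, intro]: "x \<in> H \<Longrightarrow> x [^] (n::nat) \<in> H"
  by (induction n) auto

lemma H_finprod [intro]: "(\<And>i. i \<in> T \<Longrightarrow> g i \<in> H) \<Longrightarrow> finprod Q g T \<in> H"
proof (induction T rule: infinite_finite_induct)
  case (insert i T)
  then have "finprod Q g (insert i T) = g i \<otimes> finprod Q g T" by (intro finprod_insert) auto
  with insert show ?case by auto
qed (auto simp: finprod_infinite)

lemma frac:
  assumes "x \<in> carrier Q" obtains t where "t \<in> H" "t \<otimes> x \<in> H"
proof -
  obtain a b where "a \<in> H" "b \<in> H" "x = a \<otimes> inv b" using quotient assms by blast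
  then have "b \<otimes> x = a" by (simp add: gsimps)
  with \<open>a \<in> H\<close> \<open>b \<in> H\<close> that show ?thesis by auto
qed

text \<open>Localizations and the complete integral closure thus satisfy the hypotheses of this
  locale again, inside the same \<open>Q\<close>, and every result proved for \<open>H\<close> can
  be instantiated at them.\<close>

lemma overmonoid_quotient:
  assumes "submonoid S Q" "H \<subseteq> S" shows "quotient_group_of Q S"
proof -
  interpret S: submonoid S Q by fact
  show ?thesis
  proof (intro quotient_group_of.intro comm_group_axioms assms(1) quotient_group_of_axioms.intro)
    fix x assume "x \<in> carrier Q"
    from quotient[OF this] assms(2) show "\<exists>a\<in>S. \<exists>b\<in>S. x = a \<otimes> inv b" by blast
  qed
qed

text \<open>An ideal containing 1 is everything, so properness becomes a condition on 1, and
  \<open>p H = p\<close> reduces to absorption because 1 is in \<open>H\<close>. The empty ideal is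
  prime in this sense.\<close>

lemma prime_s_ideal_iff:
  "prime_s_ideal Q H p \<longleftrightarrow> p \<subseteq> H \<and> \<one> \<notin> p \<and> (\<forall>a\<in>p. \<forall>h\<in>H. a \<otimes> h \<in> p) \<and>
    (\<forall>a\<in>H. \<forall>b\<in>H. a \<otimes> b \<in> p \<longrightarrow> a \<in> p \<or> b \<in> p)" (is "?l \<longleftrightarrow> ?r")
proof
  assume ?l
  then have p: "p \<subseteq> H" "p <#> H = p" "p \<noteq> H" "\<forall>a\<in>H. \<forall>b\<in>H. a \<otimes> b \<in> p \<longrightarrow> a \<in> p \<or> b \<in> p"
    unfolding prime_s_ideal_def s_ideal_def by simp_all
  have c: "a \<otimes> h \<in> p" if "a \<in> p" "h \<in> H" for a h
    using p(2) that by (auto simp: set_mult_def)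
  have "\<one> \<notin> p"
  proof
    assume "\<one> \<in> p"
    have "h \<in> p" if "h \<in> H" for h using c[OF \<open>\<one> \<in> p\<close> that] that by simp
    with p show False by blast
  qed
  with c p show ?r by blast
next
  assume r: ?r
  have "p <#> H = p"
  proof
    show "p <#> H \<subseteq> p" using r by (auto simp: set_mult_def)
    show "p \<subseteq> p <#> H"
    proof
      fix a assume "a \<in> p"
      then have "a \<otimes> \<one> = a" using r by (intro r_one) auto
      then show "a \<in> p <#> H" using \<open>a \<in> p\<close> H_one unfolding set_mult_def by force
    qed
  qed
  with r H_one show ?l unfolding prime_s_ideal_def s_ideal_def by metis
qed

lemma primeD:
  assumes "prime_s_ideal Q H p"
  shows "p \<subseteq> H" "\<one> \<notin> p" "a \<in> p \<Longrightarrow> h \<in> H \<Longrightarrow> a \<otimes> h \<in> p" "a \<in> p \<Longrightarrow> h \<in> H \<Longrightarrow> h \<otimes> a \<in> p"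
    "a \<in> H \<Longrightarrow> b \<in> H \<Longrightarrow> a \<otimes> b \<in> p \<Longrightarrow> a \<in> p \<or> b \<in> p"
  using assms unfolding prime_s_ideal_iff
  by (auto simp: m_comm[of h a] subset_iff)

lemma prime_compl:
  assumes "prime_s_ideal Q H p"
  shows "s \<in> H - p \<Longrightarrow> t \<in> H - p \<Longrightarrow> s \<otimes> t \<in> H - p" "\<one> \<in> H - p"
    "s \<in> H - p \<Longrightarrow> s [^] (n::nat) \<in> H - p"
proof -
  show m: "s \<otimes> t \<in> H - p" if "s \<in> H - p" "t \<in> H - p" for s t using that primeD[OF assms] by blast
  show "\<one> \<in> H - p" using primeD[OF assms] by blast
  then show "s [^] (n::nat) \<in> H - p" if "s \<in> H - p"
  proof (induction n)
    case (Suc n)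
    from m[OF Suc.IH[OF Suc.prems] that] show ?case by simp
  qed simp
qed

lemma prime_finprod_compl:
  assumes "prime_s_ideal Q H p" "\<And>i. i \<in> T \<Longrightarrow> g i \<in> H - p" shows "finprod Q g T \<in> H - p"
  using assms(2)
proof (induction T rule: infinite_finite_induct)
  case (insert i T)
  then have "finprod Q g (insert i T) = g i \<otimes> finprod Q g T" by (intro finprod_insert) auto
  with insert prime_compl[OF assms(1)] show ?case by auto
qed (use prime_compl[OF assms(1)] in \<open>auto simp: finprod_infinite\<close>)

lemma localize_iff:
  assumes "A \<subseteq> carrier Q"
  shows "x \<in> localize Q H p A \<longleftrightarrow> x \<in> carrier Q \<and> (\<exists>t\<in>H - p. t \<otimes> x \<in> A)"
proof
  assume "x \<in> localize Q H p A"
  then obtain t a where ta: "t \<in> H - p" "a \<in> A" "x = inv t \<otimes> a" unfolding localize_def by blast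
  then have "t \<otimes> x = a" using assms by (auto simp: gsimps subset_iff)
  then have "t \<otimes> x \<in> A" "x \<in> carrier Q" using ta assms by auto
  with ta(1) show "x \<in> carrier Q \<and> (\<exists>t\<in>H - p. t \<otimes> x \<in> A)" by blast
next
  assume "x \<in> carrier Q \<and> (\<exists>t\<in>H - p. t \<otimes> x \<in> A)"
  then obtain t where t: "x \<in> carrier Q" "t \<in> H - p" "t \<otimes> x \<in> A" by blast
  then have "x = inv t \<otimes> (t \<otimes> x)" by (simp add: gsimps)
  with t show "x \<in> localize Q H p A" unfolding localize_def by blast
qed

lemmas L_iff = localize_iff[OF subset]

lemma localizeE:
  assumes "x \<in> localize Q H p A" "A \<subseteq> carrier Q"
  obtains t where "t \<in> H - p" "t \<otimes> x \<in> A" "x \<in> carrier Q"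
  using assms localize_iff by blast

lemma localizeI:
  assumes "t \<in> H - p" "t \<otimes> x \<in> A" "x \<in> carrier Q" "A \<subseteq> carrier Q"
  shows "x \<in> localize Q H p A"
  using assms localize_iff by blast

lemma localize_subset_carrier: "A \<subseteq> carrier Q \<Longrightarrow> localize Q H p A \<subseteq> carrier Q"
  using localize_iff by blast

lemma localize_mono: "A \<subseteq> B \<Longrightarrow> localize Q H p A \<subseteq> localize Q H p B"
  unfolding localize_def by blast

lemma localize_mult:
  assumes p: "prime_s_ideal Q H p" and A: "A \<subseteq> carrier Q" and B: "B \<subseteq> carrier Q"
    and C: "C \<subseteq> carrier Q" "\<And>a b. a \<in> A \<Longrightarrow> b \<in> B \<Longrightarrow> a \<otimes> b \<in> C"
    and x: "x \<in> localize Q H p A" and y: "y \<in> localize Q H p B"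
  shows "x \<otimes> y \<in> localize Q H p C"
proof -
  obtain s where s: "s \<in> H - p" "s \<otimes> x \<in> A" "x \<in> carrier Q" using localizeE[OF x A] .
  obtain t where t: "t \<in> H - p" "t \<otimes> y \<in> B" "y \<in> carrier Q" using localizeE[OF y B] .
  have "(s \<otimes> t) \<otimes> (x \<otimes> y) = (s \<otimes> x) \<otimes> (t \<otimes> y)" using s t by (simp add: gsimps)
  with C(2)[OF s(2) t(2)] s t show ?thesis
    using prime_compl(1)[OF p s(1) t(1)] by (intro localizeI[of "s \<otimes> t" p "x \<otimes> y" C] C(1)) auto
qed

lemma subset_localize:
  assumes "prime_s_ideal Q H p" "A \<subseteq> carrier Q" shows "A \<subseteq> localize Q H p A"
  using assms prime_compl(2)[OF assms(1)] localizeI[of \<one> p _ A] by auto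

lemma localize_submonoid:
  assumes "prime_s_ideal Q H p" "submonoid S Q" shows "submonoid (localize Q H p S) Q"
proof -
  interpret S: submonoid S Q by fact
  show ?thesis
  proof
    show "localize Q H p S \<subseteq> carrier Q" by (rule localize_subset_carrier[OF S.subset])
    show "\<one> \<in> localize Q H p S" using subset_localize[OF assms(1) S.subset] S.one_closed by blast
    show "x \<otimes> y \<in> localize Q H p S" if "x \<in> localize Q H p S" "y \<in> localize Q H p S" for x y
      using localize_mult[OF assms(1) S.subset S.subset S.subset S.m_closed that] by blast
  qed
qed

lemma L_submonoid: "prime_s_ideal Q H p \<Longrightarrow> submonoid (L p) Q"
  using localize_submonoid is_submonoid by blast

lemma H_sub_L: "prime_s_ideal Q H p \<Longrightarrow> H \<subseteq> L p"
  using subset_localize subset by blast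

lemma L_quotient: "prime_s_ideal Q H p \<Longrightarrow> quotient_group_of Q (L p)"
  using overmonoid_quotient L_submonoid H_sub_L by blast

lemma L_carrier: "x \<in> L p \<Longrightarrow> x \<in> carrier Q"
  using L_iff by blast

lemma L_one [simp]: "prime_s_ideal Q H p \<Longrightarrow> \<one> \<in> L p"
  using H_sub_L H_one by blast

lemma L_mult: "prime_s_ideal Q H p \<Longrightarrow> x \<in> L p \<Longrightarrow> y \<in> L p \<Longrightarrow> x \<otimes> y \<in> L p"
  using submonoid.m_closed[OF L_submonoid] .

lemma U_iff: "prime_s_ideal Q H p \<Longrightarrow> x \<in> U p \<longleftrightarrow> x \<in> L p \<and> inv x \<in> L p"
  using Units_submonoid[OF L_submonoid] by blast

lemma U_subgroup: "prime_s_ideal Q H p \<Longrightarrow> subgroup (U p) Q"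
  using Units_subgroup[OF L_submonoid] by blast

lemma U_sub_L: "prime_s_ideal Q H p \<Longrightarrow> x \<in> U p \<Longrightarrow> x \<in> L p"
  using U_iff by blast

lemma U_mult: "prime_s_ideal Q H p \<Longrightarrow> x \<in> U p \<Longrightarrow> y \<in> U p \<Longrightarrow> x \<otimes> y \<in> U p"
  using subgroup.m_closed[OF U_subgroup] .

lemma U_inv: "prime_s_ideal Q H p \<Longrightarrow> x \<in> U p \<Longrightarrow> inv x \<in> U p"
  using subgroup.m_inv_closed[OF U_subgroup] .

lemma U_one [simp]: "prime_s_ideal Q H p \<Longrightarrow> \<one> \<in> U p"
  using U_subgroup subgroup.one_closed by blast

lemma U_carrier: "prime_s_ideal Q H p \<Longrightarrow> x \<in> U p \<Longrightarrow> x \<in> carrier Q"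
  using U_iff L_carrier by blast

text \<open>If \<open>inv x\<close> has a denominator \<open>t\<close> outside \<open>p\<close>,
  then \<open>t = x (t/x)\<close> would lie in \<open>p\<close> as soon as \<open>x\<close>
  does.\<close>

lemma U_H:
  assumes p: "prime_s_ideal Q H p" and x: "x \<in> H" shows "x \<in> U p \<longleftrightarrow> x \<notin> p"
proof
  assume "x \<in> U p"
  then have "inv x \<in> L p" using U_iff p by blast
  then obtain t where t: "t \<in> H - p" "t \<otimes> inv x \<in> H" using L_iff by blast
  have "x \<otimes> (t \<otimes> inv x) = t" using t x by (simp add: gsimps)
  with t primeD(3)[OF p, of x "t \<otimes> inv x"] show "x \<notin> p" by auto
next
  assume "x \<notin> p"
  then have "inv x \<in> L p" using x L_iff by (intro localizeI[of x]) (auto simp: gsimps subset)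
  then show "x \<in> U p" using U_iff[OF p] x H_sub_L[OF p] by blast
qed

lemma U_mult_iff:
  assumes p: "prime_s_ideal Q H p" and t: "t \<in> U p" and x: "x \<in> carrier Q"
  shows "t \<otimes> x \<in> U p \<longleftrightarrow> x \<in> U p" "t \<otimes> x \<in> L p \<longleftrightarrow> x \<in> L p"
proof -
  have e: "inv t \<otimes> (t \<otimes> x) = x" using U_carrier[OF p t] x by (simp add: gsimps)
  show "t \<otimes> x \<in> U p \<longleftrightarrow> x \<in> U p" using U_mult[OF p U_inv[OF p t], of "t \<otimes> x"] U_mult[OF p t, of x] e by auto
  show "t \<otimes> x \<in> L p \<longleftrightarrow> x \<in> L p"
    using L_mult[OF p U_sub_L[OF p U_inv[OF p t]], of "t \<otimes> x"] L_mult[OF p U_sub_L[OF p t], of x] e by auto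
qed

lemma L_nonunitE:
  assumes p: "prime_s_ideal Q H p" and x: "x \<in> L p" "x \<notin> U p"
  obtains t where "t \<in> H - p" "t \<otimes> x \<in> p"
proof -
  obtain t where t: "t \<in> H - p" "t \<otimes> x \<in> H" using x L_iff by blast
  then have "t \<otimes> x \<notin> U p"
    using U_mult_iff(1)[OF p, of t x] U_H[OF p, of t] x L_carrier[of x p] by auto
  with t that show ?thesis using U_H[OF p, of "t \<otimes> x"] by blast
qed

lemma L_nonunit_mult:
  assumes p: "prime_s_ideal Q H p" and x: "x \<in> L p" "x \<notin> U p" and y: "y \<in> L p"
  shows "x \<otimes> y \<notin> U p"
proof
  assume "x \<otimes> y \<in> U p"
  then have "inv (x \<otimes> y) \<otimes> y \<in> L p" using U_iff[OF p] L_mult[OF p] y by blast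
  then have "inv x \<in> L p" using x y L_carrier by (simp add: gsimps)
  with x show False using U_iff[OF p] by blast
qed

section \<open>Minimal primes and the primary property of the localizations\<close>

lemma min_primeD:
  assumes "p \<in> min_primes Q H"
  shows "prime_s_ideal Q H p" "p \<noteq> {}"
    "prime_s_ideal Q H p' \<Longrightarrow> p' \<noteq> {} \<Longrightarrow> p' \<subseteq> p \<Longrightarrow> p' = p"
  using assms unfolding min_primes_def by blast+

text \<open>The divisor-closed submonoid generated by \<open>b\<close> and the complement of \<open>p\<close> is all of \<open>H\<close>, since
its complement is a prime ideal strictly below \<open>p\<close>.\<close>

lemma min_prime_dvd_pow:
  assumes p: "p \<in> min_primes Q H" and b: "b \<in> p" and a: "a \<in> H"
  obtains t n h where "t \<in> H - p" "h \<in> H" "t \<otimes> b [^] (n::nat) = a \<otimes> h"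
proof -
  note P = min_primeD(1)[OF p] and PD = primeD[OF min_primeD(1)[OF p]]
  have bH: "b \<in> H" using b PD(1) by blast
  define S where "S = {x \<in> H. \<exists>t\<in>H - p. \<exists>n::nat. \<exists>h\<in>H. t \<otimes> b [^] n = x \<otimes> h}"
  have sub: "H - p \<subseteq> S"
  proof
    fix x assume x: "x \<in> H - p"
    then have "x \<otimes> b [^] (0::nat) = x \<otimes> \<one>" by simp
    with x show "x \<in> S" unfolding S_def by blast
  qed
  have bS: "b \<in> S"
  proof -
    have "\<one> \<otimes> b [^] (1::nat) = b \<otimes> \<one>" using bH by simp
    with bH prime_compl(2)[OF P] show ?thesis unfolding S_def by blast
  qed
  have mS: "x \<otimes> y \<in> S" if xy: "x \<in> S" "y \<in> S" for x y
  proof -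
    from xy obtain s n h t m k where *: "x \<in> H" "y \<in> H" "s \<in> H - p" "t \<in> H - p" "h \<in> H" "k \<in> H"
      "s \<otimes> b [^] (n::nat) = x \<otimes> h" "t \<otimes> b [^] (m::nat) = y \<otimes> k" unfolding S_def by blast
    have "(s \<otimes> t) \<otimes> b [^] (n + m) = (s \<otimes> b [^] n) \<otimes> (t \<otimes> b [^] m)"
      using *(1-6) bH by (simp add: nat_pow_mult[symmetric] gsimps)
    also have "\<dots> = (x \<otimes> y) \<otimes> (h \<otimes> k)" unfolding *(7,8) using *(1-6) by (simp add: gsimps)
    finally show ?thesis unfolding S_def using * prime_compl(1)[OF P *(3,4)] by blast
  qed
  have dS: "x \<in> S" if "x \<otimes> y \<in> S" "x \<in> H" "y \<in> H" for x y
  proof -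
    from that(1) obtain s n h where *: "s \<in> H - p" "h \<in> H" "s \<otimes> b [^] (n::nat) = x \<otimes> y \<otimes> h"
      unfolding S_def by blast
    then have "s \<otimes> b [^] n = x \<otimes> (y \<otimes> h)" using that by (simp add: m_assoc)
    with * that show ?thesis unfolding S_def by blast
  qed
  have "prime_s_ideal Q H (H - S)"
    unfolding prime_s_ideal_iff
  proof (intro conjI ballI impI)
    show "\<one> \<notin> H - S" using sub prime_compl(2)[OF P] by blast
    show "a \<otimes> h \<in> H - S" if "a \<in> H - S" "h \<in> H" for a h using that dS[of a h] by auto
    show "a \<in> H - S \<or> b \<in> H - S" if "a \<in> H" "b \<in> H" "a \<otimes> b \<in> H - S" for a b
      using that mS[of a b] by auto
  qed blast
  moreover have "H - S \<subseteq> p" "H - S \<noteq> p" using sub bS b by blast+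
  ultimately have "H - S = {}" using min_primeD(3)[OF p] by blast
  with a that show ?thesis unfolding S_def by blast
qed

text \<open>Up to a factor outside \<open>p\<close>, a power of \<open>b\<close> is a multiple of
  the denominator \<open>a\<close> of \<open>y\<close>; further powers of \<open>b\<close> preserve
  this, which gives all large exponents at once.\<close>

lemma min_prime_pow_mult:
  assumes p: "p \<in> min_primes Q H" and b: "b \<in> p" and y: "y \<in> carrier Q"
  shows "\<exists>N. \<forall>n\<ge>N. b [^] (n::nat) \<otimes> y \<in> L p"
proof -
  note P = min_primeD(1)[OF p]
  have bH: "b \<in> H" using b primeD(1)[OF P] by blast
  obtain a where a: "a \<in> H" "a \<otimes> y \<in> H" using frac[OF y] .
  obtain t n h where *: "t \<in> H - p" "h \<in> H" "t \<otimes> b [^] (n::nat) = a \<otimes> h"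
    using min_prime_dvd_pow[OF p b a(1)] .
  have "b [^] m \<otimes> y \<in> L p" if "m \<ge> n" for m
  proof (rule localizeI[OF *(1)])
    have "b [^] m = b [^] n \<otimes> b [^] (m - n)" using that bH by (simp add: nat_pow_mult)
    then have "t \<otimes> (b [^] m \<otimes> y) = (t \<otimes> b [^] n) \<otimes> (b [^] (m - n) \<otimes> y)"
      using *(1,2) bH y by (simp add: m_assoc)
    also have "\<dots> = h \<otimes> (a \<otimes> y) \<otimes> b [^] (m - n)" unfolding *(3) using *(1,2) bH y a(1) by (simp add: gsimps)
    also have "\<dots> \<in> H" using H_closed[OF H_closed[OF *(2) a(2)] H_pow[OF bH]] .
    finally show "t \<otimes> (b [^] m \<otimes> y) \<in> H" .
  qed (use bH y subset in auto)
  then show ?thesis by blast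
qed

text \<open>The primary property in the form in which it is applied below: high powers of a non-unit
  clear every denominator. A factor outside \<open>p\<close> turns \<open>x\<close> into an element
  of \<open>p\<close>, to which the preceding lemma applies.\<close>

lemma L_primary:
  assumes p: "p \<in> min_primes Q H" and x: "x \<in> L p" "x \<notin> U p" and y: "y \<in> carrier Q"
  shows "\<exists>N. \<forall>n\<ge>N. x [^] (n::nat) \<otimes> y \<in> L p"
proof -
  note P = min_primeD(1)[OF p]
  obtain t where t: "t \<in> H - p" "t \<otimes> x \<in> p" using L_nonunitE[OF P x] .
  have xQ: "x \<in> carrier Q" using L_carrier x by blast
  obtain N where N: "\<forall>n\<ge>N. (t \<otimes> x) [^] (n::nat) \<otimes> y \<in> L p" using min_prime_pow_mult[OF p t(2) y] by blast
  have "x [^] n \<otimes> y \<in> L p" if "n \<ge> N" for n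
  proof -
    have "t [^] n \<otimes> (x [^] n \<otimes> y) = (t \<otimes> x) [^] n \<otimes> y"
      using t xQ y by (simp add: nat_pow_distrib m_assoc)
    also have "\<dots> \<in> L p" using N that by blast
    finally show ?thesis
      using U_mult_iff(2)[OF P, of "t [^] n" "x [^] n \<otimes> y"] U_H[OF P, of "t [^] n"]
        prime_compl(3)[OF P t(1), of n] xQ y by auto
  qed
  then show ?thesis by blast
qed

lemma L_nonunit_exists:
  assumes p: "p \<in> min_primes Q H" obtains c where "c \<in> p" "c \<in> H" "c \<in> L p" "c \<notin> U p"
proof -
  note P = min_primeD(1)[OF p]
  obtain c where "c \<in> p" using min_primeD(2)[OF p] by blast
  with that U_H[OF P, of c] H_sub_L[OF P] primeD(1)[OF P] show ?thesis by blast
qed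

lemma nat_pow_consistent': "x [^]\<^bsub>Q\<lparr>carrier := S\<rparr>\<^esub> (n::nat) = x [^] n"
  by (simp add: nat_pow_def)

lemma submonoid_cancel:
  assumes "submonoid S Q" shows "comm_monoid_cancel (Q\<lparr>carrier := S\<rparr>)"
proof -
  interpret S: submonoid S Q by fact
  have sub: "x \<in> carrier Q" if "x \<in> S" for x using that S.subset by blast
  have "comm_monoid (Q\<lparr>carrier := S\<rparr>)"
    by (rule comm_monoidI) (use sub in \<open>auto simp: gsimps\<close>)
  then show ?thesis
    by (rule comm_monoid_cancelI) (use sub in auto)
qed

text \<open>If \<open>b\<close> is a unit, it cancels from the divisibility of \<open>ab\<close> by
  \<open>q\<close>; otherwise a power of \<open>b\<close> clears the denominator of
  \<open>inv q\<close>.\<close>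

lemma primary_monoid_L:
  assumes p: "p \<in> min_primes Q H" shows "primary_monoid (Q\<lparr>carrier := L p\<rparr>)"
proof -
  note P = min_primeD(1)[OF p]
  have dvd: "q divides\<^bsub>Q\<lparr>carrier := L p\<rparr>\<^esub> (b [^]\<^bsub>Q\<lparr>carrier := L p\<rparr>\<^esub> (n::nat))"
    if "q \<in> L p" "b \<in> L p" "b [^] n \<otimes> inv q \<in> L p" for q b n
  proof -
    have "b [^] n = q \<otimes> (b [^] n \<otimes> inv q)" using that(1,2) L_carrier by (simp add: gsimps)
    with that(3) show ?thesis unfolding factor_def nat_pow_consistent' by auto
  qed
  have dvd': "q divides\<^bsub>Q\<lparr>carrier := L p\<rparr>\<^esub> a" if "q \<in> L p" "a \<in> L p" "b \<in> U p"
    "q divides\<^bsub>Q\<lparr>carrier := L p\<rparr>\<^esub> (a \<otimes> b)" for q a b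
  proof -
    from that(4) obtain c where c: "c \<in> L p" "a \<otimes> b = q \<otimes> c" unfolding factor_def by auto
    have "a = (a \<otimes> b) \<otimes> inv b" using that U_carrier[OF P] L_carrier by (simp add: gsimps)
    also have "\<dots> = q \<otimes> (c \<otimes> inv b)" unfolding c(2)
      using that c(1) U_carrier[OF P] L_carrier by (simp add: m_assoc)
    finally show ?thesis using L_mult[OF P c(1)] U_inv[OF P that(3)] U_sub_L[OF P]
      unfolding factor_def by auto
  qed
  have "primary_elem (Q\<lparr>carrier := L p\<rparr>) q" if q: "q \<in> L p" "q \<notin> U p" for q
    unfolding primary_elem_def
  proof (intro conjI ballI impI)
    fix a b assume ab: "a \<in> carrier (Q\<lparr>carrier := L p\<rparr>)" "b \<in> carrier (Q\<lparr>carrier := L p\<rparr>)"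
      and d: "q divides\<^bsub>Q\<lparr>carrier := L p\<rparr>\<^esub> (a \<otimes>\<^bsub>Q\<lparr>carrier := L p\<rparr>\<^esub> b)"
    show "q divides\<^bsub>Q\<lparr>carrier := L p\<rparr>\<^esub> a \<or>
      (\<exists>n::nat. q divides\<^bsub>Q\<lparr>carrier := L p\<rparr>\<^esub> (b [^]\<^bsub>Q\<lparr>carrier := L p\<rparr>\<^esub> n))"
    proof (cases "b \<in> U p")
      case True
      then show ?thesis using dvd'[of q a b] q ab d by auto
    next
      case False
      then obtain N where "\<forall>n\<ge>N. b [^] (n::nat) \<otimes> inv q \<in> L p"
        using L_primary[OF p _ False, of "inv q"] ab q L_carrier[of q] by auto
      then show ?thesis using dvd[of q b N] q ab by auto
    qed
  qed (use q in auto)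
  moreover have "L p \<noteq> U p" using L_nonunit_exists[OF p] by metis
  ultimately show ?thesis
    unfolding primary_monoid_def using submonoid_cancel[OF L_submonoid[OF P]] by auto
qed

section \<open>Divisorial ideals\<close>

lemma v_ideal_colon:
  assumes "B \<subseteq> carrier Q" "\<one> \<in> B" shows "v_ideal Q H (colon Q H B)"
  using assms v_closure_colon[OF assms(1)] unfolding v_ideal_def by (force simp: colon_iff)

lemma v_closure_subset_H: "E \<subseteq> H \<Longrightarrow> v_closure Q H E \<subseteq> H"
proof
  fix x assume "E \<subseteq> H" "x \<in> v_closure Q H E"
  moreover from this have "\<one> \<in> colon Q H E" by (auto simp: colon_iff)
  ultimately have "x \<otimes> \<one> \<in> H" "x \<in> carrier Q" unfolding v_closure_def colon_iff[of x] by blast+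
  then show "x \<in> H" by simp
qed

lemma v_ideal_v_closure: "E \<subseteq> H \<Longrightarrow> v_ideal Q H (v_closure Q H E)"
  unfolding v_ideal_def using v_closure_subset_H v_closure_idem[of E] subset by auto

text \<open>The denominators of \<open>z\<close> form \<open>(H : {1, z})\<close>, so the chain
  condition applies to sets of denominators; suitably chosen maximal ones will turn out to be
  prime.\<close>

lemma v_ideal_conductor:
  assumes "z \<in> carrier Q" shows "v_ideal Q H {x \<in> H. x \<otimes> z \<in> H}"
proof -
  have "{x \<in> H. x \<otimes> z \<in> H} = colon Q H {\<one>, z}" by (auto simp: colon_iff)
  then show ?thesis using v_ideal_colon[of "{\<one>, z}"] assms by auto
qed

lemma v_noetherian_maximal:
  assumes v: "v_noetherian Q H" and C: "\<And>A. A \<in> \<C> \<Longrightarrow> v_ideal Q H A" and A0: "A0 \<in> \<C>"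
  shows "\<exists>M\<in>\<C>. \<forall>A\<in>\<C>. M \<subseteq> A \<longrightarrow> A = M"
proof (rule ccontr)
  assume "\<not> ?thesis"
  then have "\<forall>M\<in>\<C>. \<exists>A\<in>\<C>. M \<subset> A" by blast
  then obtain s where s: "\<And>M. M \<in> \<C> \<Longrightarrow> s M \<in> \<C> \<and> M \<subset> s M" by metis
  define A where "A n = (s ^^ n) A0" for n
  have AC: "A n \<in> \<C>" for n by (induction n) (use A0 s in \<open>auto simp: A_def\<close>)
  have As: "A n \<subset> A (Suc n)" for n using s[OF AC[of n]] by (simp add: A_def)
  then have "\<forall>n. A n \<subseteq> A (Suc n)" by (simp add: less_imp_le)
  with C[OF AC] have "(\<forall>n. v_ideal Q H (A n)) \<and> (\<forall>n. A n \<subseteq> A (Suc n))" by simp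
  from v[unfolded v_noetherian_def, THEN spec, THEN mp, OF this]
  obtain n where "\<forall>m\<ge>n. A m = A n" ..
  then have "A (Suc n) = A n" by (rule allE[of _ "Suc n"]) (erule impE, simp)
  with As[of n] show False by blast
qed

text \<open>Among the \<open>v\<close>-closures of finite subsets of \<open>A\<close> take a maximal
  one: adjoining any \<open>a\<close> to its generators cannot enlarge it, so it already contains
  \<open>A\<close>.\<close>

lemma v_noetherian_finite:
  assumes v: "v_noetherian Q H" and A: "A \<subseteq> H"
  obtains E where "finite E" "E \<subseteq> A" "colon Q H E = colon Q H A"
proof -
  let ?C = "{v_closure Q H E | E. finite E \<and> E \<subseteq> A}"
  have "v_ideal Q H B" if "B \<in> ?C" for B using that A v_ideal_v_closure by blast
  moreover have "v_closure Q H {} \<in> ?C" by blast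
  ultimately have "\<exists>M\<in>?C. \<forall>A\<in>?C. M \<subseteq> A \<longrightarrow> A = M" by (rule v_noetherian_maximal[OF v])
  then obtain M where M: "M \<in> ?C" and max: "\<forall>A\<in>?C. M \<subseteq> A \<longrightarrow> A = M" ..
  from M obtain E where E: "finite E" "E \<subseteq> A" "M = v_closure Q H E" by blast
  have EQ: "E \<subseteq> carrier Q" using E A subset by blast
  have "A \<subseteq> M"
  proof
    fix a assume a: "a \<in> A"
    have "v_closure Q H (insert a E) \<in> ?C" using E a by blast
    moreover have "M \<subseteq> v_closure Q H (insert a E)" unfolding E(3) by (rule v_closure_mono) blast
    ultimately have "v_closure Q H (insert a E) = M" using max by simp
    moreover have "insert a E \<subseteq> v_closure Q H (insert a E)"
      using a A subset EQ by (intro subset_v_closure) auto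
    ultimately show "a \<in> M" by blast
  qed
  then have "colon Q H E \<subseteq> colon Q H A"
    using colon_v_closure[OF EQ, of H] colon_antimono[of A M H] E(3) by auto
  with colon_antimono[OF E(2)] E that show ?thesis by blast
qed

text \<open>A finite subset of the union of a chain lies in one member; if it has no larger inverse
  than the union, all later members have the same inverse as this one.\<close>

lemma v_noetherianI:
  assumes "\<And>A. A \<subseteq> H \<Longrightarrow> \<exists>E. finite E \<and> E \<subseteq> A \<and> colon Q H E \<subseteq> colon Q H A"
  shows "v_noetherian Q H"
  unfolding v_noetherian_def
proof (intro allI impI)
  fix A :: "nat \<Rightarrow> 'a set"
  assume A: "(\<forall>n. v_ideal Q H (A n)) \<and> (\<forall>n. A n \<subseteq> A (Suc n))"
  then have mono: "A n \<subseteq> A m" if "n \<le> m" for n m using that lift_Suc_mono_le[of A n m] by blast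
  have v: "A n \<subseteq> H" "v_closure Q H (A n) = A n" for n using A by (auto simp: v_ideal_def)
  obtain E where E: "finite E" "E \<subseteq> (\<Union>n. A n)" "colon Q H E \<subseteq> colon Q H (\<Union>n. A n)"
    using assms[of "\<Union>n. A n"] v(1) by blast
  have "\<exists>n. E \<subseteq> A n" using E(1,2)
  proof (induction E)
    case (insert x E)
    then obtain n m where "E \<subseteq> A n" "x \<in> A m" by blast
    then have "insert x E \<subseteq> A (max n m)" using mono[of n "max n m"] mono[of m "max n m"] by auto
    then show ?case by blast
  qed auto
  then obtain n where n: "E \<subseteq> A n" by blast
  have "A m = A n" if "m \<ge> n" for m
  proof
    show "A n \<subseteq> A m" using mono that .
    have "colon Q H (A n) \<subseteq> colon Q H E" using n by (rule colon_antimono)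
    also have "\<dots> \<subseteq> colon Q H (\<Union>n. A n)" by fact
    also have "\<dots> \<subseteq> colon Q H (A m)" by (rule colon_antimono) blast
    finally have "v_closure Q H (A m) \<subseteq> v_closure Q H (A n)"
      unfolding v_closure_def by (rule colon_antimono)
    then show "A m \<subseteq> A n" unfolding v .
  qed
  then show "\<exists>n. \<forall>m\<ge>n. A m = A n" by blast
qed

lemma common_denominator:
  assumes P: "prime_s_ideal Q H p" and "finite E" "E \<subseteq> L p"
  shows "\<exists>t\<in>H - p. \<forall>x\<in>E. t \<otimes> x \<in> H"
  using assms(2,3)
proof (induction E)
  case (insert x E)
  then obtain t s where ts: "t \<in> H - p" "\<forall>x\<in>E. t \<otimes> x \<in> H" "s \<in> H - p" "s \<otimes> x \<in> H" using L_iff by auto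
  have "t \<otimes> s \<otimes> y \<in> H" if y: "y \<in> insert x E" for y
  proof -
    have yQ: "y \<in> carrier Q" using y insert.prems L_carrier by blast
    show ?thesis
    proof (cases "y = x")
      case True
      have "t \<otimes> s \<otimes> y = t \<otimes> (s \<otimes> y)" using ts(1,3) yQ by (simp add: m_assoc)
      then show ?thesis using ts True by auto
    next
      case False
      have "t \<otimes> s \<otimes> y = s \<otimes> (t \<otimes> y)" using ts(1,3) yQ by (simp add: gsimps)
      then show ?thesis using ts y False by auto
    qed
  qed
  then show ?case using prime_compl(1)[OF P ts(1,3)] by blast
qed (use prime_compl(2)[OF P] in auto)

text \<open>Forming inverses commutes with localization: by \<open>v_noetherian_finite\<close> only
  finitely many of the products \<open>z a\<close> have to be cleared, and these have a common
  denominator.\<close>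

lemma colon_localize:
  assumes v: "v_noetherian Q H" and P: "prime_s_ideal Q H p" and A: "A \<subseteq> H"
    and z: "z \<in> carrier Q" "\<And>a. a \<in> A \<Longrightarrow> z \<otimes> a \<in> L p"
  obtains t where "t \<in> H - p" "t \<otimes> z \<in> colon Q H A"
proof -
  obtain E where E: "finite E" "E \<subseteq> A" "colon Q H E = colon Q H A"
    using v_noetherian_finite[OF v A] .
  have "(\<lambda>a. z \<otimes> a) ` E \<subseteq> L p" using z E by blast
  then obtain t where t: "t \<in> H - p" "\<forall>x\<in>(\<lambda>a. z \<otimes> a) ` E. t \<otimes> x \<in> H"
    using common_denominator[OF P, of "(\<lambda>a. z \<otimes> a) ` E"] E(1) by blast
  have "t \<otimes> z \<otimes> e \<in> H" if "e \<in> E" for e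
    using t that z(1) E A by (auto simp: m_assoc subset_iff)
  then have "t \<otimes> z \<in> colon Q H E" using t z by (auto simp: colon_iff)
  with t E that show ?thesis by auto
qed

text \<open>Choose \<open>z\<close> outside \<open>L p\<close> with a maximal set of denominators.
  If some \<open>b\<close> in \<open>p\<close> were not among them, a suitable
  \<open>t b^m z\<close> would keep all denominators of \<open>z\<close> and gain \<open>b\<close>,
  while staying outside \<open>L p\<close>.\<close>

lemma min_prime_conductor:
  assumes v: "v_noetherian Q H" and p: "p \<in> min_primes Q H"
  obtains z where "z \<in> carrier Q" "z \<notin> L p" "p = {x \<in> H. x \<otimes> z \<in> H}"
proof -
  note P = min_primeD(1)[OF p]
  obtain a where a: "a \<in> p" "a \<in> H" "a \<in> L p" "a \<notin> U p" using L_nonunit_exists[OF p] .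
  let ?Z = "{z \<in> carrier Q. z \<notin> L p \<and> a \<otimes> z \<in> H}"
  let ?I = "\<lambda>z. {x \<in> H. x \<otimes> z \<in> H}"
  have "inv a \<in> ?Z" using a U_iff[OF P, of a] by auto
  then have 1: "?I (inv a) \<in> ?I ` ?Z" by (rule imageI)
  have 2: "v_ideal Q H A" if "A \<in> ?I ` ?Z" for A using that v_ideal_conductor by (elim imageE) simp
  obtain M where M: "M \<in> ?I ` ?Z" and max': "\<forall>A\<in>?I ` ?Z. M \<subseteq> A \<longrightarrow> A = M"
    using v_noetherian_maximal[OF v 2 1] ..
  from M obtain z where z: "z \<in> ?Z" and Mz: "M = ?I z" by (elim imageE)
  have max: "?I z' = ?I z" if "z' \<in> ?Z" "?I z \<subseteq> ?I z'" for z'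
    using max'[THEN bspec, OF imageI[OF that(1)]] that(2) unfolding Mz by simp
  have zQ: "z \<in> carrier Q" "z \<notin> L p" using z by auto
  have "?I z \<subseteq> p" using zQ by (auto intro: localizeI[OF _ _ _ subset])
  moreover have "b \<in> ?I z" if b: "b \<in> p" for b
  proof -
    have bH: "b \<in> H" using b primeD(1)[OF P] by blast
    obtain N where N: "b [^] (N::nat) \<otimes> z \<in> L p" using min_prime_pow_mult[OF p b zQ(1)] by blast
    \<comment> \<open>\<open>n\<close> is the first exponent that brings \<open>z\<close> into
      \<open>L p\<close>. It is not 0, and with one factor \<open>b\<close> less the product is
      still outside.\<close>
    define n where "n = (LEAST n::nat. b [^] n \<otimes> z \<in> L p)"
    have n: "b [^] n \<otimes> z \<in> L p" unfolding n_def using N by (rule LeastI)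
    have "n \<noteq> 0" using n zQ by (cases n) auto
    then obtain m where m: "n = Suc m" by (cases n) auto
    have "b [^] m \<otimes> z \<notin> L p" using not_less_Least[of m "\<lambda>n. b [^] n \<otimes> z \<in> L p"] m n_def by auto
    obtain t where t: "t \<in> H - p" "t \<otimes> (b [^] n \<otimes> z) \<in> H" using n L_iff by blast
    define z' where "z' = t \<otimes> b [^] m \<otimes> z"
    have z'Q: "z' \<in> carrier Q" using t bH zQ z'_def by simp
    have "z' \<notin> L p"
      using U_mult_iff(2)[OF P, of t "b [^] m \<otimes> z"] U_H[OF P, of t] t bH zQ \<open>b [^] m \<otimes> z \<notin> L p\<close>
      by (auto simp: z'_def m_assoc)
    have in1: "x \<otimes> z' \<in> H" if "x \<otimes> z \<in> H" "x \<in> H" for x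
    proof -
      have "x \<otimes> z' = t \<otimes> b [^] m \<otimes> (x \<otimes> z)" unfolding z'_def using t bH zQ that by (simp add: gsimps)
      then show ?thesis using that t bH by auto
    qed
    have "?I z' = ?I z"
      using in1[of a] in1 z z'Q \<open>z' \<notin> L p\<close> a by (intro max) (auto simp: m_comm)
    moreover have "b \<otimes> z' \<in> H"
    proof -
      have "b \<otimes> z' = t \<otimes> (b [^] n \<otimes> z)" unfolding z'_def m using t bH zQ by (simp add: gsimps)
      then show ?thesis using t by simp
    qed
    ultimately show ?thesis using bH by blast
  qed
  ultimately have "p = ?I z" by blast
  with zQ that show ?thesis by blast
qed

text \<open>Replace \<open>A\<close> by its multiples in \<open>H\<close> and choose finitely many
  of these with the same inverse; the elements of \<open>A\<close> they come from determine the
  inverse of \<open>A\<close> over \<open>L p\<close>.\<close>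

lemma v_noetherian_L:
  assumes v: "v_noetherian Q H" and P: "prime_s_ideal Q H p" shows "v_noetherian Q (L p)"
proof -
  interpret D: quotient_group_of Q "L p" using L_quotient[OF P] .
  show ?thesis
  proof (rule D.v_noetherianI)
    fix A assume A: "A \<subseteq> L p"
    let ?A = "{x \<in> H. \<exists>t\<in>H - p. \<exists>a\<in>A. x = t \<otimes> a}"
    obtain E where E: "finite E" "E \<subseteq> ?A" "colon Q H E = colon Q H ?A"
      using v_noetherian_finite[OF v, of ?A] by blast
    then have "\<forall>e\<in>E. \<exists>t\<in>H - p. \<exists>a\<in>A. e = t \<otimes> a" by blast
    then obtain t a where ta: "\<And>e. e \<in> E \<Longrightarrow> t e \<in> H - p \<and> a e \<in> A \<and> e = t e \<otimes> a e" by metis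
    have "colon Q (L p) (a ` E) \<subseteq> colon Q (L p) A"
    proof
      fix y assume y: "y \<in> colon Q (L p) (a ` E)"
      then have yQ: "y \<in> carrier Q" by (simp add: colon_iff)
      have "y \<otimes> e \<in> L p" if e: "e \<in> E" for e
      proof -
        have "y \<otimes> e = t e \<otimes> (y \<otimes> a e)"
        proof -
          have "t e \<in> carrier Q" "a e \<in> carrier Q" using ta[OF e] A L_carrier by blast+
          then have "y \<otimes> (t e \<otimes> a e) = t e \<otimes> (y \<otimes> a e)" using yQ by (simp add: m_lcomm)
          with ta[OF e] show ?thesis by metis
        qed
        moreover have "y \<otimes> a e \<in> L p" using y e by (auto simp: colon_iff)
        moreover have "t e \<in> L p" using ta[OF e] H_sub_L[OF P] by blast
        ultimately show ?thesis using L_mult[OF P] by metis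
      qed
      then have "(\<lambda>e. y \<otimes> e) ` E \<subseteq> L p" by blast
      then obtain s where s: "s \<in> H - p" "\<forall>x\<in>(\<lambda>e. y \<otimes> e) ` E. s \<otimes> x \<in> H"
        using common_denominator[OF P, of "(\<lambda>e. y \<otimes> e) ` E"] E(1) by blast
      have "s \<otimes> y \<in> colon Q H E"
        using s yQ E(2) by (auto simp: colon_iff m_assoc subset_iff)
      then have sy: "s \<otimes> y \<in> colon Q H ?A" using E(3) by blast
      have "y \<otimes> b \<in> L p" if b: "b \<in> A" for b
      proof -
        obtain r where r: "r \<in> H - p" "r \<otimes> b \<in> H" "b \<in> carrier Q" using b A L_iff by blast
        then have "s \<otimes> y \<otimes> (r \<otimes> b) \<in> H" using sy b unfolding colon_iff by blast
        moreover have "s \<otimes> y \<otimes> (r \<otimes> b) = s \<otimes> r \<otimes> (y \<otimes> b)" using s r yQ by (simp add: gsimps)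
        ultimately show ?thesis
          using r yQ by (intro localizeI[OF prime_compl(1)[OF P s(1) r(1)] _ _ subset]) auto
      qed
      then show "y \<in> colon Q (L p) A" using yQ by (simp add: colon_iff)
    qed
    moreover have "a ` E \<subseteq> A" using ta by blast
    ultimately show "\<exists>E. finite E \<and> E \<subseteq> A \<and> colon Q (L p) E \<subseteq> colon Q (L p) A"
      using E(1) by blast
  qed
qed

section \<open>Seminormality under localization and for large powers\<close>

text \<open>A common denominator \<open>t\<close> of \<open>x^2\<close> and \<open>x^3\<close>
  brings the square and the cube of \<open>tx\<close> into \<open>H\<close>.\<close>

lemma seminormal_L:
  assumes s: "seminormal Q H" and P: "prime_s_ideal Q H p" shows "seminormal Q (L p)"
  unfolding seminormal_def
proof (intro ballI impI)
  fix x assume x: "x \<in> carrier Q" "x [^] (2::nat) \<in> L p \<and> x [^] (3::nat) \<in> L p"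
  then obtain t where t: "t \<in> H - p" "t \<otimes> x [^] (2::nat) \<in> H" "t \<otimes> x [^] (3::nat) \<in> H"
    using common_denominator[OF P, of "{x [^] (2::nat), x [^] (3::nat)}"] by auto
  have e: "(t \<otimes> x) [^] (2::nat) = t \<otimes> (t \<otimes> x [^] (2::nat))"
    "(t \<otimes> x) [^] (3::nat) = t \<otimes> t \<otimes> (t \<otimes> x [^] (3::nat))"
    using t x by (simp_all add: nat_pow_distrib numeral_2_eq_2 numeral_3_eq_3 gsimps)
  have "(t \<otimes> x) [^] (2::nat) \<in> H" "(t \<otimes> x) [^] (3::nat) \<in> H" unfolding e
    by (rule H_closed[OF _ t(2)] H_closed[OF _ t(3)], use t(1) in blast)+
  then have "t \<otimes> x \<in> H" using s[unfolded seminormal_def, THEN bspec, of "t \<otimes> x"] t(1) x(1) by blast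
  then show "x \<in> L p" using t x L_iff by blast
qed

text \<open>Descending induction on positive exponents: the square and the cube of
  \<open>x^n\<close> are \<open>x^(2n)\<close> and \<open>x^(3n)\<close>, whose exponents are
  larger. Exponent 1 is the claim.\<close>

lemma seminormal_pow:
  assumes s: "seminormal Q H" and x: "x \<in> carrier Q" and N: "\<And>n. n \<ge> N \<Longrightarrow> x [^] (n::nat) \<in> H"
  shows "x \<in> H"
proof -
  have "x [^] n \<in> H" if "n > 0" for n :: nat
    using that
  proof (induction "N - n" arbitrary: n rule: less_induct)
    case (less n)
    show ?case
    proof (cases "n \<ge> N")
      case False
      have "x [^] (n * 2) \<in> H" "x [^] (n * 3) \<in> H" using False less.prems by (intro less.hyps; simp)+
      then have "(x [^] n) [^] (2::nat) \<in> H" "(x [^] n) [^] (3::nat) \<in> H" using x by (simp_all add: nat_pow_pow)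
      then show ?thesis using s[unfolded seminormal_def, THEN bspec, of "x [^] n"] x by blast
    qed (use N in auto)
  qed
  from this[of 1] show ?thesis using x by simp
qed

section \<open>The complete integral closure\<close>

lemma hat_iff: "x \<in> complete_int_closure Q H \<longleftrightarrow>
    x \<in> carrier Q \<and> (\<exists>c\<in>H. \<forall>n::nat. c \<otimes> x [^] n \<in> H)"
  by (simp add: complete_int_closure_def)

lemma hat_carrier: "complete_int_closure Q H \<subseteq> carrier Q"
  by (auto simp: complete_int_closure_def)

lemma H_sub_hat: "H \<subseteq> complete_int_closure Q H"
proof
  fix x assume x: "x \<in> H"
  have "\<one> \<otimes> x [^] n \<in> H" for n :: nat by (intro H_closed H_pow x H_one)
  then show "x \<in> complete_int_closure Q H" unfolding hat_iff using x H_one by blast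
qed

lemma hat_submonoid: "submonoid (complete_int_closure Q H) Q"
proof
  show "complete_int_closure Q H \<subseteq> carrier Q" by (rule hat_carrier)
  show "\<one> \<in> complete_int_closure Q H" using H_sub_hat by blast
  fix x y assume "x \<in> complete_int_closure Q H" "y \<in> complete_int_closure Q H"
  then obtain c d where *: "x \<in> carrier Q" "y \<in> carrier Q" "c \<in> H" "d \<in> H"
    "\<And>n::nat. c \<otimes> x [^] n \<in> H" "\<And>n::nat. d \<otimes> y [^] n \<in> H" unfolding hat_iff by blast
  have "c \<otimes> d \<otimes> (x \<otimes> y) [^] n \<in> H" for n :: nat
  proof -
    have "c \<otimes> d \<otimes> (x \<otimes> y) [^] n = (c \<otimes> x [^] n) \<otimes> (d \<otimes> y [^] n)"
      using *(1-4) by (simp add: nat_pow_distrib gsimps)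
    also have "\<dots> \<in> H" using *(5,6) by (rule H_closed)
    finally show ?thesis .
  qed
  moreover have "c \<otimes> d \<in> H" using *(3,4) by (rule H_closed)
  ultimately show "x \<otimes> y \<in> complete_int_closure Q H" unfolding hat_iff using *(1,2) by blast
qed

lemma hat_quotient: "quotient_group_of Q (complete_int_closure Q H)"
  using overmonoid_quotient[OF hat_submonoid H_sub_hat] .

lemma cond_mult:
  assumes "c \<in> colon Q H (complete_int_closure Q H)" "y \<in> complete_int_closure Q H"
  shows "c \<otimes> y \<in> colon Q H (complete_int_closure Q H)" "c \<otimes> y \<in> H"
proof -
  have c: "c \<in> carrier Q" "y \<in> carrier Q" using assms hat_carrier by (auto simp: colon_iff)
  have "c \<otimes> y \<otimes> b \<in> H" if b: "b \<in> complete_int_closure Q H" for b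
  proof -
    have "c \<otimes> (y \<otimes> b) \<in> H" using assms(1) submonoid.m_closed[OF hat_submonoid assms(2) b]
      unfolding colon_iff by blast
    then show ?thesis using c b hat_carrier by (simp add: m_assoc subset_iff)
  qed
  then show "c \<otimes> y \<in> colon Q H (complete_int_closure Q H)" using c by (simp add: colon_iff)
  show "c \<otimes> y \<in> H" using assms by (auto simp: colon_iff)
qed

lemma cond_sub_H: "colon Q H (complete_int_closure Q H) \<subseteq> H"
proof
  fix c assume c: "c \<in> colon Q H (complete_int_closure Q H)"
  then have "c \<otimes> \<one> \<in> H" using cond_mult(2)[OF c, of \<one>] H_sub_hat by blast
  then show "c \<in> H" using c by (simp add: colon_iff)
qed

text \<open>By induction \<open>c x^n\<close> stays in \<open>A\<close>, so any element of a stable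
  subset of \<open>H\<close> is a common denominator of the powers of \<open>x\<close>.\<close>

lemma hatI:
  assumes "x \<in> carrier Q" "c \<in> A" "A \<subseteq> H" "\<And>a. a \<in> A \<Longrightarrow> x \<otimes> a \<in> A"
  shows "x \<in> complete_int_closure Q H"
proof -
  have "c \<otimes> x [^] n \<in> A" for n :: nat
  proof (induction n)
    case (Suc n)
    have "c \<otimes> x [^] Suc n = x \<otimes> (c \<otimes> x [^] n)"
      using assms(1-3) by (auto simp: gsimps subset_iff)
    then show ?case using assms(4)[OF Suc.IH] by simp
  qed (use assms in auto)
  then show ?thesis using assms(1-3) unfolding hat_iff by blast
qed

text \<open>A complete integral closure need not be completely integrally closed; here an element
  \<open>d\<close> of the conductor turns a denominator \<open>c\<close> over the closure into a
  denominator \<open>dc\<close> over \<open>H\<close>.\<close>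

lemma hat_hat:
  assumes f: "colon Q H (complete_int_closure Q H) \<noteq> {}"
  shows "complete_int_closure Q (complete_int_closure Q H) = complete_int_closure Q H"
proof -
  interpret K: quotient_group_of Q "complete_int_closure Q H" using hat_quotient .
  show ?thesis
  proof
    show "complete_int_closure Q (complete_int_closure Q H) \<subseteq> complete_int_closure Q H"
    proof
      fix x assume "x \<in> complete_int_closure Q (complete_int_closure Q H)"
      then obtain c where c: "x \<in> carrier Q" "c \<in> complete_int_closure Q H"
        "\<And>n::nat. c \<otimes> x [^] n \<in> complete_int_closure Q H" unfolding K.hat_iff by blast
      obtain d where d: "d \<in> colon Q H (complete_int_closure Q H)" using f by blast
      have "d \<otimes> c \<otimes> x [^] n \<in> H" for n :: nat
        using cond_mult(2)[OF d c(3)[of n]] c(1,2) d by (simp add: m_assoc colon_iff)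
      moreover have "d \<otimes> c \<in> H" by (rule cond_mult(2)[OF d c(2)])
      ultimately show "x \<in> complete_int_closure Q H" using c(1) unfolding hat_iff by blast
    qed
  qed (rule K.H_sub_hat)
qed

text \<open>Multiplication by the conductor moves subsets of the closure into \<open>H\<close>,
  where finite subsets with the same inverse exist. The way back uses that \<open>x b\<close>
  belongs to the closure as soon as it maps the conductor into itself.\<close>

lemma v_noetherian_hat:
  assumes v: "v_noetherian Q H" and f: "colon Q H (complete_int_closure Q H) \<noteq> {}"
  shows "v_noetherian Q (complete_int_closure Q H)"
proof -
  let ?K = "complete_int_closure Q H" and ?f = "colon Q H (complete_int_closure Q H)"
  interpret K: quotient_group_of Q ?K using hat_quotient .
  obtain c0 where c0: "c0 \<in> ?f" using f by blast
  show ?thesis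
  proof (rule K.v_noetherianI)
    fix A assume A: "A \<subseteq> ?K"
    let ?A = "{c \<otimes> a | c a. c \<in> ?f \<and> a \<in> A}"
    have AH: "?A \<subseteq> H" using A cond_mult(2) by blast
    obtain E where E: "finite E" "E \<subseteq> ?A" "colon Q H E = colon Q H ?A"
      using v_noetherian_finite[OF v AH] .
    then have "\<forall>e\<in>E. \<exists>a c. a \<in> A \<and> c \<in> ?f \<and> e = c \<otimes> a" by blast
    then obtain a c where ac: "\<And>e. e \<in> E \<Longrightarrow> a e \<in> A \<and> c e \<in> ?f \<and> e = c e \<otimes> a e" by metis
    have "colon Q ?K (a ` E) \<subseteq> colon Q ?K A"
    proof
      fix x assume x: "x \<in> colon Q ?K (a ` E)"
      then have xQ: "x \<in> carrier Q" by (simp add: colon_iff)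
      have "x \<otimes> e \<in> H" if e: "e \<in> E" for e
      proof -
        have "x \<otimes> a e \<in> ?K" using x e unfolding colon_iff by blast
        then have 1: "c e \<otimes> (x \<otimes> a e) \<in> H" using ac[OF e] cond_mult(2) by blast
        have "c e \<in> carrier Q" "a e \<in> carrier Q" using ac[OF e] A hat_carrier colon_subset by blast+
        then have "c e \<otimes> (x \<otimes> a e) = x \<otimes> (c e \<otimes> a e)" using xQ by (simp add: m_lcomm)
        with 1 ac[OF e] show ?thesis by metis
      qed
      then have "x \<in> colon Q H E" using xQ by (simp add: colon_iff)
      then have xA: "x \<in> colon Q H ?A" unfolding E(3) .
      have xA': "x \<otimes> b \<in> H" if "b \<in> ?A" for b using xA that unfolding colon_iff[of x] by blast
      have "x \<otimes> b \<in> ?K" if b: "b \<in> A" for b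
      proof (rule hatI[OF _ c0 cond_sub_H])
        have bQ: "b \<in> carrier Q" using b A hat_carrier by blast
        then show "x \<otimes> b \<in> carrier Q" using xQ by simp
        fix d assume d: "d \<in> ?f"
        have "x \<otimes> b \<otimes> d \<otimes> y \<in> H" if y: "y \<in> ?K" for y
        proof -
          have "x \<otimes> (d \<otimes> y \<otimes> b) \<in> H" using cond_mult(1)[OF d y] b by (intro xA') blast
          moreover have "x \<otimes> (d \<otimes> y \<otimes> b) = x \<otimes> b \<otimes> d \<otimes> y"
            using xQ bQ d y hat_carrier colon_subset[of H ?K] by (auto simp: gsimps subset_iff)
          ultimately show ?thesis by simp
        qed
        then show "x \<otimes> b \<otimes> d \<in> ?f"
          using xQ bQ d colon_subset[of H ?K] by (auto simp: colon_iff[of "x \<otimes> b \<otimes> d"])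
      qed
      then show "x \<in> colon Q ?K A" using xQ by (simp add: colon_iff)
    qed
    moreover have "a ` E \<subseteq> A" using ac by blast
    ultimately show "\<exists>E. finite E \<and> E \<subseteq> A \<and> colon Q ?K E \<subseteq> colon Q ?K A" using E(1) by blast
  qed
qed

text \<open>If the closure were all of \<open>Q\<close>, then the conductor would be stable under
  multiplication by \<open>Q\<close> and would contain \<open>H\<close>. This excludes the
  degenerate case without valuations.\<close>

lemma hat_proper:
  assumes f: "colon Q H (complete_int_closure Q H) \<noteq> {}" "colon Q H (complete_int_closure Q H) \<subset> H"
  shows "complete_int_closure Q H \<noteq> carrier Q"
proof
  assume e: "complete_int_closure Q H = carrier Q"
  obtain d where d: "d \<in> colon Q H (carrier Q)" using f e by auto
  then have dQ: "d \<in> carrier Q" by (simp add: colon_iff)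
  have "x \<in> colon Q H (carrier Q)" if "x \<in> H" for x
  proof -
    have "x \<otimes> y \<in> H" if y: "y \<in> carrier Q" for y
    proof -
      have "d \<otimes> (inv d \<otimes> (x \<otimes> y)) \<in> H"
        using d y dQ \<open>x \<in> H\<close> unfolding colon_iff by (elim conjE bspec) simp
      then show ?thesis using y dQ \<open>x \<in> H\<close> by (simp add: cancel_simps)
    qed
    then show ?thesis using that by (simp add: colon_iff)
  qed
  then show False using f(2) e by auto
qed

section \<open>Prime avoidance and finiteness of the minimal primes containing an element\<close>

lemma finprod_mem_prime:
  assumes P: "prime_s_ideal Q H p" and T: "finite T" "i \<in> T" and g: "\<And>j. j \<in> T \<Longrightarrow> g j \<in> H" "g i \<in> p"
  shows "finprod Q g T \<in> p"
proof -
  have "finprod Q g (insert i (T - {i})) = g i \<otimes> finprod Q g (T - {i})"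
    by (rule finprod_insert) (use T g in auto)
  moreover have "finprod Q g (T - {i}) \<in> H" by (rule H_finprod) (use g in auto)
  ultimately show ?thesis using primeD(3)[OF P g(2)] T by (simp add: insert_absorb)
qed

text \<open>Distinct minimal primes are incomparable, so each \<open>p\<close> in \<open>T\<close>
  has an element outside \<open>q\<close>; the product of these works because the complement of
  \<open>q\<close> is multiplicatively closed.\<close>

lemma prime_avoid:
  assumes q: "q \<in> min_primes Q H" and T: "finite T" "T \<subseteq> min_primes Q H" "q \<notin> T"
  obtains c where "c \<in> H - q" "\<And>p. p \<in> T \<Longrightarrow> c \<in> p"
proof -
  have "\<exists>c. c \<in> p \<and> c \<notin> q" if "p \<in> T" for p
    using min_primeD(3)[OF q min_primeD(1,2)] T that by blast
  then obtain g where g: "\<And>p. p \<in> T \<Longrightarrow> g p \<in> p \<and> g p \<notin> q" by metis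
  have gH: "g p \<in> H" if "p \<in> T" for p using g[OF that] primeD(1)[OF min_primeD(1)] T that by blast
  have "finprod Q g T \<in> H - q"
    by (rule prime_finprod_compl[OF min_primeD(1)[OF q]]) (use g gH in blast)
  moreover have "finprod Q g T \<in> p" if "p \<in> T" for p
    by (rule finprod_mem_prime[OF min_primeD(1) T(1) that]) (use g gH T that in blast)+
  ultimately show ?thesis using that by blast
qed

text \<open>Write each prime containing \<open>a\<close> as the set of denominators of some
  \<open>z p\<close>. Finitely many of the elements \<open>a z p\<close> have the same inverse as
  all of them; a further prime \<open>q\<close> would contain every \<open>c\<close> that lies in
  the corresponding finitely many primes, against prime avoidance.\<close>

lemma finite_min_primes:
  assumes v: "v_noetherian Q H" and a: "a \<in> H"
  shows "finite {p \<in> min_primes Q H. a \<in> p}"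
proof -
  let ?Y = "{p \<in> min_primes Q H. a \<in> p}"
  have "\<exists>z. z \<in> carrier Q \<and> p = {x \<in> H. x \<otimes> z \<in> H}" if "p \<in> ?Y" for p
    using min_prime_conductor[OF v, of p] that by blast
  then obtain z where z: "\<And>p. p \<in> ?Y \<Longrightarrow> z p \<in> carrier Q \<and> p = {x \<in> H. x \<otimes> z p \<in> H}" by metis
  let ?A = "(\<lambda>p. a \<otimes> z p) ` ?Y"
  have "?A \<subseteq> H" using z by blast
  then obtain E where E: "finite E" "E \<subseteq> ?A" "colon Q H E = colon Q H ?A"
    using v_noetherian_finite[OF v] by blast
  obtain T where T: "T \<subseteq> ?Y" "finite T" "E = (\<lambda>p. a \<otimes> z p) ` T"
    using finite_subset_image[OF E(1,2)] by blast
  have "?Y \<subseteq> T"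
  proof
    fix q assume q: "q \<in> ?Y"
    show "q \<in> T"
    proof (rule ccontr)
      assume "q \<notin> T"
      then obtain c where c: "c \<in> H - q" "\<And>p. p \<in> T \<Longrightarrow> c \<in> p"
        using prime_avoid[of q T] q T by blast
      have e: "c \<otimes> inv a \<otimes> (a \<otimes> z p) = c \<otimes> z p" if "p \<in> ?Y" for p
        using c(1) a z[OF that] by (simp add: gsimps)
      have "c \<otimes> inv a \<otimes> (a \<otimes> z p) \<in> H" if "p \<in> T" for p
      proof -
        have p: "p \<in> ?Y" using that T(1) by blast
        have "c \<in> {x \<in> H. x \<otimes> z p \<in> H}" using c(2)[OF that] z[OF p] by metis
        then show ?thesis unfolding e[OF p] by blast
      qed
      then have "c \<otimes> inv a \<in> colon Q H E" using c(1) a by (auto simp: colon_iff T(3))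
      then have "c \<otimes> inv a \<otimes> (a \<otimes> z q) \<in> H" using q unfolding E(3) colon_iff by blast
      then have "c \<in> q" using e[OF q] c(1) z[OF q] by auto
      with c(1) show False by blast
    qed
  qed
  then show ?thesis using T(2) finite_subset by blast
qed

section \<open>Discrete valuations\<close>

text \<open>A normalized valuation: that the value 1 occurs makes \<open>v\<close> map onto the
  integers. It lives on all of \<open>Q\<close>, so that the values of one element at different
  primes can be compared.\<close>

definition discrete_val :: "'a set \<Rightarrow> ('a \<Rightarrow> int) \<Rightarrow> bool" where
  "discrete_val D v \<longleftrightarrow> (\<forall>x\<in>carrier Q. \<forall>y\<in>carrier Q. v (x \<otimes> y) = v x + v y) \<and>
    (\<exists>c\<in>carrier Q. v c = 1) \<and> D = {x \<in> carrier Q. 0 \<le> v x}"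

text \<open>\<open>z\<close> multiplies \<open>p\<close> into \<open>H\<close>, while
  \<open>az\<close> lies in \<open>H\<close> outside \<open>p\<close> and hence is a unit of
  \<open>L p\<close>; so \<open>x/a = (xz)/(az)\<close>.\<close>

lemma uniformizer:
  assumes P: "prime_s_ideal Q H p" and z: "z \<in> carrier Q" "p = {x \<in> H. x \<otimes> z \<in> H}"
    and a: "a \<in> p" "a \<otimes> z \<notin> p" and x: "x \<in> L p" "x \<notin> U p"
  shows "x \<otimes> inv a \<in> L p"
proof -
  obtain t where t: "t \<in> H - p" "t \<otimes> x \<in> p" using L_nonunitE[OF P x] .
  have xQ: "x \<in> carrier Q" using x L_carrier by blast
  have aH: "a \<in> H" using a primeD(1)[OF P] by blast
  have az: "a \<otimes> z \<in> H - p" using a z by blast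
  show ?thesis
  proof (rule localizeI[OF prime_compl(1)[OF P t(1) az] _ _ subset])
    have "t \<otimes> (a \<otimes> z) \<otimes> (x \<otimes> inv a) = t \<otimes> x \<otimes> z" using t(1) aH z(1) xQ by (simp add: gsimps)
    then show "t \<otimes> (a \<otimes> z) \<otimes> (x \<otimes> inv a) \<in> H" using t(2) z(2) by auto
  qed (use aH xQ in simp)
qed

text \<open>All non-units are multiples of \<open>a\<close>, and high powers of \<open>a\<close> are
  multiples of any given element, so every element is a power of \<open>a\<close> up to a unit; the
  exponent is the valuation.\<close>

lemma discrete_val_exists:
  assumes p: "p \<in> min_primes Q H" and a: "a \<in> L p" "a \<notin> U p"
    and x: "\<And>x. x \<in> L p \<Longrightarrow> x \<notin> U p \<Longrightarrow> x \<otimes> inv a \<in> L p"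
  shows "\<exists>v. discrete_val (L p) v"
proof -
  note P = min_primeD(1)[OF p]
  have aQ: "a \<in> carrier Q" using a L_carrier by blast
  have nat: "\<exists>n::nat. a [^] n \<otimes> inv y \<in> U p" if y: "y \<in> L p" for y
  proof -
    have yQ: "y \<in> carrier Q" using y L_carrier by blast
    obtain N where N: "a [^] (N::nat) \<otimes> inv y \<in> L p"
      using L_primary[OF p a, of "inv y"] yQ by blast
    \<comment> \<open>At the least exponent \<open>a^n/y\<close> must be a unit, because a non-unit
      could be divided by \<open>a\<close> once more.\<close>
    define n where "n = (LEAST n::nat. a [^] n \<otimes> inv y \<in> L p)"
    have n: "a [^] n \<otimes> inv y \<in> L p" unfolding n_def using N by (rule LeastI)
    have "a [^] n \<otimes> inv y \<in> U p"
    proof (cases n)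
      case 0
      then have "inv y \<in> L p" using n yQ by simp
      then show ?thesis using 0 y yQ U_iff[OF P, of "inv y"] by simp
    next
      case (Suc m)
      show ?thesis
      proof (rule ccontr)
        assume "a [^] n \<otimes> inv y \<notin> U p"
        then have "a [^] n \<otimes> inv y \<otimes> inv a \<in> L p" using x n by blast
        then have "a [^] m \<otimes> inv y \<in> L p" using Suc aQ yQ by (simp add: gsimps)
        then show False using not_less_Least[of m "\<lambda>n. a [^] n \<otimes> inv y \<in> L p"] Suc n_def by auto
      qed
    qed
    then show ?thesis by blast
  qed
  have powL: "a [^] m \<in> L p" for m :: nat
  proof (induction m)
    case (Suc m)
    show ?case using L_mult[OF P Suc.IH a(1)] by simp
  qed (use P in simp)
  \<comment> \<open>A general element is a fraction of two elements of \<open>H\<close>, and the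
    exponents of these are subtracted.\<close>
  have ex: "\<exists>k::int. a [^] k \<otimes> inv y \<in> U p" if yQ: "y \<in> carrier Q" for y
  proof -
    obtain t where t: "t \<in> H" "t \<otimes> y \<in> H" using frac[OF yQ] .
    obtain n m where nm: "a [^] (n::nat) \<otimes> inv t \<in> U p" "a [^] (m::nat) \<otimes> inv (t \<otimes> y) \<in> U p"
      using nat[of t] nat[of "t \<otimes> y"] t H_sub_L[OF P] by blast
    have "a [^] (int m - int n) = a [^] m \<otimes> inv (a [^] n)"
      using aQ int_pow_diff[of a "int m" "int n"] by (simp add: int_pow_int)
    then have "a [^] (int m - int n) \<otimes> inv y
        = a [^] m \<otimes> inv (t \<otimes> y) \<otimes> inv (a [^] n \<otimes> inv t)"
      using aQ yQ t(1) by (simp add: gsimps)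
    also have "\<dots> \<in> U p" by (intro U_mult[OF P] U_inv[OF P] nm)
    finally show ?thesis by blast
  qed
  have pos: "a [^] k \<notin> U p" if "k > 0" for k :: int
  proof -
    have m: "k = int (Suc (nat (k - 1)))" using that by simp
    define m where "m = nat (k - 1)"
    have "a \<otimes> a [^] m \<notin> U p" by (rule L_nonunit_mult[OF P a powL])
    then have "a [^] Suc m \<notin> U p" using aQ by (simp add: m_comm)
    moreover have "a [^] k = a [^] Suc m" by (subst m) (simp only: m_def int_pow_int)
    ultimately show ?thesis by simp
  qed
  have z: "k = 0" if "a [^] k \<in> U p" for k :: int
  proof (rule ccontr)
    assume "k \<noteq> 0"
    moreover have "a [^] (- k) \<in> U p" using U_inv[OF P that] aQ by (simp add: int_pow_neg)
    ultimately show False using pos[of k] pos[of "- k"] that by (cases "k > 0") auto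
  qed
  have uniq: "k = l" if "a [^] k \<otimes> inv y \<in> U p" "a [^] l \<otimes> inv y \<in> U p" "y \<in> carrier Q" for k l :: int and y
  proof -
    have "a [^] (k - l) = a [^] k \<otimes> inv y \<otimes> inv (a [^] l \<otimes> inv y)"
      using aQ that(3) int_pow_diff[of a k l] by (simp add: gsimps)
    also have "\<dots> \<in> U p" by (intro U_mult[OF P] U_inv[OF P] that)
    finally show ?thesis using z by fastforce
  qed
  define v where "v y = (THE k::int. a [^] k \<otimes> inv y \<in> U p)" for y
  have veq: "v y = k" if "a [^] k \<otimes> inv y \<in> U p" "y \<in> carrier Q" for k y
    unfolding v_def using that uniq by blast
  have vmem: "a [^] (v y) \<otimes> inv y \<in> U p" if "y \<in> carrier Q" for y
    using ex[OF that] veq[OF _ that] by metis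
  have "v (y \<otimes> w) = v y + v w" if "y \<in> carrier Q" "w \<in> carrier Q" for y w
  proof (rule veq)
    have "a [^] (v y + v w) \<otimes> inv (y \<otimes> w) = a [^] (v y) \<otimes> inv y \<otimes> (a [^] (v w) \<otimes> inv w)"
      using aQ that by (simp add: int_pow_mult gsimps)
    also have "\<dots> \<in> U p" by (intro U_mult[OF P] vmem that)
    finally show "a [^] (v y + v w) \<otimes> inv (y \<otimes> w) \<in> U p" .
  qed (use that in auto)
  moreover have "v a = 1"
  proof (rule veq)
    have "a [^] (1::int) \<otimes> inv a = \<one>" using aQ by simp
    then show "a [^] (1::int) \<otimes> inv a \<in> U p" using U_one[OF P] by simp
  qed (rule aQ)
  moreover have "L p = {y \<in> carrier Q. 0 \<le> v y}"
  proof (intro equalityI subsetI CollectI conjI)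
    fix y assume y: "y \<in> L p"
    then show yQ: "y \<in> carrier Q" by (rule L_carrier)
    obtain n where "a [^] (n::nat) \<otimes> inv y \<in> U p" using nat[OF y] by blast
    then have "v y = int n" by (intro veq yQ) (simp add: int_pow_int)
    then show "0 \<le> v y" by simp
  next
    fix y assume "y \<in> {y \<in> carrier Q. 0 \<le> v y}"
    then have y: "y \<in> carrier Q" "0 \<le> v y" by auto
    have "a [^] (v y) \<in> L p" using powL[of "nat (v y)"] int_pow_int[of Q a "nat (v y)"] y(2) by simp
    then have "a [^] (v y) \<otimes> inv (a [^] (v y) \<otimes> inv y) \<in> L p"
      using U_inv[OF P vmem[OF y(1)]] U_sub_L[OF P] by (intro L_mult[OF P]) auto
    then show "y \<in> L p" using y(1) aQ by (simp add: gsimps)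
  qed
  ultimately show ?thesis unfolding discrete_val_def using aQ by blast
qed

lemma discrete_valD:
  assumes "discrete_val D v"
  shows "x \<in> carrier Q \<Longrightarrow> y \<in> carrier Q \<Longrightarrow> v (x \<otimes> y) = v x + v y"
    "x \<in> D \<longleftrightarrow> x \<in> carrier Q \<and> 0 \<le> v x" "v \<one> = 0"
    "x \<in> carrier Q \<Longrightarrow> v (inv x) = - v x"
    "x \<in> carrier Q \<Longrightarrow> v (x [^] (n::nat)) = int n * v x"
    "x \<in> carrier Q \<Longrightarrow> v (x [^] (k::int)) = k * v x"
    "(\<And>i. i \<in> T \<Longrightarrow> g i \<in> carrier Q) \<Longrightarrow> v (finprod Q g T) = (\<Sum>i\<in>T. v (g i))"
proof -
  show m: "v (x \<otimes> y) = v x + v y" if "x \<in> carrier Q" "y \<in> carrier Q" for x y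
    using assms that unfolding discrete_val_def by blast
  show "x \<in> D \<longleftrightarrow> x \<in> carrier Q \<and> 0 \<le> v x" using assms unfolding discrete_val_def by blast
  show o: "v \<one> = 0" using m[of \<one> \<one>] by simp
  show i: "v (inv x) = - v x" if "x \<in> carrier Q" for x using m[of x "inv x"] that o by simp
  show n: "v (x [^] (n::nat)) = int n * v x" if "x \<in> carrier Q" for x n
    by (induction n) (use o m that in \<open>simp_all add: algebra_simps\<close>)
  show "v (x [^] (k::int)) = k * v x" if "x \<in> carrier Q"
    using n[OF that] i that by (cases k rule: int_cases2) (simp_all add: int_pow_neg int_pow_int)
  show "v (finprod Q g T) = (\<Sum>i\<in>T. v (g i))" if "\<And>i. i \<in> T \<Longrightarrow> g i \<in> carrier Q"
    using that
  proof (induction T rule: infinite_finite_induct)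
    case (insert i T)
    then have "finprod Q g (insert i T) = g i \<otimes> finprod Q g T" by (intro finprod_insert) auto
    with insert show ?case by (simp add: m)
  qed (simp_all add: o finprod_infinite)
qed

lemma discrete_val_submonoid: "discrete_val D v \<Longrightarrow> submonoid D Q"
  by (rule submonoid.intro) (auto simp: discrete_valD)

lemma discrete_val_Units:
  "discrete_val D v \<Longrightarrow> Units (Q\<lparr>carrier := D\<rparr>) = {x \<in> carrier Q. v x = 0}"
  by (auto simp: Units_submonoid[OF discrete_val_submonoid] discrete_valD)

lemma discrete_val_one: "discrete_val D v \<Longrightarrow> \<exists>c\<in>carrier Q. v c = 1"
  unfolding discrete_val_def by blast

lemma discrete_valuation_monoid_of_val:
  assumes v: "discrete_val D v" shows "discrete_valuation_monoid (Q\<lparr>carrier := D\<rparr>)"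
proof -
  note vD = discrete_valD[OF v] and un = discrete_val_Units[OF v]
  let ?D = "Q\<lparr>carrier := D\<rparr>" and ?U = "{x \<in> carrier Q. v x = 0}"
  obtain c where c: "c \<in> carrier Q" "v c = 1" using discrete_val_one[OF v] by blast
  have coset: "?U #>\<^bsub>?D\<^esub> x = {y \<in> carrier Q. v y = v x}" if x: "x \<in> carrier Q" for x
  proof (intro equalityI subsetI)
    fix y assume "y \<in> {y \<in> carrier Q. v y = v x}"
    then have y: "y \<in> carrier Q" "v y = v x" by auto
    then have "y \<otimes> inv x \<in> ?U" "y = y \<otimes> inv x \<otimes> x" using x by (simp_all add: vD gsimps)
    then show "y \<in> ?U #>\<^bsub>?D\<^esub> x" unfolding r_coset_def by auto
  qed (use x in \<open>auto simp: r_coset_def vD(1)\<close>)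
  \<comment> \<open>\<open>SOME\<close> is harmless here, since \<open>v\<close> is constant on each
    coset.\<close>
  define h where "h C = nat (v (SOME x. x \<in> C))" for C
  let ?C = "\<lambda>k. {y \<in> carrier Q. v y = int k}"
  have ne: "c [^] k \<in> ?C k" for k using c by (simp add: vD)
  have h: "h (?C k) = k" for k
    unfolding h_def using someI[of "\<lambda>x. x \<in> ?C k", OF ne] by auto
  have carr: "carrier (monoid_red ?D) = range ?C"
  proof (intro equalityI subsetI)
    fix A assume "A \<in> carrier (monoid_red ?D)"
    then obtain x where x: "x \<in> D" "A = ?U #>\<^bsub>?D\<^esub> x" unfolding monoid_red_def un by auto
    then have "A = ?C (nat (v x))" using coset[of x] vD(2)[of x] by auto
    then show "A \<in> range ?C" by blast
  next
    fix A assume "A \<in> range ?C"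
    then obtain k where k: "A = ?C k" by blast
    then have "A = ?U #>\<^bsub>?D\<^esub> c [^] k" using coset[of "c [^] k"] c by (simp add: vD)
    moreover have "c [^] k \<in> D" using c by (simp add: vD)
    ultimately show "A \<in> carrier (monoid_red ?D)" unfolding monoid_red_def un by auto
  qed
  have mult: "?C k <#>\<^bsub>?D\<^esub> ?C l = ?C (k + l)" for k l
  proof (intro equalityI subsetI)
    fix y assume "y \<in> ?C (k + l)"
    then have y: "y \<in> carrier Q" "v y = int k + int l" by auto
    then have "c [^] k \<in> ?C k" "inv (c [^] k) \<otimes> y \<in> ?C l" "y = c [^] k \<otimes> (inv (c [^] k) \<otimes> y)"
      using c by (simp_all add: vD cancel_simps)
    then show "y \<in> ?C k <#>\<^bsub>?D\<^esub> ?C l" unfolding set_mult_def by auto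
  qed (auto simp: set_mult_def vD(1))
  have "h \<in> iso (monoid_red ?D) nat_add_monoid"
  proof (rule isoI)
    show "h \<in> hom (monoid_red ?D) nat_add_monoid"
    proof (rule homI)
      fix A B assume "A \<in> carrier (monoid_red ?D)" "B \<in> carrier (monoid_red ?D)"
      then obtain k l where AB: "A = ?C k" "B = ?C l" unfolding carr by blast
      have "A \<otimes>\<^bsub>monoid_red ?D\<^esub> B = ?C (k + l)" unfolding AB mult[symmetric] by (simp add: monoid_red_def)
      then have "h (A \<otimes>\<^bsub>monoid_red ?D\<^esub> B) = k + l" by (simp only: h)
      then show "h (A \<otimes>\<^bsub>monoid_red ?D\<^esub> B) = h A \<otimes>\<^bsub>nat_add_monoid\<^esub> h B"
        unfolding AB h by (simp add: nat_add_monoid_def)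
    qed (simp add: nat_add_monoid_def)
    show "bij_betw h (carrier (monoid_red ?D)) (carrier nat_add_monoid)"
      unfolding carr by (rule bij_betwI[of _ _ _ ?C]) (auto simp: h nat_add_monoid_def)
  qed
  then show ?thesis unfolding discrete_valuation_monoid_def
    using submonoid_cancel[OF discrete_val_submonoid[OF v]] is_isoI by blast
qed

section \<open>Krull monoids\<close>

text \<open>Both claims rest on one principle: a non-empty part of \<open>p\<close> that is stable
  under \<open>z\<close> would put \<open>z\<close> into the complete integral closure, that is,
  into \<open>H\<close>. Hence \<open>p z\<close> is not inside \<open>p\<close>, and a strictly
  smaller non-empty prime cannot exist, because it would be stable under \<open>z\<close>.\<close>

lemma cic_conductor_prime:
  assumes cic: "complete_int_closure Q H = H" and P: "prime_s_ideal Q H p" "p \<noteq> {}"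
    and z: "z \<in> carrier Q" "z \<notin> H" "p = {x \<in> H. x \<otimes> z \<in> H}"
  shows "\<exists>a\<in>p. a \<otimes> z \<notin> p" "p \<in> min_primes Q H"
proof -
  note PD = primeD[OF P(1)]
  have no: False if q: "q \<subseteq> p" "q \<noteq> {}" "\<And>y. y \<in> q \<Longrightarrow> y \<otimes> z \<in> q" for q
  proof -
    obtain y where y: "y \<in> q" using q(2) by blast
    have "z \<in> complete_int_closure Q H"
    proof (rule hatI[OF z(1) y])
      show qH: "q \<subseteq> H" using q(1) PD(1) by blast
      fix a assume a: "a \<in> q"
      then have "a \<in> carrier Q" using qH by blast
      then show "z \<otimes> a \<in> q" using q(3)[OF a] z(1) m_comm[of z a] by simp
    qed
    then show False using cic z(2) by simp
  qed
  then show "\<exists>a\<in>p. a \<otimes> z \<notin> p" using P(2) by blast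
  then obtain a where a: "a \<in> p" "a \<otimes> z \<notin> p" "a \<in> H" using PD(1) by blast
  have azH: "a \<otimes> z \<in> H" using a z(3) by blast
  have "q = p" if q: "prime_s_ideal Q H q" "q \<noteq> {}" "q \<subseteq> p" for q
  proof (rule ccontr)
    assume "q \<noteq> p"
    note QD = primeD[OF q(1)]
    \<comment> \<open>Otherwise \<open>x (az) = (xz) a\<close> lies in \<open>q\<close> for all
      \<open>x\<close> in \<open>p\<close> while \<open>az\<close> does not, so \<open>p\<close>
      would be inside \<open>q\<close>.\<close>
    have "a \<notin> q"
    proof
      assume aq: "a \<in> q"
      have "x \<in> q" if "x \<in> p" for x
      proof -
        have x: "x \<in> H" "x \<otimes> z \<in> H" using that z(3) by auto
        have "x \<otimes> (a \<otimes> z) = (x \<otimes> z) \<otimes> a" using x(1) a(3) z(1) by (simp add: gsimps)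
        then have "x \<otimes> (a \<otimes> z) \<in> q" using QD(4)[OF aq x(2)] by simp
        then show ?thesis using QD(5)[OF x(1) azH] a(2) q(3) by blast
      qed
      then show False using \<open>q \<noteq> p\<close> q(3) by blast
    qed
    have "y \<otimes> z \<in> q" if y: "y \<in> q" for y
    proof -
      have yz: "y \<in> H" "y \<otimes> z \<in> H" using y q(3) z(3) by auto
      have "(y \<otimes> z) \<otimes> a = y \<otimes> (a \<otimes> z)" using yz(1) a(3) z(1) by (simp add: gsimps)
      then have "(y \<otimes> z) \<otimes> a \<in> q" using QD(3)[OF y azH] by simp
      then show ?thesis using QD(5)[OF yz(2) a(3)] \<open>a \<notin> q\<close> by blast
    qed
    then show False using no[OF q(3,2)] by blast
  qed
  then show "p \<in> min_primes Q H" unfolding min_primes_def using P by blast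
qed

lemma cic_discrete_val:
  assumes v: "v_noetherian Q H" and cic: "complete_int_closure Q H = H" and p: "p \<in> min_primes Q H"
  shows "\<exists>w. discrete_val (L p) w"
proof -
  note P = min_primeD(1)[OF p]
  obtain z where z: "z \<in> carrier Q" "z \<notin> L p" "p = {x \<in> H. x \<otimes> z \<in> H}"
    using min_prime_conductor[OF v p] .
  have zH: "z \<notin> H" using z H_sub_L[OF P] by blast
  obtain a where a: "a \<in> p" "a \<otimes> z \<notin> p"
    using cic_conductor_prime(1)[OF cic P min_primeD(2)[OF p] z(1) zH z(3)] by blast
  have aH: "a \<in> H" using a primeD(1)[OF P] by blast
  show ?thesis
    by (rule discrete_val_exists[OF p _ _ uniformizer[OF P z(1,3) a]])
      (use H_sub_L[OF P] U_H[OF P aH] a aH in auto)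
qed

text \<open>If \<open>x\<close> lies in all localizations but not in \<open>H\<close>, enlarge its
  set of denominators to a maximal one belonging to some \<open>z\<close> outside \<open>H\<close>.
  Maximality makes this set prime and complete integral closedness makes it a minimal prime; but
  \<open>x\<close> has a denominator outside every minimal prime.\<close>

lemma cic_krull:
  assumes v: "v_noetherian Q H" and cic: "complete_int_closure Q H = H"
  shows "krull Q H"
proof -
  have "x \<in> H" if x: "x \<in> carrier Q" "\<And>p. p \<in> min_primes Q H \<Longrightarrow> x \<in> L p" for x
  proof (rule ccontr)
    assume xH: "x \<notin> H"
    let ?I = "\<lambda>z. {y \<in> H. y \<otimes> z \<in> H}"
    let ?C = "?I ` {z \<in> carrier Q. z \<notin> H \<and> ?I x \<subseteq> ?I z}"
    have "v_ideal Q H A" if "A \<in> ?C" for A using that v_ideal_conductor by (elim imageE) simp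
    moreover have "?I x \<in> ?C" using x xH by (intro imageI) auto
    ultimately have "\<exists>M\<in>?C. \<forall>A\<in>?C. M \<subseteq> A \<longrightarrow> A = M" by (rule v_noetherian_maximal[OF v])
    then obtain M where M: "M \<in> ?C" and max: "\<forall>A\<in>?C. M \<subseteq> A \<longrightarrow> A = M" ..
    from M obtain z where z: "z \<in> carrier Q" "z \<notin> H" "?I x \<subseteq> ?I z" "M = ?I z" by auto
    have P: "prime_s_ideal Q H M"
      unfolding prime_s_ideal_iff
    proof (intro conjI ballI impI)
      show "M \<subseteq> H" "\<one> \<notin> M" using z by auto
      show "a \<otimes> h \<in> M" if ah: "a \<in> M" "h \<in> H" for a h
      proof -
        have a: "a \<in> H" "a \<otimes> z \<in> H" using ah z(4) by auto
        have "a \<otimes> h \<otimes> z = (a \<otimes> z) \<otimes> h" using a(1) ah(2) z(1) by (simp add: gsimps)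
        then have "a \<otimes> h \<otimes> z \<in> H" using H_closed[OF a(2) ah(2)] by simp
        then show ?thesis using z(4) a ah(2) by auto
      qed
      fix a b assume ab: "a \<in> H" "b \<in> H" "a \<otimes> b \<in> M"
      show "a \<in> M \<or> b \<in> M"
      proof (rule disjCI)
        assume "b \<notin> M"
        then have bz: "b \<otimes> z \<notin> H" using z(4) ab(2) by blast
        have sub: "?I z \<subseteq> ?I (b \<otimes> z)"
        proof
          fix y assume y: "y \<in> ?I z"
          have "y \<otimes> (b \<otimes> z) = b \<otimes> (y \<otimes> z)" using y ab(2) z(1) by (simp add: m_lcomm)
          then show "y \<in> ?I (b \<otimes> z)" using y ab(2) by auto
        qed
        have "?I (b \<otimes> z) \<in> ?C"
          using bz ab(2) z(1) order.trans[OF z(3) sub] by (intro imageI) simp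
        then have "?I (b \<otimes> z) = M" using max[THEN bspec, THEN mp] sub z(4) by blast
        moreover have "a \<in> ?I (b \<otimes> z)" using ab z(1,4) by (auto simp: m_assoc)
        ultimately show "a \<in> M" by blast
      qed
    qed
    have "M \<noteq> {}" using frac[OF z(1)] z(4) by (metis (no_types, lifting) empty_iff mem_Collect_eq)
    then have Mmin: "M \<in> min_primes Q H" using cic_conductor_prime(2)[OF cic P _ z(1,2,4)] by blast
    obtain t where "t \<in> H - M" "t \<otimes> x \<in> H" using x(2)[OF Mmin] L_iff by blast
    then show False using z by blast
  qed
  then have "H = carrier Q \<inter> (\<Inter>p\<in>min_primes Q H. L p)"
    using subset H_sub_L[OF min_primeD(1)] by blast
  moreover have "finite {p \<in> min_primes Q H. a \<in> p}" if "a \<in> H" for a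
    by (rule finite_min_primes[OF v that])
  moreover have "discrete_valuation_monoid (Q\<lparr>carrier := L p\<rparr>)" if "p \<in> min_primes Q H" for p
    using cic_discrete_val[OF v cic that] discrete_valuation_monoid_of_val by blast
  ultimately show ?thesis unfolding krull_def weakly_krull_def by auto
qed

section \<open>Localizations of seminormal monoids\<close>

lemma L_hat_sub:
  assumes P: "prime_s_ideal Q H p"
  shows "localize Q H p (complete_int_closure Q H) \<subseteq> complete_int_closure Q (L p)"
proof
  interpret D: quotient_group_of Q "L p" using L_quotient[OF P] .
  fix x assume "x \<in> localize Q H p (complete_int_closure Q H)"
  then obtain t where t: "t \<in> H - p" "t \<otimes> x \<in> complete_int_closure Q H" "x \<in> carrier Q"
    using localizeE[OF _ hat_carrier] by blast
  then obtain c where c: "c \<in> H" "\<And>n::nat. c \<otimes> (t \<otimes> x) [^] n \<in> H" unfolding hat_iff by blast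
  have "c \<otimes> x [^] n \<in> L p" for n :: nat
  proof -
    have "t [^] n \<otimes> (c \<otimes> x [^] n) = c \<otimes> (t \<otimes> x) [^] n"
      using t(1,3) c(1) by (simp add: nat_pow_distrib m_lcomm)
    then have "t [^] n \<otimes> (c \<otimes> x [^] n) \<in> H" using c(2) by simp
    then show ?thesis
      by (rule localizeI[OF prime_compl(3)[OF P t(1)] _ _ subset]) (use c(1) t(3) in simp)
  qed
  then show "x \<in> complete_int_closure Q (L p)"
    unfolding D.hat_iff using t(3) c(1) H_sub_L[OF P] by blast
qed

text \<open>A power of the non-unit \<open>x\<close> is a multiple of the denominator \<open>c\<close> of the powers of \<open>y\<close>, so all
large powers of \<open>xy\<close> lie in the localization; now use seminormality.\<close>

lemma nonunit_hat:
  assumes s: "seminormal Q H" and p: "p \<in> min_primes Q H" and x: "x \<in> L p" "x \<notin> U p"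
    and y: "y \<in> complete_int_closure Q (L p)"
  shows "x \<otimes> y \<in> L p" "x \<otimes> y \<notin> U p"
proof -
  note P = min_primeD(1)[OF p]
  interpret D: quotient_group_of Q "L p" using L_quotient[OF P] .
  have *: "x \<otimes> y \<in> L p" if y: "y \<in> complete_int_closure Q (L p)" for y
  proof -
    obtain c where c: "y \<in> carrier Q" "c \<in> L p" "\<And>n::nat. c \<otimes> y [^] n \<in> L p"
      using y unfolding D.hat_iff by blast
    obtain N where N: "\<forall>n\<ge>N. x [^] (n::nat) \<otimes> inv c \<in> L p"
      using L_primary[OF p x, of "inv c"] c L_carrier by blast
    show ?thesis
    proof (rule D.seminormal_pow[OF seminormal_L[OF s P], of _ N])
      fix n :: nat assume n: "n \<ge> N"
      have "(x \<otimes> y) [^] n = x [^] n \<otimes> inv c \<otimes> (c \<otimes> y [^] n)"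
        using c(1,2) x(1) L_carrier by (simp add: nat_pow_distrib gsimps)
      also have "\<dots> \<in> L p" using N n by (intro L_mult[OF P _ c(3)]) auto
      finally show "(x \<otimes> y) [^] n \<in> L p" .
    qed (use c x L_carrier in auto)
  qed
  show "x \<otimes> y \<in> L p" using *[OF y] .
  have yQ: "y \<in> carrier Q" "x \<in> carrier Q" using y x D.hat_carrier L_carrier by blast+
  show "x \<otimes> y \<notin> U p"
  proof
    assume u: "x \<otimes> y \<in> U p"
    have "inv x = y \<otimes> inv (x \<otimes> y)" using yQ by (simp add: gsimps)
    moreover have "inv (x \<otimes> y) \<in> complete_int_closure Q (L p)"
      using U_inv[OF P u] U_sub_L[OF P] D.H_sub_hat by blast
    ultimately have i: "inv x \<in> complete_int_closure Q (L p)"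
      using submonoid.m_closed[OF D.hat_submonoid y] by simp
    \<comment> \<open>The first claim, applied to the square of \<open>inv x\<close> in place of
      \<open>y\<close>, brings \<open>inv x\<close> itself into \<open>L p\<close>.\<close>
    have "x \<otimes> (inv x \<otimes> inv x) \<in> L p" by (intro * submonoid.m_closed[OF D.hat_submonoid] i)
    then have "inv x \<in> L p" using yQ by (simp add: gsimps)
    then show False using x U_iff[OF P] by blast
  qed
qed

text \<open>By \<open>nonunit_hat\<close> an element \<open>x\<close> of the closure of
  \<open>L p\<close> maps non-units to non-units. One denominator \<open>t\<close> serves for the
  products of \<open>x\<close> with all elements of \<open>p\<close>, by
  \<open>colon_localize\<close>; so \<open>tx\<close> maps \<open>p\<close> into itself and belongs
  to the closure of \<open>H\<close>.\<close>

lemma hat_L: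
  assumes v: "v_noetherian Q H" and s: "seminormal Q H" and p: "p \<in> min_primes Q H"
  shows "localize Q H p (complete_int_closure Q H) = complete_int_closure Q (L p)"
proof
  note P = min_primeD(1)[OF p]
  interpret D: quotient_group_of Q "L p" using L_quotient[OF P] .
  show "localize Q H p (complete_int_closure Q H) \<subseteq> complete_int_closure Q (L p)" by (rule L_hat_sub[OF P])
  show "complete_int_closure Q (L p) \<subseteq> localize Q H p (complete_int_closure Q H)"
  proof
    fix x assume x: "x \<in> complete_int_closure Q (L p)"
    have xQ: "x \<in> carrier Q" using x D.hat_carrier by blast
    have non: "a \<in> L p" "a \<notin> U p" "a \<in> H" if "a \<in> p" for a
      using that primeD(1)[OF P] H_sub_L[OF P] U_H[OF P] by blast+
    have xa: "x \<otimes> a \<in> L p" "x \<otimes> a \<notin> U p" if "a \<in> p" for a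
      using nonunit_hat[OF s p non(1,2)[OF that] x] m_comm[of a x] non(3)[OF that] xQ by auto
    obtain t where t: "t \<in> H - p" "t \<otimes> x \<in> colon Q H p"
      using colon_localize[OF v P primeD(1)[OF P] xQ xa(1)] .
    obtain c where c: "c \<in> p" using min_primeD(2)[OF p] by blast
    have "t \<otimes> x \<in> complete_int_closure Q H"
    proof (rule hatI[OF _ c primeD(1)[OF P]])
      show "t \<otimes> x \<in> carrier Q" using t xQ by simp
      fix a assume a: "a \<in> p"
      have e: "t \<otimes> x \<otimes> a = t \<otimes> (x \<otimes> a)" using t xQ non(3)[OF a] by (simp add: m_assoc)
      have "t \<otimes> (x \<otimes> a) \<notin> U p"
        using U_mult_iff(1)[OF P, of t "x \<otimes> a"] U_H[OF P, of t] t(1) xa[OF a] L_carrier by auto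
      moreover have "t \<otimes> (x \<otimes> a) \<in> H" using t(2) a unfolding e[symmetric] colon_iff by blast
      ultimately show "t \<otimes> x \<otimes> a \<in> p" using U_H[OF P, of "t \<otimes> (x \<otimes> a)"] e by auto
    qed
    then show "x \<in> localize Q H p (complete_int_closure Q H)"
      using t(1) xQ hat_carrier by (intro localizeI) auto
  qed
qed

lemma hat_sub_L:
  assumes P: "prime_s_ideal Q H p" and f: "\<not> colon Q H (complete_int_closure Q H) \<subseteq> p"
  shows "complete_int_closure Q H \<subseteq> L p"
proof
  fix x assume x: "x \<in> complete_int_closure Q H"
  obtain c where c: "c \<in> colon Q H (complete_int_closure Q H)" "c \<notin> p" using f by blast
  then have "c \<in> H - p" "c \<otimes> x \<in> H" using cond_sub_H cond_mult(2)[OF c(1) x] by auto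
  then show "x \<in> L p" using x hat_carrier by (intro localizeI[OF _ _ _ subset]) auto
qed

text \<open>If \<open>p\<close> does not contain the conductor, the closure of \<open>H\<close> lies
  in \<open>L p\<close>. As \<open>z\<close> is not in \<open>L p\<close>, it cannot map
  \<open>p\<close> into itself, and an \<open>a\<close> in \<open>p\<close> with \<open>az\<close>
  outside \<open>p\<close> is a uniformizer.\<close>

lemma outside_conductor_discrete_val:
  assumes v: "v_noetherian Q H" and p: "p \<in> min_primes Q H"
    and f: "\<not> colon Q H (complete_int_closure Q H) \<subseteq> p"
  shows "\<exists>w. discrete_val (L p) w"
proof -
  note P = min_primeD(1)[OF p]
  obtain z where z: "z \<in> carrier Q" "z \<notin> L p" "p = {x \<in> H. x \<otimes> z \<in> H}"
    using min_prime_conductor[OF v p] .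
  obtain c where c: "c \<in> p" using min_primeD(2)[OF p] by blast
  have "\<exists>a\<in>p. a \<otimes> z \<notin> p"
  proof (rule ccontr)
    assume no: "\<not> ?thesis"
    have "z \<in> complete_int_closure Q H"
    proof (rule hatI[OF z(1) c primeD(1)[OF P]])
      fix a assume "a \<in> p"
      with no z(1) primeD(1)[OF P] show "z \<otimes> a \<in> p" using m_comm[of z a] by auto
    qed
    then show False using hat_sub_L[OF P f] z(2) by blast
  qed
  then obtain a where a: "a \<in> p" "a \<otimes> z \<notin> p" by blast
  have aH: "a \<in> H" using a primeD(1)[OF P] by blast
  show ?thesis
    by (rule discrete_val_exists[OF p _ _ uniformizer[OF P z(1,3) a]])
      (use H_sub_L[OF P] U_H[OF P aH] a aH in auto)
qed

end

section \<open>Quotient groups\<close>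

lemma (in comm_group) rcos_eq_iff:
  assumes "subgroup N G" "x \<in> carrier G" "y \<in> carrier G"
  shows "N #> x = N #> y \<longleftrightarrow> inv x \<otimes> y \<in> N"
proof -
  interpret N: subgroup N G by fact
  show ?thesis
  proof
    assume "N #> x = N #> y"
    then have "y \<in> N #> x" using rcos_self[OF assms(3,1)] by simp
    then obtain h where h: "h \<in> N" "y = h \<otimes> x" unfolding r_coset_def by auto
    then have "inv x \<otimes> y = h" using assms N.subset by (auto simp: gsimps subset_iff)
    with h show "inv x \<otimes> y \<in> N" by simp
  next
    assume h: "inv x \<otimes> y \<in> N"
    have "y = (inv x \<otimes> y) \<otimes> x" using assms by (simp add: gsimps)
    then have "y \<in> N #> x" using h unfolding r_coset_def by auto
    then show "N #> x = N #> y" using repr_independence assms by blast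
  qed
qed

lemma (in comm_group) rcos_mult:
  assumes "subgroup N G" "x \<in> carrier G" "y \<in> carrier G"
  shows "(N #> x) <#> (N #> y) = N #> (x \<otimes> y)"
  using normal.rcos_sum[OF subgroup_imp_normal[OF assms(1)] assms(2,3)] .

text \<open>The product of \<open>quot_group\<close> is a union over representatives; carrying the
  group axioms back along a bijection onto a known group avoids their direct verification.\<close>

lemma comm_group_pullback:
  assumes G: "comm_group G" and inj: "inj_on \<phi> (carrier M)" and img: "\<phi> ` carrier M = carrier G"
    and closed: "\<And>x y. x \<in> carrier M \<Longrightarrow> y \<in> carrier M \<Longrightarrow> x \<otimes>\<^bsub>M\<^esub> y \<in> carrier M"
    and mult: "\<And>x y. x \<in> carrier M \<Longrightarrow> y \<in> carrier M \<Longrightarrow> \<phi> (x \<otimes>\<^bsub>M\<^esub> y) = \<phi> x \<otimes>\<^bsub>G\<^esub> \<phi> y"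
    and one: "\<one>\<^bsub>M\<^esub> \<in> carrier M" "\<phi> \<one>\<^bsub>M\<^esub> = \<one>\<^bsub>G\<^esub>"
  shows "comm_group M" "\<phi> \<in> iso M G"
proof -
  interpret G: comm_group G by fact
  have in_G: "\<phi> x \<in> carrier G" if "x \<in> carrier M" for x using img that by blast
  have eq: "x = y" if "x \<in> carrier M" "y \<in> carrier M" "\<phi> x = \<phi> y" for x y
    using inj that by (simp add: inj_on_eq_iff)
  show "comm_group M"
  proof (rule comm_groupI)
    fix x y z assume xyz: "x \<in> carrier M" "y \<in> carrier M" "z \<in> carrier M"
    show "x \<otimes>\<^bsub>M\<^esub> y \<otimes>\<^bsub>M\<^esub> z = x \<otimes>\<^bsub>M\<^esub> (y \<otimes>\<^bsub>M\<^esub> z)"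
      by (rule eq) (use xyz in_G in \<open>simp_all add: closed mult G.m_assoc\<close>)
  next
    fix x y assume xy: "x \<in> carrier M" "y \<in> carrier M"
    show "x \<otimes>\<^bsub>M\<^esub> y = y \<otimes>\<^bsub>M\<^esub> x"
      by (rule eq) (use xy in_G in \<open>simp_all add: closed mult G.m_comm\<close>)
    show "x \<otimes>\<^bsub>M\<^esub> y \<in> carrier M" using closed xy .
  next
    fix x assume x: "x \<in> carrier M"
    show "\<one>\<^bsub>M\<^esub> \<otimes>\<^bsub>M\<^esub> x = x" by (rule eq) (use x in_G one in \<open>simp_all add: closed mult\<close>)
    obtain y where y: "y \<in> carrier M" "\<phi> y = inv\<^bsub>G\<^esub> \<phi> x" using img in_G[OF x] G.inv_closed by (metis imageE)
    have "y \<otimes>\<^bsub>M\<^esub> x = \<one>\<^bsub>M\<^esub>" by (rule eq) (use x y in_G one in \<open>simp_all add: closed mult\<close>)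
    with y show "\<exists>y\<in>carrier M. y \<otimes>\<^bsub>M\<^esub> x = \<one>\<^bsub>M\<^esub>" by blast
  qed (rule one)
  show "\<phi> \<in> iso M G"
    using inj img in_G mult by (auto simp: iso_def hom_def bij_betw_def)
qed

text \<open>Under \<open>j\<close> the fraction of \<open>a\<close> and \<open>b\<close> becomes a
  fibre of the map sending \<open>(c, d)\<close> to \<open>j c / j d\<close>. So fractions
  correspond to elements of \<open>G\<close>, and their product does not depend on
  representatives.\<close>

lemma quot_group_iso:
  assumes M: "comm_monoid_cancel M" and G: "comm_group G" and j: "j \<in> hom M G" "inj_on j (carrier M)"
    and gen: "\<And>g. g \<in> carrier G \<Longrightarrow> \<exists>a\<in>carrier M. \<exists>b\<in>carrier M. g = j a \<otimes>\<^bsub>G\<^esub> inv\<^bsub>G\<^esub> j b"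
  obtains \<phi> where "comm_group (quot_group M)" "\<phi> \<in> iso (quot_group M) G"
    "\<forall>a\<in>carrier M. \<forall>b\<in>carrier M. \<phi> (fraction M a b) = j a \<otimes>\<^bsub>G\<^esub> inv\<^bsub>G\<^esub> j b"
    "\<forall>a\<in>carrier M. \<phi> (quot_embed M a) = j a"
proof -
  interpret M: comm_monoid_cancel M by fact
  interpret G: comm_group G by fact
  have jG: "j a \<in> carrier G" if "a \<in> carrier M" for a using j(1) that by (auto simp: hom_def)
  have jm: "j (a \<otimes>\<^bsub>M\<^esub> b) = j a \<otimes>\<^bsub>G\<^esub> j b" if "a \<in> carrier M" "b \<in> carrier M" for a b
    using j(1) that by (auto simp: hom_def)
  have j1: "j \<one>\<^bsub>M\<^esub> = \<one>\<^bsub>G\<^esub>" using jm[of "\<one>\<^bsub>M\<^esub>" "\<one>\<^bsub>M\<^esub>"] jG[of "\<one>\<^bsub>M\<^esub>"] by simp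
  let ?q = "\<lambda>a b. j a \<otimes>\<^bsub>G\<^esub> inv\<^bsub>G\<^esub> j b"
  have fr: "fraction M a b = {(c, d). c \<in> carrier M \<and> d \<in> carrier M \<and> ?q c d = ?q a b}"
    if ab: "a \<in> carrier M" "b \<in> carrier M" for a b
  proof -
    have "a \<otimes>\<^bsub>M\<^esub> d = c \<otimes>\<^bsub>M\<^esub> b \<longleftrightarrow> ?q c d = ?q a b" if cd: "c \<in> carrier M" "d \<in> carrier M" for c d
    proof -
      have "a \<otimes>\<^bsub>M\<^esub> d = c \<otimes>\<^bsub>M\<^esub> b \<longleftrightarrow> j (a \<otimes>\<^bsub>M\<^esub> d) = j (c \<otimes>\<^bsub>M\<^esub> b)"
        using j(2) ab cd by (simp add: inj_on_eq_iff)
      also have "\<dots> \<longleftrightarrow> j a \<otimes>\<^bsub>G\<^esub> j d = j c \<otimes>\<^bsub>G\<^esub> j b" using ab cd by (simp add: jm)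
      also have "\<dots> \<longleftrightarrow> ?q c d = ?q a b"
      proof
        assume "j a \<otimes>\<^bsub>G\<^esub> j d = j c \<otimes>\<^bsub>G\<^esub> j b"
        then have "j a \<otimes>\<^bsub>G\<^esub> j d \<otimes>\<^bsub>G\<^esub> (inv\<^bsub>G\<^esub> j b \<otimes>\<^bsub>G\<^esub> inv\<^bsub>G\<^esub> j d)
          = j c \<otimes>\<^bsub>G\<^esub> j b \<otimes>\<^bsub>G\<^esub> (inv\<^bsub>G\<^esub> j b \<otimes>\<^bsub>G\<^esub> inv\<^bsub>G\<^esub> j d)" by simp
        then show "?q c d = ?q a b" using ab cd jG by (simp add: G.gsimps)
      next
        assume "?q c d = ?q a b"
        then have "?q c d \<otimes>\<^bsub>G\<^esub> (j b \<otimes>\<^bsub>G\<^esub> j d) = ?q a b \<otimes>\<^bsub>G\<^esub> (j b \<otimes>\<^bsub>G\<^esub> j d)" by simp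
        then show "j a \<otimes>\<^bsub>G\<^esub> j d = j c \<otimes>\<^bsub>G\<^esub> j b" using ab cd jG by (simp add: G.gsimps)
      qed
      finally show ?thesis .
    qed
    then show ?thesis unfolding fraction_def by blast
  qed
  have fr_eq: "fraction M a b = fraction M c d \<longleftrightarrow> ?q a b = ?q c d"
    if "a \<in> carrier M" "b \<in> carrier M" "c \<in> carrier M" "d \<in> carrier M" for a b c d
  proof
    assume e: "fraction M a b = fraction M c d"
    have "(a, b) \<in> fraction M a b" using that by (simp add: fr)
    then show "?q a b = ?q c d" using that unfolding e by (simp add: fr)
  qed (use that in \<open>simp add: fr\<close>)
  have fr_mult: "fraction M a b \<otimes>\<^bsub>quot_group M\<^esub> fraction M c d = fraction M (a \<otimes>\<^bsub>M\<^esub> c) (b \<otimes>\<^bsub>M\<^esub> d)"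
    if abcd: "a \<in> carrier M" "b \<in> carrier M" "c \<in> carrier M" "d \<in> carrier M" for a b c d
  proof -
    have *: "fraction M (a' \<otimes>\<^bsub>M\<^esub> c') (b' \<otimes>\<^bsub>M\<^esub> d') = fraction M (a \<otimes>\<^bsub>M\<^esub> c) (b \<otimes>\<^bsub>M\<^esub> d)"
      if "(a', b') \<in> fraction M a b" "(c', d') \<in> fraction M c d" for a' b' c' d'
    proof -
      have 1: "a' \<in> carrier M" "b' \<in> carrier M" "c' \<in> carrier M" "d' \<in> carrier M"
        "?q a' b' = ?q a b" "?q c' d' = ?q c d" using that abcd by (auto simp: fr)
      have q: "?q (a \<otimes>\<^bsub>M\<^esub> c) (b \<otimes>\<^bsub>M\<^esub> d) = ?q a b \<otimes>\<^bsub>G\<^esub> ?q c d"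
        if "a \<in> carrier M" "b \<in> carrier M" "c \<in> carrier M" "d \<in> carrier M" for a b c d
        using that jG by (simp add: jm G.gsimps)
      show ?thesis using 1(1-4) abcd by (subst fr_eq) (simp_all only: q 1(5,6) M.m_closed)
    qed
    have mem: "(a, b) \<in> fraction M a b" "(c, d) \<in> fraction M c d" using abcd by (simp_all add: fr)
    have "(\<Union>(a', b')\<in>fraction M a b. \<Union>(c', d')\<in>fraction M c d. fraction M (a' \<otimes>\<^bsub>M\<^esub> c') (b' \<otimes>\<^bsub>M\<^esub> d'))
      = fraction M (a \<otimes>\<^bsub>M\<^esub> c) (b \<otimes>\<^bsub>M\<^esub> d)" (is "?A = ?B")
    proof (intro equalityI subsetI)
      fix x assume "x \<in> ?A"
      then obtain a' b' c' d' where "(a', b') \<in> fraction M a b" "(c', d') \<in> fraction M c d"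
        "x \<in> fraction M (a' \<otimes>\<^bsub>M\<^esub> c') (b' \<otimes>\<^bsub>M\<^esub> d')" by auto
      then show "x \<in> ?B" using *[of a' b' c' d'] by simp
    next
      fix x assume "x \<in> ?B"
      then have "x \<in> (\<Union>(c', d')\<in>fraction M c d. fraction M (a \<otimes>\<^bsub>M\<^esub> c') (b \<otimes>\<^bsub>M\<^esub> d'))"
        by (intro UN_I[OF mem(2)]) simp
      then show "x \<in> ?A" by (intro UN_I[OF mem(1)]) simp
    qed
    then show ?thesis by (simp add: quot_group_def)
  qed
  define \<phi> where "\<phi> X = (THE g. \<exists>a\<in>carrier M. \<exists>b\<in>carrier M. X = fraction M a b \<and> g = ?q a b)" for X
  have \<phi>: "\<phi> (fraction M a b) = ?q a b" if ab: "a \<in> carrier M" "b \<in> carrier M" for a b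
    unfolding \<phi>_def
  proof (rule the_equality)
    show "\<exists>a'\<in>carrier M. \<exists>b'\<in>carrier M. fraction M a b = fraction M a' b' \<and> ?q a b = ?q a' b'"
      using ab by blast
    show "g = ?q a b" if "\<exists>a'\<in>carrier M. \<exists>b'\<in>carrier M. fraction M a b = fraction M a' b' \<and> g = ?q a' b'" for g
      using that ab fr_eq by (elim bexE conjE) simp
  qed
  have carr: "carrier (quot_group M) = {fraction M a b | a b. a \<in> carrier M \<and> b \<in> carrier M}"
    by (simp add: quot_group_def)
  have inj: "inj_on \<phi> (carrier (quot_group M))"
  proof (rule inj_onI)
    fix x y assume xy: "x \<in> carrier (quot_group M)" "y \<in> carrier (quot_group M)" "\<phi> x = \<phi> y"
    then obtain a b c d where abcd: "x = fraction M a b" "y = fraction M c d"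
      "a \<in> carrier M" "b \<in> carrier M" "c \<in> carrier M" "d \<in> carrier M" unfolding carr by blast
    with xy(3) show "x = y" using fr_eq[OF abcd(3-6)] by (simp add: \<phi>)
  qed
  have img: "\<phi> ` carrier (quot_group M) = carrier G"
  proof
    show "\<phi> ` carrier (quot_group M) \<subseteq> carrier G" unfolding carr using jG by (auto simp: \<phi>)
    show "carrier G \<subseteq> \<phi> ` carrier (quot_group M)"
    proof
      fix g assume "g \<in> carrier G"
      then obtain a b where ab: "a \<in> carrier M" "b \<in> carrier M" "g = ?q a b" using gen by blast
      then have "g = \<phi> (fraction M a b)" by (simp add: \<phi>)
      with ab show "g \<in> \<phi> ` carrier (quot_group M)" unfolding carr by blast
    qed
  qed
  have one: "\<one>\<^bsub>quot_group M\<^esub> = fraction M \<one>\<^bsub>M\<^esub> \<one>\<^bsub>M\<^esub>" by (simp add: quot_group_def)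
  have closed_mult: "x \<otimes>\<^bsub>quot_group M\<^esub> y \<in> carrier (quot_group M)"
    "\<phi> (x \<otimes>\<^bsub>quot_group M\<^esub> y) = \<phi> x \<otimes>\<^bsub>G\<^esub> \<phi> y"
    if xy: "x \<in> carrier (quot_group M)" "y \<in> carrier (quot_group M)" for x y
  proof -
    from xy obtain a b c d where abcd: "x = fraction M a b" "y = fraction M c d"
      "a \<in> carrier M" "b \<in> carrier M" "c \<in> carrier M" "d \<in> carrier M" unfolding carr by blast
    show "x \<otimes>\<^bsub>quot_group M\<^esub> y \<in> carrier (quot_group M)"
      unfolding abcd(1,2) fr_mult[OF abcd(3-6)] unfolding carr using abcd by blast
    show "\<phi> (x \<otimes>\<^bsub>quot_group M\<^esub> y) = \<phi> x \<otimes>\<^bsub>G\<^esub> \<phi> y"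
      unfolding abcd(1,2) fr_mult[OF abcd(3-6)] using abcd(3-6) jG by (simp add: \<phi> jm G.gsimps)
  qed
  have one': "\<one>\<^bsub>quot_group M\<^esub> \<in> carrier (quot_group M)" unfolding one carr by blast
  have one'': "\<phi> \<one>\<^bsub>quot_group M\<^esub> = \<one>\<^bsub>G\<^esub>" unfolding one by (simp add: \<phi> j1)
  note cg = comm_group_pullback[OF G inj img closed_mult one' one'']
  show ?thesis
    by (rule that[OF cg]) (simp_all add: quot_embed_def \<phi> j1 jG)
qed

lemma FactGroup_iso:
  assumes G: "comm_group G" "comm_group G'" and \<phi>: "\<phi> \<in> iso G G'" and N: "subgroup N G"
  shows "(`) \<phi> \<in> iso (G Mod N) (G' Mod (\<phi> ` N))"
    "x \<in> carrier G \<Longrightarrow> \<phi> ` (N #>\<^bsub>G\<^esub> x) = (\<phi> ` N) #>\<^bsub>G'\<^esub> \<phi> x"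
    "subgroup (\<phi> ` N) G'"
proof -
  interpret G: comm_group G by fact
  interpret G': comm_group G' by fact
  interpret N: subgroup N G by fact
  have h: "\<phi> \<in> hom G G'" and inj: "inj_on \<phi> (carrier G)" and img: "\<phi> ` carrier G = carrier G'"
    using \<phi> by (auto simp: iso_def bij_betw_def)
  interpret h: group_hom G G' \<phi> by unfold_locales (rule h)
  show sub: "subgroup (\<phi> ` N) G'" using h.subgroup_img_is_subgroup[OF N] .
  show cos: "\<phi> ` (N #>\<^bsub>G\<^esub> x) = (\<phi> ` N) #>\<^bsub>G'\<^esub> \<phi> x" if "x \<in> carrier G" for x
    using that N.subset by (auto simp: r_coset_def image_iff)
  show "(`) \<phi> \<in> iso (G Mod N) (G' Mod (\<phi> ` N))"
  proof (rule isoI)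
    show "(`) \<phi> \<in> hom (G Mod N) (G' Mod (\<phi> ` N))"
    proof (rule homI)
      fix x assume "x \<in> carrier (G Mod N)"
      then obtain a where "a \<in> carrier G" "x = N #>\<^bsub>G\<^esub> a" unfolding carrier_FactGroup by blast
      then show "\<phi> ` x \<in> carrier (G' Mod (\<phi> ` N))" unfolding carrier_FactGroup by (simp add: cos)
    next
      fix x y assume "x \<in> carrier (G Mod N)" "y \<in> carrier (G Mod N)"
      then obtain a b where "a \<in> carrier G" "x = N #>\<^bsub>G\<^esub> a" "b \<in> carrier G" "y = N #>\<^bsub>G\<^esub> b"
        unfolding carrier_FactGroup by blast
      then show "\<phi> ` (x \<otimes>\<^bsub>G Mod N\<^esub> y) = \<phi> ` x \<otimes>\<^bsub>G' Mod \<phi> ` N\<^esub> \<phi> ` y"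
        by (simp add: cos G.rcos_mult[OF N] G'.rcos_mult[OF sub])
    qed
    have "inj_on ((`) \<phi>) (carrier (G Mod N))"
    proof (rule inj_onI)
      fix x y assume "x \<in> carrier (G Mod N)" "y \<in> carrier (G Mod N)" "\<phi> ` x = \<phi> ` y"
      moreover have "x \<subseteq> carrier G" if "x \<in> carrier (G Mod N)" for x
        using that unfolding carrier_FactGroup by (auto simp: r_coset_def)
      ultimately show "x = y" using inj by (simp add: inj_on_image_eq_iff)
    qed
    moreover have "(`) \<phi> ` carrier (G Mod N) = carrier (G' Mod (\<phi> ` N))"
      unfolding carrier_FactGroup img[symmetric] image_image by (rule image_cong) (simp_all add: cos)
    ultimately show "bij_betw ((`) \<phi>) (carrier (G Mod N)) (carrier (G' Mod (\<phi> ` N)))"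
      by (simp add: bij_betw_def)
  qed
qed

section \<open>Divisorial ideals of weakly Krull monoids\<close>

text \<open>This setting applies to \<open>H\<close> and later to its complete integral closure as
  well. \<open>proper\<close> guarantees a minimal non-empty prime.\<close>

locale mori_weakly_krull = quotient_group_of +
  assumes v_noeth: "v_noetherian Q H" and wk: "weakly_krull Q H" and proper: "H \<noteq> carrier Q"
begin

abbreviation "X \<equiv> min_primes Q H"

lemma prime: "p \<in> X \<Longrightarrow> prime_s_ideal Q H p"
  by (rule min_primeD(1))

lemma mem_H_iff: "x \<in> H \<longleftrightarrow> x \<in> carrier Q \<and> (\<forall>p\<in>X. x \<in> L p)"
  using wk unfolding weakly_krull_def by blast

lemma finite_mem: "a \<in> H \<Longrightarrow> finite {p \<in> X. a \<in> p}"
  using wk unfolding weakly_krull_def by blast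

lemma X_nonempty: "X \<noteq> {}"
  using mem_H_iff proper subset by blast

lemma finite_nonunit:
  assumes x: "x \<in> carrier Q" shows "finite {p \<in> X. x \<notin> U p}"
proof -
  obtain t where t: "t \<in> H" "t \<otimes> x \<in> H" using frac[OF x] .
  have "{p \<in> X. x \<notin> U p} \<subseteq> {p \<in> X. t \<in> p} \<union> {p \<in> X. t \<otimes> x \<in> p}"
  proof clarify
    fix p assume p: "p \<in> X" "x \<notin> U p" "t \<otimes> x \<notin> p"
    show "t \<in> p"
      using U_mult_iff(1)[OF prime[OF p(1)] _ x, of t] U_H[OF prime[OF p(1)]] t p by blast
  qed
  then show ?thesis using finite_mem t finite_subset by blast
qed

text \<open>Such an \<open>x\<close> represents an element of the coproduct of the groups
  \<open>Q/U p\<close>. Working with representatives keeps the arithmetic in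
  \<open>Q\<close>.\<close>

definition fam :: "('a set \<Rightarrow> 'a) \<Rightarrow> bool" where
  "fam x \<longleftrightarrow> (\<forall>p\<in>X. x p \<in> carrier Q) \<and> finite {p \<in> X. x p \<notin> U p}"

text \<open>The intersection of the sets \<open>x p L_p\<close>. It is fractional in general;
  integrality of the \<open>x p\<close> is imposed separately.\<close>

definition ideal_of :: "('a set \<Rightarrow> 'a) \<Rightarrow> 'a set" where
  "ideal_of x = {a \<in> carrier Q. \<forall>p\<in>X. inv (x p) \<otimes> a \<in> L p}"

lemma fam_carrier: "fam x \<Longrightarrow> p \<in> X \<Longrightarrow> x p \<in> carrier Q"
  unfolding fam_def by blast

lemma fam_const: "a \<in> carrier Q \<Longrightarrow> fam (\<lambda>p. a)"
  unfolding fam_def using finite_nonunit by blast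

lemma fam_mult:
  assumes "fam x" "fam y" shows "fam (\<lambda>p. x p \<otimes> y p)"
proof -
  have "{p \<in> X. x p \<otimes> y p \<notin> U p} \<subseteq> {p \<in> X. x p \<notin> U p} \<union> {p \<in> X. y p \<notin> U p}"
    using U_mult[OF prime] by blast
  then show ?thesis using assms finite_subset unfolding fam_def by blast
qed

lemma fam_inv:
  assumes "fam x" shows "fam (\<lambda>p. inv (x p))"
proof -
  have "{p \<in> X. inv (x p) \<notin> U p} \<subseteq> {p \<in> X. x p \<notin> U p}" using U_inv[OF prime] by blast
  then show ?thesis using assms finite_subset unfolding fam_def by blast
qed

lemma fam_finite_support:
  assumes "finite T" "\<And>p. p \<in> X \<Longrightarrow> x p \<in> carrier Q" "\<And>p. p \<in> X \<Longrightarrow> p \<notin> T \<Longrightarrow> x p \<in> U p"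
  shows "fam x"
proof -
  have "{p \<in> X. x p \<notin> U p} \<subseteq> T" using assms(3) by blast
  then show ?thesis using assms(1,2) finite_subset unfolding fam_def by blast
qed

text \<open>\<open>x p\<close> is already a generator at \<open>p\<close> and can fail to be a
  multiple of \<open>x q\<close> only at finitely many other \<open>q\<close>. It is corrected there
  by a factor \<open>d\<close> outside \<open>p\<close>, built from high powers of elements of those
  \<open>q\<close>.\<close>

lemma approximation:
  assumes x: "fam x" and p: "p \<in> X"
  obtains a where "a \<in> ideal_of x" "inv (x p) \<otimes> a \<in> U p" "a \<in> carrier Q"
proof -
  have xQ: "x q \<in> carrier Q" if "q \<in> X" for q using x that by (rule fam_carrier)
  have xpQ: "x p \<in> carrier Q" using xQ p .
  define T where "T = {q \<in> X. inv (x q) \<otimes> x p \<notin> U q} - {p}"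
  have "fam (\<lambda>q. inv (x q) \<otimes> x p)" by (intro fam_mult fam_inv x fam_const xpQ)
  then have finT: "finite T" unfolding T_def fam_def by blast
  have "\<exists>c. c \<in> H \<and> c \<notin> p \<and> c \<otimes> (inv (x q) \<otimes> x p) \<in> L q" if q: "q \<in> T" for q
  proof -
    have qX: "q \<in> X" "q \<noteq> p" using q by (auto simp: T_def)
    obtain c where c: "c \<in> H - p" "c \<in> q" using prime_avoid[OF p, of "{q}"] qX by auto
    obtain N where "c [^] (N::nat) \<otimes> (inv (x q) \<otimes> x p) \<in> L q"
      using min_prime_pow_mult[OF qX(1) c(2), of "inv (x q) \<otimes> x p"] xQ[OF qX(1)] xpQ by auto
    with prime_compl(3)[OF prime[OF p] c(1), of N] show ?thesis by blast
  qed
  then obtain c where c: "\<And>q. q \<in> T \<Longrightarrow> c q \<in> H \<and> c q \<notin> p \<and> c q \<otimes> (inv (x q) \<otimes> x p) \<in> L q" by metis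
  define d where "d = finprod Q c T"
  have dH: "d \<in> H - p" unfolding d_def by (rule prime_finprod_compl[OF prime[OF p]]) (use c in blast)
  have in_L: "inv (x q) \<otimes> (x p \<otimes> d) \<in> L q" if q: "q \<in> X" for q
  proof -
    note Pq = prime[OF q]
    have e: "inv (x q) \<otimes> (x p \<otimes> d) = d \<otimes> (inv (x q) \<otimes> x p)"
      using xQ[OF q] xpQ dH by (simp add: gsimps)
    consider "q = p" | "q \<in> T" | "q \<noteq> p" "q \<notin> T" by blast
    then show ?thesis
    proof cases
      case 1
      then show ?thesis using xpQ dH H_sub_L[OF Pq] by (auto simp: cancel_simps)
    next
      case 2
      have "finprod Q c (insert q (T - {q})) = c q \<otimes> finprod Q c (T - {q})"
        by (rule finprod_insert) (use finT c 2 in auto)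
      then have d: "d = c q \<otimes> finprod Q c (T - {q})" unfolding d_def using 2 by (simp add: insert_absorb)
      have fH: "finprod Q c (T - {q}) \<in> H" by (rule H_finprod) (use c in auto)
      have "d \<otimes> (inv (x q) \<otimes> x p) = c q \<otimes> (inv (x q) \<otimes> x p) \<otimes> finprod Q c (T - {q})"
        unfolding d using c[OF 2] fH xQ[OF q] xpQ by (simp add: gsimps)
      also have "\<dots> \<in> L q" by (rule L_mult[OF Pq]) (use c[OF 2] fH H_sub_L[OF Pq] in auto)
      finally show ?thesis using e by simp
    next
      case 3
      then have "inv (x q) \<otimes> x p \<in> L q" using q U_sub_L[OF Pq] by (auto simp: T_def)
      moreover have "d \<in> L q" using dH H_sub_L[OF Pq] by blast
      ultimately show ?thesis unfolding e using L_mult[OF Pq] by blast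
    qed
  qed
  show ?thesis
  proof (rule that[of "x p \<otimes> d"])
    show "x p \<otimes> d \<in> ideal_of x" unfolding ideal_of_def using in_L xpQ dH by auto
    show "inv (x p) \<otimes> (x p \<otimes> d) \<in> U p"
      using xpQ dH U_H[OF prime[OF p], of d] by (auto simp: cancel_simps)
  qed (use xpQ dH in auto)
qed

text \<open>Whether \<open>z\<close> lies in \<open>(H : B)\<close> can be tested at each \<open>p\<close> against a local generator \<open>x p\<close>
of \<open>B\<close>.\<close>

lemma colon_local:
  assumes x: "\<And>p. p \<in> X \<Longrightarrow> x p \<in> carrier Q" and B: "B \<subseteq> carrier Q"
    and 1: "\<And>b p. b \<in> B \<Longrightarrow> p \<in> X \<Longrightarrow> inv (x p) \<otimes> b \<in> L p"
    and 2: "\<And>p. p \<in> X \<Longrightarrow> \<exists>b\<in>B. inv (x p) \<otimes> b \<in> U p"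
  shows "colon Q H B = ideal_of (\<lambda>p. inv (x p))"
proof
  show "colon Q H B \<subseteq> ideal_of (\<lambda>p. inv (x p))"
  proof
    fix z assume z: "z \<in> colon Q H B"
    then have zQ: "z \<in> carrier Q" by (simp add: colon_iff)
    have "inv (inv (x p)) \<otimes> z \<in> L p" if p: "p \<in> X" for p
    proof -
      obtain b where b: "b \<in> B" "inv (x p) \<otimes> b \<in> U p" using 2[OF p] by blast
      have bQ: "b \<in> carrier Q" "x p \<in> carrier Q" using b B x p by auto
      have "z \<otimes> b \<in> L p" using z b(1) H_sub_L[OF prime[OF p]] unfolding colon_iff by blast
      moreover have "inv (inv (x p) \<otimes> b) \<in> L p"
        by (rule U_sub_L[OF prime[OF p] U_inv[OF prime[OF p] b(2)]])
      ultimately have "z \<otimes> b \<otimes> inv (inv (x p) \<otimes> b) \<in> L p" by (rule L_mult[OF prime[OF p]])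
      then show ?thesis using bQ zQ by (simp add: gsimps)
    qed
    then show "z \<in> ideal_of (\<lambda>p. inv (x p))" using zQ by (simp add: ideal_of_def)
  qed
  show "ideal_of (\<lambda>p. inv (x p)) \<subseteq> colon Q H B"
  proof
    fix z assume z: "z \<in> ideal_of (\<lambda>p. inv (x p))"
    then have zQ: "z \<in> carrier Q" by (simp add: ideal_of_def)
    have "z \<otimes> b \<in> H" if b: "b \<in> B" for b
    proof -
      have bQ: "b \<in> carrier Q" using b B by blast
      have "z \<otimes> b \<in> L p" if p: "p \<in> X" for p
      proof -
        have "inv (inv (x p)) \<otimes> z \<otimes> (inv (x p) \<otimes> b) \<in> L p"
            by (rule L_mult[OF prime[OF p] _ 1[OF b p]]) (use z p in \<open>simp add: ideal_of_def\<close>)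
        then show ?thesis using bQ zQ x[OF p] by (simp add: gsimps)
      qed
      then show ?thesis using mem_H_iff zQ bQ by blast
    qed
    then show "z \<in> colon Q H B" using zQ by (simp add: colon_iff)
  qed
qed

lemma ideal_of_carrier: "ideal_of x \<subseteq> carrier Q"
  by (auto simp: ideal_of_def)

lemma ideal_of_cong: "(\<And>p. p \<in> X \<Longrightarrow> x p = y p) \<Longrightarrow> ideal_of x = ideal_of y"
  by (simp add: ideal_of_def)

lemma colon_ideal_of:
  assumes "fam x" shows "colon Q H (ideal_of x) = ideal_of (\<lambda>p. inv (x p))"
proof (rule colon_local[OF fam_carrier[OF assms] ideal_of_carrier])
  show "\<exists>b\<in>ideal_of x. inv (x p) \<otimes> b \<in> U p" if "p \<in> X" for p
    using approximation[OF assms that] by blast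
qed (simp_all add: ideal_of_def)

text \<open>The inverse of \<open>B\<close> is given by the inverse family, by
  \<open>colon_local\<close>, and that family has exact local generators by
  \<open>approximation\<close>, so the second inverse can be computed in the same way.\<close>

lemma v_closure_local:
  assumes x: "fam x" and B: "B \<subseteq> carrier Q"
    and 1: "\<And>b p. b \<in> B \<Longrightarrow> p \<in> X \<Longrightarrow> inv (x p) \<otimes> b \<in> L p"
    and 2: "\<And>p. p \<in> X \<Longrightarrow> \<exists>b\<in>B. inv (x p) \<otimes> b \<in> U p"
  shows "v_closure Q H B = ideal_of x"
proof -
  have "colon Q H B = ideal_of (\<lambda>p. inv (x p))" by (rule colon_local[OF fam_carrier[OF x] B 1 2])
  then have "v_closure Q H B = ideal_of (\<lambda>p. inv (inv (x p)))"
    unfolding v_closure_def using colon_ideal_of[OF fam_inv[OF x]] by simp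
  also have "\<dots> = ideal_of x" by (rule ideal_of_cong) (simp add: fam_carrier[OF x])
  finally show ?thesis .
qed

lemma ideal_of_mult:
  assumes x: "fam x" and y: "fam y"
  shows "v_closure Q H (ideal_of x <#> ideal_of y) = ideal_of (\<lambda>p. x p \<otimes> y p)"
proof (rule v_closure_local[OF fam_mult[OF x y]])
  show "ideal_of x <#> ideal_of y \<subseteq> carrier Q" by (auto simp: set_mult_def ideal_of_def)
  have e: "inv (x p \<otimes> y p) \<otimes> (a \<otimes> b) = (inv (x p) \<otimes> a) \<otimes> (inv (y p) \<otimes> b)"
    if "p \<in> X" "a \<in> carrier Q" "b \<in> carrier Q" for a b p
    using that fam_carrier[OF x] fam_carrier[OF y] by (simp add: gsimps)
  show "inv (x p \<otimes> y p) \<otimes> b \<in> L p" if "b \<in> ideal_of x <#> ideal_of y" "p \<in> X" for b p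
    using that e L_mult[OF prime] by (auto simp: set_mult_def ideal_of_def)
  show "\<exists>b\<in>ideal_of x <#> ideal_of y. inv (x p \<otimes> y p) \<otimes> b \<in> U p" if p: "p \<in> X" for p
  proof -
    obtain a where a: "a \<in> ideal_of x" "inv (x p) \<otimes> a \<in> U p" "a \<in> carrier Q" using approximation[OF x p] .
    obtain b where b: "b \<in> ideal_of y" "inv (y p) \<otimes> b \<in> U p" "b \<in> carrier Q" using approximation[OF y p] .
    have "inv (x p \<otimes> y p) \<otimes> (a \<otimes> b) \<in> U p"
      unfolding e[OF p a(3) b(3)] by (rule U_mult[OF prime[OF p] a(2) b(2)])
    with a b show ?thesis by (auto simp: set_mult_def)
  qed
qed

lemma ideal_of_subset_iff:
  assumes x: "fam x" and y: "\<And>p. p \<in> X \<Longrightarrow> y p \<in> carrier Q"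
  shows "ideal_of x \<subseteq> ideal_of y \<longleftrightarrow> (\<forall>p\<in>X. inv (y p) \<otimes> x p \<in> L p)"
proof
  assume s: "ideal_of x \<subseteq> ideal_of y"
  show "\<forall>p\<in>X. inv (y p) \<otimes> x p \<in> L p"
  proof
    fix p assume p: "p \<in> X"
    obtain a where a: "a \<in> ideal_of x" "inv (x p) \<otimes> a \<in> U p" "a \<in> carrier Q" using approximation[OF x p] .
    have "inv (y p) \<otimes> a \<in> L p" using s a(1) p by (auto simp: ideal_of_def)
    then have "inv (y p) \<otimes> a \<otimes> inv (inv (x p) \<otimes> a) \<in> L p"
      by (rule L_mult[OF prime[OF p] _ U_sub_L[OF prime[OF p] U_inv[OF prime[OF p] a(2)]]])
    then show "inv (y p) \<otimes> x p \<in> L p" using a y[OF p] fam_carrier[OF x p] by (simp add: gsimps)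
  qed
next
  assume s: "\<forall>p\<in>X. inv (y p) \<otimes> x p \<in> L p"
  show "ideal_of x \<subseteq> ideal_of y"
  proof
    fix a assume a: "a \<in> ideal_of x"
    have "inv (y p) \<otimes> a \<in> L p" if p: "p \<in> X" for p
    proof -
      have "inv (y p) \<otimes> x p \<otimes> (inv (x p) \<otimes> a) \<in> L p"
        by (rule L_mult[OF prime[OF p]]) (use s a p in \<open>auto simp: ideal_of_def\<close>)
      then show ?thesis using a y[OF p] fam_carrier[OF x p] by (simp add: gsimps ideal_of_def)
    qed
    then show "a \<in> ideal_of y" using a by (simp add: ideal_of_def)
  qed
qed

lemma ideal_of_const: "a \<in> carrier Q \<Longrightarrow> ideal_of (\<lambda>p. a) = a <# H"
proof (intro equalityI subsetI)
  fix b assume a: "a \<in> carrier Q" and b: "b \<in> ideal_of (\<lambda>p. a)"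
  then have "inv a \<otimes> b \<in> H" by (auto simp: ideal_of_def mem_H_iff)
  moreover have "b = a \<otimes> (inv a \<otimes> b)" using a b by (simp add: ideal_of_def cancel_simps)
  ultimately show "b \<in> a <# H" unfolding l_coset_def by blast
next
  fix b assume a: "a \<in> carrier Q" and b: "b \<in> a <# H"
  then obtain h where h: "h \<in> H" "b = a \<otimes> h" unfolding l_coset_def by blast
  then show "b \<in> ideal_of (\<lambda>p. a)" using a H_sub_L[OF prime] by (auto simp: ideal_of_def cancel_simps)
qed

lemma ideal_of_one: "ideal_of (\<lambda>p. \<one>) = H"
  using ideal_of_const[of \<one>] lcos_mult_one[OF subset] by simp

lemma ideal_of_eq_iff:
  assumes x: "fam x" and y: "fam y"
  shows "ideal_of x = ideal_of y \<longleftrightarrow> (\<forall>p\<in>X. inv (x p) \<otimes> y p \<in> U p)"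
proof -
  have "inv (x p) \<otimes> y p \<in> U p \<longleftrightarrow> inv (x p) \<otimes> y p \<in> L p \<and> inv (y p) \<otimes> x p \<in> L p" if p: "p \<in> X" for p
  proof -
    have "inv (inv (x p) \<otimes> y p) = inv (y p) \<otimes> x p"
      using fam_carrier[OF x p] fam_carrier[OF y p] by (simp add: inv_mult m_comm)
    then show ?thesis using U_iff[OF prime[OF p]] by simp
  qed
  moreover have "ideal_of x \<subseteq> ideal_of y \<longleftrightarrow> (\<forall>p\<in>X. inv (y p) \<otimes> x p \<in> L p)"
    using fam_carrier[OF y] by (intro ideal_of_subset_iff x)
  moreover have "ideal_of y \<subseteq> ideal_of x \<longleftrightarrow> (\<forall>p\<in>X. inv (x p) \<otimes> y p \<in> L p)"
    using fam_carrier[OF x] by (intro ideal_of_subset_iff y)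
  ultimately show ?thesis by blast
qed

lemma ideal_of_subset_H_iff: "fam x \<Longrightarrow> ideal_of x \<subseteq> H \<longleftrightarrow> (\<forall>p\<in>X. x p \<in> L p)"
  using ideal_of_subset_iff[of x "\<lambda>p. \<one>"] fam_carrier[of x] by (simp add: ideal_of_one)

text \<open>The point is that all of \<open>x p L_p\<close> is reached: \<open>approximation\<close>
  provides an element of the ideal that generates at \<open>p\<close>.\<close>

lemma localize_ideal_of:
  assumes x: "fam x" and p: "p \<in> X" shows "localize Q H p (ideal_of x) = x p <# L p"
proof (intro equalityI subsetI)
  note P = prime[OF p]
  have xQ: "x p \<in> carrier Q" using fam_carrier[OF x p] .
  fix z assume "z \<in> localize Q H p (ideal_of x)"
  then obtain t where t: "t \<in> H - p" "t \<otimes> z \<in> ideal_of x" "z \<in> carrier Q"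
    using localizeE[OF _ ideal_of_carrier] by blast
  have "inv (x p) \<otimes> (t \<otimes> z) \<in> L p" using t(2) p by (simp add: ideal_of_def)
  moreover have "inv (x p) \<otimes> (t \<otimes> z) = t \<otimes> (inv (x p) \<otimes> z)" using t xQ by (simp add: gsimps)
  ultimately have "inv (x p) \<otimes> z \<in> L p"
    using U_mult_iff(2)[OF P, of t "inv (x p) \<otimes> z"] U_H[OF P, of t] t xQ by auto
  moreover have "z = x p \<otimes> (inv (x p) \<otimes> z)" using t(3) xQ by (simp add: cancel_simps)
  ultimately show "z \<in> x p <# L p" unfolding l_coset_def by blast
next
  note P = prime[OF p]
  have xQ: "x p \<in> carrier Q" using fam_carrier[OF x p] .
  fix z assume "z \<in> x p <# L p"
  then obtain l where l: "l \<in> L p" "z = x p \<otimes> l" unfolding l_coset_def by blast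
  obtain a where a: "a \<in> ideal_of x" "inv (x p) \<otimes> a \<in> U p" "a \<in> carrier Q" using approximation[OF x p] .
  have lQ: "l \<in> carrier Q" using l L_carrier by blast
  have "inv (inv (x p) \<otimes> a) \<otimes> l \<in> L p"
    by (rule L_mult[OF P U_sub_L[OF P U_inv[OF P a(2)]] l(1)])
  then obtain t where t: "t \<in> H - p" "t \<otimes> (inv (inv (x p) \<otimes> a) \<otimes> l) \<in> H" using L_iff by blast
  define h where "h = t \<otimes> (inv (inv (x p) \<otimes> a) \<otimes> l)"
  have e: "t \<otimes> z = a \<otimes> h" unfolding h_def l(2) using t(1) a(3) xQ lQ by (simp add: gsimps)
  have "a \<otimes> h \<in> ideal_of x"
  proof -
    have "inv (x q) \<otimes> (a \<otimes> h) \<in> L q" if q: "q \<in> X" for q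
    proof -
      have "inv (x q) \<otimes> a \<otimes> h \<in> L q"
        by (rule L_mult[OF prime[OF q]])
          (use a(1) q t(2) H_sub_L[OF prime[OF q]] in \<open>auto simp: ideal_of_def h_def\<close>)
      then show ?thesis using a(3) t(2) fam_carrier[OF x q] by (simp add: m_assoc h_def[symmetric])
    qed
    then show ?thesis using a(3) t(2) by (simp add: ideal_of_def h_def[symmetric])
  qed
  then show "z \<in> localize Q H p (ideal_of x)"
    using t(1) xQ lQ l(2) e by (intro localizeI[OF t(1) _ _ ideal_of_carrier]) auto
qed

text \<open>A minimal prime \<open>p\<close> is the set of denominators of some \<open>z\<close>
  outside \<open>L p\<close>. If \<open>A (H : A)\<close> were inside \<open>p\<close>, this
  \<open>z\<close> would lie in the inverse of a set with \<open>v\<close>-closure \<open>H\<close>,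
  hence in \<open>H\<close>. So some product \<open>a p b p\<close> is a unit at \<open>p\<close>,
  and then \<open>a p\<close> generates \<open>A\<close> there.\<close>

lemma v_invertibleE:
  assumes A: "v_ideal Q H A" "v_invertible Q H A"
  obtains x where "fam x" "\<forall>p\<in>X. x p \<in> L p" "A = ideal_of x"
proof -
  have AH: "A \<subseteq> H" using A by (simp add: v_ideal_def)
  have "\<exists>a b. a \<in> A \<and> b \<in> colon Q H A \<and> a \<otimes> b \<notin> p" if p: "p \<in> X" for p
  proof (rule ccontr)
    assume no: "\<not> ?thesis"
    obtain z where z: "z \<in> carrier Q" "z \<notin> L p" "p = {x \<in> H. x \<otimes> z \<in> H}"
      using min_prime_conductor[OF v_noeth p] .
    have "z \<otimes> c \<in> H" if c: "c \<in> A <#> colon Q H A" for c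
    proof -
      obtain a b where ab: "a \<in> A" "b \<in> colon Q H A" "c = a \<otimes> b" using c unfolding set_mult_def by blast
      then have "c \<in> p" using no by blast
      then have "c \<otimes> z \<in> H" "c \<in> carrier Q" using z(3) by auto
      then show ?thesis using z(1) by (simp add: m_comm)
    qed
    then have "z \<in> colon Q H (A <#> colon Q H A)" using z(1) by (simp add: colon_iff)
    moreover have "\<one> \<in> v_closure Q H (A <#> colon Q H A)" using A(2) by (simp add: v_invertible_def)
    ultimately have "\<one> \<otimes> z \<in> H" unfolding v_closure_def colon_iff[of \<one>] by blast
    then show False using z H_sub_L[OF prime[OF p]] by auto
  qed
  then obtain a b where ab: "\<And>p. p \<in> X \<Longrightarrow> a p \<in> A \<and> b p \<in> colon Q H A \<and> a p \<otimes> b p \<notin> p" by metis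
  have in_H: "a p \<in> H" "b p \<in> carrier Q" "a p \<otimes> b p \<in> H" "a p \<otimes> b p \<in> U p" if p: "p \<in> X" for p
  proof -
    show 1: "a p \<in> H" "b p \<in> carrier Q" using ab[OF p] AH by (auto simp: colon_iff)
    have "b p \<otimes> a p \<in> H" using ab[OF p] unfolding colon_iff by blast
    then show 2: "a p \<otimes> b p \<in> H" using 1 by (simp add: m_comm)
    show "a p \<otimes> b p \<in> U p" using U_H[OF prime[OF p] 2] ab[OF p] by blast
  qed
  have loc: "inv (a p) \<otimes> c \<in> L p" if c: "c \<in> A" and p: "p \<in> X" for c p
  proof -
    have cQ: "c \<in> carrier Q" using c AH by blast
    have "b p \<otimes> c \<in> H" using ab[OF p] c unfolding colon_iff by blast
    then have "b p \<otimes> c \<in> L p" using H_sub_L[OF prime[OF p]] by blast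
    then have "b p \<otimes> c \<otimes> inv (a p \<otimes> b p) \<in> L p"
      by (rule L_mult[OF prime[OF p] _ U_sub_L[OF prime[OF p] U_inv[OF prime[OF p] in_H(4)[OF p]]]])
    then show ?thesis using cQ in_H[OF p] by (simp add: gsimps)
  qed
  obtain p0 where p0: "p0 \<in> X" using X_nonempty by blast
  \<comment> \<open>One element \<open>c\<close> of \<open>A\<close> bounds the support: it is a
    local multiple of every \<open>a p\<close>, so \<open>a p\<close> is a unit wherever
    \<open>c\<close> is.\<close>
  define c where "c = a p0"
  have cA: "c \<in> A" and cH: "c \<in> H" using ab[OF p0] in_H[OF p0] by (auto simp: c_def)
  have fam: "fam a"
  proof (rule fam_finite_support[OF finite_mem[OF cH]])
    show "a p \<in> U p" if p: "p \<in> X" "p \<notin> {p \<in> X. c \<in> p}" for p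
    proof -
      note P = prime[OF p(1)]
      have "c \<in> U p" using U_H[OF P cH] p by blast
      then have "inv (a p) \<otimes> c \<otimes> inv c \<in> L p"
        by (rule L_mult[OF P loc[OF cA p(1)] U_sub_L[OF P U_inv[OF P]]])
      then have "inv (a p) \<in> L p" using cH in_H(1)[OF p(1)] by (simp add: gsimps)
      then show ?thesis using U_iff[OF P] in_H(1)[OF p(1)] H_sub_L[OF P] by blast
    qed
  qed (use in_H in auto)
  have "v_closure Q H A = ideal_of a"
  proof (rule v_closure_local[OF fam _ loc])
    show "\<exists>b\<in>A. inv (a p) \<otimes> b \<in> U p" if "p \<in> X" for p
      using ab[OF that] in_H(1)[OF that] U_one[OF prime[OF that]] by (intro bexI[of _ "a p"]) auto
  qed (use AH in auto)
  then have "A = ideal_of a" using A by (simp add: v_ideal_def)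
  then show ?thesis using H_sub_L[OF prime] in_H(1) by (intro that[OF fam]) blast+
qed

lemma v_invertible_ideal_of:
  assumes x: "fam x" "\<And>p. p \<in> X \<Longrightarrow> x p \<in> L p"
  shows "v_ideal Q H (ideal_of x)" "v_invertible Q H (ideal_of x)"
proof -
  have "v_closure Q H (ideal_of x) = ideal_of x"
  proof (rule v_closure_local[OF x(1) ideal_of_carrier])
    show "\<exists>b\<in>ideal_of x. inv (x p) \<otimes> b \<in> U p" if "p \<in> X" for p
      using approximation[OF x(1) that] by blast
  qed (simp add: ideal_of_def)
  then show "v_ideal Q H (ideal_of x)"
    using ideal_of_subset_H_iff[OF x(1)] x(2) by (simp add: v_ideal_def)
  have "v_closure Q H (ideal_of x <#> colon Q H (ideal_of x)) = ideal_of (\<lambda>p. x p \<otimes> inv (x p))"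
    unfolding colon_ideal_of[OF x(1)] by (rule ideal_of_mult[OF x(1) fam_inv[OF x(1)]])
  also have "\<dots> = ideal_of (\<lambda>p. \<one>)" by (rule ideal_of_cong) (simp add: fam_carrier[OF x(1)])
  finally show "v_invertible Q H (ideal_of x)" by (simp add: v_invertible_def ideal_of_one)
qed

lemma carrier_v_inv_monoid:
  "carrier (v_inv_monoid Q H) = {ideal_of x | x. fam x \<and> (\<forall>p\<in>X. x p \<in> L p)}"
proof (intro equalityI subsetI)
  fix A assume "A \<in> carrier (v_inv_monoid Q H)"
  then have A: "v_ideal Q H A" "v_invertible Q H A" by (auto simp: v_inv_monoid_def)
  obtain x where "fam x" "\<forall>p\<in>X. x p \<in> L p" "A = ideal_of x" using v_invertibleE[OF A] .
  then show "A \<in> {ideal_of x | x. fam x \<and> (\<forall>p\<in>X. x p \<in> L p)}" by blast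
next
  fix A assume "A \<in> {ideal_of x | x. fam x \<and> (\<forall>p\<in>X. x p \<in> L p)}"
  then show "A \<in> carrier (v_inv_monoid Q H)"
    using v_invertible_ideal_of by (auto simp: v_inv_monoid_def)
qed

lemma mult_v_inv_monoid:
  "fam x \<Longrightarrow> fam y \<Longrightarrow> ideal_of x \<otimes>\<^bsub>v_inv_monoid Q H\<^esub> ideal_of y = ideal_of (\<lambda>p. x p \<otimes> y p)"
  by (simp add: v_inv_monoid_def ideal_of_mult)

lemma one_v_inv_monoid: "\<one>\<^bsub>v_inv_monoid Q H\<^esub> = ideal_of (\<lambda>p. \<one>)"
  by (simp add: v_inv_monoid_def ideal_of_one)

end

section \<open>The class group\<close>

lemma subgroup_pullback:
  assumes G: "group G" "group G'" and \<phi>: "\<phi> \<in> iso G G'" and N: "N \<subseteq> carrier G" "subgroup (\<phi> ` N) G'"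
  shows "subgroup N G"
proof -
  interpret G: group G by fact
  interpret G': group G' by fact
  have h: "\<phi> \<in> hom G G'" and inj: "inj_on \<phi> (carrier G)" using \<phi> by (auto simp: iso_def bij_betw_def)
  interpret h: group_hom G G' \<phi> by unfold_locales (rule h)
  interpret N: subgroup "\<phi> ` N" G' by fact
  have mem: "x \<in> N" if "x \<in> carrier G" "\<phi> x \<in> \<phi> ` N" for x
    using that inj N(1) by (simp add: inj_on_image_mem_iff)
  have inN: "x \<in> carrier G" if "x \<in> N" for x using that N(1) by blast
  show ?thesis
  proof
    fix x y assume xy: "x \<in> N" "y \<in> N"
    show "x \<otimes>\<^bsub>G\<^esub> y \<in> N" by (rule mem) (use xy inN in auto)
    show "inv\<^bsub>G\<^esub> x \<in> N" by (rule mem) (use xy inN in auto)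
  next
    show "\<one>\<^bsub>G\<^esub> \<in> N" by (rule mem) (use N.one_closed in auto)
  qed (rule N(1))
qed

section \<open>Divisorial ideals as positive divisors\<close>

context mori_weakly_krull
begin

abbreviation "cosets x \<equiv> local_unit_cosets Q H x"
abbreviation "Div \<equiv> weak_divisors Q H"
abbreviation "Inv \<equiv> v_inv_monoid Q H"

definition pos :: "('a set \<Rightarrow> 'a) \<Rightarrow> bool" where "pos x \<longleftrightarrow> fam x \<and> (\<forall>p\<in>X. x p \<in> L p)"

lemma pos_fam: "pos x \<Longrightarrow> fam x" by (simp add: pos_def)

lemma carrier_Inv: "carrier Inv = {ideal_of x | x. pos x}"
  unfolding carrier_v_inv_monoid pos_def by blast

lemma ideal_of_Inv: "pos x \<Longrightarrow> ideal_of x \<in> carrier Inv"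
  unfolding carrier_Inv by blast

lemma pos_one: "pos (\<lambda>p. \<one>)"
  using fam_const[of \<one>] prime by (simp add: pos_def)

lemma pos_mult: "pos x \<Longrightarrow> pos y \<Longrightarrow> pos (\<lambda>p. x p \<otimes> y p)"
  using fam_mult L_mult[OF prime] by (simp add: pos_def)

lemma pos_const: "a \<in> H \<Longrightarrow> pos (\<lambda>p. a)"
  using fam_const H_sub_L[OF prime] by (auto simp: pos_def)

lemma Inv_cancel: "comm_monoid_cancel Inv"
proof (rule comm_monoid_cancelI)
  show "comm_monoid Inv"
  proof (rule comm_monoidI)
    fix A B assume "A \<in> carrier Inv" "B \<in> carrier Inv"
    then obtain x y where xy: "pos x" "pos y" "A = ideal_of x" "B = ideal_of y" unfolding carrier_Inv by blast
    note f = pos_fam[OF xy(1)] pos_fam[OF xy(2)]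
    show "A \<otimes>\<^bsub>Inv\<^esub> B \<in> carrier Inv"
      unfolding xy(3,4) mult_v_inv_monoid[OF f] by (rule ideal_of_Inv[OF pos_mult[OF xy(1,2)]])
    show "A \<otimes>\<^bsub>Inv\<^esub> B = B \<otimes>\<^bsub>Inv\<^esub> A"
      unfolding xy(3,4) mult_v_inv_monoid[OF f] mult_v_inv_monoid[OF f(2,1)]
      by (rule ideal_of_cong) (simp add: m_comm fam_carrier f)
    fix C assume "C \<in> carrier Inv"
    then obtain z where z: "pos z" "C = ideal_of z" unfolding carrier_Inv by blast
    note g = pos_fam[OF z(1)]
    show "A \<otimes>\<^bsub>Inv\<^esub> B \<otimes>\<^bsub>Inv\<^esub> C = A \<otimes>\<^bsub>Inv\<^esub> (B \<otimes>\<^bsub>Inv\<^esub> C)"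
      unfolding xy(3,4) z(2) mult_v_inv_monoid[OF f] mult_v_inv_monoid[OF f(2) g]
        mult_v_inv_monoid[OF fam_mult[OF f] g] mult_v_inv_monoid[OF f(1) fam_mult[OF f(2) g]]
      by (rule ideal_of_cong) (simp add: m_assoc fam_carrier f g)
  next
    show "\<one>\<^bsub>Inv\<^esub> \<in> carrier Inv" unfolding one_v_inv_monoid by (rule ideal_of_Inv[OF pos_one])
    fix A assume "A \<in> carrier Inv"
    then obtain x where x: "pos x" "A = ideal_of x" unfolding carrier_Inv by blast
    show "\<one>\<^bsub>Inv\<^esub> \<otimes>\<^bsub>Inv\<^esub> A = A"
      unfolding x(2) one_v_inv_monoid mult_v_inv_monoid[OF pos_fam[OF pos_one] pos_fam[OF x(1)]]
      by (rule ideal_of_cong) (simp add: fam_carrier pos_fam x)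
  qed
  fix A B C assume ABC: "A \<otimes>\<^bsub>Inv\<^esub> C = B \<otimes>\<^bsub>Inv\<^esub> C" and "A \<in> carrier Inv" "B \<in> carrier Inv" "C \<in> carrier Inv"
  then obtain x y z where xyz: "pos x" "pos y" "pos z" "A = ideal_of x" "B = ideal_of y" "C = ideal_of z"
    unfolding carrier_Inv by blast
  note f = pos_fam[OF xyz(1)] pos_fam[OF xyz(2)] pos_fam[OF xyz(3)]
  have "ideal_of (\<lambda>p. x p \<otimes> z p) = ideal_of (\<lambda>p. y p \<otimes> z p)"
    using ABC unfolding xyz(4-6) mult_v_inv_monoid[OF f(1,3)] mult_v_inv_monoid[OF f(2,3)] .
  then have "\<forall>p\<in>X. inv (x p \<otimes> z p) \<otimes> (y p \<otimes> z p) \<in> U p"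
    using ideal_of_eq_iff[OF fam_mult[OF f(1,3)] fam_mult[OF f(2,3)]] by blast
  then have "\<forall>p\<in>X. inv (x p) \<otimes> y p \<in> U p" using f by (simp add: fam_carrier gsimps)
  then show "A = B" unfolding xyz using ideal_of_eq_iff[OF f(1,2)] by blast
qed

lemma cosets_apply: "p \<in> X \<Longrightarrow> cosets x p = U p #> x p"
  by (simp add: local_unit_cosets_def)

lemma group_local: "p \<in> X \<Longrightarrow> comm_group (Q Mod U p)"
  by (rule abelian_FactGroup[OF U_subgroup[OF prime]])

lemma cosets_eq_iff:
  assumes "\<And>p. p \<in> X \<Longrightarrow> x p \<in> carrier Q" "\<And>p. p \<in> X \<Longrightarrow> y p \<in> carrier Q"
  shows "cosets x = cosets y \<longleftrightarrow> (\<forall>p\<in>X. inv (x p) \<otimes> y p \<in> U p)"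
proof -
  have "cosets x = cosets y \<longleftrightarrow> (\<forall>p\<in>X. U p #> x p = U p #> y p)"
    unfolding local_unit_cosets_def by (auto simp: fun_eq_iff restrict_def)
  also have "\<dots> \<longleftrightarrow> (\<forall>p\<in>X. inv (x p) \<otimes> y p \<in> U p)"
    using rcos_eq_iff[OF U_subgroup[OF prime]] assms by blast
  finally show ?thesis .
qed

lemma cosets_fam_eq_iff:
  assumes "fam x" "fam y"
  shows "cosets x = cosets y \<longleftrightarrow> (\<forall>p\<in>X. inv (x p) \<otimes> y p \<in> U p)"
  by (rule cosets_eq_iff) (simp_all add: assms fam_carrier)

lemma coset_eq_U_iff:
  assumes "p \<in> X" "a \<in> carrier Q" shows "U p #> a = U p \<longleftrightarrow> a \<in> U p"
proof -
  have "U p \<subseteq> carrier Q" using subgroup.subset[OF U_subgroup[OF prime[OF assms(1)]]] .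
  then have "U p #> \<one> = U p" by (rule coset_mult_one)
  then show ?thesis
    using rcos_eq_iff[OF U_subgroup[OF prime[OF assms(1)]] in_carrier[OF H_one] assms(2)] assms(2) by auto
qed

lemma carrier_Div: "carrier Div = {cosets x | x. fam x}"
proof -
  have c: "carrier Div = {f \<in> \<Pi>\<^sub>E p\<in>X. carrier (Q Mod U p). finite {p \<in> X. f p \<noteq> \<one>\<^bsub>Q Mod U p\<^esub>}}"
    unfolding weak_divisors_def
    by (rule carrier_sum_group) (use group_local comm_group.axioms(2) in blast)
  show ?thesis
  proof (intro equalityI subsetI)
    fix f assume f: "f \<in> carrier Div"
    then have "\<forall>p\<in>X. \<exists>a\<in>carrier Q. f p = U p #> a" unfolding c by (auto simp: PiE_iff carrier_FactGroup)
    then obtain x where x: "\<And>p. p \<in> X \<Longrightarrow> x p \<in> carrier Q \<and> f p = U p #> x p" by metis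
    have "f = cosets x"
    proof
      fix p show "f p = cosets x p"
        using f x unfolding c by (cases "p \<in> X") (auto simp: local_unit_cosets_def PiE_iff extensional_def)
    qed
    moreover have "{p \<in> X. x p \<notin> U p} = {p \<in> X. f p \<noteq> \<one>\<^bsub>Q Mod U p\<^esub>}"
      by (intro Collect_cong conj_cong refl) (use x coset_eq_U_iff in simp)
    then have "fam x" using f x unfolding c fam_def by simp
    ultimately show "f \<in> {cosets x | x. fam x}" by blast
  next
    fix f assume "f \<in> {cosets x | x. fam x}"
    then obtain x where x: "fam x" "f = cosets x" by blast
    have "{p \<in> X. f p \<noteq> \<one>\<^bsub>Q Mod U p\<^esub>} = {p \<in> X. x p \<notin> U p}"
      by (intro Collect_cong conj_cong refl)
        (use x coset_eq_U_iff fam_carrier[OF x(1)] in \<open>simp add: cosets_apply\<close>)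
    then show "f \<in> carrier Div"
      using x fam_carrier[OF x(1)] unfolding c
      by (auto simp: fam_def PiE_iff carrier_FactGroup local_unit_cosets_def)
  qed
qed

lemma cosets_Div: "fam x \<Longrightarrow> cosets x \<in> carrier Div"
  unfolding carrier_Div by blast

lemma mult_Div:
  assumes "\<And>p. p \<in> X \<Longrightarrow> x p \<in> carrier Q" "\<And>p. p \<in> X \<Longrightarrow> y p \<in> carrier Q"
  shows "cosets x \<otimes>\<^bsub>Div\<^esub> cosets y = cosets (\<lambda>p. x p \<otimes> y p)"
  unfolding weak_divisors_def
  by (simp add: local_unit_cosets_def rcos_mult[OF U_subgroup[OF prime]] assms cong: restrict_cong)

lemma mult_Div_fam:
  assumes "fam x" "fam y"
  shows "cosets x \<otimes>\<^bsub>Div\<^esub> cosets y = cosets (\<lambda>p. x p \<otimes> y p)"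
  by (rule mult_Div) (simp_all add: assms fam_carrier)

lemma one_Div: "\<one>\<^bsub>Div\<^esub> = cosets (\<lambda>p. \<one>)"
proof -
  have "U p #> \<one> = U p" if "p \<in> X" for p
    using coset_mult_one[OF subgroup.subset[OF U_subgroup[OF prime[OF that]]]] .
  then show ?thesis unfolding weak_divisors_def local_unit_cosets_def by (simp cong: restrict_cong)
qed

lemma group_Div: "comm_group Div"
proof (rule group.group_comm_groupI)
  show "group Div" unfolding weak_divisors_def
    by (rule sum_group) (use group_local comm_group.axioms(2) in blast)
  fix f g assume "f \<in> carrier Div" "g \<in> carrier Div"
  then obtain x y where "fam x" "fam y" "f = cosets x" "g = cosets y" unfolding carrier_Div by blast
  then show "f \<otimes>\<^bsub>Div\<^esub> g = g \<otimes>\<^bsub>Div\<^esub> f"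
    by (simp add: mult_Div fam_carrier) (simp add: local_unit_cosets_def fam_carrier m_comm cong: restrict_cong)
qed

lemma inv_Div:
  assumes x: "fam x" shows "inv\<^bsub>Div\<^esub> cosets x = cosets (\<lambda>p. inv (x p))"
proof -
  interpret D: comm_group Div by (rule group_Div)
  have "cosets (\<lambda>p. inv (x p)) \<otimes>\<^bsub>Div\<^esub> cosets x = \<one>\<^bsub>Div\<^esub>"
    unfolding one_Div using fam_carrier[OF x]
    by (simp add: mult_Div) (simp add: local_unit_cosets_def fam_carrier x cong: restrict_cong)
  then show ?thesis by (rule D.inv_equality) (intro cosets_Div x fam_inv)+
qed

lemma fam_pow: "fam x \<Longrightarrow> fam (\<lambda>p. x p [^] (n::nat))"
proof (induction n)
  case (Suc n)
  then show ?case using fam_mult[of "\<lambda>p. x p [^] n" x] by simp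
qed (simp add: fam_const)

lemma pow_Div:
  assumes x: "fam x" shows "cosets x [^]\<^bsub>Div\<^esub> (n::nat) = cosets (\<lambda>p. x p [^] n)"
proof (induction n)
  case (Suc n)
  have "cosets x [^]\<^bsub>Div\<^esub> Suc n = cosets (\<lambda>p. x p [^] n) \<otimes>\<^bsub>Div\<^esub> cosets x"
    using Suc.IH by (simp add: nat_pow_def)
  also have "\<dots> = cosets (\<lambda>p. x p [^] n \<otimes> x p)" by (rule mult_Div) (simp_all add: fam_carrier[OF x])
  finally show ?case by simp
qed (simp add: one_Div nat_pow_def)

lemma positive_quotient:
  assumes x: "fam x"
  obtains y w where "pos y" "pos w" "\<forall>p\<in>X. x p = y p \<otimes> inv (w p)"
proof -
  have "\<exists>t. t \<in> H \<and> t \<otimes> x p \<in> H \<and> t \<in> carrier Q" if "p \<in> X" for p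
    using frac[OF fam_carrier[OF x that]] in_carrier by metis
  then obtain t where t: "\<And>p. p \<in> X \<Longrightarrow> t p \<in> H \<and> t p \<otimes> x p \<in> H \<and> t p \<in> carrier Q" by metis
  \<comment> \<open>Denominators are set to 1 wherever \<open>x p\<close> is already a unit, so that
    they form a family of finite support.\<close>
  define w where "w p = (if x p \<in> U p then \<one> else t p)" for p
  define y where "y p = w p \<otimes> x p" for p
  have xU: "x p \<in> L p" if "p \<in> X" "x p \<in> U p" for p using that U_sub_L prime by blast
  have finT: "finite {p \<in> X. x p \<notin> U p}" using x by (simp add: fam_def)
  have HL: "h \<in> L p" if "p \<in> X" "h \<in> H" for p h using that H_sub_L[OF prime] by blast
  have "pos w" unfolding pos_def
  proof (intro conjI ballI)
    show "fam w" by (rule fam_finite_support[OF finT]) (use t prime in \<open>auto simp: w_def\<close>)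
  qed (use t HL prime in \<open>auto simp: w_def\<close>)
  moreover have "pos y" unfolding pos_def
  proof (intro conjI ballI)
    show "fam y" unfolding y_def by (rule fam_mult) (use calculation x in \<open>auto simp: pos_def\<close>)
    show "y p \<in> L p" if "p \<in> X" for p
      using t[OF that] HL[OF that] xU[OF that] fam_carrier[OF x that] by (auto simp: y_def w_def)
  qed
  moreover have "x p = y p \<otimes> inv (w p)" if "p \<in> X" for p
    using t[OF that] fam_carrier[OF x that] by (auto simp: y_def w_def gsimps)
  ultimately show ?thesis using that by blast
qed

text \<open>Two families give the same ideal exactly when they give the same cosets, so
  \<open>j\<close> does not depend on the representative picked by \<open>SOME\<close>. It embeds
  the ideals into the divisors, and by \<open>positive_quotient\<close> their images
  generate.\<close>

lemma quot_group_Inv: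
  obtains \<phi> where "comm_group (quot_group Inv)" "\<phi> \<in> iso (quot_group Inv) Div"
    "\<forall>x y. pos x \<longrightarrow> pos y \<longrightarrow> \<phi> (fraction Inv (ideal_of x) (ideal_of y)) = cosets (\<lambda>p. x p \<otimes> inv (y p))"
    "\<forall>x. pos x \<longrightarrow> \<phi> (quot_embed Inv (ideal_of x)) = cosets x"
proof -
  define j where "j A = cosets (SOME x. pos x \<and> A = ideal_of x)" for A
  have ceq: "cosets x = cosets y \<longleftrightarrow> ideal_of x = ideal_of y" if "pos x" "pos y" for x y
    using ideal_of_eq_iff[OF pos_fam[OF that(1)] pos_fam[OF that(2)]]
      cosets_fam_eq_iff[OF pos_fam[OF that(1)] pos_fam[OF that(2)]] by simp
  have j: "j (ideal_of x) = cosets x" if "pos x" for x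
  proof -
    have "pos (SOME y. pos y \<and> ideal_of x = ideal_of y) \<and>
        ideal_of x = ideal_of (SOME y. pos y \<and> ideal_of x = ideal_of y)"
      using that by (intro someI[of "\<lambda>y. pos y \<and> ideal_of x = ideal_of y" x]) simp
    then show ?thesis unfolding j_def using ceq[OF _ that] by simp
  qed
  have hom: "j \<in> hom Inv Div"
  proof (rule homI)
    fix A B assume "A \<in> carrier Inv" "B \<in> carrier Inv"
    then obtain x y where xy: "pos x" "pos y" "A = ideal_of x" "B = ideal_of y" unfolding carrier_Inv by blast
    show "j A \<in> carrier Div" unfolding xy j[OF xy(1)] by (rule cosets_Div[OF pos_fam[OF xy(1)]])
    show "j (A \<otimes>\<^bsub>Inv\<^esub> B) = j A \<otimes>\<^bsub>Div\<^esub> j B"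
      unfolding xy mult_v_inv_monoid[OF pos_fam[OF xy(1)] pos_fam[OF xy(2)]]
        j[OF pos_mult[OF xy(1,2)]] j[OF xy(1)] j[OF xy(2)]
      by (rule mult_Div_fam[OF pos_fam[OF xy(1)] pos_fam[OF xy(2)], symmetric])
  qed
  have inj: "inj_on j (carrier Inv)"
    by (rule inj_onI) (auto simp: carrier_Inv j ceq)
  have frac_eq: "cosets x \<otimes>\<^bsub>Div\<^esub> inv\<^bsub>Div\<^esub> cosets y = cosets (\<lambda>p. x p \<otimes> inv (y p))" if "fam x" "fam y" for x y
    unfolding inv_Div[OF that(2)] by (rule mult_Div_fam[OF that(1) fam_inv[OF that(2)]])
  have gen: "\<exists>a\<in>carrier Inv. \<exists>b\<in>carrier Inv. g = j a \<otimes>\<^bsub>Div\<^esub> inv\<^bsub>Div\<^esub> j b"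
    if g: "g \<in> carrier Div" for g
  proof -
    obtain x where x: "fam x" "g = cosets x" using g unfolding carrier_Div by blast
    obtain y w where yw: "pos y" "pos w" "\<forall>p\<in>X. x p = y p \<otimes> inv (w p)"
      using positive_quotient[OF x(1)] .
    have "g = cosets (\<lambda>p. y p \<otimes> inv (w p))"
      unfolding x(2) local_unit_cosets_def by (simp add: yw(3) cong: restrict_cong)
    also have "\<dots> = j (ideal_of y) \<otimes>\<^bsub>Div\<^esub> inv\<^bsub>Div\<^esub> j (ideal_of w)"
      unfolding j[OF yw(1)] j[OF yw(2)] by (rule frac_eq[symmetric]) (use yw pos_fam in auto)
    finally show ?thesis using ideal_of_Inv yw by blast
  qed
  obtain \<phi> where \<phi>: "comm_group (quot_group Inv)" "\<phi> \<in> iso (quot_group Inv) Div"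
    "\<forall>a\<in>carrier Inv. \<forall>b\<in>carrier Inv. \<phi> (fraction Inv a b) = j a \<otimes>\<^bsub>Div\<^esub> inv\<^bsub>Div\<^esub> j b"
    "\<forall>a\<in>carrier Inv. \<phi> (quot_embed Inv a) = j a"
    using quot_group_iso[OF Inv_cancel group_Div hom inj gen] .
  show ?thesis
    by (rule that[OF \<phi>(1,2)]) (use \<phi>(3,4) ideal_of_Inv j frac_eq pos_fam in simp_all)
qed

lemma subgroup_principal: "subgroup (principal_weak_divisors Q H) Div"
proof -
  interpret D: comm_group Div by (rule group_Div)
  show ?thesis
  proof
    show "principal_weak_divisors Q H \<subseteq> carrier Div"
      unfolding principal_weak_divisors_def using cosets_Div fam_const by blast
    show "\<one>\<^bsub>Div\<^esub> \<in> principal_weak_divisors Q H" unfolding one_Div principal_weak_divisors_def by blast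
    fix f assume "f \<in> principal_weak_divisors Q H"
    then obtain a where a: "a \<in> carrier Q" "f = cosets (\<lambda>p. a)" unfolding principal_weak_divisors_def by blast
    show "inv\<^bsub>Div\<^esub> f \<in> principal_weak_divisors Q H"
      unfolding a(2) inv_Div[OF fam_const[OF a(1)]] principal_weak_divisors_def using a(1) by blast
    fix g assume "g \<in> principal_weak_divisors Q H"
    then obtain b where b: "b \<in> carrier Q" "g = cosets (\<lambda>p. b)" unfolding principal_weak_divisors_def by blast
    have "f \<otimes>\<^bsub>Div\<^esub> g = cosets (\<lambda>p. a \<otimes> b)" unfolding a(2) b(2) by (rule mult_Div) (use a b in auto)
    then show "f \<otimes>\<^bsub>Div\<^esub> g \<in> principal_weak_divisors Q H"
      unfolding principal_weak_divisors_def using a(1) b(1) by auto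
  qed
qed

text \<open>The isomorphism of \<open>quot_group_Inv\<close> carries the principal fractional ideals
  exactly onto the principal divisors and therefore descends to the classes, on which it acts by
  taking images of cosets.\<close>

lemma class_iso:
  obtains \<psi> where "canonical_class_iso Q H \<psi>" "comm_group (v_class_group Q H)"
    "\<forall>x. pos x \<longrightarrow> \<psi> (v_class Q H (ideal_of x)) = weak_class Q H (cosets x)"
    "\<forall>x. pos x \<longrightarrow> v_class Q H (ideal_of x) \<in> carrier (v_class_group Q H)"
proof -
  obtain \<phi> where cg: "comm_group (quot_group Inv)" and \<phi>: "\<phi> \<in> iso (quot_group Inv) Div"
    and fr': "\<forall>x y. pos x \<longrightarrow> pos y \<longrightarrow>
      \<phi> (fraction Inv (ideal_of x) (ideal_of y)) = cosets (\<lambda>p. x p \<otimes> inv (y p))"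
    and em': "\<forall>x. pos x \<longrightarrow> \<phi> (quot_embed Inv (ideal_of x)) = cosets x"
    using quot_group_Inv .
  note fr = fr'[rule_format] and em = em'[rule_format]
  let ?N = "principal_fracs Q H"
  have N: "?N \<subseteq> carrier (quot_group Inv)"
    unfolding principal_fracs_def quot_group_def
    using ideal_of_Inv[OF pos_const] ideal_of_const[OF in_carrier] by auto
  have frN: "\<phi> (fraction Inv (b <# H) (c <# H)) = cosets (\<lambda>p. b \<otimes> inv c)" if "b \<in> H" "c \<in> H" for b c
    using fr[OF pos_const[OF that(1)] pos_const[OF that(2)]] that by (simp add: ideal_of_const)
  have img: "\<phi> ` ?N = principal_weak_divisors Q H"
  proof (intro equalityI subsetI)
    fix f assume "f \<in> \<phi> ` ?N"
    then obtain b c where bc: "b \<in> H" "c \<in> H" "f = \<phi> (fraction Inv (b <# H) (c <# H))"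
      unfolding principal_fracs_def by blast
    then have "f = cosets (\<lambda>p. b \<otimes> inv c)" using frN by simp
    then show "f \<in> principal_weak_divisors Q H" unfolding principal_weak_divisors_def using bc by auto
  next
    fix f assume "f \<in> principal_weak_divisors Q H"
    then obtain a where a: "a \<in> carrier Q" "f = cosets (\<lambda>p. a)" unfolding principal_weak_divisors_def by blast
    obtain b c where bc: "b \<in> H" "c \<in> H" "a = b \<otimes> inv c" using quotient[OF a(1)] by blast
    then have "f = \<phi> (fraction Inv (b <# H) (c <# H))" using frN a by simp
    then show "f \<in> \<phi> ` ?N" unfolding principal_fracs_def using bc by blast
  qed
  have sub: "subgroup ?N (quot_group Inv)"
    by (rule subgroup_pullback[OF _ _ \<phi> N])
      (use cg group_Div subgroup_principal in \<open>auto simp: img comm_group.axioms(2)\<close>)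
  note F = FactGroup_iso[OF cg group_Div \<phi> sub, unfolded img]
  let ?\<psi> = "(`) \<phi>"
  have iso: "?\<psi> \<in> iso (v_class_group Q H) (weak_class_group Q H)"
    unfolding v_class_group_def weak_class_group_def by (rule F(1))
  have emC: "quot_embed Inv (ideal_of x) \<in> carrier (quot_group Inv)" if "pos x" for x
    unfolding quot_embed_def quot_group_def one_v_inv_monoid
    using ideal_of_Inv[OF that] ideal_of_Inv[OF pos_one] by auto
  have val: "?\<psi> (v_class Q H (ideal_of x)) = weak_class Q H (cosets x)" if "pos x" for x
    unfolding v_class_def weak_class_def using F(2)[OF emC[OF that]] em[OF that] by simp
  have can: "canonical_class_iso Q H ?\<psi>"
    unfolding canonical_class_iso_def
  proof (intro conjI ballI iso)
    fix A assume "A \<in> carrier Inv"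
    then obtain x where x: "pos x" "A = ideal_of x" unfolding carrier_Inv by blast
    note f = pos_fam[OF x(1)]
    show "\<exists>x. (\<forall>p\<in>X. x p \<in> carrier Q \<and> localize Q H p A = x p <# L p) \<and>
        cosets x \<in> carrier Div \<and> ?\<psi> (v_class Q H A) = weak_class Q H (cosets x)"
      using x(2) val[OF x(1)] localize_ideal_of[OF f] fam_carrier[OF f] cosets_Div[OF f] by blast
  qed
  have "comm_group (v_class_group Q H)"
    unfolding v_class_group_def by (rule comm_group.abelian_FactGroup[OF cg sub])
  moreover have "v_class Q H (ideal_of x) \<in> carrier (v_class_group Q H)" if "pos x" for x
    unfolding v_class_def v_class_group_def carrier_FactGroup using emC[OF that] by blast
  ultimately show ?thesis using val by (intro that[OF can]) blast+
qed

section \<open>Seminormality, chain condition and factorization for the \<open>v\<close>-invertible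
  ideals\<close>

text \<open>Seminormality and the chain condition are defined inside a quotient group; membership in
  the copy of the ideal monoid is translated here into positivity of any family representing the
  element.\<close>

lemma quot_Inv_structure:
  obtains \<phi> where "\<phi> \<in> iso (quot_group Inv) Div" "quotient_group_of (quot_group Inv) (quot_embed Inv ` carrier Inv)"
    "\<forall>g x. g \<in> carrier (quot_group Inv) \<longrightarrow> fam x \<longrightarrow> \<phi> g = cosets x \<longrightarrow>
      (g \<in> quot_embed Inv ` carrier Inv \<longleftrightarrow> pos x)"
    "\<forall>x. pos x \<longrightarrow> \<phi> (quot_embed Inv (ideal_of x)) = cosets x"
proof -
  obtain \<phi> where cg: "comm_group (quot_group Inv)" and \<phi>: "\<phi> \<in> iso (quot_group Inv) Div"
    and fr': "\<forall>x y. pos x \<longrightarrow> pos y \<longrightarrow>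
      \<phi> (fraction Inv (ideal_of x) (ideal_of y)) = cosets (\<lambda>p. x p \<otimes> inv (y p))"
    and em': "\<forall>x. pos x \<longrightarrow> \<phi> (quot_embed Inv (ideal_of x)) = cosets x"
    using quot_group_Inv .
  note em = em'[rule_format]
  interpret G: comm_group "quot_group Inv" by (rule cg)
  interpret D: comm_group Div by (rule group_Div)
  let ?M = "quot_embed Inv ` carrier Inv"
  have hom: "\<phi> \<in> hom (quot_group Inv) Div" and inj: "inj_on \<phi> (carrier (quot_group Inv))"
    using \<phi> by (auto simp: iso_def bij_betw_def)
  interpret h: group_hom "quot_group Inv" Div \<phi> by unfold_locales (rule hom)
  have emC: "quot_embed Inv (ideal_of x) \<in> carrier (quot_group Inv)" if "pos x" for x
    unfolding quot_embed_def quot_group_def one_v_inv_monoid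
    using ideal_of_Inv[OF that] ideal_of_Inv[OF pos_one] by auto
  have mem: "g \<in> ?M \<longleftrightarrow> pos x" if g: "g \<in> carrier (quot_group Inv)" "fam x" "\<phi> g = cosets x" for g x
  proof
    assume "g \<in> ?M"
    then obtain y where y: "pos y" "g = quot_embed Inv (ideal_of y)" unfolding carrier_Inv by blast
    have "cosets y = cosets x" using em[OF y(1)] g(3) y(2) by simp
    then have u: "inv (y p) \<otimes> x p \<in> U p" if "p \<in> X" for p
      using cosets_fam_eq_iff[OF pos_fam[OF y(1)] g(2)] that by blast
    have "x p \<in> L p" if p: "p \<in> X" for p
    proof -
      have "y p \<otimes> (inv (y p) \<otimes> x p) \<in> L p"
        by (rule L_mult[OF prime[OF p] _ U_sub_L[OF prime[OF p] u[OF p]]])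
          (use y(1) p in \<open>simp add: pos_def\<close>)
      then show ?thesis using fam_carrier[OF pos_fam[OF y(1)] p] fam_carrier[OF g(2) p] by (simp add: cancel_simps)
    qed
    then show "pos x" using g(2) by (simp add: pos_def)
  next
    assume x: "pos x"
    have "g = quot_embed Inv (ideal_of x)"
      by (rule inj_onD[OF inj _ g(1) emC[OF x]]) (simp add: em[OF x] g(3))
    then show "g \<in> ?M" using ideal_of_Inv[OF x] by blast
  qed
  have Mc: "?M \<subseteq> carrier (quot_group Inv)" using emC unfolding carrier_Inv by blast
  have rep: "\<exists>x. fam x \<and> \<phi> g = cosets x" if "g \<in> carrier (quot_group Inv)" for g
    using h.hom_closed[OF that] unfolding carrier_Div by blast
  have "quotient_group_of (quot_group Inv) ?M"
  proof (intro quotient_group_of.intro cg quotient_group_of_axioms.intro submonoid.intro Mc)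
    fix g k assume gk: "g \<in> ?M" "k \<in> ?M"
    then have c: "g \<in> carrier (quot_group Inv)" "k \<in> carrier (quot_group Inv)" using Mc by blast+
    obtain x where x: "fam x" "\<phi> g = cosets x" using rep[OF c(1)] by blast
    obtain y where y: "fam y" "\<phi> k = cosets y" using rep[OF c(2)] by blast
    note xy = x y
    have "\<phi> (g \<otimes>\<^bsub>quot_group Inv\<^esub> k) = cosets (\<lambda>p. x p \<otimes> y p)"
      using c xy mult_Div_fam[OF xy(1) xy(3)] by simp
    moreover have "pos (\<lambda>p. x p \<otimes> y p)"
      using pos_mult mem[OF c(1) xy(1,2)] mem[OF c(2) xy(3,4)] gk by blast
    ultimately show "g \<otimes>\<^bsub>quot_group Inv\<^esub> k \<in> ?M"
      using mem[of "g \<otimes>\<^bsub>quot_group Inv\<^esub> k"] c pos_fam by auto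
  next
    have "quot_embed Inv (ideal_of (\<lambda>p. \<one>)) = \<one>\<^bsub>quot_group Inv\<^esub>"
      by (simp add: quot_embed_def quot_group_def one_v_inv_monoid)
    then show "\<one>\<^bsub>quot_group Inv\<^esub> \<in> ?M" using ideal_of_Inv[OF pos_one] by (metis imageI)
  next
    fix g assume g: "g \<in> carrier (quot_group Inv)"
    obtain x where x: "fam x" "\<phi> g = cosets x" using rep[OF g] by blast
    obtain y w where yw: "pos y" "pos w" "\<forall>p\<in>X. x p = y p \<otimes> inv (w p)"
      using positive_quotient[OF x(1)] .
    let ?a = "quot_embed Inv (ideal_of y)" and ?b = "quot_embed Inv (ideal_of w)"
    have "cosets x = cosets (\<lambda>p. y p \<otimes> inv (w p))"
      unfolding local_unit_cosets_def by (simp add: yw(3) cong: restrict_cong)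
    also have "\<dots> = cosets y \<otimes>\<^bsub>Div\<^esub> cosets (\<lambda>p. inv (w p))"
      by (rule mult_Div_fam[OF pos_fam[OF yw(1)] fam_inv[OF pos_fam[OF yw(2)]], symmetric])
    also have "\<dots> = \<phi> (?a \<otimes>\<^bsub>quot_group Inv\<^esub> inv\<^bsub>quot_group Inv\<^esub> ?b)"
      using emC[OF yw(1)] emC[OF yw(2)] em[OF yw(1)] em[OF yw(2)] inv_Div[OF pos_fam[OF yw(2)]] by simp
    finally have "g = ?a \<otimes>\<^bsub>quot_group Inv\<^esub> inv\<^bsub>quot_group Inv\<^esub> ?b"
      by (intro inj_onD[OF inj _ g]) (use emC[OF yw(1)] emC[OF yw(2)] x(2) in simp_all)
    then show "\<exists>a\<in>?M. \<exists>b\<in>?M. g = a \<otimes>\<^bsub>quot_group Inv\<^esub> inv\<^bsub>quot_group Inv\<^esub> b"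
      using ideal_of_Inv[OF yw(1)] ideal_of_Inv[OF yw(2)] by blast
  qed
  from this show ?thesis by (rule that[OF \<phi>]) (intro allI impI, (rule mem em; assumption))+
qed

text \<open>Positivity is tested in each localization separately, and the localizations are
  seminormal.\<close>

lemma seminormal_Inv:
  assumes s: "seminormal Q H" shows "seminormal (quot_group Inv) (quot_embed Inv ` carrier Inv)"
proof -
  obtain \<phi> where \<phi>: "\<phi> \<in> iso (quot_group Inv) Div"
    and Qt: "quotient_group_of (quot_group Inv) (quot_embed Inv ` carrier Inv)"
    and mem': "\<forall>g x. g \<in> carrier (quot_group Inv) \<longrightarrow> fam x \<longrightarrow> \<phi> g = cosets x \<longrightarrow>
      (g \<in> quot_embed Inv ` carrier Inv \<longleftrightarrow> pos x)" using quot_Inv_structure .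
  note mem = mem'[rule_format]
  interpret G: quotient_group_of "quot_group Inv" "quot_embed Inv ` carrier Inv" by (rule Qt)
  interpret D: comm_group Div by (rule group_Div)
  have hom: "\<phi> \<in> hom (quot_group Inv) Div" using \<phi> by (auto simp: iso_def)
  interpret h: group_hom "quot_group Inv" Div \<phi> by unfold_locales (rule hom)
  show ?thesis
    unfolding seminormal_def
  proof (intro ballI impI)
    fix g assume g: "g \<in> carrier (quot_group Inv)"
      and g23: "g [^]\<^bsub>quot_group Inv\<^esub> (2::nat) \<in> quot_embed Inv ` carrier Inv \<and>
        g [^]\<^bsub>quot_group Inv\<^esub> (3::nat) \<in> quot_embed Inv ` carrier Inv"
    obtain x where x: "fam x" "\<phi> g = cosets x" using h.hom_closed[OF g] unfolding carrier_Div by blast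
    have pw: "\<phi> (g [^]\<^bsub>quot_group Inv\<^esub> n) = cosets (\<lambda>p. x p [^] n)" for n :: nat
      using h.hom_nat_pow[OF g, of n] x pow_Div[OF x(1)] by simp
    have "pos (\<lambda>p. x p [^] (2::nat))" "pos (\<lambda>p. x p [^] (3::nat))"
      using mem[OF _ fam_pow[OF x(1)] pw, of 2] mem[OF _ fam_pow[OF x(1)] pw, of 3] g g23 by auto
    then have "x p [^] (2::nat) \<in> L p" "x p [^] (3::nat) \<in> L p" if "p \<in> X" for p
      using that by (auto simp: pos_def)
    then have "x p \<in> L p" if "p \<in> X" for p
      using seminormal_L[OF s prime[OF that], unfolded seminormal_def, THEN bspec, of "x p"]
        fam_carrier[OF x(1) that] that by blast
    then show "g \<in> quot_embed Inv ` carrier Inv" using mem[OF g x] x(1) by (simp add: pos_def)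
  qed
qed

text \<open>A subset of \<open>\<I>\<^sub>v\<^sup>*(H)\<close> is handled through the union of its members, a subset of \<open>H\<close>.\<close>

lemma v_noetherian_Inv: "v_noetherian (quot_group Inv) (quot_embed Inv ` carrier Inv)"
proof -
  obtain \<phi> where \<phi>: "\<phi> \<in> iso (quot_group Inv) Div"
    and Qt: "quotient_group_of (quot_group Inv) (quot_embed Inv ` carrier Inv)"
    and mem': "\<forall>g x. g \<in> carrier (quot_group Inv) \<longrightarrow> fam x \<longrightarrow> \<phi> g = cosets x \<longrightarrow>
      (g \<in> quot_embed Inv ` carrier Inv \<longleftrightarrow> pos x)" using quot_Inv_structure .
  note mem = mem'[rule_format]
  let ?M = "quot_embed Inv ` carrier Inv"
  interpret G: quotient_group_of "quot_group Inv" ?M by (rule Qt)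
  interpret D: comm_group Div by (rule group_Div)
  have hom: "\<phi> \<in> hom (quot_group Inv) Div" using \<phi> by (auto simp: iso_def)
  interpret h: group_hom "quot_group Inv" Div \<phi> by unfold_locales (rule hom)
  have rep: "\<exists>x. fam x \<and> \<phi> g = cosets x" if "g \<in> carrier (quot_group Inv)" for g
    using h.hom_closed[OF that] unfolding carrier_Div by blast
  have mult: "g \<otimes>\<^bsub>quot_group Inv\<^esub> k \<in> ?M \<longleftrightarrow> (\<forall>p\<in>X. x p \<otimes> y p \<in> L p)"
    if gk: "g \<in> carrier (quot_group Inv)" "k \<in> carrier (quot_group Inv)"
      "fam x" "\<phi> g = cosets x" "fam y" "\<phi> k = cosets y" for g k x y
  proof -
    have "\<phi> (g \<otimes>\<^bsub>quot_group Inv\<^esub> k) = cosets (\<lambda>p. x p \<otimes> y p)"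
      using gk mult_Div_fam[OF gk(3) gk(5)] by simp
    then have "g \<otimes>\<^bsub>quot_group Inv\<^esub> k \<in> ?M \<longleftrightarrow> pos (\<lambda>p. x p \<otimes> y p)"
      using gk by (intro mem fam_mult) auto
    then show ?thesis using fam_mult[OF gk(3,5)] by (simp add: pos_def)
  qed
  show ?thesis
  proof (rule G.v_noetherianI)
    fix A assume A: "A \<subseteq> ?M"
    define W where "W = {e. \<exists>y a. a \<in> A \<and> fam y \<and> \<phi> a = cosets y \<and> e \<in> ideal_of y}"
    have AC: "a \<in> carrier (quot_group Inv)" if "a \<in> A" for a using A that by blast
    have "W \<subseteq> H"
    proof
      fix e assume "e \<in> W"
      then obtain y a where ya: "a \<in> A" "fam y" "\<phi> a = cosets y" "e \<in> ideal_of y" unfolding W_def by blast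
      then have "pos y" using mem[OF AC ya(2,3)] A by blast
      then have "ideal_of y \<subseteq> H" using ideal_of_subset_H_iff[OF ya(2)] by (simp add: pos_def)
      then show "e \<in> H" using ya(4) by blast
    qed
    then obtain E where E: "finite E" "E \<subseteq> W" "colon Q H E = colon Q H W"
      using v_noetherian_finite[OF v_noeth] by blast
    have "\<forall>e\<in>E. \<exists>a y. a \<in> A \<and> fam y \<and> \<phi> a = cosets y \<and> e \<in> ideal_of y"
      using E(2) unfolding W_def by blast
    then obtain a y where ay: "\<And>e. e \<in> E \<Longrightarrow> a e \<in> A \<and> fam (y e) \<and> \<phi> (a e) = cosets (y e) \<and> e \<in> ideal_of (y e)"
      by metis
    have "colon (quot_group Inv) ?M (a ` E) \<subseteq> colon (quot_group Inv) ?M A"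
    proof
      fix g assume g: "g \<in> colon (quot_group Inv) ?M (a ` E)"
      then have gC: "g \<in> carrier (quot_group Inv)" by (simp add: G.colon_iff)
      obtain w where w: "fam w" "\<phi> g = cosets w" using rep[OF gC] by blast
      \<comment> \<open>Since \<open>E\<close> and \<open>W\<close> have the same inverse, only
        products of \<open>c\<close> with elements \<open>e\<close> of \<open>E\<close> have to be
        tested, and \<open>c e\<close> is a local multiple of \<open>w p\<close> times
        \<open>y e p\<close>.\<close>
      have cW: "c \<in> colon Q H W" if c: "c \<in> ideal_of w" for c
      proof -
        have cQ: "c \<in> carrier Q" using c by (simp add: ideal_of_def)
        have "c \<otimes> e \<in> H" if e: "e \<in> E" for e
        proof -
          have eQ: "e \<in> carrier Q" using ay[OF e] by (simp add: ideal_of_def)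
          have "g \<otimes>\<^bsub>quot_group Inv\<^esub> a e \<in> ?M" using g e by (simp add: G.colon_iff)
          then have l: "\<forall>p\<in>X. w p \<otimes> y e p \<in> L p" using mult[OF gC AC w] ay[OF e] by blast
          have "c \<otimes> e \<in> L p" if p: "p \<in> X" for p
          proof -
            have "inv (w p) \<otimes> c \<otimes> (inv (y e p) \<otimes> e) \<in> L p"
              by (rule L_mult[OF prime[OF p]]) (use c ay[OF e] p in \<open>auto simp: ideal_of_def\<close>)
            then have "w p \<otimes> y e p \<otimes> (inv (w p) \<otimes> c \<otimes> (inv (y e p) \<otimes> e)) \<in> L p"
              using l p by (intro L_mult[OF prime[OF p], of "w p \<otimes> y e p"]) auto
            then show ?thesis
              using cQ eQ fam_carrier[OF w(1) p] fam_carrier[of "y e" p] ay[OF e] p by (simp add: gsimps)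
          qed
          then show ?thesis using mem_H_iff cQ eQ by blast
        qed
        then have "c \<in> colon Q H E" using cQ by (simp add: colon_iff)
        then show ?thesis using E(3) by simp
      qed
      have "g \<otimes>\<^bsub>quot_group Inv\<^esub> b \<in> ?M" if b: "b \<in> A" for b
      proof -
        obtain z where z: "fam z" "\<phi> b = cosets z" using rep[OF AC[OF b]] by blast
        have "w p \<otimes> z p \<in> L p" if p: "p \<in> X" for p
        proof -
          \<comment> \<open>With exact local generators \<open>c\<close> and \<open>d\<close> at
            \<open>p\<close>, the product \<open>w p z p\<close> differs from the element
            \<open>cd\<close> of \<open>H\<close> only by a unit of \<open>L p\<close>.\<close>
          obtain c where c: "c \<in> ideal_of w" "inv (w p) \<otimes> c \<in> U p" "c \<in> carrier Q"
            using approximation[OF w(1) p] .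
          obtain d where d: "d \<in> ideal_of z" "inv (z p) \<otimes> d \<in> U p" "d \<in> carrier Q"
            using approximation[OF z(1) p] .
          have "d \<in> W" using d(1) z b unfolding W_def by blast
          then have "c \<otimes> d \<in> H" using cW[OF c(1)] by (simp add: colon_iff)
          then have cd: "c \<otimes> d \<in> L p" using H_sub_L[OF prime[OF p]] by blast
          note wz = fam_carrier[OF w(1) p] fam_carrier[OF z(1) p]
          have "(inv (w p) \<otimes> c) \<otimes> (inv (z p) \<otimes> d) \<in> U p" by (rule U_mult[OF prime[OF p] c(2) d(2)])
          then have u: "inv ((inv (w p) \<otimes> c) \<otimes> (inv (z p) \<otimes> d)) \<in> L p"
            by (rule U_sub_L[OF prime[OF p] U_inv[OF prime[OF p]]])
          have "inv ((inv (w p) \<otimes> c) \<otimes> (inv (z p) \<otimes> d)) \<otimes> (c \<otimes> d) \<in> L p"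
            by (rule L_mult[OF prime[OF p] u cd])
          then show ?thesis using wz c(3) d(3) by (simp add: gsimps)
        qed
        then show ?thesis using mult[OF gC AC[OF b] w z] by blast
      qed
      then show "g \<in> colon (quot_group Inv) ?M A" using gC by (simp add: G.colon_iff)
    qed
    moreover have "a ` E \<subseteq> A" using ay by blast
    ultimately show "\<exists>E. finite E \<and> E \<subseteq> A \<and>
        colon (quot_group Inv) ?M E \<subseteq> colon (quot_group Inv) ?M A" using E(1) by blast
  qed
qed

lemma divides_Inv:
  assumes x: "pos x" and y: "pos y"
  shows "ideal_of x divides\<^bsub>Inv\<^esub> ideal_of y \<longleftrightarrow> (\<forall>p\<in>X. inv (x p) \<otimes> y p \<in> L p)"
proof
  note fx = pos_fam[OF x] and fy = pos_fam[OF y]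
  assume "ideal_of x divides\<^bsub>Inv\<^esub> ideal_of y"
  then obtain c where c: "pos c" "ideal_of y = ideal_of x \<otimes>\<^bsub>Inv\<^esub> ideal_of c"
    unfolding factor_def carrier_Inv by blast
  note fc = pos_fam[OF c(1)]
  have "ideal_of y = ideal_of (\<lambda>p. x p \<otimes> c p)" using c(2) mult_v_inv_monoid[OF fx fc] by simp
  then have u: "\<forall>p\<in>X. inv (x p \<otimes> c p) \<otimes> y p \<in> U p"
    using ideal_of_eq_iff[OF fam_mult[OF fx fc] fy] by simp
  show "\<forall>p\<in>X. inv (x p) \<otimes> y p \<in> L p"
  proof
    fix p assume p: "p \<in> X"
    have "c p \<otimes> (inv (x p \<otimes> c p) \<otimes> y p) \<in> L p"
      by (rule L_mult[OF prime[OF p] _ U_sub_L[OF prime[OF p]]]) (use u c(1) p in \<open>auto simp: pos_def\<close>)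
    then show "inv (x p) \<otimes> y p \<in> L p"
      using fam_carrier[OF fx p] fam_carrier[OF fy p] fam_carrier[OF fc p] by (simp add: gsimps)
  qed
next
  note fx = pos_fam[OF x] and fy = pos_fam[OF y]
  assume d: "\<forall>p\<in>X. inv (x p) \<otimes> y p \<in> L p"
  have c: "pos (\<lambda>p. inv (x p) \<otimes> y p)" using d fam_mult[OF fam_inv[OF fx] fy] by (simp add: pos_def)
  have "ideal_of x \<otimes>\<^bsub>Inv\<^esub> ideal_of (\<lambda>p. inv (x p) \<otimes> y p) = ideal_of y"
    unfolding mult_v_inv_monoid[OF fx pos_fam[OF c]]
    by (rule ideal_of_cong) (simp add: cancel_simps fam_carrier[OF fx] fam_carrier[OF fy])
  then show "ideal_of x divides\<^bsub>Inv\<^esub> ideal_of y"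
    unfolding factor_def using ideal_of_Inv[OF c] by metis
qed

lemma Units_Inv:
  assumes x: "pos x" shows "ideal_of x \<in> Units Inv \<longleftrightarrow> (\<forall>p\<in>X. x p \<in> U p)"
proof -
  interpret I: comm_monoid_cancel Inv by (rule Inv_cancel)
  have "ideal_of x \<in> Units Inv \<longleftrightarrow> ideal_of x divides\<^bsub>Inv\<^esub> \<one>\<^bsub>Inv\<^esub>"
    using I.Unit_eq_dividesone[OF ideal_of_Inv[OF x]] .
  also have "\<dots> \<longleftrightarrow> (\<forall>p\<in>X. inv (x p) \<otimes> \<one> \<in> L p)"
    unfolding one_v_inv_monoid by (rule divides_Inv[OF x pos_one])
  also have "\<dots> \<longleftrightarrow> (\<forall>p\<in>X. x p \<in> U p)"
    using U_iff[OF prime] x fam_carrier[OF pos_fam[OF x]] by (auto simp: pos_def)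
  finally show ?thesis .
qed

lemma pow_Inv:
  assumes x: "pos x" shows "ideal_of x [^]\<^bsub>Inv\<^esub> (n::nat) = ideal_of (\<lambda>p. x p [^] n)"
proof (induction n)
  case (Suc n)
  have "ideal_of x [^]\<^bsub>Inv\<^esub> Suc n = ideal_of (\<lambda>p. x p [^] n) \<otimes>\<^bsub>Inv\<^esub> ideal_of x"
    using Suc.IH by (simp add: nat_pow_def)
  also have "\<dots> = ideal_of (\<lambda>p. x p [^] n \<otimes> x p)"
    by (rule mult_v_inv_monoid) (use x pos_fam fam_pow in blast)+
  finally show ?case by simp
qed (simp add: one_v_inv_monoid nat_pow_def)

lemma pos_pow: "pos x \<Longrightarrow> pos (\<lambda>p. x p [^] (n::nat))"
proof (induction n)
  case (Suc n)
  then show ?case using pos_mult[of "\<lambda>p. x p [^] n" x] by simp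
qed (simp add: pos_one)

text \<open>Divisibility by \<open>ideal_of q\<close> depends only on the component at
  \<open>p\<close>, where \<open>L_primary\<close> applies.\<close>

lemma primary_single:
  assumes q: "pos q" and p: "p \<in> X" and np: "q p \<notin> U p" and other: "\<And>p'. p' \<in> X \<Longrightarrow> p' \<noteq> p \<Longrightarrow> q p' \<in> U p'"
  shows "primary_elem Inv (ideal_of q)"
  unfolding primary_elem_def
proof (intro conjI ballI impI)
  note P = prime[OF p] and fq = pos_fam[OF q]
  show "ideal_of q \<in> carrier Inv - Units Inv" using ideal_of_Inv[OF q] Units_Inv[OF q] np p by blast
  have div: "ideal_of q divides\<^bsub>Inv\<^esub> ideal_of a \<longleftrightarrow> inv (q p) \<otimes> a p \<in> L p" if a: "pos a" for a
  proof -
    have "inv (q p') \<otimes> a p' \<in> L p'" if "p' \<in> X" "p' \<noteq> p" for p'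
      by (rule L_mult[OF prime[OF that(1)] U_sub_L[OF prime[OF that(1)] U_inv[OF prime[OF that(1)] other[OF that]]]])
        (use a that in \<open>simp add: pos_def\<close>)
    then show ?thesis unfolding divides_Inv[OF q a] using p by blast
  qed
  fix A B assume "A \<in> carrier Inv" "B \<in> carrier Inv" and d: "ideal_of q divides\<^bsub>Inv\<^esub> (A \<otimes>\<^bsub>Inv\<^esub> B)"
  then obtain a b where ab: "pos a" "A = ideal_of a" "pos b" "B = ideal_of b" unfolding carrier_Inv by blast
  note fa = pos_fam[OF ab(1)] and fb = pos_fam[OF ab(3)]
  note Qs = fam_carrier[OF fq p] fam_carrier[OF fa p] fam_carrier[OF fb p]
  have d': "inv (q p) \<otimes> (a p \<otimes> b p) \<in> L p"
    using d div[OF pos_mult[OF ab(1,3)]] unfolding ab(2,4) mult_v_inv_monoid[OF fa fb] by simp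
  show "ideal_of q divides\<^bsub>Inv\<^esub> A \<or> (\<exists>n::nat. ideal_of q divides\<^bsub>Inv\<^esub> (B [^]\<^bsub>Inv\<^esub> n))"
  proof (cases "b p \<in> U p")
    case True
    have "inv (q p) \<otimes> (a p \<otimes> b p) \<otimes> inv (b p) \<in> L p"
      by (rule L_mult[OF P d' U_sub_L[OF P U_inv[OF P True]]])
    then have "inv (q p) \<otimes> a p \<in> L p" using Qs by (simp add: gsimps)
    then show ?thesis using div[OF ab(1)] ab(2) by simp
  next
    case False
    have "b p \<in> L p" using ab(3) p by (simp add: pos_def)
    then obtain N where "b p [^] (N::nat) \<otimes> inv (q p) \<in> L p"
      using L_primary[OF p _ False, of "inv (q p)"] Qs by blast
    then have "inv (q p) \<otimes> b p [^] N \<in> L p" using Qs by (simp add: m_comm)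
    then have "ideal_of q divides\<^bsub>Inv\<^esub> (B [^]\<^bsub>Inv\<^esub> N)"
      using div[OF pos_pow[OF ab(3)]] unfolding ab(4) pow_Inv[OF ab(3)] by blast
    then show ?thesis by blast
  qed
qed

text \<open>Induction over a finite set containing the support; each step splits off one component,
  and an ideal with a single non-trivial component is primary.\<close>

lemma weakly_factorial_Inv: "weakly_factorial Inv"
  unfolding weakly_factorial_def
proof (intro conjI ballI Inv_cancel)
  have "\<exists>qs. (\<forall>q\<in>set qs. primary_elem Inv q) \<and> ideal_of x = foldr (\<otimes>\<^bsub>Inv\<^esub>) qs \<one>\<^bsub>Inv\<^esub>"
    if "finite T" "pos x" "{p \<in> X. x p \<notin> U p} \<subseteq> T" for T x
    using that
  proof (induction T arbitrary: x)
    case empty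
    then have "ideal_of x = ideal_of (\<lambda>p. \<one>)"
      using ideal_of_eq_iff[OF pos_fam[OF empty(1)] pos_fam[OF pos_one]] U_inv[OF prime]
        fam_carrier[OF pos_fam[OF empty(1)]] by auto
    then have "ideal_of x = foldr (\<otimes>\<^bsub>Inv\<^esub>) [] \<one>\<^bsub>Inv\<^esub>" by (simp add: one_v_inv_monoid)
    then show ?case by (metis empty_iff list.set(1))
  next
    case (insert p T)
    show ?case
    proof (cases "p \<in> X \<and> x p \<notin> U p")
      case False
      then show ?thesis using insert.IH[OF insert.prems(1)] insert.prems(2) by blast
    next
      case True
      note fx = pos_fam[OF insert.prems(1)]
      define q where "q p' = (if p' = p then x p else \<one>)" for p'
      define y where "y p' = (if p' = p then \<one> else x p')" for p'
      have finT: "finite {p \<in> X. x p \<notin> U p}" using fx by (simp add: fam_def)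
      have q: "pos q" unfolding pos_def
      proof (intro conjI ballI)
        show "fam q" by (rule fam_finite_support[OF finT])
          (use True fam_carrier[OF fx] prime in \<open>auto simp: q_def\<close>)
      qed (use insert.prems(1) prime in \<open>auto simp: q_def pos_def\<close>)
      have y: "pos y" unfolding pos_def
      proof (intro conjI ballI)
        show "fam y" by (rule fam_finite_support[OF finT])
          (use fam_carrier[OF fx] prime in \<open>auto simp: y_def\<close>)
      qed (use insert.prems(1) prime in \<open>auto simp: y_def pos_def\<close>)
      have "{p \<in> X. y p \<notin> U p} \<subseteq> T" using insert.prems(2) prime by (auto simp: y_def)
      then obtain qs where qs: "\<forall>q\<in>set qs. primary_elem Inv q" "ideal_of y = foldr (\<otimes>\<^bsub>Inv\<^esub>) qs \<one>\<^bsub>Inv\<^esub>"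
        using insert.IH[OF y] by blast
      have "primary_elem Inv (ideal_of q)"
        by (rule primary_single[OF q, of p]) (use True prime in \<open>auto simp: q_def\<close>)
      moreover have "ideal_of x = ideal_of q \<otimes>\<^bsub>Inv\<^esub> ideal_of y"
        unfolding mult_v_inv_monoid[OF pos_fam[OF q] pos_fam[OF y]]
        by (rule ideal_of_cong) (use fam_carrier[OF fx] in \<open>auto simp: q_def y_def\<close>)
      ultimately show ?thesis
        using qs by (intro exI[of _ "ideal_of q # qs"]) simp
    qed
  qed
  then show "\<exists>qs. (\<forall>q\<in>set qs. primary_elem Inv q) \<and> A = foldr (\<otimes>\<^bsub>Inv\<^esub>) qs \<one>\<^bsub>Inv\<^esub>"
    if "A \<in> carrier Inv - Units Inv" for A
    using that unfolding carrier_Inv by (auto simp: pos_def fam_def)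
qed

section \<open>The product decomposition of the monoid of \<open>v\<close>-invertible ideals\<close>

text \<open>As a divisor, \<open>p\<close> is a uniformizer at \<open>p\<close> and trivial
  elsewhere. This recognizes \<open>p\<close> as an element of the ideal monoid, so that
  \<open>\<chi>\<close> can be evaluated at it.\<close>

lemma min_prime_ideal_of:
  assumes p: "p \<in> X" and v: "discrete_val (L p) v" and c: "c \<in> carrier Q" "v c = 1"
  shows "p = ideal_of (\<lambda>q. if q = p then c else \<one>)" "pos (\<lambda>q. if q = p then c else \<one>)"
proof -
  note P = prime[OF p] and vD = discrete_valD[OF v] and UV = discrete_val_Units[OF v]
  let ?x = "\<lambda>q. if q = p then c else \<one>"
  show "pos ?x" unfolding pos_def
  proof (intro conjI ballI)
    show "fam ?x" by (rule fam_finite_support[of "{p}"]) (use c prime in auto)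
  qed (use c vD(2) prime in auto)
  have "a \<in> p \<longleftrightarrow> a \<in> ideal_of ?x" for a
  proof
    assume a: "a \<in> p"
    have aH: "a \<in> H" using a primeD(1)[OF P] by blast
    have "a \<in> L p" "a \<notin> U p" using H_sub_L[OF P] aH U_H[OF P aH] a by blast+
    then have "v a \<ge> 1" unfolding UV using vD(2)[of a] by auto
    then have "inv c \<otimes> a \<in> L p" unfolding vD(2) using c aH by (simp add: vD)
    then show "a \<in> ideal_of ?x" using aH H_sub_L[OF prime] by (auto simp: ideal_of_def)
  next
    assume a: "a \<in> ideal_of ?x"
    then have aQ: "a \<in> carrier Q" by (simp add: ideal_of_def)
    have "inv (if p = p then c else \<one>) \<otimes> a \<in> L p" using a p unfolding ideal_of_def by blast
    then have "inv c \<otimes> a \<in> L p" by simp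
    then have va: "v a \<ge> 1" unfolding vD(2) using c aQ by (simp add: vD)
    have "a \<in> L q" if q: "q \<in> X" for q
    proof (cases "q = p")
      case True
      then show ?thesis using va aQ vD(2)[of a] by simp
    next
      case False
      have "inv (if q = p then c else \<one>) \<otimes> a \<in> L q" using a q unfolding ideal_of_def by blast
      then show ?thesis using aQ False by simp
    qed
    then have aH: "a \<in> H" using mem_H_iff aQ by blast
    have "a \<notin> U p" unfolding UV using va by auto
    then show "a \<in> p" using U_H[OF P aH] by blast
  qed
  then show "p = ideal_of ?x" by blast
qed

text \<open>Components at the discrete primes are recorded by their values, collected in a multiset,
  the finitely many others by their cosets.\<close>

lemma Inv_iso_product:
  assumes PS: "X = P \<union> S" "P \<inter> S = {}" "finite S" and val: "\<And>p. p \<in> P \<Longrightarrow> \<exists>v. discrete_val (L p) v"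
  defines "PR \<equiv> product_group S (\<lambda>p. monoid_red (Q\<lparr>carrier := L p\<rparr>))"
  shows "\<exists>\<chi>\<in>iso Inv (free_abelian_monoid P \<times>\<times> PR). \<forall>p\<in>P. \<chi> p = ({#p#}, \<one>\<^bsub>PR\<^esub>)"
proof -
  have "\<forall>p. \<exists>v. p \<in> P \<longrightarrow> discrete_val (L p) v" using val by blast
  then obtain v where v: "\<And>p. p \<in> P \<Longrightarrow> discrete_val (L p) (v p)" by metis
  have "\<forall>p. \<exists>c. p \<in> P \<longrightarrow> c \<in> carrier Q \<and> v p c = 1" using discrete_val_one[OF v] by blast
  then obtain c where c: "\<And>p. p \<in> P \<Longrightarrow> c p \<in> carrier Q \<and> v p (c p) = 1" by metis
  have UV: "x \<in> U p \<longleftrightarrow> x \<in> carrier Q \<and> v p x = 0" if "p \<in> P" for p x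
    using discrete_val_Units[OF v[OF that]] by blast
  have PX: "p \<in> X" if "p \<in> P" for p using that PS by blast
  have SX: "p \<in> X" if "p \<in> S" for p using that PS by blast
  \<comment> \<open>\<open>Abs_multiset\<close> has these counts only because their support is
    finite; \<open>countM\<close> derives this from the finite support of \<open>x\<close>.\<close>
  define M where "M x = Abs_multiset (\<lambda>p. if p \<in> P then nat (v p (x p)) else 0)" for x :: "'a set \<Rightarrow> 'a"
  define N where "N x = (\<lambda>p\<in>S. U p #> x p)" for x :: "'a set \<Rightarrow> 'a"
  have countM: "count (M x) p = (if p \<in> P then nat (v p (x p)) else 0)" if x: "pos x" for x p
  proof -
    have fx: "fam x" using x by (rule pos_fam)
    have "{p. 0 < (if p \<in> P then nat (v p (x p)) else 0)} \<subseteq> {p \<in> X. x p \<notin> U p}"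
      using UV PX by (auto split: if_splits)
    moreover have "finite {p \<in> X. x p \<notin> U p}" using fx by (simp add: fam_def)
    ultimately have "finite {p. 0 < (if p \<in> P then nat (v p (x p)) else 0)}" by (rule finite_subset)
    then show ?thesis unfolding M_def by (simp add: count_Abs_multiset)
  qed
  have nonneg: "v p (x p) \<ge> 0" if "pos x" "p \<in> P" for x p
    using discrete_valD(2)[OF v[OF that(2)], of "x p"] that PX by (auto simp: pos_def)
  have MN_eq: "M x = M y \<and> N x = N y \<longleftrightarrow> ideal_of x = ideal_of y" if xy: "pos x" "pos y" for x y
  proof -
    note fx = pos_fam[OF xy(1)] and fy = pos_fam[OF xy(2)]
    have "M x = M y \<longleftrightarrow> (\<forall>p\<in>P. inv (x p) \<otimes> y p \<in> U p)"
    proof -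
      have "M x = M y \<longleftrightarrow> (\<forall>p\<in>P. v p (x p) = v p (y p))"
        unfolding multiset_eq_iff countM[OF xy(1)] countM[OF xy(2)]
        using nonneg[OF xy(1)] nonneg[OF xy(2)] by (auto simp: nat_eq_iff2) (metis int_nat_eq nat_int)?
      also have "\<dots> \<longleftrightarrow> (\<forall>p\<in>P. inv (x p) \<otimes> y p \<in> U p)"
        using fam_carrier[OF fx] fam_carrier[OF fy] PX
        by (intro ball_cong refl) (auto simp: UV discrete_valD(1,4)[OF v])
      finally show ?thesis .
    qed
    moreover have "N x = N y \<longleftrightarrow> (\<forall>p\<in>S. inv (x p) \<otimes> y p \<in> U p)"
    proof -
      have "N x = N y \<longleftrightarrow> (\<forall>p\<in>S. U p #> x p = U p #> y p)"
        unfolding N_def by (auto simp: fun_eq_iff restrict_def)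
      also have "\<dots> \<longleftrightarrow> (\<forall>p\<in>S. inv (x p) \<otimes> y p \<in> U p)"
        using rcos_eq_iff[OF U_subgroup[OF prime]] fam_carrier[OF fx] fam_carrier[OF fy] SX
        by (intro ball_cong refl) simp
      finally show ?thesis .
    qed
    ultimately show ?thesis unfolding ideal_of_eq_iff[OF fx fy] PS(1) by blast
  qed
  define \<chi> where "\<chi> A = (M (SOME x. pos x \<and> A = ideal_of x), N (SOME x. pos x \<and> A = ideal_of x))" for A
  have \<chi>: "\<chi> (ideal_of x) = (M x, N x)" if "pos x" for x
  proof -
    have "pos (SOME y. pos y \<and> ideal_of x = ideal_of y) \<and>
        ideal_of x = ideal_of (SOME y. pos y \<and> ideal_of x = ideal_of y)"
      using that by (intro someI[of "\<lambda>y. pos y \<and> ideal_of x = ideal_of y" x]) simp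
    then show ?thesis unfolding \<chi>_def using MN_eq[OF _ that] by simp
  qed
  have carrPR: "carrier PR = (\<Pi>\<^sub>E p\<in>S. (\<lambda>a. U p #> a) ` L p)"
    unfolding PR_def by (simp add: monoid_red_def)
  have carrF: "carrier (free_abelian_monoid P) = {A. set_mset A \<subseteq> P}" by (simp add: free_abelian_monoid_def)
  have MF: "M x \<in> carrier (free_abelian_monoid P)" if "pos x" for x
    unfolding carrF using countM[OF that] by (auto simp flip: count_greater_zero_iff split: if_splits)
  have NPR: "N x \<in> carrier PR" if "pos x" for x
    unfolding carrPR N_def using that SX by (auto simp: pos_def)
  have iso: "\<chi> \<in> iso Inv (free_abelian_monoid P \<times>\<times> PR)"
  proof (rule isoI)
    show "\<chi> \<in> hom Inv (free_abelian_monoid P \<times>\<times> PR)"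
    proof (rule homI)
      fix A assume "A \<in> carrier Inv"
      then obtain x where x: "pos x" "A = ideal_of x" unfolding carrier_Inv by blast
      show "\<chi> A \<in> carrier (free_abelian_monoid P \<times>\<times> PR)" unfolding x(2) \<chi>[OF x(1)] using MF NPR x(1) by simp
      fix B assume "B \<in> carrier Inv"
      then obtain y where y: "pos y" "B = ideal_of y" unfolding carrier_Inv by blast
      note fx = pos_fam[OF x(1)] and fy = pos_fam[OF y(1)]
      have "M (\<lambda>p. x p \<otimes> y p) = M x + M y"
        by (rule multiset_eqI)
          (use nonneg[OF x(1)] nonneg[OF y(1)] fam_carrier[OF fx] fam_carrier[OF fy] PX in
            \<open>simp add: countM pos_mult x(1) y(1) discrete_valD(1)[OF v] nat_add_distrib\<close>)
      moreover have "N (\<lambda>p. x p \<otimes> y p) = N x \<otimes>\<^bsub>PR\<^esub> N y"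
        unfolding N_def PR_def using fam_carrier[OF fx] fam_carrier[OF fy] SX rcos_mult[OF U_subgroup[OF prime]]
        by (simp add: monoid_red_def cong: restrict_cong)
      ultimately show "\<chi> (A \<otimes>\<^bsub>Inv\<^esub> B) = \<chi> A \<otimes>\<^bsub>free_abelian_monoid P \<times>\<times> PR\<^esub> \<chi> B"
        unfolding x(2) y(2) mult_v_inv_monoid[OF fx fy] \<chi>[OF x(1)] \<chi>[OF y(1)] \<chi>[OF pos_mult[OF x(1) y(1)]]
        by (simp add: free_abelian_monoid_def)
    qed
    have "inj_on \<chi> (carrier Inv)"
    proof (rule inj_onI)
      fix A B assume "A \<in> carrier Inv" "B \<in> carrier Inv" and e: "\<chi> A = \<chi> B"
      then obtain x y where xy: "pos x" "A = ideal_of x" "pos y" "B = ideal_of y" unfolding carrier_Inv by blast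
      show "A = B" using e MN_eq[OF xy(1,3)] unfolding xy(2,4) \<chi>[OF xy(1)] \<chi>[OF xy(3)] by simp
    qed
    moreover have "\<chi> ` carrier Inv = carrier (free_abelian_monoid P \<times>\<times> PR)"
    proof
      show "\<chi> ` carrier Inv \<subseteq> carrier (free_abelian_monoid P \<times>\<times> PR)"
        unfolding carrier_Inv using \<chi> MF NPR by auto
      show "carrier (free_abelian_monoid P \<times>\<times> PR) \<subseteq> \<chi> ` carrier Inv"
      proof clarsimp
        fix A g assume A: "A \<in> carrier (free_abelian_monoid P)" and g: "g \<in> carrier PR"
        have "\<forall>p. \<exists>a. p \<in> S \<longrightarrow> a \<in> L p \<and> g p = U p #> a" using g unfolding carrPR by (auto simp: PiE_iff)
        then obtain a where a: "\<And>p. p \<in> S \<Longrightarrow> a p \<in> L p \<and> g p = U p #> a p" by metis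
        \<comment> \<open>A preimage: powers of uniformizers at the discrete primes and chosen
          representatives at the others. As \<open>S\<close> is finite, this has finite
          support.\<close>
        define x where "x p = (if p \<in> P then c p [^] count A p else a p)" for p
        have xP: "x p \<in> carrier Q" "v p (x p) = int (count A p)" if "p \<in> P" for p
          using c[OF that] that discrete_valD(5)[OF v[OF that]] by (simp_all add: x_def)
        have xS: "x p = a p" if "p \<in> S" for p using that PS(2) by (auto simp: x_def)
        have "pos x" unfolding pos_def
        proof (intro conjI ballI)
          show "fam x"
          proof (rule fam_finite_support[of "S \<union> set_mset A"])
            show "x p \<in> U p" if "p \<in> X" "p \<notin> S \<union> set_mset A" for p
            proof -
              have "p \<in> P" using that PS(1) by blast
              then show ?thesis using that xP UV[of p "x p"] by (simp add: not_in_iff)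
            qed
            show "x p \<in> carrier Q" if "p \<in> X" for p
            proof (cases "p \<in> P")
              case False
              then have "p \<in> S" using that PS(1) by blast
              then show ?thesis using xS a L_carrier by metis
            qed (use xP in blast)
          qed (use PS in simp)
          show "x p \<in> L p" if "p \<in> X" for p
          proof (cases "p \<in> P")
            case True
            then show ?thesis using discrete_valD(2)[OF v[OF True]] xP[OF True] by simp
          next
            case False
            then show ?thesis using that PS(1) xS a by auto
          qed
        qed
        moreover have "M x = A"
        proof (rule multiset_eqI)
          fix p show "count (M x) p = count A p"
            using countM[OF \<open>pos x\<close>, of p] xP(2)[of p] A by (auto simp: carrF count_eq_zero_iff)
        qed
        moreover have "N x = g"
        proof
          fix p show "N x p = g p"
            using g a xS unfolding carrPR by (cases "p \<in> S") (auto simp: N_def PiE_iff extensional_def)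
        qed
        ultimately show "(A, g) \<in> \<chi> ` carrier Inv" using \<chi> ideal_of_Inv by (metis image_eqI)
      qed
    qed
    ultimately show "bij_betw \<chi> (carrier Inv) (carrier (free_abelian_monoid P \<times>\<times> PR))"
      by (simp add: bij_betw_def)
  qed
  have "\<chi> p = ({#p#}, \<one>\<^bsub>PR\<^esub>)" if p: "p \<in> P" for p
  proof -
    let ?x = "\<lambda>q. if q = p then c p else \<one>"
    have x: "p = ideal_of ?x" "pos ?x" using min_prime_ideal_of[OF PX[OF p] v[OF p]] c[OF p] by auto
    have "\<chi> p = (M ?x, N ?x)" using \<chi>[OF x(2)] x(1) by simp
    moreover have "M ?x = {#p#}"
      by (rule multiset_eqI) (use c[OF p] p discrete_valD(3)[OF v] in \<open>auto simp: countM[OF x(2)]\<close>)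
    moreover have "N ?x = \<one>\<^bsub>PR\<^esub>"
    proof -
      have "U q #> ?x q = U q" if "q \<in> S" for q
      proof -
        have "?x q = \<one>" using that p PS(2) by auto
        then show ?thesis using coset_mult_one[OF subgroup.subset[OF U_subgroup[OF prime[OF SX[OF that]]]]] by simp
      qed
      then show ?thesis unfolding N_def PR_def by (simp add: monoid_red_def cong: restrict_cong)
    qed
    ultimately show ?thesis by simp
  qed
  with iso show ?thesis by blast
qed

end

section \<open>Factorial monoids and C-monoids from valuations\<close>

text \<open>When divisibility is read off natural values and each coordinate has an element
  \<open>c i\<close> with value 1 there and 0 elsewhere, the \<open>c i\<close> are all primes up to
  associates. The sum of the values drops along proper divisors, which gives the divisor chain
  condition.\<close>

lemma factorial_from_valuations:
  fixes w :: "'i \<Rightarrow> 'b \<Rightarrow> nat"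
  assumes M: "comm_monoid_cancel M"
    and w_mult: "\<And>i x y. i \<in> V \<Longrightarrow> x \<in> carrier M \<Longrightarrow> y \<in> carrier M \<Longrightarrow> w i (x \<otimes>\<^bsub>M\<^esub> y) = w i x + w i y"
    and fin: "\<And>x. x \<in> carrier M \<Longrightarrow> finite {i \<in> V. w i x \<noteq> 0}"
    and div: "\<And>x y. x \<in> carrier M \<Longrightarrow> y \<in> carrier M \<Longrightarrow> (\<And>i. i \<in> V \<Longrightarrow> w i x \<le> w i y) \<Longrightarrow> x divides\<^bsub>M\<^esub> y"
    and c: "\<And>i. i \<in> V \<Longrightarrow> c i \<in> carrier M" "\<And>i j. i \<in> V \<Longrightarrow> j \<in> V \<Longrightarrow> w j (c i) = (if i = j then 1 else 0)"
  shows "factorial_monoid M"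
    "x \<in> carrier M \<Longrightarrow> x \<in> Units M \<longleftrightarrow> (\<forall>i\<in>V. w i x = 0)"
    "i \<in> V \<Longrightarrow> Divisibility.prime M (c i)"
proof -
  interpret comm_monoid_cancel M by fact
  have div_iff: "x divides\<^bsub>M\<^esub> y \<longleftrightarrow> (\<forall>i\<in>V. w i x \<le> w i y)" if "x \<in> carrier M" "y \<in> carrier M" for x y
  proof
    assume "x divides\<^bsub>M\<^esub> y"
    then obtain d where "d \<in> carrier M" "y = x \<otimes>\<^bsub>M\<^esub> d" unfolding factor_def by blast
    then show "\<forall>i\<in>V. w i x \<le> w i y" using that w_mult by simp
  qed (use div that in blast)
  have w1: "w i \<one>\<^bsub>M\<^esub> = 0" if "i \<in> V" for i using w_mult[OF that, of "\<one>\<^bsub>M\<^esub>" "\<one>\<^bsub>M\<^esub>"] by simp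
  have un: "x \<in> Units M \<longleftrightarrow> (\<forall>i\<in>V. w i x = 0)" if "x \<in> carrier M" for x
    using Unit_eq_dividesone[OF that] div_iff[OF that one_closed] w1 by simp
  then show "x \<in> carrier M \<Longrightarrow> x \<in> Units M \<longleftrightarrow> (\<forall>i\<in>V. w i x = 0)" .
  have c_div: "c i divides\<^bsub>M\<^esub> x \<longleftrightarrow> 1 \<le> w i x" if "i \<in> V" "x \<in> carrier M" for i x
    using div_iff[OF c(1)[OF that(1)] that(2)] c(2)[OF that(1)] that(1) by auto
  have c_prime: "Divisibility.prime M (c i)" if i: "i \<in> V" for i
    unfolding Divisibility.prime_def
  proof (intro conjI ballI impI)
    show "c i \<notin> Units M" using un[OF c(1)[OF i]] c(2)[OF i i] i by auto
    fix a b assume ab: "a \<in> carrier M" "b \<in> carrier M" "c i divides\<^bsub>M\<^esub> (a \<otimes>\<^bsub>M\<^esub> b)"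
    then have "1 \<le> w i a + w i b" using c_div[OF i m_closed[OF ab(1,2)]] w_mult[OF i ab(1,2)] by simp
    then have "1 \<le> w i a \<or> 1 \<le> w i b" by linarith
    then show "c i divides\<^bsub>M\<^esub> a \<or> c i divides\<^bsub>M\<^esub> b" using c_div[OF i] ab by blast
  qed
  then show "i \<in> V \<Longrightarrow> Divisibility.prime M (c i)" .
  define size where "size x = (\<Sum>i\<in>{i \<in> V. w i x \<noteq> 0}. w i x)" for x
  have "wf {(x, y). x \<in> carrier M \<and> y \<in> carrier M \<and> properfactor M x y}"
  proof (rule wf_subset[OF wf_measure[of size]], clarify)
    fix x y assume xy: "x \<in> carrier M" "y \<in> carrier M" "properfactor M x y"
    then have le: "w i x \<le> w i y" if "i \<in> V" for i using div_iff[OF xy(1,2)] that by (simp add: properfactor_def)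
    obtain k where k: "k \<in> V" "w k x < w k y"
      using xy(3) div_iff[OF xy(2,1)] by (auto simp: properfactor_def not_le)
    have "size x = (\<Sum>i\<in>{i \<in> V. w i y \<noteq> 0}. w i x)"
      unfolding size_def
      by (intro sum.mono_neutral_left fin xy) (auto intro: less_le_trans[OF _ le])
    also have "\<dots> < size y"
      unfolding size_def using le k by (intro sum_strict_mono_ex1 fin xy) auto
    finally show "(x, y) \<in> measure size" by simp
  qed
  then have "divisor_chain_condition_monoid M"
    by (intro divisor_chain_condition_monoid.intro M divisor_chain_condition_monoid_axioms.intro)
  moreover have "primeness_condition_monoid M"
  proof (intro primeness_condition_monoid.intro M primeness_condition_monoid_axioms.intro)
    fix a assume a: "a \<in> carrier M" "irreducible M a"
    then obtain i where i: "i \<in> V" "w i a \<noteq> 0" using un[OF a(1)] by (auto simp: irreducible_def)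
    then have d: "c i divides\<^bsub>M\<^esub> a" using c_div[OF i(1) a(1)] by simp
    have "\<not> properfactor M (c i) a"
      using a(2) c(1)[OF i(1)] c_prime[OF i(1)] by (auto simp: irreducible_def Divisibility.prime_def)
    then have "a divides\<^bsub>M\<^esub> c i" using d by (simp add: properfactor_def)
    then have "c i \<sim>\<^bsub>M\<^esub> a" using d by (simp add: associated_def)
    then show "Divisibility.prime M a" using prime_cong c(1)[OF i(1)] a(1) c_prime[OF i(1)] by blast
  qed
  ultimately show "factorial_monoid M" using factorial_condition_one by blast
qed

lemma iso_inv_into:
  assumes "monoid M" "h \<in> iso M N" shows "inv_into (carrier M) h \<in> iso N M"
proof -
  interpret monoid M by fact
  have h: "bij_betw h (carrier M) (carrier N)" "\<And>x y. x \<in> carrier M \<Longrightarrow> y \<in> carrier M \<Longrightarrow> h (x \<otimes>\<^bsub>M\<^esub> y) = h x \<otimes>\<^bsub>N\<^esub> h y"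
    using assms(2) by (auto simp: iso_def hom_def)
  let ?g = "inv_into (carrier M) h"
  have g: "?g x \<in> carrier M" "h (?g x) = x" if "x \<in> carrier N" for x
    using h(1) that by (auto simp: bij_betw_def inv_into_into f_inv_into_f)
  have gh: "?g (h x) = x" if "x \<in> carrier M" for x using h(1) that by (simp add: bij_betw_def)
  have "?g (x \<otimes>\<^bsub>N\<^esub> y) = ?g x \<otimes>\<^bsub>M\<^esub> ?g y" if "x \<in> carrier N" "y \<in> carrier N" for x y
    using gh[of "?g x \<otimes>\<^bsub>M\<^esub> ?g y"] h(2)[of "?g x" "?g y"] g that by simp
  then have "?g \<in> hom N M" using g(1) by (auto simp: hom_def)
  then show ?thesis using bij_betw_inv_into[OF h(1)] by (simp add: iso_def)
qed

text \<open>Elements with equal \<open>\<tau>\<close> are equivalent, so one element chosen for each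
  value of \<open>\<tau>\<close> represents every class.\<close>

lemma finite_equiv_in_classes:
  assumes A: "A \<subseteq> carrier F" and fin: "finite (\<tau> ` A)"
    and eq: "\<And>y y'. y \<in> A \<Longrightarrow> y' \<in> A \<Longrightarrow> \<tau> y = \<tau> y' \<Longrightarrow> (y, y') \<in> equiv_in F K"
  shows "finite (A // equiv_in F K)"
proof -
  let ?g = "\<lambda>t. equiv_in F K `` {SOME y. y \<in> A \<and> \<tau> y = t}"
  have "A // equiv_in F K \<subseteq> ?g ` \<tau> ` A"
  proof
    fix C assume "C \<in> A // equiv_in F K"
    then obtain y where y: "y \<in> A" "C = equiv_in F K `` {y}" by (rule quotientE)
    define y' where "y' = (SOME z. z \<in> A \<and> \<tau> z = \<tau> y)"
    have y': "y' \<in> A \<and> \<tau> y' = \<tau> y" unfolding y'_def by (rule someI[of _ y]) (use y in simp)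
    then have "(y, y') \<in> equiv_in F K" using eq y(1) by metis
    then have "C = equiv_in F K `` {y'}" unfolding y(2) equiv_in_def by auto
    then show "C \<in> ?g ` \<tau> ` A" using y(1) unfolding y'_def by blast
  qed
  then show ?thesis using fin finite_subset by blast
qed

text \<open>The factorial monoid is transported along the injection \<open>\<iota>\<close> to the type required by the
definition of a C-monoid.\<close>

lemma c_monoid_from_valuations:
  fixes w :: "'i \<Rightarrow> 'g \<Rightarrow> int" and \<iota> :: "'g \<Rightarrow> ('b \<times> 'b) set" and M :: "('b, 'm) monoid_scheme"
  assumes G: "comm_group G"
    and w: "\<And>i x y. i \<in> V \<Longrightarrow> x \<in> carrier G \<Longrightarrow> y \<in> carrier G \<Longrightarrow> w i (x \<otimes>\<^bsub>G\<^esub> y) = w i x + w i y"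
    and fin: "\<And>x. x \<in> carrier G \<Longrightarrow> finite {i \<in> V. w i x \<noteq> 0}"
    and c: "\<And>i. i \<in> V \<Longrightarrow> c i \<in> carrier G" "\<And>i j. i \<in> V \<Longrightarrow> j \<in> V \<Longrightarrow> w j (c i) = (if i = j then 1 else 0)"
    and F: "F = {x \<in> carrier G. \<forall>i\<in>V. 0 \<le> w i x}"
    and K: "submonoid K G" "K \<subseteq> F"
    and K_units: "\<And>x. x \<in> K \<Longrightarrow> (\<forall>i\<in>V. w i x = 0) \<Longrightarrow> inv\<^bsub>G\<^esub> x \<in> K"
    and mon: "monoid M" and M: "h \<in> iso M (G\<lparr>carrier := K\<rparr>)"
    and \<iota>: "inj_on \<iota> F"
    and \<tau>: "finite (\<tau> ` F)"
      "\<And>y y' x. y \<in> F \<Longrightarrow> y' \<in> F \<Longrightarrow> x \<in> F \<Longrightarrow> \<tau> y = \<tau> y' \<Longrightarrow> x \<otimes>\<^bsub>G\<^esub> y \<in> K \<Longrightarrow> x \<otimes>\<^bsub>G\<^esub> y' \<in> K"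
  shows "c_monoid M"
proof -
  interpret G: comm_group G by fact
  interpret K: submonoid K G by fact
  have w1: "w i \<one>\<^bsub>G\<^esub> = 0" if "i \<in> V" for i using w[OF that, of "\<one>\<^bsub>G\<^esub>" "\<one>\<^bsub>G\<^esub>"] by simp
  have winv: "w i (inv\<^bsub>G\<^esub> x) = - w i x" if "i \<in> V" "x \<in> carrier G" for i x
    using w[OF that(1), of x "inv\<^bsub>G\<^esub> x"] w1[OF that(1)] that(2) by simp
  have FG: "x \<in> carrier G" if "x \<in> F" for x using that F by blast
  have F_one: "\<one>\<^bsub>G\<^esub> \<in> F" using w1 by (simp add: F)
  have F_mult: "x \<otimes>\<^bsub>G\<^esub> y \<in> F" if "x \<in> F" "y \<in> F" for x y using that w by (auto simp: F)
  define \<kappa> where "\<kappa> = inv_into F \<iota>"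
  have \<kappa>\<iota>: "\<kappa> (\<iota> x) = x" if "x \<in> F" for x unfolding \<kappa>_def using inv_into_f_f[OF \<iota> that] .
  define F' where "F' = \<lparr>carrier = \<iota> ` F, monoid.mult = (\<lambda>a b. \<iota> (\<kappa> a \<otimes>\<^bsub>G\<^esub> \<kappa> b)), one = \<iota> \<one>\<^bsub>G\<^esub>\<rparr>"
  have F': "carrier F' = \<iota> ` F" "\<one>\<^bsub>F'\<^esub> = \<iota> \<one>\<^bsub>G\<^esub>" "a \<otimes>\<^bsub>F'\<^esub> b = \<iota> (\<kappa> a \<otimes>\<^bsub>G\<^esub> \<kappa> b)" for a b by (simp_all add: F'_def)
  have mult: "\<iota> x \<otimes>\<^bsub>F'\<^esub> \<iota> y = \<iota> (x \<otimes>\<^bsub>G\<^esub> y)" if "x \<in> F" "y \<in> F" for x y using that by (simp add: F'(3) \<kappa>\<iota>)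
  have \<iota>_eq: "\<iota> x = \<iota> y \<longleftrightarrow> x = y" if "x \<in> F" "y \<in> F" for x y using \<iota> that by (simp add: inj_on_eq_iff)
  have canc: "comm_monoid_cancel F'"
  proof (rule comm_monoid_cancelI)
    show "comm_monoid F'"
    proof (rule comm_monoidI)
      fix a b assume "a \<in> carrier F'" "b \<in> carrier F'"
      then obtain x y where xy: "x \<in> F" "y \<in> F" "a = \<iota> x" "b = \<iota> y" unfolding F'(1) by blast
      show "a \<otimes>\<^bsub>F'\<^esub> b \<in> carrier F'" unfolding xy mult[OF xy(1,2)] unfolding F'(1) using F_mult xy by blast
      show "a \<otimes>\<^bsub>F'\<^esub> b = b \<otimes>\<^bsub>F'\<^esub> a"
        unfolding xy mult[OF xy(1,2)] mult[OF xy(2,1)] using G.m_comm[OF FG[OF xy(1)] FG[OF xy(2)]] by simp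
      fix d assume "d \<in> carrier F'"
      then obtain z where z: "z \<in> F" "d = \<iota> z" unfolding F'(1) by blast
      show "a \<otimes>\<^bsub>F'\<^esub> b \<otimes>\<^bsub>F'\<^esub> d = a \<otimes>\<^bsub>F'\<^esub> (b \<otimes>\<^bsub>F'\<^esub> d)"
        unfolding xy z(2) using xy(1,2) z(1) FG by (simp add: mult F_mult G.m_assoc)
    next
      show "\<one>\<^bsub>F'\<^esub> \<in> carrier F'" unfolding F' using F_one by blast
      fix a assume "a \<in> carrier F'"
      then obtain x where "x \<in> F" "a = \<iota> x" unfolding F'(1) by blast
      then show "\<one>\<^bsub>F'\<^esub> \<otimes>\<^bsub>F'\<^esub> a = a" unfolding F'(2) using F_one FG by (simp add: mult)
    qed
    fix a b d assume abd: "a \<otimes>\<^bsub>F'\<^esub> d = b \<otimes>\<^bsub>F'\<^esub> d" "a \<in> carrier F'" "b \<in> carrier F'" "d \<in> carrier F'"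
    then obtain x y z where xyz: "x \<in> F" "y \<in> F" "z \<in> F" "a = \<iota> x" "b = \<iota> y" "d = \<iota> z" unfolding F'(1) by blast
    then have "x \<otimes>\<^bsub>G\<^esub> z = y \<otimes>\<^bsub>G\<^esub> z" using abd(1) by (simp add: mult \<iota>_eq F_mult)
    then show "a = b" using xyz FG by simp
  qed
  interpret F': comm_monoid_cancel F' by (rule canc)
  let ?w = "\<lambda>i a. nat (w i (\<kappa> a))"
  have cF: "c i \<in> F" if "i \<in> V" for i using c that by (simp add: F)
  note wF = F[THEN equalityD1, THEN subsetD]
  have fact: "factorial_monoid F'" and unitsF': "\<And>a. a \<in> carrier F' \<Longrightarrow> a \<in> Units F' \<longleftrightarrow> (\<forall>i\<in>V. ?w i a = 0)"
  proof -
    have 1: "?w i (a \<otimes>\<^bsub>F'\<^esub> b) = ?w i a + ?w i b" if "i \<in> V" "a \<in> carrier F'" "b \<in> carrier F'" for i a b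
    proof -
      obtain x y where xy: "x \<in> F" "y \<in> F" "a = \<iota> x" "b = \<iota> y" using \<open>a \<in> carrier F'\<close> \<open>b \<in> carrier F'\<close> unfolding F'(1) by blast
      then have "0 \<le> w i x" "0 \<le> w i y" using \<open>i \<in> V\<close> by (auto simp: F)
      then show ?thesis unfolding xy(3,4) using xy(1,2) FG \<open>i \<in> V\<close> by (simp add: mult \<kappa>\<iota> F_mult w nat_add_distrib)
    qed
    have 2: "finite {i \<in> V. ?w i a \<noteq> 0}" if "a \<in> carrier F'" for a
    proof -
      obtain x where x: "x \<in> F" "a = \<iota> x" using \<open>a \<in> carrier F'\<close> unfolding F'(1) by blast
      then have "{i \<in> V. ?w i a \<noteq> 0} \<subseteq> {i \<in> V. w i x \<noteq> 0}" by (auto simp: \<kappa>\<iota>)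
      then show ?thesis using fin[OF FG[OF x(1)]] finite_subset by blast
    qed
    have 3: "a divides\<^bsub>F'\<^esub> b" if ab: "a \<in> carrier F'" "b \<in> carrier F'" "\<And>i. i \<in> V \<Longrightarrow> ?w i a \<le> ?w i b" for a b
    proof -
      obtain x y where xy: "x \<in> F" "y \<in> F" "a = \<iota> x" "b = \<iota> y" using ab(1,2) unfolding F'(1) by blast
      have "w i x \<le> w i y" if "i \<in> V" for i
        using ab(3)[OF that] xy that by (auto simp: \<kappa>\<iota> F nat_le_eq_zle)
      then have d: "inv\<^bsub>G\<^esub> x \<otimes>\<^bsub>G\<^esub> y \<in> F"
        using FG[OF xy(1)] FG[OF xy(2)] by (simp add: F w winv)
      have "x \<otimes>\<^bsub>G\<^esub> (inv\<^bsub>G\<^esub> x \<otimes>\<^bsub>G\<^esub> y) = y" using FG[OF xy(1)] FG[OF xy(2)] by (simp add: G.cancel_simps)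
      then have "\<iota> y = \<iota> x \<otimes>\<^bsub>F'\<^esub> \<iota> (inv\<^bsub>G\<^esub> x \<otimes>\<^bsub>G\<^esub> y)" using mult[OF xy(1) d] by simp
      then show ?thesis unfolding factor_def xy(3,4) F'(1) using d by blast
    qed
    have 4: "\<iota> (c i) \<in> carrier F'" if "i \<in> V" for i using cF[OF that] unfolding F'(1) by blast
    have 5: "?w j (\<iota> (c i)) = (if i = j then 1 else 0)" if "i \<in> V" "j \<in> V" for i j
      using cF[OF that(1)] c(2)[OF that] by (simp add: \<kappa>\<iota>)
    show "factorial_monoid F'" by (rule factorial_from_valuations(1)[OF canc, of V ?w "\<lambda>i. \<iota> (c i)"]) (fact 1 2 3 4 5)+
    show "a \<in> Units F' \<longleftrightarrow> (\<forall>i\<in>V. ?w i a = 0)" if "a \<in> carrier F'" for a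
      by (rule factorial_from_valuations(2)[OF canc, of V ?w "\<lambda>i. \<iota> (c i)"]) (fact 1 2 3 4 5 that)+
  qed
  let ?K = "\<iota> ` K"
  have KF: "x \<in> F" if "x \<in> K" for x using that K(2) by blast
  have sub: "submonoid ?K F'"
  proof
    show "?K \<subseteq> carrier F'" unfolding F'(1) using K(2) by blast
    show "\<one>\<^bsub>F'\<^esub> \<in> ?K" unfolding F'(2) by simp
    show "a \<otimes>\<^bsub>F'\<^esub> b \<in> ?K" if "a \<in> ?K" "b \<in> ?K" for a b using that by (auto simp: mult KF)
  qed
  have units: "?K \<inter> Units F' = Units (F'\<lparr>carrier := ?K\<rparr>)"
  proof (intro equalityI subsetI)
    fix a assume a: "a \<in> ?K \<inter> Units F'"
    then obtain x where x: "x \<in> K" "a = \<iota> x" by blast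
    have "a \<in> carrier F'" using a sub submonoid.subset by blast
    \<comment> \<open>Values on \<open>F\<close> are non-negative, so a vanishing \<open>nat\<close>
      means a vanishing value, and then the hypothesis on units of \<open>K\<close> gives the
      inverse.\<close>
    then have "nat (w i x) = 0" if "i \<in> V" for i
      using unitsF'[of a] a that \<kappa>\<iota>[OF KF[OF x(1)]] x(2) by simp
    then have "\<forall>i\<in>V. w i x = 0" using KF[OF x(1)] by (fastforce simp: F)
    then have i: "inv\<^bsub>G\<^esub> x \<in> K" by (rule K_units[OF x(1)])
    have "\<iota> (inv\<^bsub>G\<^esub> x) \<otimes>\<^bsub>F'\<^esub> a = \<one>\<^bsub>F'\<^esub>" "a \<otimes>\<^bsub>F'\<^esub> \<iota> (inv\<^bsub>G\<^esub> x) = \<one>\<^bsub>F'\<^esub>"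
      unfolding x(2) F'(2) using FG[OF KF[OF x(1)]] by (simp_all add: mult KF i x(1))
    then show "a \<in> Units (F'\<lparr>carrier := ?K\<rparr>)" unfolding Units_def using i x by auto
  next
    fix a assume "a \<in> Units (F'\<lparr>carrier := ?K\<rparr>)"
    then show "a \<in> ?K \<inter> Units F'" using submonoid.subset[OF sub] unfolding Units_def by auto
  qed
  have iso: "F'\<lparr>carrier := ?K\<rparr> \<cong> M"
  proof -
    have h: "h \<in> hom M (G\<lparr>carrier := K\<rparr>)" "bij_betw h (carrier M) K" using M by (auto simp: iso_def)
    have hK: "h m \<in> K" if "m \<in> carrier M" for m using h(2) that by (auto simp: bij_betw_def)
    have "bij_betw (\<lambda>m. \<iota> (h m)) (carrier M) ?K"
      using bij_betw_trans[OF h(2), of \<iota> ?K] inj_on_subset[OF \<iota> K(2)] by (simp add: bij_betw_def o_def)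
    moreover have "(\<lambda>m. \<iota> (h m)) \<in> hom M (F'\<lparr>carrier := ?K\<rparr>)"
      using h(1) hK by (auto simp: hom_def mult KF)
    ultimately have "(\<lambda>m. \<iota> (h m)) \<in> iso M (F'\<lparr>carrier := ?K\<rparr>)" by (simp add: iso_def)
    then show ?thesis using iso_inv_into[OF mon] is_isoI by blast
  qed
  have "finite ((carrier F' - Units F' \<union> {\<one>\<^bsub>F'\<^esub>}) // equiv_in F' ?K)"
  proof (rule finite_equiv_in_classes[where \<tau> = "\<tau> \<circ> \<kappa>"])
    have sub: "carrier F' - Units F' \<union> {\<one>\<^bsub>F'\<^esub>} \<subseteq> \<iota> ` F" using F'.one_closed unfolding F'(1) by blast
    then show "carrier F' - Units F' \<union> {\<one>\<^bsub>F'\<^esub>} \<subseteq> carrier F'" unfolding F'(1) .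
    have "(\<tau> \<circ> \<kappa>) ` (carrier F' - Units F' \<union> {\<one>\<^bsub>F'\<^esub>}) \<subseteq> \<tau> ` F"
    proof (rule image_subsetI)
      fix a assume "a \<in> carrier F' - Units F' \<union> {\<one>\<^bsub>F'\<^esub>}"
      then obtain x where "x \<in> F" "a = \<iota> x" using sub by blast
      then show "(\<tau> \<circ> \<kappa>) a \<in> \<tau> ` F" by (simp add: \<kappa>\<iota>)
    qed
    then show "finite ((\<tau> \<circ> \<kappa>) ` (carrier F' - Units F' \<union> {\<one>\<^bsub>F'\<^esub>}))" using \<tau>(1) finite_subset by blast
    fix a b assume ab: "a \<in> carrier F' - Units F' \<union> {\<one>\<^bsub>F'\<^esub>}" "b \<in> carrier F' - Units F' \<union> {\<one>\<^bsub>F'\<^esub>}"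
      and e: "(\<tau> \<circ> \<kappa>) a = (\<tau> \<circ> \<kappa>) b"
    obtain y where y1: "y \<in> F" "a = \<iota> y" using subsetD[OF sub ab(1)] by blast
    obtain y' where y2: "y' \<in> F" "b = \<iota> y'" using subsetD[OF sub ab(2)] by blast
    note y = y1(1) y2(1) y1(2) y2(2)
    have e': "\<tau> y = \<tau> y'" using e y by (simp add: \<kappa>\<iota>)
    have memK: "\<iota> z \<in> ?K \<longleftrightarrow> z \<in> K" if "z \<in> F" for z
      using that \<iota> K(2) by (auto simp: inj_on_eq_iff)
    have "d \<otimes>\<^bsub>F'\<^esub> a \<in> ?K \<longleftrightarrow> d \<otimes>\<^bsub>F'\<^esub> b \<in> ?K" if "d \<in> carrier F'" for d
    proof -
      obtain x where x: "x \<in> F" "d = \<iota> x" using \<open>d \<in> carrier F'\<close> unfolding F'(1) by blast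
      show ?thesis
        unfolding x(2) y(3,4) mult[OF x(1) y(1)] mult[OF x(1) y(2)] memK[OF F_mult[OF x(1) y(1)]]
          memK[OF F_mult[OF x(1) y(2)]]
        using \<tau>(2)[OF y(1,2) x(1) e'] \<tau>(2)[OF y(2,1) x(1) e'[symmetric]] by blast
    qed
    moreover have "a \<in> carrier F'" "b \<in> carrier F'" using y unfolding F'(1) by blast+
    ultimately show "(a, b) \<in> equiv_in F' ?K" unfolding equiv_in_def by blast
  qed
  with fact sub iso units show ?thesis unfolding c_monoid_def by blast
qed

section \<open>Seminormal weakly Krull monoids with non-trivial conductor\<close>

locale seminormal_weakly_krull = mori_weakly_krull +
  assumes semi: "seminormal Q H"
    and cond: "colon Q H (complete_int_closure Q H) \<noteq> {}" "colon Q H (complete_int_closure Q H) \<subset> H"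
begin

abbreviation "K \<equiv> complete_int_closure Q H"
abbreviation "cf \<equiv> colon Q H K"
abbreviation "KL p \<equiv> localize Q H p K"

lemma K_krull: "krull Q K"
proof -
  interpret K: quotient_group_of Q K by (rule hat_quotient)
  show ?thesis by (rule K.cic_krull[OF v_noetherian_hat[OF v_noeth cond(1)] hat_hat[OF cond(1)]])
qed

end

text \<open>The complete integral closure meets the same hypotheses, so the theory of divisorial
  ideals and divisors is available for it as well, under the prefix \<open>K\<close>.\<close>

sublocale seminormal_weakly_krull \<subseteq> K: mori_weakly_krull Q "complete_int_closure Q H"
  by (intro mori_weakly_krull.intro hat_quotient mori_weakly_krull_axioms.intro
      v_noetherian_hat[OF v_noeth cond(1)] hat_proper[OF cond])
    (use K_krull krull_def in blast)

context seminormal_weakly_krull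
begin

definition val :: "'a set \<Rightarrow> 'a \<Rightarrow> int" where "val P = (SOME v. discrete_val (K.L P) v)"

lemma val: "P \<in> K.X \<Longrightarrow> discrete_val (K.L P) (val P)"
  unfolding val_def
  using K.cic_discrete_val[OF v_noetherian_hat[OF v_noeth cond(1)] hat_hat[OF cond(1)], of P]
  by (rule someI_ex)

lemmas valD = discrete_valD[OF val]

lemma KX_prime: "P \<in> K.X \<Longrightarrow> prime_s_ideal Q K P"
  by (rule K.prime)

lemma K_carrier: "x \<in> K \<Longrightarrow> x \<in> carrier Q"
  using hat_carrier by blast

lemma mem_K_iff: "x \<in> K \<longleftrightarrow> x \<in> carrier Q \<and> (\<forall>P\<in>K.X. 0 \<le> val P x)"
  unfolding K.mem_H_iff[of x] by (intro conj_cong refl ball_cong) (simp add: valD(2))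

lemma KU_iff: "P \<in> K.X \<Longrightarrow> x \<in> K.U P \<longleftrightarrow> x \<in> carrier Q \<and> val P x = 0"
  using discrete_val_Units[OF val] by blast

lemma val_pos_iff: "P \<in> K.X \<Longrightarrow> x \<in> K \<Longrightarrow> x \<in> P \<longleftrightarrow> 0 < val P x"
  using K.U_H[OF KX_prime, of P x] KU_iff[of P x] mem_K_iff[of x] by force

lemma val_finite: "x \<in> carrier Q \<Longrightarrow> finite {P \<in> K.X. val P x \<noteq> 0}"
proof -
  assume x: "x \<in> carrier Q"
  have "{P \<in> K.X. val P x \<noteq> 0} = {P \<in> K.X. x \<notin> K.U P}"
    by (intro Collect_cong conj_cong refl) (simp add: KU_iff x)
  then show ?thesis using K.finite_nonunit[OF x] by simp
qed

lemma KL_submonoid: "p \<in> X \<Longrightarrow> submonoid (KL p) Q"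
  by (rule localize_submonoid[OF prime hat_submonoid])

lemma KL_hat: "p \<in> X \<Longrightarrow> KL p = complete_int_closure Q (L p)"
  by (rule hat_L[OF v_noeth semi])

lemma L_sub_KL: "L p \<subseteq> KL p"
  by (rule localize_mono[OF H_sub_hat])

lemma KL_eq_L:
  assumes p: "p \<in> X" "\<not> cf \<subseteq> p" shows "KL p = L p"
proof
  show "KL p \<subseteq> L p"
  proof
    fix x assume "x \<in> KL p"
    then obtain t where t: "t \<in> H - p" "t \<otimes> x \<in> K" "x \<in> carrier Q" using localizeE[OF _ hat_carrier] by blast
    have "t \<otimes> x \<in> L p" using hat_sub_L[OF prime[OF p(1)] p(2)] t(2) by blast
    then show "x \<in> L p" using U_mult_iff(2)[OF prime[OF p(1)] _ t(3), of t] U_H[OF prime[OF p(1)]] t(1) by blast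
  qed
qed (rule L_sub_KL)

text \<open>One element \<open>d\<close> of the conductor is a denominator for all powers of
  \<open>x\<close>. At primes containing \<open>d\<close> it is a non-unit and absorbs the closure
  by \<open>nonunit_hat\<close>; the other primes do not contain the conductor, and there the
  closure adds nothing to \<open>L p\<close>.\<close>

lemma K_inter:
  assumes x: "x \<in> carrier Q" "\<And>p. p \<in> X \<Longrightarrow> x \<in> KL p" shows "x \<in> K"
proof -
  obtain d where d: "d \<in> cf" using cond(1) by blast
  have dH: "d \<in> H" using d cond_sub_H by blast
  have "d \<otimes> x [^] n \<in> H" for n :: nat
  proof -
    have "d \<otimes> x [^] n \<in> L p" if p: "p \<in> X" for p
    proof -
      have "x [^] n \<in> KL p"
      proof (induction n)
        case (Suc n)
        then show ?case using submonoid.m_closed[OF KL_submonoid[OF p] Suc.IH x(2)[OF p]] by simp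
      qed (use submonoid.one_closed[OF KL_submonoid[OF p]] in simp)
      show ?thesis
      proof (cases "d \<in> p")
        case True
        then have "d \<in> L p" "d \<notin> U p" using H_sub_L[OF prime[OF p]] U_H[OF prime[OF p] dH] dH by blast+
        then show ?thesis using nonunit_hat(1)[OF semi p] \<open>x [^] n \<in> KL p\<close> KL_hat[OF p] by simp
      next
        case False
        then have "KL p = L p" using d p by (intro KL_eq_L) blast+
        moreover have "d \<in> L p" using H_sub_L[OF prime[OF p]] dH by blast
        ultimately show ?thesis using L_mult[OF prime[OF p], of d "x [^] n"] \<open>x [^] n \<in> KL p\<close> by simp
      qed
    qed
    then show ?thesis using mem_H_iff x(1) dH by simp
  qed
  then show ?thesis using dH x(1) unfolding hat_iff by blast
qed

section \<open>Primes of the complete integral closure above a minimal prime\<close>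

definition over :: "'a set \<Rightarrow> 'a set set" where "over p = {P \<in> K.X. P \<inter> H = p}"

lemma overD: "P \<in> over p \<Longrightarrow> P \<in> K.X" "P \<in> over p \<Longrightarrow> P \<inter> H = p"
  by (simp_all add: over_def)

text \<open>The conductor makes the contraction non-empty. If no minimal prime \<open>p\<close> of
  \<open>H\<close> contained it, then at each \<open>p\<close> some element of \<open>P\<close>
  outside \<open>p\<close> would be a denominator for the \<open>z\<close> that defines
  \<open>P\<close>, and \<open>K_inter\<close> would put \<open>z\<close> into
  \<open>K\<close>.\<close>

lemma contraction:
  assumes P: "P \<in> K.X" shows "P \<inter> H \<in> X"
proof -
  note PD = K.primeD[OF KX_prime[OF P]]
  have HK: "h \<in> K" if "h \<in> H" for h using that H_sub_hat by blast
  have pr: "prime_s_ideal Q H (P \<inter> H)"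
    unfolding prime_s_ideal_iff
  proof (intro conjI ballI impI)
    fix a b assume ab: "a \<in> H" "b \<in> H" "a \<otimes> b \<in> P \<inter> H"
    then show "a \<in> P \<inter> H \<or> b \<in> P \<inter> H" using PD(5)[OF HK HK, of a b] by blast
  next
    show "a \<otimes> h \<in> P \<inter> H" if "a \<in> P \<inter> H" "h \<in> H" for a h
      using that PD(3)[of a h] HK[of h] by blast
  qed (use PD(2) in auto)
  obtain b d where bd: "b \<in> P" "d \<in> cf" using cond(1) min_primeD(2) K.min_primeD(2)[OF P] by blast
  have "d \<otimes> b \<in> P \<inter> H"
    using PD(4)[OF bd(1), of d] cond_mult(2)[OF bd(2), of b] PD(1) bd cond_sub_H H_sub_hat by blast
  then have ne: "P \<inter> H \<noteq> {}" by blast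
  obtain z where z: "z \<in> carrier Q" "z \<notin> K.L P" "P = {x \<in> K. x \<otimes> z \<in> K}"
    using K.min_prime_conductor[OF K.v_noeth P] .
  have "\<exists>p\<in>X. P \<inter> H \<subseteq> p"
  proof (rule ccontr)
    assume no: "\<not> ?thesis"
    have "z \<in> KL p" if p: "p \<in> X" for p
    proof -
      obtain t where t: "t \<in> P" "t \<in> H" "t \<notin> p" using no p by blast
      then have "t \<otimes> z \<in> K" using z(3) by blast
      then show ?thesis using t z(1) hat_carrier by (intro localizeI[of t]) auto
    qed
    then have "z \<in> K" using K_inter z(1) by blast
    then show False using z(2) K.H_sub_L[OF KX_prime[OF P]] by blast
  qed
  then show ?thesis using min_primeD(3)[OF _ pr ne] by blast
qed

lemma over_contraction: "P \<in> K.X \<Longrightarrow> P \<in> over (P \<inter> H)"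
  by (simp add: over_def)

lemma finite_over: assumes p: "p \<in> X" shows "finite (over p)"
proof -
  obtain d where d: "d \<in> p" using min_primeD(2)[OF p] by blast
  have "d \<in> K" using d primeD(1)[OF prime[OF p]] H_sub_hat by blast
  moreover have "over p \<subseteq> {P \<in> K.X. d \<in> P}" using d by (auto simp: over_def)
  ultimately show ?thesis using K.finite_mem finite_subset by blast
qed

lemma val_unit_over:
  assumes "P \<in> over p" "t \<in> H - p" shows "val P t = 0"
proof -
  have "t \<in> K" "t \<notin> P" using assms H_sub_hat overD(2)[OF assms(1)] by blast+
  then show ?thesis using val_pos_iff[OF overD(1)[OF assms(1)]] mem_K_iff[of t] overD(1)[OF assms(1)] by force
qed

text \<open>Elements of \<open>H\<close> outside \<open>p\<close> have value 0 above
  \<open>p\<close>, which gives one direction. For the other, only finitely many values of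
  \<open>x\<close> are negative, all at primes whose contraction differs from \<open>p\<close>;
  powers of elements of these contractions outside \<open>p\<close> compensate them.\<close>

lemma KL_iff:
  assumes p: "p \<in> X" shows "x \<in> KL p \<longleftrightarrow> x \<in> carrier Q \<and> (\<forall>P\<in>over p. 0 \<le> val P x)"
proof (intro iffI conjI ballI)
  fix P assume x: "x \<in> KL p" and P: "P \<in> over p"
  then obtain t where t: "t \<in> H - p" "t \<otimes> x \<in> K" "x \<in> carrier Q" using localizeE[OF _ hat_carrier] by blast
  have "0 \<le> val P (t \<otimes> x)" using t(2) mem_K_iff overD(1)[OF P] by blast
  then show "0 \<le> val P x" using valD(1)[OF overD(1)[OF P], of t x] t val_unit_over[OF P t(1)] by auto
next
  show "x \<in> carrier Q" if "x \<in> KL p" using that localize_subset_carrier[OF hat_carrier] by blast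
next
  assume "x \<in> carrier Q \<and> (\<forall>P\<in>over p. 0 \<le> val P x)"
  then have x: "x \<in> carrier Q" "\<And>P. P \<in> over p \<Longrightarrow> 0 \<le> val P x" by blast+
  define T where "T = {P \<in> K.X. val P x < 0}"
  have finT: "finite T" by (rule finite_subset[OF _ val_finite[OF x(1)]]) (auto simp: T_def)
  have "\<exists>t. t \<in> H \<and> t \<notin> p \<and> 0 \<le> val P (t \<otimes> x)" if P: "P \<in> T" for P
  proof -
    have PX: "P \<in> K.X" "P \<inter> H \<noteq> p" using P x(2)[of P] by (auto simp: T_def over_def)
    obtain t where t: "t \<in> H - p" "t \<in> P \<inter> H"
      using prime_avoid[OF p, of "{P \<inter> H}"] contraction[OF PX(1)] PX(2) by auto
    obtain N where "t [^] (N::nat) \<otimes> x \<in> K.L P"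
      using K.min_prime_pow_mult[OF PX(1) _ x(1), of t] t(2) by blast
    then have "0 \<le> val P (t [^] N \<otimes> x)" using valD(2)[OF PX(1)] by blast
    moreover have "t [^] N \<in> H - p" by (rule prime_compl(3)[OF prime[OF p] t(1)])
    ultimately show ?thesis by blast
  qed
  then obtain t where t: "\<And>P. P \<in> T \<Longrightarrow> t P \<in> H \<and> t P \<notin> p \<and> 0 \<le> val P (t P \<otimes> x)" by metis
  define d where "d = finprod Q t T"
  have dH: "d \<in> H - p" unfolding d_def by (rule prime_finprod_compl[OF prime[OF p]]) (use t in blast)
  have tQ: "t P \<in> carrier Q" if "P \<in> T" for P using t[OF that] by blast
  have "0 \<le> val P (d \<otimes> x)" if P: "P \<in> K.X" for P
  proof (cases "P \<in> T")
    case True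
    have nn: "0 \<le> val P (t P')" if "P' \<in> T" for P'
      using t[OF that] mem_K_iff P H_sub_hat by blast
    have "val P d = (\<Sum>P'\<in>T. val P (t P'))" unfolding d_def by (rule valD(7)[OF P tQ])
    also have "\<dots> = val P (t P) + (\<Sum>P'\<in>T - {P}. val P (t P'))" by (rule sum.remove[OF finT True])
    also have "\<dots> \<ge> val P (t P)"       using nn sum_nonneg[of "T - {P}" "\<lambda>P'. val P (t P')"] by auto
    finally have "val P (t P) \<le> val P d" .
    then show ?thesis using t[OF True] valD(1)[OF P _ x(1), of "t P"] valD(1)[OF P _ x(1), of d] tQ[OF True] dH by auto
  next
    case False
    have "0 \<le> val P d" using dH mem_K_iff P H_sub_hat by blast
    then show ?thesis using False P valD(1)[OF P _ x(1), of d] dH by (auto simp: T_def)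
  qed
  then have "d \<otimes> x \<in> K" using mem_K_iff x(1) dH by blast
  then show "x \<in> KL p" using dH x(1) hat_carrier by (intro localizeI) auto
qed

lemma KL_Units:
  assumes p: "p \<in> X" shows "Units (Q\<lparr>carrier := KL p\<rparr>) = {x \<in> carrier Q. \<forall>P\<in>over p. val P x = 0}"
proof -
  have "x \<in> KL p \<and> inv x \<in> KL p \<longleftrightarrow> (\<forall>P\<in>over p. val P x = 0)" if x: "x \<in> carrier Q" for x
  proof -
    have "val P (inv x) = - val P x" if "P \<in> over p" for P using valD(4)[OF overD(1)[OF that] x] .
    then show ?thesis using x by (auto simp: KL_iff[OF p] intro: order_antisym)
  qed
  then show ?thesis unfolding Units_submonoid[OF KL_submonoid[OF p]] using KL_iff[OF p] by auto
qed

lemma U_val: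
  assumes p: "p \<in> X" and x: "x \<in> U p" shows "P \<in> over p \<Longrightarrow> val P x = 0"
proof -
  have "x \<in> Units (Q\<lparr>carrier := KL p\<rparr>)"
    using x L_sub_KL U_iff[OF prime[OF p]] unfolding Units_submonoid[OF KL_submonoid[OF p]] by blast
  then show "P \<in> over p \<Longrightarrow> val P x = 0" unfolding KL_Units[OF p] by blast
qed

text \<open>A factor outside \<open>p\<close> moves \<open>x\<close> into \<open>p\<close>, which is
  contained in every prime above it, and does not change the values there.\<close>

lemma L_nonunit_val:
  assumes p: "p \<in> X" and x: "x \<in> L p" "x \<notin> U p" and P: "P \<in> over p" shows "0 < val P x"
proof -
  obtain t where t: "t \<in> H - p" "t \<otimes> x \<in> p" using L_nonunitE[OF prime[OF p] x] .
  have "t \<otimes> x \<in> P" using t(2) overD(2)[OF P] by blast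
  then have "0 < val P (t \<otimes> x)"
    using val_pos_iff[OF overD(1)[OF P]] K.primeD(1)[OF KX_prime[OF overD(1)[OF P]]] by blast
  then show ?thesis using valD(1)[OF overD(1)[OF P], of t x] t val_unit_over[OF P t(1)] L_carrier[OF x(1)] by auto
qed

text \<open>For large \<open>n\<close> the values of \<open>x^n\<close> reach those of a fixed
  non-unit \<open>d\<close> at all primes above \<open>p\<close>. Then \<open>x^n/d\<close> is in
  the closure of \<open>L p\<close> and \<open>x^n\<close> is a non-unit of \<open>L p\<close>;
  seminormality descends from large powers to \<open>x\<close>.\<close>

lemma L_pos_val:
  assumes p: "p \<in> X" and x: "x \<in> carrier Q" "\<And>P. P \<in> over p \<Longrightarrow> 0 < val P x"
  shows "x \<in> L p" "x \<notin> U p"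
proof -
  note Pp = prime[OF p]
  interpret D: quotient_group_of Q "L p" using L_quotient[OF Pp] .
  obtain d where d: "d \<in> p" "d \<in> H" "d \<in> L p" "d \<notin> U p" using L_nonunit_exists[OF p] .
  \<comment> \<open>The sum bounds each of the finitely many values of \<open>d\<close>, and every
    value of \<open>x\<close> is at least 1.\<close>
  define N where "N = (\<Sum>P\<in>over p. nat (val P d))"
  have *: "x [^] n \<in> L p \<and> x [^] n \<notin> U p" if n: "n \<ge> N" for n
  proof -
    have "x [^] n \<otimes> inv d \<in> KL p"
      unfolding KL_iff[OF p]
    proof (intro conjI ballI)
      fix P assume P: "P \<in> over p"
      have "nat (val P d) \<le> N" unfolding N_def by (rule member_le_sum) (use P finite_over[OF p] in auto)
      then have "val P d \<le> int n" using n by linarith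
      also have "int n \<le> int n * val P x" using x(2)[OF P] by (simp add: mult_le_cancel_left1)
      finally show "0 \<le> val P (x [^] n \<otimes> inv d)" using x(1) d(2) by (simp add: valD(1,4,5)[OF overD(1)[OF P]])
    qed (use x d in simp)
    then have "x [^] n \<otimes> inv d \<in> complete_int_closure Q (L p)" using KL_hat[OF p] by simp
    from nonunit_hat[OF semi p d(3,4) this] show ?thesis using x(1) d(2) by (simp add: cancel_simps)
  qed
  show "x \<in> L p" by (rule D.seminormal_pow[OF seminormal_L[OF semi Pp] x(1)]) (use * in blast)
  show "x \<notin> U p"
  proof
    assume u: "x \<in> U p"
    have "x [^] n \<in> U p" for n :: nat
    proof (induction n)
      case (Suc n)
      then show ?case using U_mult[OF Pp Suc.IH u] by simp
    qed (simp add: Pp)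
    then show False using * by blast
  qed
qed

text \<open>Without primes above \<open>p\<close> the positivity condition of
  \<open>L_pos_val\<close> would hold vacuously for 1 and make it a non-unit.\<close>

lemma over_nonempty: "p \<in> X \<Longrightarrow> over p \<noteq> {}"
  using L_pos_val(2)[of p \<one>] U_one[OF prime] by fastforce

section \<open>Finitely primary localizations and independent values\<close>

text \<open>In other words, the values at the primes above \<open>p\<close> map \<open>Q\<close>
  onto all integer vectors. This is the working form of finite primariness; the next results show
  that both agree here.\<close>

definition independent :: "'a set \<Rightarrow> bool" where
  "independent p \<longleftrightarrow> (\<forall>P\<in>over p. \<exists>c\<in>carrier Q. val P c = 1 \<and> (\<forall>P'\<in>over p. P' \<noteq> P \<longrightarrow> val P' c = 0))"

text \<open>The factorial overmonoid is \<open>KL p\<close>, with the elements of independent values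
  as its primes. By \<open>L_pos_val\<close> all multiples of their product lie in
  \<open>L p\<close>, so the exponent is 1.\<close>

lemma independent_finitely_primary:
  assumes p: "p \<in> X" and ind: "independent p" shows "finitely_primary Q (L p)"
proof -
  note Pp = prime[OF p]
  define s where "s = card (over p)"
  obtain e where e: "bij_betw e {0..<s} (over p)" unfolding s_def using ex_bij_betw_nat_finite[OF finite_over[OF p]] by blast
  have eO: "e i \<in> over p" if "i < s" for i using e that by (auto simp: bij_betw_def)
  have O: "over p = e ` {..<s}" using e by (simp add: bij_betw_def atLeast0LessThan)
  have eX: "e i \<in> K.X" if "i < s" for i using overD(1)[OF eO[OF that]] .
  have e_inj: "e i = e j \<longleftrightarrow> i = j" if "i < s" "j < s" for i j
    using e that by (auto simp: bij_betw_def inj_on_eq_iff)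
  have e_surj: "\<exists>i<s. P = e i" if "P \<in> over p" for P
  proof -
    have "P \<in> e ` {0..<s}" using e that by (simp add: bij_betw_def)
    then show ?thesis by auto
  qed
  have "\<exists>c. i < s \<longrightarrow> c \<in> carrier Q \<and> (\<forall>j<s. val (e j) c = (if i = j then 1 else 0))" for i
  proof (cases "i < s")
    case True
    then obtain c where c: "c \<in> carrier Q" "val (e i) c = 1" "\<forall>P'\<in>over p. P' \<noteq> e i \<longrightarrow> val P' c = 0"
      using ind eO unfolding independent_def by blast
    then have "\<forall>j<s. val (e j) c = (if i = j then 1 else 0)" using eO e_inj True by auto
    with c show ?thesis by blast
  qed simp
  then obtain q where q: "\<And>i. i < s \<Longrightarrow> q i \<in> carrier Q \<and> (\<forall>j<s. val (e j) (q i) = (if i = j then 1 else 0))" by metis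
  have qQ: "q i \<in> carrier Q" if "i \<in> {..<s}" for i using q that by auto
  have qv: "val (e j) (q i) = (if i = j then 1 else 0)" if "i < s" "j < s" for i j using q that by blast
  let ?F = "KL p" and ?F' = "Q\<lparr>carrier := KL p\<rparr>" and ?q = "finprod Q q {..<s}"
  have F_iff: "x \<in> ?F \<longleftrightarrow> x \<in> carrier Q \<and> (\<forall>i<s. 0 \<le> val (e i) x)" for x
    unfolding KL_iff[OF p] O by auto
  have F_units: "x \<in> Units ?F' \<longleftrightarrow> x \<in> carrier Q \<and> (\<forall>i<s. val (e i) x = 0)" for x
    unfolding KL_Units[OF p] O by auto
  have qF: "q i \<in> ?F" if "i < s" for i unfolding F_iff using q[OF that] by auto
  have val_q: "val (e j) (finprod Q (\<lambda>i. q i [^] n i) {..<s}) = int (n j)" if j: "j < s" for j and n :: "nat \<Rightarrow> nat"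
  proof -
    have "val (e j) (finprod Q (\<lambda>i. q i [^] n i) {..<s}) = (\<Sum>i<s. val (e j) (q i [^] n i))"
      by (rule valD(7)[OF eX[OF j]]) (use qQ in auto)
    also have "\<dots> = (\<Sum>i<s. if i = j then int (n j) else 0)"
      by (rule sum.cong) (use qQ qv j in \<open>auto simp: valD(5)[OF eX[OF j]]\<close>)
    finally show ?thesis using j by simp
  qed
  have qpQ: "?q \<in> carrier Q" by (rule finprod_closed) (use qQ in auto)
  have val_qp: "val (e j) ?q = 1" if "j < s" for j
  proof -
    have "val (e j) ?q = (\<Sum>i<s. val (e j) (q i))" by (rule valD(7)[OF eX[OF that] qQ])
    also have "\<dots> = (\<Sum>i<s. if i = j then 1 else 0)" by (rule sum.cong) (use qv that in auto)
    finally show ?thesis using that by simp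
  qed
  have s1: "s \<ge> 1" unfolding s_def using over_nonempty[OF p] finite_over[OF p] by (simp add: Suc_le_eq card_gt_0_iff)
  let ?w = "\<lambda>i x. nat (val (e i) x)"
  have wm: "?w i (x \<otimes>\<^bsub>?F'\<^esub> y) = ?w i x + ?w i y" if "i \<in> {..<s}" "x \<in> carrier ?F'" "y \<in> carrier ?F'" for i x y
    using that F_iff[of x] F_iff[of y] valD(1)[OF eX[of i], of x y] by (auto simp: nat_add_distrib)
  have fv: "finite {i \<in> {..<s}. ?w i x \<noteq> 0}" if "x \<in> carrier ?F'" for x by simp
  have dv: "x divides\<^bsub>?F'\<^esub> y" if xy: "x \<in> carrier ?F'" "y \<in> carrier ?F'" "\<And>i. i \<in> {..<s} \<Longrightarrow> ?w i x \<le> ?w i y" for x y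
  proof -
    have c: "x \<in> carrier Q" "y \<in> carrier Q" using xy F_iff by auto
    have "inv x \<otimes> y \<in> ?F" unfolding F_iff
    proof (intro conjI allI impI)
      fix i assume i: "i < s"
      have "0 \<le> val (e i) x" "0 \<le> val (e i) y" using xy(1,2) i F_iff by auto
      then have "val (e i) x \<le> val (e i) y" using xy(3)[of i] i by (simp add: nat_le_eq_zle)
      then show "0 \<le> val (e i) (inv x \<otimes> y)" using c by (simp add: valD(1,4)[OF eX[OF i]])
    qed (use c in simp)
    moreover have "y = x \<otimes> (inv x \<otimes> y)" using c by (simp add: cancel_simps)
    ultimately show ?thesis unfolding factor_def by auto
  qed
  have canc: "comm_monoid_cancel ?F'" by (rule submonoid_cancel[OF KL_submonoid[OF p]])
  have qc: "q i \<in> carrier ?F'" if "i \<in> {..<s}" for i using qF that by simp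
  have qv': "?w j (q i) = (if i = j then 1 else 0)" if "i \<in> {..<s}" "j \<in> {..<s}" for i j using qv that by simp
  note ff = factorial_from_valuations[where M = ?F' and V = "{..<s}" and w = ?w and c = q]
  have fact: "factorial_monoid ?F'" by (rule ff(1)) (fact canc wm fv dv qc qv')+
  have prm: "Divisibility.prime ?F' (q i)" if i: "i \<in> {..<s}" for i
    by (rule ff(3)) (fact canc wm fv dv qc qv' i)+
  have nass: "\<not> q i \<sim>\<^bsub>?F'\<^esub> q j" if ij: "i < s" "j < s" "i \<noteq> j" for i j
  proof
    assume "q i \<sim>\<^bsub>?F'\<^esub> q j"
    then obtain c where c: "c \<in> ?F" "q j = q i \<otimes> c" unfolding associated_def factor_def by auto
    then have "val (e i) (q j) = val (e i) (q i) + val (e i) c"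
      using valD(1)[OF eX[OF ij(1)], of "q i" c] qQ ij F_iff by auto
    then show False using qv[of j i] qv[of i i] ij c(1) F_iff[of c] by auto
  qed
  have repr: "\<exists>u\<in>Units ?F'. \<exists>n :: nat \<Rightarrow> nat. x = u \<otimes> finprod Q (\<lambda>i. q i [^] n i) {..<s}" if x: "x \<in> ?F" for x
  proof -
    let ?n = "\<lambda>i. nat (val (e i) x)"
    let ?y = "finprod Q (\<lambda>i. q i [^] ?n i) {..<s}"
    have y: "?y \<in> carrier Q" by (rule finprod_closed) (use qQ in auto)
    have xQ: "x \<in> carrier Q" using x F_iff by blast
    have u: "x \<otimes> inv ?y \<in> Units ?F'"
      unfolding F_units using xQ y x F_iff[of x] by (auto simp: valD(1,4)[OF eX] val_q)
    have "x = x \<otimes> inv ?y \<otimes> ?y" using xQ y by (simp add: gsimps)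
    then show ?thesis by (intro bexI[OF _ u] exI[of _ ?n])
  qed
  have sub1: "L p - Units (Q\<lparr>carrier := L p\<rparr>) \<subseteq> ?q <# ?F"
  proof
    fix x assume x: "x \<in> L p - U p"
    have xQ: "x \<in> carrier Q" using x L_carrier by blast
    have "inv ?q \<otimes> x \<in> ?F" unfolding F_iff
    proof (intro conjI allI impI)
      fix i assume i: "i < s"
      have "0 < val (e i) x" by (rule L_nonunit_val[OF p _ _ eO[OF i]]) (use x in blast)+
      then show "0 \<le> val (e i) (inv ?q \<otimes> x)" using xQ qpQ val_qp[OF i] by (simp add: valD(1,4)[OF eX[OF i]])
    qed (use xQ qpQ in simp)
    moreover have "x = ?q \<otimes> (inv ?q \<otimes> x)" using xQ qpQ by (simp add: cancel_simps)
    ultimately show "x \<in> ?q <# ?F" unfolding l_coset_def by blast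
  qed
  have sub2: "(?q [^] (1::nat)) <# ?F \<subseteq> L p"
  proof
    fix x assume "x \<in> (?q [^] (1::nat)) <# ?F"
    then obtain y where y: "y \<in> ?F" "x = ?q \<otimes> y" unfolding l_coset_def using qpQ by auto
    have yQ: "y \<in> carrier Q" using y F_iff by blast
    have "0 < val P x" if P: "P \<in> over p" for P
    proof -
      obtain i where i: "i < s" "P = e i" using e_surj[OF P] by blast
      have "0 \<le> val (e i) y" using y i F_iff by blast
      then show ?thesis unfolding i(2) y(2) using yQ qpQ val_qp[OF i(1)] by (simp add: valD(1)[OF eX[OF i(1)]])
    qed
    then show "x \<in> L p" using L_pos_val(1)[OF p, of x] y(2) yQ qpQ by auto
  qed
  show ?thesis
    unfolding finitely_primary_def Let_def
    by (rule exI[of _ ?F], rule exI[of _ s], rule exI[of _ 1], rule exI[of _ q])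
      (use KL_submonoid[OF p] L_submonoid[OF Pp] L_sub_KL fact s1 qF prm nass repr sub1 sub2 in auto)
qed

lemma K_uniformizer:
  assumes P: "P \<in> K.X" obtains b where "b \<in> K" "val P b = 1"
proof -
  obtain c where c: "c \<in> carrier Q" "val P c = 1" using discrete_val_one[OF val[OF P]] by blast
  then have "c \<in> K.L P" using valD(2)[OF P, of c] by simp
  then obtain t where t: "t \<in> K - P" "t \<otimes> c \<in> K" using K.localizeE[OF _ hat_carrier] by blast
  have "t \<in> K" "t \<notin> P" using t by blast+
  then have "val P t = 0" using val_pos_iff[OF P, of t] mem_K_iff[of t] P by force
  then have "val P (t \<otimes> c) = 1" using valD(1)[OF P, of t c] c K_carrier[OF \<open>t \<in> K\<close>] by simp
  with t(2) that show ?thesis by blast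
qed

text \<open>The given \<open>F\<close> must be \<open>KL p\<close>: the power of the product of the
  \<open>q i\<close> is a denominator for all of \<open>F\<close>, and conversely a factorial monoid
  is completely integrally closed. Each prime above \<open>p\<close> is then cut out by one of the
  \<open>q i\<close>.\<close>

lemma finitely_primary_independent:
  assumes p: "p \<in> X" and fp: "finitely_primary Q (L p)" shows "independent p"
proof -
  note Pp = prime[OF p]
  obtain F s \<alpha> q where F: "submonoid F Q" and LF: "L p \<subseteq> F" and fact: "factorial_monoid (Q\<lparr>carrier := F\<rparr>)"
    and qF: "\<forall>i<s. q i \<in> F \<and> Divisibility.prime (Q\<lparr>carrier := F\<rparr>) (q i)"
    and repr: "\<forall>x\<in>F. \<exists>u\<in>Units (Q\<lparr>carrier := F\<rparr>). \<exists>e :: nat \<Rightarrow> nat.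
        x = u \<otimes> finprod Q (\<lambda>i. q i [^] e i) {..<s}"
    and FL: "(finprod Q q {..<s} [^] (\<alpha>::nat)) <# F \<subseteq> L p"
    using fp unfolding finitely_primary_def Let_def by (elim exE conjE) (rule that)
  interpret Fs: submonoid F Q by (rule F)
  let ?F' = "Q\<lparr>carrier := F\<rparr>"
  interpret F': factorial_monoid ?F' by (rule fact)
  have FQ: "x \<in> carrier Q" if "x \<in> F" for x using that Fs.subset by blast
  have FU: "x \<in> Units ?F' \<longleftrightarrow> x \<in> F \<and> inv x \<in> F" for x using Units_submonoid[OF F] by blast
  have F_div: "a divides\<^bsub>?F'\<^esub> b \<longleftrightarrow> b \<otimes> inv a \<in> F" if ab: "a \<in> F" "b \<in> F" for a b
  proof
    assume "a divides\<^bsub>?F'\<^esub> b"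
    then obtain c where "c \<in> F" "b = a \<otimes> c" unfolding factor_def by auto
    then show "b \<otimes> inv a \<in> F" using ab FQ by (simp add: gsimps)
  next
    assume c: "b \<otimes> inv a \<in> F"
    have "b = a \<otimes> (b \<otimes> inv a)" using ab FQ by (simp add: gsimps)
    with c show "a divides\<^bsub>?F'\<^esub> b" unfolding factor_def by auto
  qed
  have q: "q i \<in> F" "q i \<in> carrier Q" "inv (q i) \<notin> F" if "i < s" for i
    using qF that FQ[of "q i"] FU[of "q i"] by (auto simp: Divisibility.prime_def)
  have q_prime: "x \<otimes> inv (q i) \<in> F \<or> y \<otimes> inv (q i) \<in> F"
    if i: "i < s" and xy: "x \<in> F" "y \<in> F" "x \<otimes> y \<otimes> inv (q i) \<in> F" for i x y
  proof -
    have "q i divides\<^bsub>?F'\<^esub> (x \<otimes> y)" using F_div[OF q(1)[OF i], of "x \<otimes> y"] xy by simp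
    then have "q i divides\<^bsub>?F'\<^esub> x \<or> q i divides\<^bsub>?F'\<^esub> y" using qF i xy(1,2) by (auto simp: Divisibility.prime_def)
    then show ?thesis using F_div[OF q(1)[OF i]] xy(1,2) by blast
  qed
  have q_prime_pow: "x \<otimes> inv (q i) \<in> F"
    if i: "i < s" and x: "x \<in> F" and a: "a \<in> F" "a \<otimes> inv (q i) \<notin> F" and d: "x \<otimes> a [^] (m::nat) \<otimes> inv (q i) \<in> F" for i x a m
    using d
  proof (induction m)
    case (Suc m)
    have am: "a [^] k \<in> F" for k :: nat
    proof (induction k)
      case (Suc k)
      then show ?case using Fs.m_closed[OF Suc.IH a(1)] by simp
    qed simp
    have "x \<otimes> a [^] m \<otimes> a \<otimes> inv (q i) \<in> F" using Suc.prems FQ x a(1) q(2)[OF i] by (simp add: m_assoc)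
    then have "x \<otimes> a [^] m \<otimes> inv (q i) \<in> F" using q_prime[OF i _ a(1)] Fs.m_closed[OF x am] a(2) by blast
    then show ?case by (rule Suc.IH)
  qed (use x FQ q(2)[OF i] in simp)
  \<comment> \<open>Division by \<open>q i\<close> without end would produce an infinite chain of
    proper divisors.\<close>
  have no_inf: False if i: "i < s" and x: "x \<in> F" "\<And>n::nat. x \<otimes> inv (q i [^] n) \<in> F" for i x
  proof -
    let ?S = "range (\<lambda>n::nat. x \<otimes> inv (q i [^] n))"
    have ne: "x \<otimes> inv (q i [^] (0::nat)) \<in> ?S" by blast
    obtain y where y: "y \<in> ?S" and min: "\<forall>y'. (y', y) \<in> {(x, y). x \<in> carrier ?F' \<and> y \<in> carrier ?F' \<and> properfactor ?F' x y} \<longrightarrow> y' \<notin> ?S"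
      using F'.division_wellfounded[unfolded wf_eq_minimal, THEN spec, THEN spec, THEN mp, OF ne] ..
    then obtain n where n: "y = x \<otimes> inv (q i [^] (n::nat))" by blast
    define y' where "y' = x \<otimes> inv (q i [^] Suc n)"
    have yF: "y \<in> F" "y' \<in> F" unfolding n y'_def using x(2) by blast+
    have xQ: "x \<in> carrier Q" using FQ x(1) by blast
    have "y \<otimes> inv y' = q i" "y' \<otimes> inv y = inv (q i)"
      unfolding n y'_def using xQ q(2)[OF i] by (simp_all add: gsimps)
    then have "properfactor ?F' y' y"
      unfolding properfactor_def using F_div[OF yF(2,1)] F_div[OF yF] q(1,3)[OF i] by simp
    then have "y' \<notin> ?S" using min[THEN spec, of y'] yF by simp
    then show False unfolding y'_def by blast
  qed
  have FK: "F \<subseteq> KL p"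
  proof
    interpret D: quotient_group_of Q "L p" using L_quotient[OF Pp] .
    fix x assume x: "x \<in> F"
    define c where "c = finprod Q q {..<s} [^] \<alpha>"
    have qpQ: "finprod Q q {..<s} \<in> carrier Q" by (rule finprod_closed) (use q(2) in auto)
    have cF: "c \<otimes> y \<in> L p" if "y \<in> F" for y using FL that unfolding c_def l_coset_def by blast
    have "c \<in> L p" using cF[OF Fs.one_closed] qpQ by (simp add: c_def)
    moreover have "x [^] n \<in> F" for n :: nat
    proof (induction n)
      case (Suc n)
      then show ?case using Fs.m_closed[OF Suc.IH x] by simp
    qed simp
    then have "\<forall>n::nat. c \<otimes> x [^] n \<in> L p" using cF by blast
    ultimately show "x \<in> KL p" unfolding KL_hat[OF p] D.hat_iff using FQ[OF x] by blast
  qed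
  have KF: "KL p \<subseteq> F"
  proof
    interpret D: quotient_group_of Q "L p" using L_quotient[OF Pp] .
    fix x assume "x \<in> KL p"
    then obtain c where c: "x \<in> carrier Q" "c \<in> L p" "\<And>n::nat. c \<otimes> x [^] n \<in> L p"
      unfolding KL_hat[OF p] D.hat_iff by blast
    have cF: "c \<in> F" using c(2) LF by blast
    \<comment> \<open>The prime factors of a denominator of \<open>x\<close> are cancelled one at a
      time, by induction on their number; in the base case only a unit is left.\<close>
    have claim: "x \<in> F" if "x \<otimes> (u \<otimes> finprod Q (\<lambda>i. q i [^] e i) {..<s}) \<in> F" "u \<in> Units ?F'" "(\<Sum>i<s. e i) = n"
      for u n and e :: "nat \<Rightarrow> nat"
      using that
    proof (induction n arbitrary: u e)
      case 0
      have uF: "u \<in> F" "inv u \<in> F" using 0(2) FU by auto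
      have "finprod Q (\<lambda>i. q i [^] e i) {..<s} = \<one>"
        using 0(3) by (intro finprod_one_eqI) (simp add: )
      then have "x \<otimes> u \<in> F" using 0(1) FQ[OF uF(1)] by simp
      then have "x \<otimes> u \<otimes> inv u \<in> F" using uF(2) by blast
      then show ?case using c(1) FQ[OF uF(1)] by (simp add: m_assoc)
    next
      case (Suc n)
      have uF: "u \<in> F" using Suc.prems(2) FU by auto
      obtain k where k: "k < s" "e k \<noteq> 0" using Suc.prems(3) by (metis lessThan_iff nat.simps(3) sum.neutral)
      define e' where "e' = e(k := e k - 1)"
      let ?y = "finprod Q (\<lambda>i. q i [^] e i) {..<s}" and ?y' = "finprod Q (\<lambda>i. q i [^] e' i) {..<s}"
      have fin1: "finprod Q (\<lambda>i. q i [^] g i) (insert k ({..<s} - {k})) = q k [^] g k \<otimes> finprod Q (\<lambda>i. q i [^] g i) ({..<s} - {k})" for g :: "nat \<Rightarrow> nat"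
        by (rule finprod_insert) (use q(2) k in auto)
      have ins: "insert k ({..<s} - {k}) = {..<s}" using k by auto
      have rest: "finprod Q (\<lambda>i. q i [^] e' i) ({..<s} - {k}) = finprod Q (\<lambda>i. q i [^] e i) ({..<s} - {k})"
        by (rule finprod_cong') (use q(2) in \<open>auto simp: e'_def\<close>)
      have rQ: "finprod Q (\<lambda>i. q i [^] e i) ({..<s} - {k}) \<in> carrier Q" by (rule finprod_closed) (use q(2) in auto)
      have "q k [^] e k = q k \<otimes> q k [^] (e k - 1)"
        using k q(2)[OF k(1)] nat_pow_Suc2[of "q k" "e k - 1"] by simp
      then have yy: "?y = q k \<otimes> ?y'"
        using fin1[of e] fin1[of e'] rest rQ q(2)[OF k(1)] unfolding ins by (simp add: e'_def m_assoc)
      have y'F: "?y' \<in> F"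
      proof -
        have pw: "a [^] (m::nat) \<in> F" if a: "a \<in> F" for a m
        proof (induction m)
          case (Suc m)
          then show ?case using Fs.m_closed[OF Suc.IH a] by simp
        qed simp
        have "finprod Q (\<lambda>i. q i [^] e' i) T \<in> F" if "T \<subseteq> {..<s}" for T
          using finite_subset[OF that finite_lessThan] that
        proof (induction T rule: finite_induct)
          case (insert i T)
          have "finprod Q (\<lambda>i. q i [^] e' i) (insert i T) = q i [^] e' i \<otimes> finprod Q (\<lambda>i. q i [^] e' i) T"
            by (rule finprod_insert) (use insert q(2) in auto)
          then show ?case using insert pw[OF q(1)[of i]] by auto
        qed simp
        then show ?thesis by blast
      qed
      define a where "a = x \<otimes> (u \<otimes> ?y)"
      define b where "b = u \<otimes> ?y'"
      have aF: "a \<in> F" unfolding a_def by (rule Suc.prems(1))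
      have bF: "b \<in> F" unfolding b_def using uF y'F by blast
      note Qs = FQ[OF aF] FQ[OF bF] FQ[OF uF] FQ[OF y'F] q(2)[OF k(1)] c(1) FQ[OF cF]
      have ab: "a = x \<otimes> b \<otimes> q k" unfolding a_def b_def yy using Qs by (simp add: gsimps)
      \<comment> \<open>If \<open>q k\<close> did not divide \<open>a\<close>, then from
        \<open>c a^m = (c x^m) b^m (q k)^m\<close> primality would force the factor
        \<open>(q k)^m\<close> into \<open>c\<close> for every \<open>m\<close>, which
        \<open>no_inf\<close> excludes.\<close>
      have "a \<otimes> inv (q k) \<in> F"
      proof (rule ccontr)
        assume na: "a \<otimes> inv (q k) \<notin> F"
        \<comment> \<open>Induction on \<open>m\<close>: one factor \<open>q k\<close> at a time is
          split off from \<open>c'\<close>, while the exponent \<open>j\<close> of \<open>a\<close>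
          stays fixed.\<close>
        have "c' \<otimes> inv (q k [^] m) \<in> F" if "c' \<in> F" "c' \<otimes> a [^] j \<otimes> inv (q k [^] m) \<in> F" for c' and m j :: nat
          using that
        proof (induction m arbitrary: c')
          case (Suc m)
          have c'Q: "c' \<in> carrier Q" using FQ Suc.prems(1) by blast
          have qm: "q k [^] m \<in> F"
          proof (induction m)
            case (Suc m)
            then show ?case using Fs.m_closed[OF Suc.IH q(1)[OF k(1)]] by simp
          qed simp
          have "c' \<otimes> a [^] j \<otimes> inv (q k [^] Suc m) \<otimes> q k [^] m \<in> F" using Suc.prems(2) qm by blast
          then have "c' \<otimes> a [^] j \<otimes> inv (q k) \<in> F" using c'Q Qs by (simp add: gsimps)
          then have d: "c' \<otimes> inv (q k) \<in> F" by (rule q_prime_pow[OF k(1) Suc.prems(1) aF na])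
          have "c' \<otimes> inv (q k) \<otimes> a [^] j \<otimes> inv (q k [^] m) \<in> F"
            using Suc.prems(2) c'Q Qs by (simp add: gsimps)
          then have "c' \<otimes> inv (q k) \<otimes> inv (q k [^] m) \<in> F" by (rule Suc.IH[OF d])
          then show ?case using c'Q Qs by (simp add: gsimps)
        qed simp
        moreover have "c \<otimes> a [^] m \<otimes> inv (q k [^] m) \<in> F" for m :: nat
        proof -
          have bm: "b [^] m \<in> F"
          proof (induction m)
            case (Suc m)
            then show ?case using Fs.m_closed[OF Suc.IH bF] by simp
          qed simp
          have "c \<otimes> a [^] m \<otimes> inv (q k [^] m) = c \<otimes> x [^] m \<otimes> b [^] m"
            unfolding ab using Qs by (simp add: nat_pow_distrib gsimps)
          then show ?thesis using Fs.m_closed[OF subsetD[OF LF c(3)[of m]] bm] by simp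
        qed
        ultimately have "c \<otimes> inv (q k [^] m) \<in> F" for m :: nat using cF by blast
        then show False using no_inf[OF k(1) cF] by blast
      qed
      moreover have "a \<otimes> inv (q k) = x \<otimes> (u \<otimes> ?y')" unfolding ab b_def using Qs by (simp add: gsimps)
      moreover have "(\<Sum>i<s. e' i) = n"
      proof -
        have "(\<Sum>i<s. g i) = g k + (\<Sum>i\<in>{..<s} - {k}. g i)" for g :: "nat \<Rightarrow> nat"
          using k by (intro sum.remove) auto
        from this[of e] this[of e'] show ?thesis using Suc.prems(3) k by (simp add: e'_def)
      qed
      ultimately show ?case using Suc.IH[of u e'] Suc.prems(2) by simp
    qed
    obtain t where t: "t \<in> L p" "t \<otimes> x \<in> L p" using D.frac[OF c(1)] .
    obtain u e where ue: "u \<in> Units ?F'" "t = u \<otimes> finprod Q (\<lambda>i. q i [^] (e i :: nat)) {..<s}"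
      using repr t(1) LF by blast
    have "x \<otimes> t \<in> F" using t LF c(1) m_comm[of t x] L_carrier[OF t(1)] by auto
    then show "x \<in> F" using claim ue by blast
  qed
  have FKL: "F = KL p" using FK KF by blast
  have over_prime: "\<exists>i<s. val P (q i) = 1 \<and> (\<forall>P'\<in>over p. P' \<noteq> P \<longrightarrow> val P' (q i) = 0)" if P: "P \<in> over p" for P
  proof -
    note PX = overD(1)[OF P]
    have nn: "0 \<le> val P' x" if "x \<in> F" "P' \<in> over p" for x P' using that FKL KL_iff[OF p] by blast
    \<comment> \<open>A non-unit of \<open>L p\<close> has positive value at \<open>P\<close>, so
      one of the \<open>q i\<close> in its factorization has positive value there.\<close>
    obtain a where a: "a \<in> p" "a \<in> H" "a \<in> L p" "a \<notin> U p" using L_nonunit_exists[OF p] .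
    obtain u e where ue: "u \<in> Units ?F'" "a = u \<otimes> finprod Q (\<lambda>i. q i [^] (e i :: nat)) {..<s}"
      using repr a(3) LF by blast
    have uQ: "u \<in> carrier Q" using ue(1) FU FQ by blast
    have "val P u = 0" using ue(1) unfolding FKL KL_Units[OF p] using P by blast
    moreover have "0 < val P a" by (rule L_nonunit_val[OF p a(3,4) P])
    moreover have fQ: "finprod Q (\<lambda>i. q i [^] e i) {..<s} \<in> carrier Q" by (rule finprod_closed) (use q(2) in auto)
    have "val P a = val P u + val P (finprod Q (\<lambda>i. q i [^] e i) {..<s})"
      unfolding ue(2) by (rule valD(1)[OF PX uQ fQ])
    moreover have "val P (finprod Q (\<lambda>i. q i [^] e i) {..<s}) = (\<Sum>i<s. val P (q i [^] e i))"
      by (rule valD(7)[OF PX]) (use q(2) in auto)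
    ultimately have "(\<Sum>i<s. val P (q i [^] e i)) \<noteq> 0" by linarith
    then obtain i where "i \<in> {..<s}" and i0: "val P (q i [^] e i) \<noteq> 0"
      by (rule sum.not_neutral_contains_not_neutral)
    then have i: "i < s" "val P (q i [^] e i) \<noteq> 0" by auto
    then have "val P (q i) \<noteq> 0" using valD(5)[OF PX q(2)[OF i(1)]] by auto
    then have vi: "0 < val P (q i)" using nn[OF q(1)[OF i(1)] P] by simp
    \<comment> \<open>The contraction to \<open>K\<close> of the prime \<open>q i F\<close>. It is
      contained in every prime above \<open>p\<close> at which \<open>q i\<close> has positive value
      and equals it by minimality; so there is only one such prime.\<close>
    define N where "N = {x \<in> K. x \<otimes> inv (q i) \<in> F}"
    have KsF: "x \<in> F" if "x \<in> K" for x using that subset_localize[OF Pp hat_carrier] FKL by blast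
    have NP: "prime_s_ideal Q K N"
      unfolding K.prime_s_ideal_iff
    proof (intro conjI ballI impI)
      show "N \<subseteq> K" unfolding N_def by blast
      show "\<one> \<notin> N" unfolding N_def using q(2,3)[OF i(1)] by simp
      show "a \<otimes> h \<in> N" if ah: "a \<in> N" "h \<in> K" for a h
      proof -
        have "a \<otimes> inv (q i) \<otimes> h \<in> F" using ah KsF unfolding N_def by blast
        moreover have "a \<otimes> inv (q i) \<otimes> h = a \<otimes> h \<otimes> inv (q i)"
          using ah K_carrier q(2)[OF i(1)] by (simp add: gsimps N_def)
        ultimately show ?thesis using ah unfolding N_def by auto
      qed
      show "a \<in> N \<or> b \<in> N" if "a \<in> K" "b \<in> K" "a \<otimes> b \<in> N" for a b
        using q_prime[OF i(1) KsF[OF that(1)] KsF[OF that(2)]] that unfolding N_def by blast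
    qed
    have Nne: "N \<noteq> {}"
    proof -
      have "q i \<in> KL p" using q(1)[OF i(1)] FKL by blast
      then obtain t where t: "t \<in> H - p" "t \<otimes> q i \<in> K" using localizeE[OF _ hat_carrier] by blast
      have "t \<otimes> q i \<otimes> inv (q i) = t" using t q(2)[OF i(1)] by (simp add: m_assoc)
      then have "t \<otimes> q i \<in> N" unfolding N_def using t H_sub_hat KsF by auto
      then show ?thesis by blast
    qed
    have N_eq: "N = P'" if P': "P' \<in> over p" "0 < val P' (q i)" for P'
    proof -
      note P'X = overD(1)[OF P'(1)]
      have "x \<in> P'" if x: "x \<in> N" for x
      proof -
        have xK: "x \<in> K" "x \<otimes> inv (q i) \<in> F" using x unfolding N_def by auto
        have "0 \<le> val P' (x \<otimes> inv (q i))" by (rule nn[OF xK(2) P'(1)])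
        then have "0 < val P' x" using P'(2) K_carrier[OF xK(1)] q(2)[OF i(1)] by (simp add: valD(1,4)[OF P'X])
        then show ?thesis using val_pos_iff[OF P'X xK(1)] by blast
      qed
      then show ?thesis using K.min_primeD(3)[OF P'X NP Nne] by blast
    qed
    have NPeq: "N = P" by (rule N_eq[OF P vi])
    have "val P' (q i) = 0" if "P' \<in> over p" "P' \<noteq> P" for P'
      using N_eq[OF that(1)] NPeq nn[OF q(1)[OF i(1)] that(1)] that(2) by force
    \<comment> \<open>An element of \<open>K\<close> of value 1 at \<open>P\<close> lies in
      \<open>N\<close>, hence is a multiple of \<open>q i\<close> in \<open>F\<close>.\<close>
    moreover have "val P (q i) = 1"
    proof -
      obtain b where b: "b \<in> K" "val P b = 1" using K_uniformizer[OF PX] .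
      then have "b \<in> N" using val_pos_iff[OF PX b(1)] NPeq by simp
      then have "0 \<le> val P (b \<otimes> inv (q i))" using nn[OF _ P] unfolding N_def by blast
      then have "val P (q i) \<le> 1" using b K_carrier[OF b(1)] q(2)[OF i(1)] by (simp add: valD(1,4)[OF PX])
      then show ?thesis using vi by simp
    qed
    ultimately show ?thesis using i(1) by blast
  qed
  show ?thesis unfolding independent_def
  proof
    fix P assume "P \<in> over p"
    from over_prime[OF this] obtain i where "i < s" "val P (q i) = 1"
      "\<forall>P'\<in>over p. P' \<noteq> P \<longrightarrow> val P' (q i) = 0" by blast
    then show "\<exists>c\<in>carrier Q. val P c = 1 \<and> (\<forall>P'\<in>over p. P' \<noteq> P \<longrightarrow> val P' c = 0)"
      using q(2) by blast
  qed
qed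

end

section \<open>Domains\<close>

text \<open>If \<open>H\<close> is the multiplicative monoid of a domain, then the addition of its field of fractions is
the relation \<open>add\<close> on \<open>Q\<close>, undefined when the sum is zero.\<close>

locale domain_monoid = quotient_group_of Q H + R: domain R
  for Q :: "('a, 'm) monoid_scheme" (structure) and H and R :: "('r, 'n) ring_scheme" +
  fixes \<phi> :: "'r \<Rightarrow> 'a"
  assumes \<phi>_iso: "\<phi> \<in> iso (mult_of R) (Q\<lparr>carrier := H\<rparr>)"
begin

definition nz :: "'r set" where "nz = carrier R - {\<zero>\<^bsub>R\<^esub>}"

lemma nz_mult: "r \<in> nz \<Longrightarrow> s \<in> nz \<Longrightarrow> r \<otimes>\<^bsub>R\<^esub> s \<in> nz"
  using R.integral_iff unfolding nz_def by auto

lemma nz_carrier: "r \<in> nz \<Longrightarrow> r \<in> carrier R"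
  by (simp add: nz_def)

lemma \<phi>_H: "r \<in> nz \<Longrightarrow> \<phi> r \<in> H"
  using \<phi>_iso by (auto simp: iso_def hom_def nz_def)

lemma \<phi>_mult: "r \<in> nz \<Longrightarrow> s \<in> nz \<Longrightarrow> \<phi> (r \<otimes>\<^bsub>R\<^esub> s) = \<phi> r \<otimes> \<phi> s"
  using \<phi>_iso by (auto simp: iso_def hom_def nz_def)

lemma \<phi>_inj: "r \<in> nz \<Longrightarrow> s \<in> nz \<Longrightarrow> \<phi> r = \<phi> s \<Longrightarrow> r = s"
  using \<phi>_iso by (auto simp: iso_def bij_betw_def inj_on_def nz_def)

lemma \<phi>_surj: assumes "h \<in> H" obtains r where "r \<in> nz" "h = \<phi> r"
proof -
  have "H = \<phi> ` nz" using \<phi>_iso by (auto simp: iso_def bij_betw_def nz_def)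
  with assms that show ?thesis by blast
qed

definition add :: "'a \<Rightarrow> 'a \<Rightarrow> 'a \<Rightarrow> bool" where
  "add x y s \<longleftrightarrow> x \<in> carrier Q \<and> y \<in> carrier Q \<and> s \<in> carrier Q \<and>
    (\<exists>d\<in>H. \<exists>r1\<in>nz. \<exists>r2\<in>nz. r1 \<oplus>\<^bsub>R\<^esub> r2 \<in> nz \<and>
      x \<otimes> d = \<phi> r1 \<and> y \<otimes> d = \<phi> r2 \<and> s \<otimes> d = \<phi> (r1 \<oplus>\<^bsub>R\<^esub> r2))"

definition add_closed :: "'a set \<Rightarrow> bool" where
  "add_closed A \<longleftrightarrow> (\<forall>x\<in>A. \<forall>y\<in>A. \<forall>s. add x y s \<longrightarrow> s \<in> A)"

definition minus_one :: 'a where "minus_one = \<phi> (\<ominus>\<^bsub>R\<^esub> \<one>\<^bsub>R\<^esub>)"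

lemma neg_one_nz: "\<ominus>\<^bsub>R\<^esub> \<one>\<^bsub>R\<^esub> \<in> nz"
  unfolding nz_def using R.minus_minus[OF R.one_closed] R.one_not_zero R.minus_zero by force

lemma minus_one: "minus_one \<in> H" "minus_one \<otimes> minus_one = \<one>"
proof -
  have 1: "\<one>\<^bsub>R\<^esub> \<in> nz" by (simp add: nz_def)
  have "\<phi> \<one>\<^bsub>R\<^esub> \<otimes> \<phi> \<one>\<^bsub>R\<^esub> = \<phi> \<one>\<^bsub>R\<^esub>" using \<phi>_mult[OF 1 1] by simp
  then have \<phi>1: "\<phi> \<one>\<^bsub>R\<^esub> = \<one>" using in_carrier[OF \<phi>_H[OF 1]] by simp
  show "minus_one \<in> H" unfolding minus_one_def by (rule \<phi>_H[OF neg_one_nz])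
  have "\<ominus>\<^bsub>R\<^esub> \<one>\<^bsub>R\<^esub> \<otimes>\<^bsub>R\<^esub> (\<ominus>\<^bsub>R\<^esub> \<one>\<^bsub>R\<^esub>) = \<one>\<^bsub>R\<^esub>" by (simp add: R.l_minus R.r_minus)
  then show "minus_one \<otimes> minus_one = \<one>"
    unfolding minus_one_def using \<phi>_mult[OF neg_one_nz neg_one_nz] \<phi>1 by simp
qed

lemma \<phi>_minus: assumes "r \<in> nz" shows "\<ominus>\<^bsub>R\<^esub> r \<in> nz" "\<phi> (\<ominus>\<^bsub>R\<^esub> r) = \<phi> r \<otimes> minus_one"
proof -
  have e: "\<ominus>\<^bsub>R\<^esub> r = r \<otimes>\<^bsub>R\<^esub> (\<ominus>\<^bsub>R\<^esub> \<one>\<^bsub>R\<^esub>)" using nz_carrier[OF assms] by (simp add: R.r_minus)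
  show "\<ominus>\<^bsub>R\<^esub> r \<in> nz" unfolding e by (rule nz_mult[OF assms neg_one_nz])
  show "\<phi> (\<ominus>\<^bsub>R\<^esub> r) = \<phi> r \<otimes> minus_one" unfolding e minus_one_def by (rule \<phi>_mult[OF assms neg_one_nz])
qed

lemma add_comm: assumes "add x y s" shows "add y x s"
proof -
  obtain d r1 r2 where "x \<in> carrier Q" "y \<in> carrier Q" "s \<in> carrier Q" "d \<in> H" "r1 \<in> nz" "r2 \<in> nz"
    "r1 \<oplus>\<^bsub>R\<^esub> r2 \<in> nz" "x \<otimes> d = \<phi> r1" "y \<otimes> d = \<phi> r2" "s \<otimes> d = \<phi> (r1 \<oplus>\<^bsub>R\<^esub> r2)"
    using assms unfolding add_def by blast
  moreover from this have "r1 \<oplus>\<^bsub>R\<^esub> r2 = r2 \<oplus>\<^bsub>R\<^esub> r1" by (intro R.a_comm nz_carrier)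
  ultimately show ?thesis unfolding add_def by metis
qed

lemma add_carrier: "add x y s \<Longrightarrow> x \<in> carrier Q" "add x y s \<Longrightarrow> y \<in> carrier Q" "add x y s \<Longrightarrow> s \<in> carrier Q"
  unfolding add_def by blast+

lemma add_scale:
  assumes z: "z \<in> carrier Q" and a: "add x y s" shows "add (z \<otimes> x) (z \<otimes> y) (z \<otimes> s)"
proof -
  obtain d r1 r2 where *: "x \<in> carrier Q" "y \<in> carrier Q" "s \<in> carrier Q" "d \<in> H" "r1 \<in> nz" "r2 \<in> nz"
    "r1 \<oplus>\<^bsub>R\<^esub> r2 \<in> nz" "x \<otimes> d = \<phi> r1" "y \<otimes> d = \<phi> r2" "s \<otimes> d = \<phi> (r1 \<oplus>\<^bsub>R\<^esub> r2)"
    using a unfolding add_def by blast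
  obtain k where k: "k \<in> H" "k \<otimes> z \<in> H" using frac[OF z] .
  obtain r where r: "r \<in> nz" "k \<otimes> z = \<phi> r" using \<phi>_surj[OF k(2)] .
  have e: "z \<otimes> w \<otimes> (d \<otimes> k) = w \<otimes> d \<otimes> (k \<otimes> z)" if "w \<in> carrier Q" for w
    using that z *(4) k(1) by (simp add: gsimps)
  have "z \<otimes> x \<otimes> (d \<otimes> k) = \<phi> (r1 \<otimes>\<^bsub>R\<^esub> r)" "z \<otimes> y \<otimes> (d \<otimes> k) = \<phi> (r2 \<otimes>\<^bsub>R\<^esub> r)"
    "z \<otimes> s \<otimes> (d \<otimes> k) = \<phi> ((r1 \<oplus>\<^bsub>R\<^esub> r2) \<otimes>\<^bsub>R\<^esub> r)"
    unfolding e[OF *(1)] e[OF *(2)] e[OF *(3)] r(2) *(8-10) using *(5-7) r(1) by (simp_all add: \<phi>_mult)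
  moreover have "(r1 \<oplus>\<^bsub>R\<^esub> r2) \<otimes>\<^bsub>R\<^esub> r = r1 \<otimes>\<^bsub>R\<^esub> r \<oplus>\<^bsub>R\<^esub> r2 \<otimes>\<^bsub>R\<^esub> r"
    using *(5,6) r(1) by (intro R.l_distr nz_carrier)
  moreover have "(r1 \<oplus>\<^bsub>R\<^esub> r2) \<otimes>\<^bsub>R\<^esub> r \<in> nz" "r1 \<otimes>\<^bsub>R\<^esub> r \<in> nz" "r2 \<otimes>\<^bsub>R\<^esub> r \<in> nz" using *(5-7) r(1) by (simp_all add: nz_mult)
  moreover have "d \<otimes> k \<in> H" "z \<otimes> x \<in> carrier Q" "z \<otimes> y \<in> carrier Q" "z \<otimes> s \<in> carrier Q" using *(1-4) k z by auto
  ultimately show ?thesis unfolding add_def by metis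
qed

lemma add_minus: assumes "add x y s" shows "add s (y \<otimes> minus_one) x"
proof -
  obtain d r1 r2 where *: "x \<in> carrier Q" "y \<in> carrier Q" "s \<in> carrier Q" "d \<in> H" "r1 \<in> nz" "r2 \<in> nz"
    "r1 \<oplus>\<^bsub>R\<^esub> r2 \<in> nz" "x \<otimes> d = \<phi> r1" "y \<otimes> d = \<phi> r2" "s \<otimes> d = \<phi> (r1 \<oplus>\<^bsub>R\<^esub> r2)"
    using assms unfolding add_def by blast
  have "y \<otimes> minus_one \<otimes> d = y \<otimes> d \<otimes> minus_one" using *(2,4) minus_one(1) by (simp add: gsimps)
  then have "y \<otimes> minus_one \<otimes> d = \<phi> (\<ominus>\<^bsub>R\<^esub> r2)" unfolding *(9) \<phi>_minus(2)[OF *(6)] .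
  moreover have "r1 \<oplus>\<^bsub>R\<^esub> r2 \<oplus>\<^bsub>R\<^esub> (\<ominus>\<^bsub>R\<^esub> r2) = r1"
    using nz_carrier[OF *(5)] nz_carrier[OF *(6)] by (simp add: R.a_assoc R.r_neg)
  moreover have "y \<otimes> minus_one \<in> carrier Q" using *(2) minus_one(1) by simp
  ultimately show ?thesis unfolding add_def using * \<phi>_minus(1)[OF *(6)] by metis
qed

text \<open>The excluded case is the only one in which the numerators over a common denominator add
  up to zero.\<close>

lemma add_exists:
  assumes x: "x \<in> carrier Q" "y \<in> carrier Q" "x \<noteq> y \<otimes> minus_one" obtains s where "add x y s"
proof -
  obtain a where a: "a \<in> H" "a \<otimes> x \<in> H" using frac[OF x(1)] .
  obtain b where b: "b \<in> H" "b \<otimes> y \<in> H" using frac[OF x(2)] .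
  define d where "d = a \<otimes> b"
  have dH: "d \<in> H" using a b by (simp add: d_def)
  have xd: "x \<otimes> d = (a \<otimes> x) \<otimes> b" "y \<otimes> d = (b \<otimes> y) \<otimes> a" unfolding d_def using a(1) b(1) x by (simp_all add: gsimps)
  have "x \<otimes> d \<in> H" "y \<otimes> d \<in> H" unfolding xd using a b by blast+
  then obtain r1 r2 where r: "r1 \<in> nz" "x \<otimes> d = \<phi> r1" "r2 \<in> nz" "y \<otimes> d = \<phi> r2" using \<phi>_surj by metis
  have "r1 \<oplus>\<^bsub>R\<^esub> r2 \<in> nz"
  proof (rule ccontr)
    assume "r1 \<oplus>\<^bsub>R\<^esub> r2 \<notin> nz"
    then have "r1 \<oplus>\<^bsub>R\<^esub> r2 = \<zero>\<^bsub>R\<^esub>" using nz_carrier[OF r(1)] nz_carrier[OF r(3)] by (simp add: nz_def)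
    then have "r1 = \<ominus>\<^bsub>R\<^esub> r2" using nz_carrier[OF r(1)] nz_carrier[OF r(3)] R.minus_equality by metis
    then have "x \<otimes> d = y \<otimes> d \<otimes> minus_one" using r \<phi>_minus(2)[OF r(3)] by simp
    also have "\<dots> = y \<otimes> minus_one \<otimes> d" using x dH minus_one(1) by (simp add: gsimps)
    finally show False using x dH minus_one(1) r_cancel[of x d "y \<otimes> minus_one"] by auto
  qed
  then have *: "\<phi> (r1 \<oplus>\<^bsub>R\<^esub> r2) \<otimes> inv d \<otimes> d = \<phi> (r1 \<oplus>\<^bsub>R\<^esub> r2)" "\<phi> (r1 \<oplus>\<^bsub>R\<^esub> r2) \<otimes> inv d \<in> carrier Q"
    using dH \<phi>_H by (auto simp: m_assoc)
  have "add x y (\<phi> (r1 \<oplus>\<^bsub>R\<^esub> r2) \<otimes> inv d)"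
    unfolding add_def using x dH r * \<open>r1 \<oplus>\<^bsub>R\<^esub> r2 \<in> nz\<close> by blast
  then show ?thesis by (rule that)
qed

lemma add_closed_H: "add_closed H"
  unfolding add_closed_def
proof (intro ballI allI impI)
  fix x y s assume xy: "x \<in> H" "y \<in> H" "add x y s"
  then obtain d r1 r2 where *: "s \<in> carrier Q" "d \<in> H" "r1 \<in> nz" "r2 \<in> nz"
    "r1 \<oplus>\<^bsub>R\<^esub> r2 \<in> nz" "x \<otimes> d = \<phi> r1" "y \<otimes> d = \<phi> r2" "s \<otimes> d = \<phi> (r1 \<oplus>\<^bsub>R\<^esub> r2)"
    unfolding add_def by blast
  obtain rx where rx: "rx \<in> nz" "x = \<phi> rx" using \<phi>_surj[OF xy(1)] .
  obtain ry where ry: "ry \<in> nz" "y = \<phi> ry" using \<phi>_surj[OF xy(2)] .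
  obtain rd where rd: "rd \<in> nz" "d = \<phi> rd" using \<phi>_surj[OF *(2)] .
  have "r1 = rx \<otimes>\<^bsub>R\<^esub> rd" "r2 = ry \<otimes>\<^bsub>R\<^esub> rd"
    by (rule \<phi>_inj; use * rx ry rd in \<open>simp add: nz_mult \<phi>_mult\<close>)+
  then have e: "r1 \<oplus>\<^bsub>R\<^esub> r2 = (rx \<oplus>\<^bsub>R\<^esub> ry) \<otimes>\<^bsub>R\<^esub> rd"
    using nz_carrier rx ry rd by (simp add: R.l_distr)
  then have nz: "rx \<oplus>\<^bsub>R\<^esub> ry \<in> nz" using *(5) nz_carrier rx ry rd unfolding nz_def by auto
  have "s \<otimes> d = \<phi> (rx \<oplus>\<^bsub>R\<^esub> ry) \<otimes> d" using *(8) \<phi>_mult[OF nz rd(1)] unfolding e rd(2) by simp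
  then have "s = \<phi> (rx \<oplus>\<^bsub>R\<^esub> ry)" using *(1,2) \<phi>_H[OF nz] by simp
  then show "s \<in> H" using \<phi>_H[OF nz] by simp
qed

lemma add_closed_colon: assumes "add_closed A" "B \<subseteq> carrier Q" shows "add_closed (colon Q A B)"
  unfolding add_closed_def
proof (intro ballI allI impI)
  fix x y s assume x: "x \<in> colon Q A B" and y: "y \<in> colon Q A B" and a: "add x y s"
  have "s \<otimes> b \<in> A" if b: "b \<in> B" for b
  proof -
    have bQ: "b \<in> carrier Q" using b assms(2) by blast
    have "add (b \<otimes> x) (b \<otimes> y) (b \<otimes> s)" by (rule add_scale[OF bQ a])
    moreover have "b \<otimes> x \<in> A" "b \<otimes> y \<in> A"
      using x y b bQ by (auto simp: colon_iff m_comm[OF bQ])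
    ultimately have "b \<otimes> s \<in> A" using assms(1) unfolding add_closed_def by blast
    then show ?thesis using bQ add_carrier(3)[OF a] by (simp add: m_comm)
  qed
  then show "s \<in> colon Q A B" using add_carrier(3)[OF a] by (simp add: colon_iff)
qed

lemma add_closed_localize:
  assumes S: "quotient_group_of Q S" "prime_s_ideal Q S P" "add_closed S" shows "add_closed (localize Q S P S)"
proof -
  interpret S: quotient_group_of Q S by (rule S(1))
  show ?thesis
    unfolding add_closed_def
  proof (intro ballI allI impI)
    fix x y s assume xy: "x \<in> localize Q S P S" "y \<in> localize Q S P S" and a: "add x y s"
    obtain t where t: "t \<in> S - P" "\<forall>w\<in>{x, y}. t \<otimes> w \<in> S"
      using S.common_denominator[OF S(2), of "{x, y}"] xy by blast
    then have "add (t \<otimes> x) (t \<otimes> y) (t \<otimes> s)" by (intro add_scale a) auto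
    then have "t \<otimes> s \<in> S" using t(2) S(3) unfolding add_closed_def by blast
    then show "s \<in> localize Q S P S" using t(1) add_carrier(3)[OF a] by (intro S.localizeI[OF _ _ _ S.subset])
  qed
qed

end

section \<open>Weak approximation in domains\<close>

locale seminormal_weakly_krull_domain = seminormal_weakly_krull Q H + domain_monoid Q H R \<phi>
  for Q :: "('a, 'm) monoid_scheme" (structure) and H and R :: "('r, 'n) ring_scheme" and \<phi>
begin

text \<open>The definition by powers does not show closedness under addition, but \<open>K\<close>
  is also \<open>(cf : cf)\<close>. Colon sets inherit closedness from their first argument, here in
  two steps, from \<open>H\<close> to \<open>cf\<close> and from \<open>cf\<close> to
  \<open>K\<close>.\<close>

lemma add_closed_K: "add_closed K"
proof -
  have "K = colon Q cf cf"
  proof (intro equalityI subsetI)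
    fix x assume x: "x \<in> K"
    have xQ: "x \<in> carrier Q" by (rule K_carrier[OF x])
    have "x \<otimes> c \<in> cf" if c: "c \<in> cf" for c
      using cond_mult(1)[OF c x] m_comm[of c x] xQ c colon_subset[of H K] by (auto simp: subset_iff)
    then show "x \<in> colon Q cf cf" using xQ by (simp add: colon_iff[of x])
  next
    fix x assume x: "x \<in> colon Q cf cf"
    obtain c where c: "c \<in> cf" using cond(1) by blast
    have "x \<in> carrier Q" "x \<otimes> a \<in> cf" if "a \<in> cf" for a using x that by (simp_all add: colon_iff[of x])
    then show "x \<in> K" using c by (intro hatI[OF _ c cond_sub_H]) blast+
  qed
  moreover have "add_closed (colon Q cf cf)"
    by (intro add_closed_colon add_closed_H hat_carrier colon_subset)
  ultimately show ?thesis by simp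
qed

text \<open>Division by an element of the smaller value moves both summands into
  \<open>K.L P\<close>, which is closed under addition.\<close>

lemma val_add_ge:
  assumes P: "P \<in> K.X" and a: "add x y s" shows "min (val P x) (val P y) \<le> val P s"
proof -
  have cl: "add_closed (K.L P)" by (rule add_closed_localize[OF hat_quotient KX_prime[OF P] add_closed_K])
  have *: "val P w \<le> val P s" if w: "w \<in> carrier Q" "val P w \<le> val P x" "val P w \<le> val P y" for w
  proof -
    have "add (inv w \<otimes> x) (inv w \<otimes> y) (inv w \<otimes> s)" using w(1) a by (intro add_scale) auto
    moreover have "inv w \<otimes> x \<in> K.L P" "inv w \<otimes> y \<in> K.L P"
      using w add_carrier[OF a] by (simp_all add: valD[OF P])
    ultimately have "inv w \<otimes> s \<in> K.L P" using cl unfolding add_closed_def by blast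
    then show ?thesis using w(1) add_carrier(3)[OF a] by (simp add: valD[OF P])
  qed
  show ?thesis using *[OF add_carrier(1)[OF a]] *[OF add_carrier(2)[OF a]] by linarith
qed

lemma val_minus_one: assumes P: "P \<in> K.X" and y: "y \<in> carrier Q" shows "val P (y \<otimes> minus_one) = val P y"
proof -
  have m: "minus_one \<in> carrier Q" using minus_one(1) by blast
  have "val P minus_one + val P minus_one = 0" using valD(1)[OF P m m] minus_one(2) valD(3)[OF P] by simp
  then show ?thesis using valD(1)[OF P y m] by simp
qed

text \<open>The inequality in the other direction comes from writing \<open>x\<close> as the sum of
  \<open>s\<close> and \<open>-y\<close>.\<close>

lemma val_add_less:
  assumes P: "P \<in> K.X" and a: "add x y s" and l: "val P x < val P y" shows "val P s = val P x"
proof -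
  have "val P x \<le> val P s" using val_add_ge[OF P a] l by simp
  moreover have "min (val P s) (val P y) \<le> val P x"
    using val_add_ge[OF P add_minus[OF a]] val_minus_one[OF P add_carrier(2)[OF a]] by simp
  ultimately show ?thesis using l by linarith
qed

text \<open>To remove a positive value at a new \<open>P\<close>, add \<open>y = c^2\<close> with
  \<open>c\<close> outside \<open>P\<close> but in \<open>P0\<close> and in all primes of
  \<open>T\<close>: at \<open>P\<close> the value 0 of \<open>y\<close> is the smaller one, at the
  others the value of \<open>x\<close> is.\<close>

lemma weak_approximation:
  assumes P0: "P0 \<in> K.X" and T: "finite T" "T \<subseteq> K.X" "P0 \<notin> T"
  shows "\<exists>x\<in>K. val P0 x = 1 \<and> (\<forall>P\<in>T. val P x = 0)"
  using T
proof (induction T rule: finite_induct)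
  case empty
  then show ?case using K_uniformizer[OF P0] by blast
next
  case (insert P T)
  then obtain x where x: "x \<in> K" "val P0 x = 1" "\<forall>P\<in>T. val P x = 0" by blast
  have PX: "P \<in> K.X" using insert.prems by blast
  show ?case
  proof (cases "val P x = 0")
    case True
    then show ?thesis using x by blast
  next
    case False
    then have xP: "0 < val P x" using x(1) mem_K_iff PX by force
    obtain c where c: "c \<in> K - P" "\<And>P'. P' \<in> insert P0 T \<Longrightarrow> c \<in> P'"
      using K.prime_avoid[OF PX, of "insert P0 T"] insert P0 by blast
    \<comment> \<open>Squaring makes the value at \<open>P0\<close> at least 2, strictly larger than
      the value 1 of \<open>x\<close>, as \<open>val_add_less\<close> requires.\<close>
    define y where "y = c [^] (2::nat)"
    have cK: "c \<in> K" "c \<in> carrier Q" using c(1) K_carrier by blast+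
    have yK: "y \<in> K" unfolding y_def using cK(1) by (rule K.H_pow)
    have yQ: "y \<in> carrier Q" by (rule K_carrier[OF yK])
    have vy: "val P' y = 2 * val P' c" if "P' \<in> K.X" for P' unfolding y_def using valD(5)[OF that cK(2), of 2] by simp
    have yP: "val P y = 0"
      using vy[OF PX] val_pos_iff[OF PX cK(1)] c(1) mem_K_iff cK(1) PX by force
    have yT: "2 \<le> val P' y" if "P' \<in> insert P0 T" for P'
    proof -
      have P'X: "P' \<in> K.X" using that P0 insert.prems by blast
      have "0 < val P' c" using val_pos_iff[OF P'X cK(1)] c(2)[OF that] by blast
      then show ?thesis using vy[OF P'X] by simp
    qed
    have "x \<noteq> y \<otimes> minus_one" using val_minus_one[OF PX yQ] yP xP by auto
    then obtain s where s: "add x y s" using add_exists[OF K_carrier[OF x(1)] yQ] by blast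
    have "s \<in> K" using add_closed_K s x(1) yK unfolding add_closed_def by blast
    moreover have "val P0 s = 1" using val_add_less[OF P0 s] x(2) yT[of P0] by simp
    moreover have "val P s = 0" using val_add_less[OF PX add_comm[OF s]] yP xP by simp
    moreover have "val P' s = 0" if P': "P' \<in> T" for P'
    proof -
      have P'X: "P' \<in> K.X" using P' insert.prems by blast
      have "val P' x = 0" "2 \<le> val P' y" using x(3) yT P' by blast+
      then show ?thesis using val_add_less[OF P'X s] by simp
    qed
    ultimately show ?thesis by blast
  qed
qed

lemma independent_domain: assumes p: "p \<in> X" shows "independent p"
  unfolding independent_def
proof
  fix P assume P: "P \<in> over p"
  obtain x where "x \<in> K" "val P x = 1" "\<forall>P'\<in>over p - {P}. val P' x = 0"
    using weak_approximation[OF overD(1)[OF P], of "over p - {P}"] finite_over[OF p] overD(1) by blast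
  then show "\<exists>c\<in>carrier Q. val P c = 1 \<and> (\<forall>P'\<in>over p. P' \<noteq> P \<longrightarrow> val P' c = 0)"
    using K_carrier by blast
qed

end

section \<open>Weak divisor classes\<close>

lemma (in comm_group) subgroup_is_comm_group:
  assumes "subgroup N G" shows "comm_group (G\<lparr>carrier := N\<rparr>)"
proof -
  interpret N: subgroup N G by fact
  show ?thesis
    by (rule group.group_comm_groupI[OF N.subgroup_is_group[OF is_group]])
      (use N.subset in \<open>auto intro: m_comm\<close>)
qed

context mori_weakly_krull
begin

abbreviation "WCl \<equiv> weak_class_group Q H"

lemma group_WCl: "comm_group WCl"
  unfolding weak_class_group_def by (rule comm_group.abelian_FactGroup[OF group_Div subgroup_principal])

lemma carrier_WCl: "carrier WCl = weak_class Q H ` carrier Div"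
  unfolding weak_class_group_def carrier_FactGroup weak_class_def ..

lemma weak_class_mult:
  assumes "f \<in> carrier Div" "g \<in> carrier Div"
  shows "weak_class Q H (f \<otimes>\<^bsub>Div\<^esub> g) = weak_class Q H f \<otimes>\<^bsub>WCl\<^esub> weak_class Q H g"
  unfolding weak_class_group_def weak_class_def
  using comm_group.rcos_mult[OF group_Div subgroup_principal assms] by simp

lemma weak_class_eq_one:
  assumes f: "f \<in> carrier Div" shows "weak_class Q H f = \<one>\<^bsub>WCl\<^esub> \<longleftrightarrow> f \<in> principal_weak_divisors Q H"
proof -
  interpret D: comm_group Div by (rule group_Div)
  have s: "principal_weak_divisors Q H \<subseteq> carrier Div" by (rule subgroup.subset[OF subgroup_principal])
  have "weak_class Q H \<one>\<^bsub>Div\<^esub> = \<one>\<^bsub>WCl\<^esub>"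
    unfolding weak_class_def weak_class_group_def using D.coset_mult_one[OF s] by simp
  then have "weak_class Q H f = \<one>\<^bsub>WCl\<^esub> \<longleftrightarrow> weak_class Q H \<one>\<^bsub>Div\<^esub> = weak_class Q H f" by metis
  also have "\<dots> \<longleftrightarrow> inv\<^bsub>Div\<^esub> \<one>\<^bsub>Div\<^esub> \<otimes>\<^bsub>Div\<^esub> f \<in> principal_weak_divisors Q H"
    unfolding weak_class_def by (rule D.rcos_eq_iff[OF subgroup_principal D.one_closed f])
  finally show ?thesis using f by simp
qed

lemma principal_cosets_iff:
  assumes "fam x"
  shows "cosets x \<in> principal_weak_divisors Q H \<longleftrightarrow> (\<exists>a\<in>carrier Q. \<forall>p\<in>X. inv (x p) \<otimes> a \<in> U p)"
  unfolding principal_weak_divisors_def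
  using cosets_fam_eq_iff[OF assms fam_const] by (auto simp: image_iff)

lemma Units_H_iff: "x \<in> Units (Q\<lparr>carrier := H\<rparr>) \<longleftrightarrow> x \<in> carrier Q \<and> (\<forall>p\<in>X. x \<in> U p)"
proof -
  have "x \<in> Units (Q\<lparr>carrier := H\<rparr>) \<longleftrightarrow> x \<in> H \<and> inv x \<in> H" using Units_submonoid[OF is_submonoid] by blast
  also have "\<dots> \<longleftrightarrow> x \<in> carrier Q \<and> (\<forall>p\<in>X. x \<in> L p \<and> inv x \<in> L p)" using mem_H_iff by auto
  also have "\<dots> \<longleftrightarrow> x \<in> carrier Q \<and> (\<forall>p\<in>X. x \<in> U p)" by (intro conj_cong refl ball_cong) (simp add: U_iff[OF prime])
  finally show ?thesis .
qed

end

section \<open>The exact sequence\<close>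

context seminormal_weakly_krull
begin

abbreviation "V p \<equiv> Units (Q\<lparr>carrier := KL p\<rparr>)"
abbreviation "loc_grp p \<equiv> Q\<lparr>carrier := V p\<rparr> Mod U p"
abbreviation "Loc \<equiv> sum_group X loc_grp"
abbreviation "UK \<equiv> Units (Q\<lparr>carrier := K\<rparr>)"
abbreviation "UH \<equiv> Units (Q\<lparr>carrier := H\<rparr>)"

lemma V_iff: "p \<in> X \<Longrightarrow> x \<in> V p \<longleftrightarrow> x \<in> carrier Q \<and> (\<forall>P\<in>over p. val P x = 0)"
  using KL_Units by blast

lemma V_subgroup: "p \<in> X \<Longrightarrow> subgroup (V p) Q"
  by (rule Units_subgroup[OF KL_submonoid])

lemma U_sub_V: "p \<in> X \<Longrightarrow> U p \<subseteq> V p"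
  using U_val U_carrier[OF prime] V_iff by blast

lemma UK_iff: "x \<in> UK \<longleftrightarrow> x \<in> carrier Q \<and> (\<forall>p\<in>X. x \<in> V p)"
proof -
  have "x \<in> UK \<longleftrightarrow> x \<in> carrier Q \<and> (\<forall>P\<in>K.X. x \<in> K.U P)" by (rule K.Units_H_iff)
  also have "\<dots> \<longleftrightarrow> x \<in> carrier Q \<and> (\<forall>p\<in>X. \<forall>P\<in>over p. val P x = 0)"
  proof (intro conj_cong refl iffI ballI)
    fix p P assume "x \<in> carrier Q" "\<forall>P\<in>K.X. x \<in> K.U P" "P \<in> over p"
    then show "val P x = 0" using KU_iff[OF overD(1)] overD(1) by blast
  next
    fix P assume "x \<in> carrier Q" "\<forall>p\<in>X. \<forall>P\<in>over p. val P x = 0" "P \<in> K.X"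
    then show "x \<in> K.U P" using KU_iff contraction over_contraction by blast
  qed
  also have "\<dots> \<longleftrightarrow> x \<in> carrier Q \<and> (\<forall>p\<in>X. x \<in> V p)" by (auto simp: V_iff)
  finally show ?thesis .
qed

lemma loc_group: "p \<in> X \<Longrightarrow> comm_group (loc_grp p)"
  by (rule comm_group.abelian_FactGroup[OF subgroup_is_comm_group[OF V_subgroup]
        subgroup_incl[OF U_subgroup[OF prime] V_subgroup U_sub_V]])

lemma carrier_Loc: "carrier Loc = {cosets x | x. fam x \<and> (\<forall>p\<in>X. x p \<in> V p)}"
proof -
  have c: "carrier Loc = {f \<in> \<Pi>\<^sub>E p\<in>X. carrier (loc_grp p). finite {p \<in> X. f p \<noteq> \<one>\<^bsub>loc_grp p\<^esub>}}"
    by (rule carrier_sum_group) (use loc_group comm_group.axioms(2) in blast)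
  show ?thesis
  proof (intro equalityI subsetI)
    fix f assume f: "f \<in> carrier Loc"
    then have "\<forall>p\<in>X. \<exists>a\<in>V p. f p = U p #> a" unfolding c by (auto simp: PiE_iff carrier_FactGroup)
    then obtain x where x: "\<And>p. p \<in> X \<Longrightarrow> x p \<in> V p \<and> f p = U p #> x p" by metis
    have xQ: "x p \<in> carrier Q" if "p \<in> X" for p using x[OF that] V_iff[OF that] by blast
    have "f = cosets x"
    proof
      fix p show "f p = cosets x p"
        using f x unfolding c by (cases "p \<in> X") (auto simp: local_unit_cosets_def PiE_iff extensional_def)
    qed
    moreover have "{p \<in> X. x p \<notin> U p} = {p \<in> X. f p \<noteq> \<one>\<^bsub>loc_grp p\<^esub>}"
      by (intro Collect_cong conj_cong refl) (use x xQ coset_eq_U_iff in simp)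
    then have "fam x" using f xQ unfolding c fam_def by simp
    ultimately show "f \<in> {cosets x | x. fam x \<and> (\<forall>p\<in>X. x p \<in> V p)}" using x by blast
  next
    fix f assume "f \<in> {cosets x | x. fam x \<and> (\<forall>p\<in>X. x p \<in> V p)}"
    then obtain x where x: "fam x" "f = cosets x" "\<And>p. p \<in> X \<Longrightarrow> x p \<in> V p" by blast
    have "{p \<in> X. f p \<noteq> \<one>\<^bsub>loc_grp p\<^esub>} = {p \<in> X. x p \<notin> U p}"
      by (intro Collect_cong conj_cong refl)
        (use x coset_eq_U_iff fam_carrier[OF x(1)] in \<open>simp add: cosets_apply\<close>)
    then show "f \<in> carrier Loc"
      using x unfolding c by (auto simp: fam_def PiE_iff carrier_FactGroup local_unit_cosets_def)
  qed
qed

lemma Loc_sub_Div: "carrier Loc \<subseteq> carrier Div"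
  unfolding carrier_Loc carrier_Div by blast

lemma mult_Loc: "f \<otimes>\<^bsub>Loc\<^esub> g = f \<otimes>\<^bsub>Div\<^esub> g"
  unfolding weak_divisors_def by simp

section \<open>Extending divisors to the complete integral closure\<close>

text \<open>On divisors this is extension of ideals to the closure: the generator at the contraction
  of \<open>P\<close> also serves at \<open>P\<close>. The support stays finite because finitely
  many primes lie above each \<open>p\<close>.\<close>

lemma fam_contract:
  assumes x: "fam x" shows "K.fam (\<lambda>P. x (P \<inter> H))"
proof (rule K.fam_finite_support)
  show "finite (\<Union>p\<in>{p \<in> X. x p \<notin> U p}. over p)" using x finite_over by (auto simp: fam_def)
  show "x (P \<inter> H) \<in> carrier Q" if "P \<in> K.X" for P using fam_carrier[OF x contraction[OF that]] .
  show "x (P \<inter> H) \<in> K.U P" if P: "P \<in> K.X" "P \<notin> (\<Union>p\<in>{p \<in> X. x p \<notin> U p}. over p)" for P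
  proof -
    have "x (P \<inter> H) \<in> U (P \<inter> H)" using P over_contraction contraction by blast
    then have "val P (x (P \<inter> H)) = 0" using U_val[OF contraction[OF P(1)]] over_contraction[OF P(1)] by blast
    then show ?thesis using KU_iff[OF P(1)] fam_carrier[OF x contraction[OF P(1)]] by blast
  qed
qed

lemma contract_cosets_eq:
  assumes "fam x" "fam y" "\<forall>p\<in>X. inv (x p) \<otimes> y p \<in> V p"
  shows "K.cosets (\<lambda>P. x (P \<inter> H)) = K.cosets (\<lambda>P. y (P \<inter> H))"
  unfolding K.cosets_fam_eq_iff[OF fam_contract[OF assms(1)] fam_contract[OF assms(2)]]
proof
  fix P assume P: "P \<in> K.X"
  have "inv (x (P \<inter> H)) \<otimes> y (P \<inter> H) \<in> V (P \<inter> H)" using assms(3) contraction[OF P] by blast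
  then show "inv (x (P \<inter> H)) \<otimes> y (P \<inter> H) \<in> K.U P"
    using V_iff[OF contraction[OF P]] over_contraction[OF P] KU_iff[OF P] by blast
qed

text \<open>A local generator at the contraction of \<open>P\<close> still generates at
  \<open>P\<close>, since \<open>L (P \<inter> H)\<close> lies in \<open>K.L P\<close> and its units
  have value 0 at \<open>P\<close>.\<close>

lemma v_closure_contract:
  assumes x: "pos x"
  shows "v_closure Q K (ideal_of x) = K.ideal_of (\<lambda>P. x (P \<inter> H))" "K.pos (\<lambda>P. x (P \<inter> H))"
proof -
  have LK: "a \<in> K.L P" if "P \<in> K.X" "a \<in> L (P \<inter> H)" for a P
    using KL_iff[OF contraction[OF that(1)], of a] L_sub_KL that over_contraction[OF that(1)]
      valD(2)[OF that(1), of a] by blast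
  show "v_closure Q K (ideal_of x) = K.ideal_of (\<lambda>P. x (P \<inter> H))"
  proof (rule K.v_closure_local[OF fam_contract[OF pos_fam[OF x]] ideal_of_carrier])
    show "inv (x (P \<inter> H)) \<otimes> b \<in> K.L P" if "b \<in> ideal_of x" "P \<in> K.X" for b P
      using that contraction[OF that(2)] by (intro LK) (auto simp: ideal_of_def)
    show "\<exists>b\<in>ideal_of x. inv (x (P \<inter> H)) \<otimes> b \<in> K.U P" if P: "P \<in> K.X" for P
    proof -
      obtain b where b: "b \<in> ideal_of x" "inv (x (P \<inter> H)) \<otimes> b \<in> U (P \<inter> H)" "b \<in> carrier Q"
        using approximation[OF pos_fam[OF x] contraction[OF P]] .
      have "inv (x (P \<inter> H)) \<otimes> b \<in> V (P \<inter> H)" using U_sub_V[OF contraction[OF P]] b(2) by blast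
      then have "inv (x (P \<inter> H)) \<otimes> b \<in> K.U P"
        using V_iff[OF contraction[OF P]] over_contraction[OF P] KU_iff[OF P] by blast
      with b(1) show ?thesis by blast
    qed
  qed
  show "K.pos (\<lambda>P. x (P \<inter> H))"
    unfolding K.pos_def using fam_contract[OF pos_fam[OF x]] x LK contraction by (auto simp: pos_def)
qed

text \<open>Independence gives for each \<open>P\<close> an element of value 1 at \<open>P\<close>
  and 0 at the other primes with the same contraction; the component at \<open>p\<close> is the
  product of their powers with the prescribed exponents.\<close>

lemma independent_lift:
  assumes ind: "\<And>p. p \<in> X \<Longrightarrow> independent p" and y: "K.fam y"
  obtains x where "fam x" "K.cosets (\<lambda>P. x (P \<inter> H)) = K.cosets y"
proof -
  have yQ: "y P \<in> carrier Q" if "P \<in> K.X" for P using K.fam_carrier[OF y that] .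
  have "\<exists>c. c \<in> carrier Q \<and> val P c = 1 \<and> (\<forall>P'\<in>over (P \<inter> H). P' \<noteq> P \<longrightarrow> val P' c = 0)" if P: "P \<in> K.X" for P
    using ind[OF contraction[OF P]] over_contraction[OF P] unfolding independent_def by blast
  then obtain c where c: "\<And>P. P \<in> K.X \<Longrightarrow> c P \<in> carrier Q \<and> val P (c P) = 1 \<and>
      (\<forall>P'\<in>over (P \<inter> H). P' \<noteq> P \<longrightarrow> val P' (c P) = 0)" by metis
  define x where "x p = finprod Q (\<lambda>P. c P [^] val P (y P)) (over p)" for p
  have cQ: "c P [^] k \<in> carrier Q" if "P \<in> over p" for P p and k :: int using c overD(1)[OF that] by simp
  have xQ: "x p \<in> carrier Q" for p unfolding x_def by (rule finprod_closed) (use cQ in blast)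
  have vx: "val P (x p) = val P (y P)" if p: "p \<in> X" and P: "P \<in> over p" for p P
  proof -
    have "val P (x p) = (\<Sum>P'\<in>over p. val P (c P' [^] val P' (y P')))"
      unfolding x_def by (rule valD(7)[OF overD(1)[OF P]]) (use cQ in blast)
    also have "\<dots> = (\<Sum>P'\<in>over p. if P' = P then val P (y P) else 0)"
    proof (rule sum.cong[OF refl])
      fix P' assume P': "P' \<in> over p"
      have "P \<in> over (P' \<inter> H)" using P P' overD(2) by simp
      then show "val P (c P' [^] val P' (y P')) = (if P' = P then val P (y P) else 0)"
        using c[OF overD(1)[OF P']] valD(6)[OF overD(1)[OF P], of "c P'"] by auto
    qed
    also have "\<dots> = val P (y P)" using P finite_over[OF p] by simp
    finally show ?thesis .
  qed
  have "fam x"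
  proof (rule fam_finite_support)
    show "finite ((\<lambda>P. P \<inter> H) ` {P \<in> K.X. y P \<notin> K.U P})" using y by (auto simp: K.fam_def)
    show "x p \<in> U p" if p: "p \<in> X" "p \<notin> (\<lambda>P. P \<inter> H) ` {P \<in> K.X. y P \<notin> K.U P}" for p
    proof -
      have "val P (y P) = 0" if P: "P \<in> over p" for P
        using p(2) overD[OF P] KU_iff[OF overD(1)[OF P], of "y P"] by blast
      \<comment> \<open>All exponents vanish here, so the product is 1 itself, and this keeps the
        support finite.\<close>
      then have "x p = \<one>" unfolding x_def by (intro finprod_one_eqI) simp
      then show ?thesis using U_one[OF prime[OF p(1)]] by simp
    qed
  qed (rule xQ)
  moreover have "K.cosets (\<lambda>P. x (P \<inter> H)) = K.cosets y"
    unfolding K.cosets_fam_eq_iff[OF fam_contract[OF \<open>fam x\<close>] y]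
  proof
    fix P assume P: "P \<in> K.X"
    have "val P (inv (x (P \<inter> H)) \<otimes> y P) = 0"
      using vx[OF contraction[OF P] over_contraction[OF P]] xQ yQ[OF P] by (simp add: valD(1,4)[OF P])
    then show "inv (x (P \<inter> H)) \<otimes> y P \<in> K.U P" using KU_iff[OF P] xQ yQ[OF P] by simp
  qed
  ultimately show ?thesis by (rule that)
qed

text \<open>The map on classes is built from divisors, which form a group, and factored through the
  principal ones; the description by \<open>v\<close>-closures of ideals is matched in
  \<open>exact_sequence\<close>.\<close>

lemma contraction_hom:
  obtains \<kappa> where "\<kappa> \<in> hom WCl K.WCl"
    "\<forall>x. fam x \<longrightarrow> \<kappa> (weak_class Q H (cosets x)) = weak_class Q K (K.cosets (\<lambda>P. x (P \<inter> H)))"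
proof -
  interpret D: comm_group Div by (rule group_Div)
  let ?\<kappa> = "\<lambda>f. weak_class Q K (K.cosets (\<lambda>P. (SOME x. fam x \<and> f = cosets x) (P \<inter> H)))"
  have \<kappa>: "?\<kappa> (cosets x) = weak_class Q K (K.cosets (\<lambda>P. x (P \<inter> H)))" if x: "fam x" for x
  proof -
    let ?y = "SOME y. fam y \<and> cosets x = cosets y"
    have y: "fam ?y \<and> cosets x = cosets ?y" by (rule someI[of _ x]) (use x in simp)
    then have "\<forall>p\<in>X. inv (x p) \<otimes> ?y p \<in> U p" using cosets_fam_eq_iff[OF x, of ?y] by simp
    then have "\<forall>p\<in>X. inv (x p) \<otimes> ?y p \<in> V p" using U_sub_V by blast
    then show ?thesis using contract_cosets_eq[OF x, of ?y] y by simp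
  qed
  have in_K: "K.cosets (\<lambda>P. x (P \<inter> H)) \<in> carrier K.Div" if "fam x" for x
    by (rule K.cosets_Div[OF fam_contract[OF that]])
  have hom: "?\<kappa> \<in> hom Div K.WCl"
  proof (rule homI)
    fix f assume "f \<in> carrier Div"
    then obtain x where x: "fam x" "f = cosets x" unfolding carrier_Div by blast
    show "?\<kappa> f \<in> carrier K.WCl" unfolding x(2) \<kappa>[OF x(1)] K.carrier_WCl using in_K[OF x(1)] by blast
    fix g assume "g \<in> carrier Div"
    then obtain y where y: "fam y" "g = cosets y" unfolding carrier_Div by blast
    have "?\<kappa> (f \<otimes>\<^bsub>Div\<^esub> g) = weak_class Q K (K.cosets (\<lambda>P. x (P \<inter> H) \<otimes> y (P \<inter> H)))"
      unfolding x(2) y(2) mult_Div_fam[OF x(1) y(1)] by (rule \<kappa>[OF fam_mult[OF x(1) y(1)]])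
    also have "K.cosets (\<lambda>P. x (P \<inter> H) \<otimes> y (P \<inter> H)) =
        K.cosets (\<lambda>P. x (P \<inter> H)) \<otimes>\<^bsub>K.Div\<^esub> K.cosets (\<lambda>P. y (P \<inter> H))"
      by (rule K.mult_Div_fam[OF fam_contract[OF x(1)] fam_contract[OF y(1)], symmetric])
    also have "weak_class Q K \<dots> = ?\<kappa> f \<otimes>\<^bsub>K.WCl\<^esub> ?\<kappa> g"
      unfolding x(2) y(2) \<kappa>[OF x(1)] \<kappa>[OF y(1)] by (rule K.weak_class_mult[OF in_K[OF x(1)] in_K[OF y(1)]])
    finally show "?\<kappa> (f \<otimes>\<^bsub>Div\<^esub> g) = ?\<kappa> f \<otimes>\<^bsub>K.WCl\<^esub> ?\<kappa> g" .
  qed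
  interpret h: group_hom Div K.WCl ?\<kappa>
    by (intro group_hom.intro group_hom_axioms.intro D.is_group comm_group.axioms(2)[OF K.group_WCl] hom)
  have "principal_weak_divisors Q H \<subseteq> kernel Div K.WCl ?\<kappa>"
  proof
    fix f assume "f \<in> principal_weak_divisors Q H"
    then obtain a where a: "a \<in> carrier Q" "f = cosets (\<lambda>p. a)" unfolding principal_weak_divisors_def by blast
    have "K.cosets (\<lambda>P. a) \<in> principal_weak_divisors Q K" using a(1) unfolding principal_weak_divisors_def by blast
    then have "?\<kappa> f = \<one>\<^bsub>K.WCl\<^esub>"
      unfolding a(2) \<kappa>[OF fam_const[OF a(1)]]
      using K.weak_class_eq_one[OF K.cosets_Div[OF K.fam_const[OF a(1)]]] by blast
    then show "f \<in> kernel Div K.WCl ?\<kappa>" unfolding kernel_def using a cosets_Div[OF fam_const[OF a(1)]] by simp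
  qed
  from h.FactGroup_universal_kernel[OF D.subgroup_imp_normal[OF subgroup_principal] this]
  obtain g where g: "g \<in> hom WCl K.WCl" "\<And>f. f \<in> carrier Div \<Longrightarrow> g (weak_class Q H f) = ?\<kappa> f"
    unfolding weak_class_group_def[of Q H] weak_class_def[of Q H] by blast
  show ?thesis
    by (rule that[OF g(1)]) (use g(2) cosets_Div \<kappa> in simp)
qed

lemma unit_hom:
  obtains \<iota> where "\<iota> \<in> hom (Q\<lparr>carrier := UK\<rparr> Mod UH) Loc" "\<forall>u\<in>UK. \<iota> (UH #> u) = cosets (\<lambda>p. u)"
proof -
  have sK: "subgroup UK Q" by (rule Units_subgroup[OF hat_submonoid])
  have sH: "subgroup UH Q" by (rule Units_subgroup[OF is_submonoid])
  have "UH \<subseteq> UK" using UK_iff Units_H_iff U_sub_V by blast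
  then have sub: "subgroup UH (Q\<lparr>carrier := UK\<rparr>)" by (rule subgroup_incl[OF sH sK])
  interpret GK: comm_group "Q\<lparr>carrier := UK\<rparr>" by (rule subgroup_is_comm_group[OF sK])
  have UKQ: "u \<in> carrier Q" if "u \<in> UK" for u using that UK_iff by blast
  have hom: "(\<lambda>u. cosets (\<lambda>p. u)) \<in> hom (Q\<lparr>carrier := UK\<rparr>) Loc"
  proof (rule homI)
    fix u assume u: "u \<in> carrier (Q\<lparr>carrier := UK\<rparr>)"
    then show "cosets (\<lambda>p. u) \<in> carrier Loc"
      unfolding carrier_Loc using UK_iff[of u] fam_const[of u] by auto
    fix w assume w: "w \<in> carrier (Q\<lparr>carrier := UK\<rparr>)"
    show "cosets (\<lambda>p. u \<otimes>\<^bsub>Q\<lparr>carrier := UK\<rparr>\<^esub> w) = cosets (\<lambda>p. u) \<otimes>\<^bsub>Loc\<^esub> cosets (\<lambda>p. w)"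
      unfolding mult_Loc using mult_Div_fam[OF fam_const[of u] fam_const[of w]] UKQ u w by simp
  qed
  obtain \<iota> where \<iota>: "\<iota> \<in> hom (Q\<lparr>carrier := UK\<rparr> Mod UH) Loc"
    "\<And>u. u \<in> carrier (Q\<lparr>carrier := UK\<rparr>) \<Longrightarrow> \<iota> (UH #>\<^bsub>Q\<lparr>carrier := UK\<rparr>\<^esub> u) = cosets (\<lambda>p. u)"
  proof (rule FactGroup_universal[OF hom GK.subgroup_imp_normal[OF sub]])
    fix u w assume u: "u \<in> carrier (Q\<lparr>carrier := UK\<rparr>)" "w \<in> carrier (Q\<lparr>carrier := UK\<rparr>)"
      "UH #>\<^bsub>Q\<lparr>carrier := UK\<rparr>\<^esub> u = UH #>\<^bsub>Q\<lparr>carrier := UK\<rparr>\<^esub> w"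
    then have "inv u \<otimes> w \<in> UH" using rcos_eq_iff[OF sH UKQ UKQ, of u w] by simp
    then show "cosets (\<lambda>p. u) = cosets (\<lambda>p. w)"
      using cosets_fam_eq_iff[OF fam_const fam_const, of u w] u(1,2) UKQ Units_H_iff[of "inv u \<otimes> w"] by simp
  qed blast
  show ?thesis by (rule that[OF \<iota>(1)]) (use \<iota>(2) in simp)
qed

lemma exact_sequence:
  assumes ind: "\<And>p. p \<in> X \<Longrightarrow> independent p"
  shows "\<exists>\<iota> \<psi> \<epsilon> \<theta>.
    canonical_class_iso Q H \<psi> \<and>
    \<iota> \<in> hom (Q\<lparr>carrier := UK\<rparr> Mod UH) Loc \<and>
    \<epsilon> \<in> hom Loc (v_class_group Q H) \<and>
    \<theta> \<in> hom (v_class_group Q H) (v_class_group Q K) \<and>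
    (\<forall>u\<in>UK. \<iota> (UH #> u) = cosets (\<lambda>p. u)) \<and>
    (\<forall>y\<in>carrier Loc. y \<in> carrier Div \<and> \<psi> (\<epsilon> y) = weak_class Q H y) \<and>
    (\<forall>A\<in>carrier Inv. v_closure Q K A \<in> carrier K.Inv \<and>
      \<theta> (v_class Q H A) = v_class Q K (v_closure Q K A)) \<and>
    inj_on \<iota> (carrier (Q\<lparr>carrier := UK\<rparr> Mod UH)) \<and>
    \<iota> ` carrier (Q\<lparr>carrier := UK\<rparr> Mod UH) = kernel Loc (v_class_group Q H) \<epsilon> \<and>
    \<epsilon> ` carrier Loc = kernel (v_class_group Q H) (v_class_group Q K) \<theta> \<and>
    \<theta> ` carrier (v_class_group Q H) = carrier (v_class_group Q K)"
proof -
  let ?C = "v_class_group Q H" and ?CK = "v_class_group Q K" and ?E = "Q\<lparr>carrier := UK\<rparr> Mod UH"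
  obtain \<psi> where can: "canonical_class_iso Q H \<psi>" and C: "comm_group ?C"
    and \<psi>cls: "\<forall>x. pos x \<longrightarrow> \<psi> (v_class Q H (ideal_of x)) = weak_class Q H (cosets x)"
    and inC: "\<forall>x. pos x \<longrightarrow> v_class Q H (ideal_of x) \<in> carrier ?C" using class_iso .
  obtain \<psi>K where canK: "canonical_class_iso Q K \<psi>K" and CK: "comm_group ?CK"
    and \<psi>Kcls: "\<forall>x. K.pos x \<longrightarrow> \<psi>K (v_class Q K (K.ideal_of x)) = weak_class Q K (K.cosets x)"
    and inCK: "\<forall>x. K.pos x \<longrightarrow> v_class Q K (K.ideal_of x) \<in> carrier ?CK" using K.class_iso .
  obtain \<kappa> where \<kappa>: "\<kappa> \<in> hom WCl K.WCl"
    "\<forall>x. fam x \<longrightarrow> \<kappa> (weak_class Q H (cosets x)) = weak_class Q K (K.cosets (\<lambda>P. x (P \<inter> H)))"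
    using contraction_hom .
  obtain \<iota> where \<iota>: "\<iota> \<in> hom ?E Loc" "\<forall>u\<in>UK. \<iota> (UH #> u) = cosets (\<lambda>p. u)" using unit_hom .
  interpret C: comm_group ?C by (rule C)
  interpret CK: comm_group ?CK by (rule CK)
  interpret W: comm_group WCl by (rule group_WCl)
  interpret WK: comm_group K.WCl by (rule K.group_WCl)
  interpret D: comm_group Div by (rule group_Div)
  have \<psi>iso: "\<psi> \<in> iso ?C WCl" and \<psi>Kiso: "\<psi>K \<in> iso ?CK K.WCl"
    using can canK unfolding canonical_class_iso_def by blast+
  define \<eta> where "\<eta> = inv_into (carrier ?C) \<psi>"
  define \<eta>K where "\<eta>K = inv_into (carrier ?CK) \<psi>K"
  have \<eta>iso: "\<eta> \<in> iso WCl ?C" unfolding \<eta>_def by (rule C.iso_set_sym[OF \<psi>iso])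
  have \<eta>Kiso: "\<eta>K \<in> iso K.WCl ?CK" unfolding \<eta>K_def by (rule CK.iso_set_sym[OF \<psi>Kiso])
  have b: "bij_betw \<psi> (carrier ?C) (carrier WCl)" "bij_betw \<psi>K (carrier ?CK) (carrier K.WCl)"
    using \<psi>iso \<psi>Kiso by (simp_all add: iso_def)
  have \<psi>\<eta>: "\<psi> (\<eta> w) = w" if "w \<in> carrier WCl" for w
    unfolding \<eta>_def using b(1) that by (simp add: bij_betw_def f_inv_into_f)
  have \<eta>\<psi>: "\<eta> (\<psi> c) = c" if "c \<in> carrier ?C" for c
    unfolding \<eta>_def using b(1) that by (simp add: bij_betw_def)
  have \<eta>K\<psi>K: "\<eta>K (\<psi>K c) = c" if "c \<in> carrier ?CK" for c
    unfolding \<eta>K_def using b(2) that by (simp add: bij_betw_def)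
  interpret h\<psi>: group_hom ?C WCl \<psi> by unfold_locales (use \<psi>iso in \<open>simp add: iso_def\<close>)
  interpret h\<eta>: group_hom WCl ?C \<eta> by unfold_locales (use \<eta>iso in \<open>simp add: iso_def\<close>)
  interpret h\<eta>K: group_hom K.WCl ?CK \<eta>K by unfold_locales (use \<eta>Kiso in \<open>simp add: iso_def\<close>)
  interpret h\<kappa>: group_hom WCl K.WCl \<kappa> by unfold_locales (rule \<kappa>(1))
  have \<eta>_one: "\<eta> w = \<one>\<^bsub>?C\<^esub> \<longleftrightarrow> w = \<one>\<^bsub>WCl\<^esub>" if "w \<in> carrier WCl" for w
    using \<psi>\<eta>[OF that] h\<eta>.hom_one h\<psi>.hom_one by auto
  have \<eta>K_one: "\<eta>K w = \<one>\<^bsub>?CK\<^esub> \<longleftrightarrow> w = \<one>\<^bsub>K.WCl\<^esub>" if "w \<in> carrier K.WCl" for w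
  proof -
    have "inj_on \<eta>K (carrier K.WCl)" using \<eta>Kiso by (simp add: iso_def bij_betw_def)
    then show ?thesis using that h\<eta>K.hom_one WK.one_closed by (metis inj_onD)
  qed
  have cW: "weak_class Q H (cosets x) \<in> carrier WCl" if "fam x" for x
    unfolding carrier_WCl using cosets_Div[OF that] by blast
  have cWK: "weak_class Q K (K.cosets x) \<in> carrier K.WCl" if "K.fam x" for x
    unfolding K.carrier_WCl using K.cosets_Div[OF that] by blast
  \<comment> \<open>\<open>\<epsilon>\<close> and \<open>\<theta>\<close> come from the maps on weak
    divisor classes, transported along the canonical isomorphisms for \<open>H\<close> and for its
    closure.\<close>
  define \<epsilon> where "\<epsilon> y = \<eta> (weak_class Q H y)" for y
  define \<theta> where "\<theta> c = \<eta>K (\<kappa> (\<psi> c))" for c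
  have \<epsilon>hom: "\<epsilon> \<in> hom Loc ?C"
  proof (rule homI)
    fix f assume f: "f \<in> carrier Loc"
    then have fD: "f \<in> carrier Div" using Loc_sub_Div by blast
    show "\<epsilon> f \<in> carrier ?C" unfolding \<epsilon>_def using fD carrier_WCl by auto
    fix g assume "g \<in> carrier Loc"
    then have gD: "g \<in> carrier Div" using Loc_sub_Div by blast
    show "\<epsilon> (f \<otimes>\<^bsub>Loc\<^esub> g) = \<epsilon> f \<otimes>\<^bsub>?C\<^esub> \<epsilon> g"
      unfolding \<epsilon>_def mult_Loc weak_class_mult[OF fD gD] by (rule h\<eta>.hom_mult) (use fD gD carrier_WCl in auto)
  qed
  have \<theta>hom: "\<theta> \<in> hom ?C ?CK"
    unfolding \<theta>_def by (rule homI) simp_all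
  have \<theta>val: "\<theta> (\<eta> (weak_class Q H (cosets x))) = \<eta>K (weak_class Q K (K.cosets (\<lambda>P. x (P \<inter> H))))"
    if "fam x" for x unfolding \<theta>_def using \<psi>\<eta>[OF cW[OF that]] \<kappa>(2) that by simp
  have repC: "\<exists>x. fam x \<and> c = \<eta> (weak_class Q H (cosets x))" if c: "c \<in> carrier ?C" for c
  proof -
    have "\<psi> c \<in> carrier WCl" using c by simp
    then obtain x where "fam x" "\<psi> c = weak_class Q H (cosets x)" unfolding carrier_WCl carrier_Div by blast
    then show ?thesis using \<eta>\<psi>[OF c] by metis
  qed
  have \<epsilon>\<psi>: "y \<in> carrier Div \<and> \<psi> (\<epsilon> y) = weak_class Q H y" if "y \<in> carrier Loc" for y
  proof -
    have "y \<in> carrier Div" using Loc_sub_Div that by blast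
    moreover from this have "weak_class Q H y \<in> carrier WCl" using carrier_WCl by blast
    ultimately show ?thesis unfolding \<epsilon>_def using \<psi>\<eta> by blast
  qed
  have \<theta>A: "v_closure Q K A \<in> carrier K.Inv \<and> \<theta> (v_class Q H A) = v_class Q K (v_closure Q K A)"
    if A: "A \<in> carrier Inv" for A
  proof -
    obtain x where x: "pos x" "A = ideal_of x" using A unfolding carrier_Inv by blast
    note vc = v_closure_contract[OF x(1)]
    have "\<theta> (v_class Q H A) = \<eta>K (\<psi>K (v_class Q K (K.ideal_of (\<lambda>P. x (P \<inter> H)))))"
      unfolding \<theta>_def x(2) using \<psi>cls x(1) \<kappa>(2) pos_fam[OF x(1)] \<psi>Kcls vc(2) by simp
    also have "\<dots> = v_class Q K (v_closure Q K A)" unfolding x(2) vc(1) using \<eta>K\<psi>K inCK vc(2) by simp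
    finally show ?thesis unfolding x(2) vc(1) using K.ideal_of_Inv[OF vc(2)] by simp
  qed
  have sH: "subgroup UH Q" by (rule Units_subgroup[OF is_submonoid])
  have carE: "carrier ?E = (\<lambda>u. UH #> u) ` UK" unfolding carrier_FactGroup by simp
  have UKQ: "u \<in> carrier Q" if "u \<in> UK" for u using that UK_iff by blast
  have \<iota>inj: "inj_on \<iota> (carrier ?E)"
  proof (rule inj_onI)
    fix e e' assume "e \<in> carrier ?E" "e' \<in> carrier ?E" and eq: "\<iota> e = \<iota> e'"
    then obtain u w where u: "u \<in> UK" "e = UH #> u" and w: "w \<in> UK" "e' = UH #> w" unfolding carE by blast
    have "cosets (\<lambda>p. u) = cosets (\<lambda>p. w)" using eq \<iota>(2) u w by simp
    then have "\<forall>p\<in>X. inv u \<otimes> w \<in> U p"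
      using cosets_fam_eq_iff[OF fam_const fam_const, of u w] UKQ u(1) w(1) by simp
    then have "inv u \<otimes> w \<in> UH" using Units_H_iff UKQ u(1) w(1) by simp
    then show "e = e'" unfolding u(2) w(2) using rcos_eq_iff[OF sH UKQ[OF u(1)] UKQ[OF w(1)]] by blast
  qed
  have \<iota>img: "\<iota> ` carrier ?E = kernel Loc ?C \<epsilon>"
  proof (intro equalityI subsetI)
    fix f assume "f \<in> \<iota> ` carrier ?E"
    then obtain u where u: "u \<in> UK" "f = cosets (\<lambda>p. u)" unfolding carE using \<iota>(2) by auto
    have uQ: "u \<in> carrier Q" by (rule UKQ[OF u(1)])
    have fD: "f \<in> carrier Div" unfolding u(2) by (rule cosets_Div[OF fam_const[OF uQ]])
    have "f \<in> principal_weak_divisors Q H" unfolding u(2) principal_weak_divisors_def using uQ by blast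
    then have "\<epsilon> f = \<one>\<^bsub>?C\<^esub>" unfolding \<epsilon>_def using weak_class_eq_one[OF fD] by simp
    moreover have "f \<in> carrier Loc" unfolding u(2) carrier_Loc using fam_const[OF uQ] u(1) UK_iff by blast
    ultimately show "f \<in> kernel Loc ?C \<epsilon>" by (simp add: kernel_def)
  next
    fix f assume "f \<in> kernel Loc ?C \<epsilon>"
    then have f: "f \<in> carrier Loc" "\<epsilon> f = \<one>\<^bsub>?C\<^esub>" by (simp_all add: kernel_def)
    then obtain x where x: "fam x" "f = cosets x" "\<forall>p\<in>X. x p \<in> V p" unfolding carrier_Loc by blast
    have "weak_class Q H f = \<one>\<^bsub>WCl\<^esub>" using f(2) \<eta>_one[OF cW[OF x(1)]] unfolding \<epsilon>_def x(2) by simp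
    then have "cosets x \<in> principal_weak_divisors Q H"
      unfolding x(2) using weak_class_eq_one[OF cosets_Div[OF x(1)]] by blast
    \<comment> \<open>The trivial class provides one \<open>a\<close> that agrees with all
      \<open>x p\<close> up to units of \<open>L p\<close>; as the \<open>x p\<close> are units of
      the localized closures, \<open>a\<close> is a unit of the closure.\<close>
    then obtain a where a: "a \<in> carrier Q" "\<forall>p\<in>X. inv (x p) \<otimes> a \<in> U p"
      using principal_cosets_iff[OF x(1)] by blast
    have "a \<in> V p" if p: "p \<in> X" for p
    proof -
      have "x p \<in> V p" "inv (x p) \<otimes> a \<in> V p" using x(3) a(2) U_sub_V[OF p] p by blast+
      then have "x p \<otimes> (inv (x p) \<otimes> a) \<in> V p" by (rule subgroup.m_closed[OF V_subgroup[OF p]])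
      then show ?thesis using a(1) fam_carrier[OF x(1) p] by (simp add: cancel_simps)
    qed
    then have aUK: "a \<in> UK" using UK_iff a(1) by blast
    have "f = cosets (\<lambda>p. a)" unfolding x(2) using cosets_fam_eq_iff[OF x(1) fam_const[OF a(1)]] a(2) by blast
    then have "f = \<iota> (UH #> a)" using \<iota>(2) aUK by simp
    then show "f \<in> \<iota> ` carrier ?E" unfolding carE using aUK by blast
  qed
  have \<epsilon>img: "\<epsilon> ` carrier Loc = kernel ?C ?CK \<theta>"
  proof (intro equalityI subsetI)
    fix c assume "c \<in> \<epsilon> ` carrier Loc"
    then obtain x where x: "fam x" "\<forall>p\<in>X. x p \<in> V p" "c = \<epsilon> (cosets x)" unfolding carrier_Loc by blast
    have "\<forall>p\<in>X. inv \<one> \<otimes> x p \<in> V p" using x(2) fam_carrier[OF x(1)] by simp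
    then have "K.cosets (\<lambda>P. x (P \<inter> H)) = K.cosets (\<lambda>P. \<one>)"
      using contract_cosets_eq[OF fam_const x(1), of \<one>] by simp
    then have "K.cosets (\<lambda>P. x (P \<inter> H)) = \<one>\<^bsub>K.Div\<^esub>" by (simp add: K.one_Div)
    then have "weak_class Q K (K.cosets (\<lambda>P. x (P \<inter> H))) = \<one>\<^bsub>K.WCl\<^esub>"
      using K.weak_class_eq_one[OF K.cosets_Div[OF fam_contract[OF x(1)]]]
        subgroup.one_closed[OF K.subgroup_principal] by simp
    then have "\<theta> c = \<one>\<^bsub>?CK\<^esub>" unfolding x(3) \<epsilon>_def using \<theta>val[OF x(1)] by simp
    moreover have "c \<in> carrier ?C" unfolding x(3) \<epsilon>_def using cW[OF x(1)] by simp
    ultimately show "c \<in> kernel ?C ?CK \<theta>" by (simp add: kernel_def)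
  next
    fix c assume "c \<in> kernel ?C ?CK \<theta>"
    then have c: "c \<in> carrier ?C" "\<theta> c = \<one>\<^bsub>?CK\<^esub>" by (simp_all add: kernel_def)
    obtain x where x: "fam x" "c = \<eta> (weak_class Q H (cosets x))" using repC[OF c(1)] by blast
    note fx = fam_contract[OF x(1)]
    have "weak_class Q K (K.cosets (\<lambda>P. x (P \<inter> H))) = \<one>\<^bsub>K.WCl\<^esub>"
      using c(2) \<theta>val[OF x(1)] \<eta>K_one[OF cWK[OF fx]] unfolding x(2) by simp
    then have "K.cosets (\<lambda>P. x (P \<inter> H)) \<in> principal_weak_divisors Q K"
      using K.weak_class_eq_one[OF K.cosets_Div[OF fx]] by blast
    \<comment> \<open>Here \<open>a\<close> only has the right values. Dividing the whole family by
      it leaves local units of the closure and does not change the class.\<close>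
    then obtain a where a: "a \<in> carrier Q" "\<forall>P\<in>K.X. inv (x (P \<inter> H)) \<otimes> a \<in> K.U P"
      using K.principal_cosets_iff[OF fx] by blast
    have fa: "fam (\<lambda>p. x p \<otimes> inv a)" by (intro fam_mult x(1) fam_const) (use a(1) in simp)
    have "x p \<otimes> inv a \<in> V p" if p: "p \<in> X" for p
    proof -
      have xQ: "x p \<in> carrier Q" by (rule fam_carrier[OF x(1) p])
      have "val P (x p \<otimes> inv a) = 0" if P: "P \<in> over p" for P
      proof -
        have "inv (x p) \<otimes> a \<in> K.U P" using a(2) overD[OF P] by blast
        then have "val P (inv (x p) \<otimes> a) = 0" using KU_iff[OF overD(1)[OF P]] by blast
        then show ?thesis using xQ a(1) by (simp add: valD(1,4)[OF overD(1)[OF P]])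
      qed
      then show ?thesis using V_iff[OF p] xQ a(1) by simp
    qed
    then have inL: "cosets (\<lambda>p. x p \<otimes> inv a) \<in> carrier Loc" unfolding carrier_Loc using fa by blast
    have "cosets (\<lambda>p. inv a) \<in> principal_weak_divisors Q H" unfolding principal_weak_divisors_def using a(1) by auto
    then have "weak_class Q H (cosets (\<lambda>p. inv a)) = \<one>\<^bsub>WCl\<^esub>"
      using weak_class_eq_one[OF cosets_Div[OF fam_const]] a(1) by simp
    then have "weak_class Q H (cosets (\<lambda>p. x p \<otimes> inv a)) = weak_class Q H (cosets x)"
      using weak_class_mult[OF cosets_Div[OF x(1)] cosets_Div[OF fam_const[of "inv a"]]] a(1)
        mult_Div_fam[OF x(1) fam_const[of "inv a"]] cW[OF x(1)] by simp
    then have "c = \<epsilon> (cosets (\<lambda>p. x p \<otimes> inv a))" unfolding x(2) \<epsilon>_def by simp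
    then show "c \<in> \<epsilon> ` carrier Loc" using inL by blast
  qed
  have \<theta>img: "\<theta> ` carrier ?C = carrier ?CK"
  proof (intro equalityI subsetI)
    show "c \<in> carrier ?CK" if "c \<in> \<theta> ` carrier ?C" for c using that \<theta>hom by (auto simp: hom_def)
    fix c assume c: "c \<in> carrier ?CK"
    have "\<psi>K c \<in> carrier K.WCl" using \<psi>Kiso c by (auto simp: iso_def hom_def)
    then obtain y where y: "K.fam y" "\<psi>K c = weak_class Q K (K.cosets y)"
      unfolding K.carrier_WCl K.carrier_Div by blast
    \<comment> \<open>Surjectivity is the place where the independence of the values enters.\<close>
    obtain x where x: "fam x" "K.cosets (\<lambda>P. x (P \<inter> H)) = K.cosets y" using independent_lift[OF ind y(1)] .
    have "\<theta> (\<eta> (weak_class Q H (cosets x))) = c" unfolding \<theta>val[OF x(1)] x(2) y(2)[symmetric] by (rule \<eta>K\<psi>K[OF c])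
    moreover have "\<eta> (weak_class Q H (cosets x)) \<in> carrier ?C" using cW[OF x(1)] by simp
    ultimately show "c \<in> \<theta> ` carrier ?C" by blast
  qed
  show ?thesis
    by (rule exI[of _ \<iota>], rule exI[of _ \<psi>], rule exI[of _ \<epsilon>], rule exI[of _ \<theta>])
      (intro conjI can \<iota> \<epsilon>hom \<theta>hom \<iota>inj \<iota>img \<epsilon>img \<theta>img ballI; (use \<epsilon>\<psi> \<theta>A in blast)?)
qed

end

section \<open>C-monoids\<close>

text \<open>\<open>G/N\<close> embeds into a free abelian group, hence is free, and \<open>N\<close> is a direct factor. The
complement of \<open>N\<close> is obtained by Zorn's lemma: a maximal partial complement \<open>C\<close> with support \<open>S C\<close> can be
extended by an element which has minimal positive value at a new index.\<close>

lemma (in comm_group) valuation_complement: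
  fixes w :: "'i \<Rightarrow> 'a \<Rightarrow> int"
  assumes w: "\<And>i x y. i \<in> V \<Longrightarrow> x \<in> carrier G \<Longrightarrow> y \<in> carrier G \<Longrightarrow> w i (x \<otimes> y) = w i x + w i y"
    and fin: "\<And>x. x \<in> carrier G \<Longrightarrow> finite {i \<in> V. w i x \<noteq> 0}"
  defines "N \<equiv> {x \<in> carrier G. \<forall>i\<in>V. w i x = 0}"
  obtains C where "subgroup C G" "C \<inter> N = {\<one>}" "\<forall>x\<in>carrier G. \<exists>c\<in>C. \<exists>n\<in>N. x = c \<otimes> n"
proof -
  have w1: "w i \<one> = 0" if "i \<in> V" for i using w[OF that, of \<one> \<one>] by simp
  have winv: "w i (inv x) = - w i x" if "i \<in> V" "x \<in> carrier G" for i x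
    using w[OF that(1), of x "inv x"] w1[OF that(1)] that(2) by simp
  have wpow: "w i (x [^] (k::int)) = k * w i x" if "i \<in> V" "x \<in> carrier G" for i x k
  proof -
    have n: "w i (x [^] (m::nat)) = int m * w i x" for m
      by (induction m) (use w w1 that in \<open>simp_all add: algebra_simps\<close>)
    show ?thesis using n winv that by (cases k rule: int_cases2) (simp_all add: int_pow_neg int_pow_int)
  qed
  define supp where "supp x = {i \<in> V. w i x \<noteq> 0}" for x
  define S where "S C = (\<Union>c\<in>C. supp c)" for C
  \<comment> \<open>Besides meeting \<open>N\<close> trivially, a member must already complement
    \<open>N\<close> among the elements supported in \<open>S C\<close>. As supports are finite,
    this condition passes to unions of chains.\<close>
  define CC where "CC = {C. subgroup C G \<and> C \<inter> N = {\<one>} \<and>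
    (\<forall>x\<in>carrier G. supp x \<subseteq> S C \<longrightarrow> (\<exists>c\<in>C. \<exists>n\<in>N. x = c \<otimes> n))}"
  have "\<exists>M\<in>CC. \<forall>X\<in>CC. M \<subseteq> X \<longrightarrow> X = M"
  proof (rule subset_Zorn_nonempty)
    have "{\<one>} \<in> CC"
      unfolding CC_def
    proof (intro CollectI conjI ballI impI)
      show "subgroup {\<one>} G" by (rule triv_subgroup)
      show "{\<one>} \<inter> N = {\<one>}" using w1 by (auto simp: N_def)
      fix x assume "x \<in> carrier G" "supp x \<subseteq> S {\<one>}"
      then have "x \<in> N" using w1 by (auto simp: N_def S_def supp_def)
      then show "\<exists>c\<in>{\<one>}. \<exists>n\<in>N. x = c \<otimes> n"
        using \<open>x \<in> carrier G\<close> by (intro bexI[of _ \<one>] bexI[of _ x]) auto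
    qed
    then show "CC \<noteq> {}" by blast
  next
    fix D assume D: "D \<noteq> {}" "subset.chain CC D"
    then have DCC: "C \<in> CC" if "C \<in> D" for C using that by (auto simp: subset.chain_def)
    have chain: "A \<subseteq> B \<or> B \<subseteq> A" if "A \<in> D" "B \<in> D" for A B
      using D(2) that by (auto simp: subset.chain_def)
    have Dsub: "subgroup C G" if "C \<in> D" for C using DCC[OF that] by (simp add: CC_def)
    show "\<Union>D \<in> CC"
      unfolding CC_def
    proof (intro CollectI conjI ballI impI)
      show "subgroup (\<Union>D) G"
      proof
        show "\<Union>D \<subseteq> carrier G" using Dsub subgroup.subset by blast
        show "\<one> \<in> \<Union>D" using D(1) Dsub subgroup.one_closed by blast
        show "inv x \<in> \<Union>D" if "x \<in> \<Union>D" for x using that Dsub subgroup.m_inv_closed by (metis UnionE UnionI)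
        fix x y assume "x \<in> \<Union>D" "y \<in> \<Union>D"
        then obtain A B where AB: "A \<in> D" "x \<in> A" "B \<in> D" "y \<in> B" by blast
        show "x \<otimes> y \<in> \<Union>D"
        proof (cases "A \<subseteq> B")
          case True
          then have "x \<otimes> y \<in> B" using subgroup.m_closed[OF Dsub[OF AB(3)]] AB by blast
          then show ?thesis using AB(3) by blast
        next
          case False
          then have "y \<in> A" using chain[OF AB(1,3)] AB(4) by blast
          then have "x \<otimes> y \<in> A" using subgroup.m_closed[OF Dsub[OF AB(1)]] AB(2) by blast
          then show ?thesis using AB(1) by blast
        qed
      qed
      have "C \<inter> N = {\<one>}" if "C \<in> D" for C using DCC[OF that] by (simp add: CC_def)
      then show "\<Union>D \<inter> N = {\<one>}" using D(1) by blast
      fix x assume x: "x \<in> carrier G" "supp x \<subseteq> S (\<Union>D)"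
      have "finite (supp x)" unfolding supp_def by (rule fin[OF x(1)])
      moreover have "supp x \<subseteq> \<Union>(S ` D)" using x(2) by (auto simp: S_def)
      moreover have "subset.chain UNIV (S ` D)"
      proof (rule subset_chain_def[THEN iffD2], intro conjI ballI)
        fix A B assume "A \<in> S ` D" "B \<in> S ` D"
        then obtain C C' where C: "C \<in> D" "A = S C" "C' \<in> D" "B = S C'" by blast
        show "A \<subseteq> B \<or> B \<subseteq> A" using chain[OF C(1,3)] unfolding C(2,4) S_def by blast
      qed simp
      ultimately obtain A where A: "A \<in> S ` D" "supp x \<subseteq> A"
        using finite_subset_Union_chain[of "supp x" "S ` D" UNIV] D(1) by blast
      then obtain C where C: "C \<in> D" "supp x \<subseteq> S C" by blast
      then obtain c n where "c \<in> C" "n \<in> N" "x = c \<otimes> n" using DCC[OF C(1)] x(1) unfolding CC_def by blast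
      then show "\<exists>c\<in>\<Union>D. \<exists>n\<in>N. x = c \<otimes> n" using C(1) by blast
    qed
  qed
  then obtain C where C: "C \<in> CC" and max: "\<forall>X\<in>CC. C \<subseteq> X \<longrightarrow> X = C" ..
  have Csub: "subgroup C G" and CN: "C \<inter> N = {\<one>}"
    and Cdec: "\<And>x. x \<in> carrier G \<Longrightarrow> supp x \<subseteq> S C \<Longrightarrow> \<exists>c\<in>C. \<exists>n\<in>N. x = c \<otimes> n"
    using C by (simp_all add: CC_def)
  interpret C: subgroup C G by (rule Csub)
  have CG: "c \<in> carrier G" if "c \<in> C" for c using C.subset that by blast
  let ?dec = "\<lambda>x. \<exists>c\<in>C. \<exists>n\<in>N. x = c \<otimes> n"
  have "?dec x" if xG: "x \<in> carrier G" for x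
  proof (rule ccontr)
    assume nx: "\<not> ?dec x"
    \<comment> \<open>An element without decomposition is chosen with as few support indices outside
      \<open>S C\<close> as possible. Elements of \<open>W\<close> with value 0 at one of these
      indices then decompose.\<close>
    let ?m = "\<lambda>x. card (supp x - S C)"
    obtain y where y: "y \<in> carrier G \<and> \<not> ?dec y"
      and ymin: "\<forall>z. z \<in> carrier G \<and> \<not> ?dec z \<longrightarrow> ?m y \<le> ?m z"
      using ex_has_least_nat[of "\<lambda>x. x \<in> carrier G \<and> \<not> ?dec x" x ?m] xG nx by blast
    define R where "R = supp y - S C"
    have finR: "finite R" unfolding R_def supp_def using fin y by blast
    have "\<not> supp y \<subseteq> S C" using Cdec y by blast
    then obtain p where p: "p \<in> R" unfolding R_def by blast
    have pV: "p \<in> V" "p \<notin> S C" using p by (auto simp: R_def supp_def)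
    define W where "W = {x \<in> carrier G. supp x \<subseteq> S C \<union> R}"
    have WG: "x \<in> carrier G" if "x \<in> W" for x using that by (simp add: W_def)
    have W_iff: "x \<in> W \<longleftrightarrow> x \<in> carrier G \<and> (\<forall>i\<in>V - (S C \<union> R). w i x = 0)" for x
      unfolding W_def supp_def by blast
    have W_mult: "x \<otimes> z \<in> W" if "x \<in> W" "z \<in> W" for x z using that w by (auto simp: W_iff)
    have W_pow: "x [^] (k::int) \<in> W" if "x \<in> W" for x k using that wpow by (auto simp: W_iff)
    have yW: "y \<in> W" using y by (auto simp: W_def R_def)
    have C_supp: "w i c = 0" if "c \<in> C" "i \<in> V" "i \<notin> S C" for c i using that by (auto simp: S_def supp_def)
    have CW: "c \<in> W" if "c \<in> C" for c using that CG C_supp by (auto simp: W_iff)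
    have small: "?dec x" if x: "x \<in> W" "w p x = 0" for x
    proof (rule ccontr)
      assume "\<not> ?dec x"
      then have "?m y \<le> ?m x" using ymin WG[OF x(1)] by blast
      moreover have "supp x - S C \<subset> R" using x p by (auto simp: W_def supp_def)
      then have "?m x < card R" by (rule psubset_card_mono[OF finR])
      ultimately show False by (simp add: R_def)
    qed
    have wpy: "w p y \<noteq> 0" using p by (auto simp: R_def supp_def)
    have "\<exists>n. n > 0 \<and> (\<exists>z\<in>W. w p z = int n)"
    proof -
      have "w p (y [^] sgn (w p y)) = \<bar>w p y\<bar>" using wpow[OF pV(1) WG[OF yW]] by (simp add: abs_sgn mult.commute)
      then have "w p (y [^] sgn (w p y)) = int (nat \<bar>w p y\<bar>)" by simp
      moreover have "nat \<bar>w p y\<bar> > 0" using wpy by simp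
      ultimately show ?thesis using W_pow[OF yW] by blast
    qed
    \<comment> \<open>The values at \<open>p\<close> of the elements of \<open>W\<close> form a
      group of integers; \<open>n\<close> is its positive generator and \<open>z\<close> attains
      it.\<close>
    then obtain n where n: "n > 0 \<and> (\<exists>z\<in>W. w p z = int n)"
      and nmin: "\<forall>m. m > 0 \<and> (\<exists>z\<in>W. w p z = int m) \<longrightarrow> n \<le> m"
      using ex_has_least_nat[of "\<lambda>n. n > 0 \<and> (\<exists>z\<in>W. w p z = int n)" _ "\<lambda>n. n"] by blast
    then obtain z where z: "z \<in> W" "w p z = int n" by blast
    have zG: "z \<in> carrier G" by (rule WG[OF z(1)])
    define C' where "C' = {c \<otimes> z [^] (k::int) | c k. c \<in> C}"
    have C'W: "x \<in> W" if "x \<in> C'" for x using that CW W_pow[OF z(1)] W_mult by (auto simp: C'_def)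
    have sub': "subgroup C' G"
    proof
      show "C' \<subseteq> carrier G" using C'W WG by blast
      have "\<one> = \<one> \<otimes> z [^] (0::int)" using zG by simp
      then show "\<one> \<in> C'" unfolding C'_def using C.one_closed by blast
      fix x assume "x \<in> C'"
      then obtain c k where ck: "c \<in> C" "x = c \<otimes> z [^] (k::int)" unfolding C'_def by blast
      have "inv x = inv c \<otimes> z [^] (- k)" unfolding ck(2) using CG[OF ck(1)] zG by (simp add: inv_mult int_pow_neg)
      then show "inv x \<in> C'" unfolding C'_def using C.m_inv_closed[OF ck(1)] by blast
      fix x' assume "x' \<in> C'"
      then obtain c' k' where ck': "c' \<in> C" "x' = c' \<otimes> z [^] (k'::int)" unfolding C'_def by blast
      have "x \<otimes> x' = (c \<otimes> c') \<otimes> z [^] (k + k')"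
        unfolding ck(2) ck'(2) using CG[OF ck(1)] CG[OF ck'(1)] zG by (simp add: int_pow_mult gsimps)
      then show "x \<otimes> x' \<in> C'" unfolding C'_def using C.m_closed[OF ck(1) ck'(1)] by blast
    qed
    have wp: "w p (c \<otimes> z [^] (k::int)) = k * int n" if "c \<in> C" for c k
      using w[OF pV(1) CG[OF that], of "z [^] k"] wpow[OF pV(1) zG, of k] z(2) zG C_supp[OF that pV] by simp
    have N': "C' \<inter> N = {\<one>}"
    proof
      show "C' \<inter> N \<subseteq> {\<one>}"
      proof
        fix x assume x: "x \<in> C' \<inter> N"
        then obtain c k where ck: "c \<in> C" "x = c \<otimes> z [^] (k::int)" unfolding C'_def by blast
        have "w p x = 0" using x pV(1) by (simp add: N_def)
        then have "k = 0" using wp[OF ck(1), of k] ck(2) n by simp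
        then have "x = c" using ck CG[OF ck(1)] by simp
        then show "x \<in> {\<one>}" using x ck(1) CN by blast
      qed
      have "\<one> \<in> N" using w1 by (simp add: N_def)
      then show "{\<one>} \<subseteq> C' \<inter> N" using subgroup.one_closed[OF sub'] by blast
    qed
    have dec': "\<exists>c\<in>C'. \<exists>n\<in>N. x = c \<otimes> n" if x: "x \<in> carrier G" "supp x \<subseteq> S C'" for x
    proof -
      have "S C' \<subseteq> S C \<union> R" using C'W unfolding S_def[of C'] W_def by blast
      then have xW: "x \<in> W" using x by (auto simp: W_def)
      \<comment> \<open>Division with remainder: minimality of \<open>n\<close> makes the remainder
        vanish, so after removing \<open>z^k\<close> the value at \<open>p\<close> is 0 and
        \<open>small\<close> applies.\<close>
      define k where "k = w p x div int n"
      define x' where "x' = x \<otimes> z [^] (- k)"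
      have x'W: "x' \<in> W" unfolding x'_def by (rule W_mult[OF xW W_pow[OF z(1)]])
      have "w p x' = w p x mod int n"
        unfolding x'_def using w[OF pV(1) x(1), of "z [^] (- k)"] wpow[OF pV(1) zG, of "- k"] z(2) zG
        by (simp add: k_def minus_div_mult_eq_mod[symmetric])
      then have b: "0 \<le> w p x'" "w p x' < int n" using n by simp_all
      have "w p x' = 0"
      proof (rule ccontr)
        assume "w p x' \<noteq> 0"
        then have "nat (w p x') > 0" "w p x' = int (nat (w p x'))" using b(1) by auto
        then have "n \<le> nat (w p x')" using nmin x'W by blast
        then show False using b by linarith
      qed
      then obtain c m where cm: "c \<in> C" "m \<in> N" "x' = c \<otimes> m" using small[OF x'W] by blast
      have mG: "m \<in> carrier G" using cm(2) by (simp add: N_def)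
      have "x = x' \<otimes> z [^] k" unfolding x'_def using x(1) zG by (simp add: int_pow_neg m_assoc)
      also have "\<dots> = (c \<otimes> z [^] k) \<otimes> m" unfolding cm(3) using CG[OF cm(1)] mG zG by (simp add: gsimps)
      finally show ?thesis unfolding C'_def using cm by blast
    qed
    have "C' \<in> CC" unfolding CC_def using sub' N' dec' by blast
    moreover have "C \<subseteq> C'"
    proof
      fix c assume c: "c \<in> C"
      then have "c = c \<otimes> z [^] (0::int)" using CG by simp
      then show "c \<in> C'" unfolding C'_def using c by blast
    qed
    ultimately have "C' = C" using max by blast
    moreover have "z \<in> C'"
    proof -
      have "z = \<one> \<otimes> z [^] (1::int)" using zG by simp
      then show ?thesis unfolding C'_def using C.one_closed by blast
    qed
    ultimately have "w p z = 0" using C_supp pV by blast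
    then show False using z(2) n by simp
  qed
  then show ?thesis using that[OF Csub CN] by blast
qed

text \<open>Projection onto \<open>N\<close> along the complement.\<close>

lemma (in comm_group) valuation_retraction:
  fixes w :: "'i \<Rightarrow> 'a \<Rightarrow> int"
  assumes w: "\<And>i x y. i \<in> V \<Longrightarrow> x \<in> carrier G \<Longrightarrow> y \<in> carrier G \<Longrightarrow> w i (x \<otimes> y) = w i x + w i y"
    and fin: "\<And>x. x \<in> carrier G \<Longrightarrow> finite {i \<in> V. w i x \<noteq> 0}"
  defines "N \<equiv> {x \<in> carrier G. \<forall>i\<in>V. w i x = 0}"
  obtains r where "\<forall>x\<in>carrier G. r x \<in> N" "\<forall>x\<in>carrier G. \<forall>y\<in>carrier G. r (x \<otimes> y) = r x \<otimes> r y" "\<forall>n\<in>N. r n = n"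
proof -
  obtain C where C: "subgroup C G" "C \<inter> N = {\<one>}" "\<forall>x\<in>carrier G. \<exists>c\<in>C. \<exists>n\<in>N. x = c \<otimes> n"
    using valuation_complement[of V w, OF w fin] unfolding N_def by blast
  interpret C: subgroup C G by (rule C(1))
  have CG: "c \<in> carrier G" if "c \<in> C" for c using C.subset that by blast
  have NG: "n \<in> carrier G" if "n \<in> N" for n using that by (simp add: N_def)
  have w1: "w i \<one> = 0" if "i \<in> V" for i using w[OF that, of \<one> \<one>] by simp
  have winv: "w i (inv x) = - w i x" if "i \<in> V" "x \<in> carrier G" for i x
    using w[OF that(1), of x "inv x"] w1[OF that(1)] that(2) by simp
  have Nm: "n \<otimes> m \<in> N" "inv n \<in> N" if "n \<in> N" "m \<in> N" for n m using that w winv by (auto simp: N_def)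
  define r where "r x = (THE n. n \<in> N \<and> (\<exists>c\<in>C. x = c \<otimes> n))" for x
  have r: "r x = n" if n: "n \<in> N" "c \<in> C" "x = c \<otimes> n" for x c n
    unfolding r_def
  proof (rule the_equality)
    fix m assume "m \<in> N \<and> (\<exists>c\<in>C. x = c \<otimes> m)"
    then obtain d where d: "m \<in> N" "d \<in> C" "x = d \<otimes> m" by blast
    note Gs = CG[OF n(2)] CG[OF d(2)] NG[OF n(1)] NG[OF d(1)]
    have "c \<otimes> n = d \<otimes> m" using n(3) d(3) by simp
    then have "inv d \<otimes> (c \<otimes> n) \<otimes> inv n = inv d \<otimes> (d \<otimes> m) \<otimes> inv n" by simp
    then have e: "c \<otimes> inv d = m \<otimes> inv n" using Gs by (simp add: gsimps)
    have "c \<otimes> inv d \<in> C" using n(2) d(2) by blast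
    moreover have "m \<otimes> inv n \<in> N" using Nm d(1) n(1) by blast
    ultimately have "m \<otimes> inv n = \<one>" using C(2) e by auto
    then have "m \<otimes> inv n \<otimes> n = \<one> \<otimes> n" by simp
    then show "m = n" using Gs by (simp add: gsimps)
  qed (use n in blast)
  show ?thesis
  proof (rule that)
    show "\<forall>x\<in>carrier G. r x \<in> N" using C(3) r by metis
    show "\<forall>n\<in>N. r n = n" using r[OF _ C.one_closed] NG by simp
    show "\<forall>x\<in>carrier G. \<forall>y\<in>carrier G. r (x \<otimes> y) = r x \<otimes> r y"
    proof (intro ballI)
      fix x y assume "x \<in> carrier G" "y \<in> carrier G"
      then obtain c n d m where *: "c \<in> C" "n \<in> N" "x = c \<otimes> n" "d \<in> C" "m \<in> N" "y = d \<otimes> m" using C(3) by meson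
      have "x \<otimes> y = (c \<otimes> d) \<otimes> (n \<otimes> m)" unfolding *(3,6) using CG NG * by (simp add: gsimps)
      then have "r (x \<otimes> y) = n \<otimes> m" using r Nm(1)[OF *(2,5)] C.m_closed[OF *(1,4)] by blast
      then show "r (x \<otimes> y) = r x \<otimes> r y" using r[OF *(2,1,3)] r[OF *(5,4,6)] by simp
    qed
  qed
qed

section \<open>Exceptional primes and the C-monoid of \<open>v\<close>-invertible ideals\<close>

context seminormal_weakly_krull
begin

definition Pstar :: "'a set set" where "Pstar = {p \<in> X. cf \<subseteq> p}"

lemma PstarD: "p \<in> Pstar \<Longrightarrow> p \<in> X"
  by (simp add: Pstar_def)

lemma finite_Pstar: "finite Pstar"
proof -
  obtain d where d: "d \<in> cf" using cond(1) by blast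
  then have "d \<in> H" using cond_sub_H by blast
  moreover have "Pstar \<subseteq> {p \<in> X. d \<in> p}" using d by (auto simp: Pstar_def)
  ultimately show ?thesis using finite_mem finite_subset by blast
qed

lemma L_of_val_nonneg:
  assumes "p \<in> X" "p \<notin> Pstar" "d \<in> carrier Q" "\<And>P. P \<in> over p \<Longrightarrow> 0 \<le> val P d"
  shows "d \<in> L p"
  using KL_eq_L[of p] KL_iff[of p d] assms by (auto simp: Pstar_def)

text \<open>Passing from \<open>xy\<close> to \<open>xy'\<close> inside \<open>L p\<close>, where \<open>\<alpha>\<close>, \<open>\<beta>\<close>, \<open>\<delta>\<close> are the values of \<open>x\<close>, \<open>y\<close>, \<open>y'\<close>.\<close>

lemma L_transfer:
  fixes \<alpha> \<beta> \<delta> :: "'a set \<Rightarrow> int"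
  assumes p: "p \<in> X" and h: "h \<in> L p" and d: "d \<in> carrier Q"
    and vh: "\<And>P. P \<in> over p \<Longrightarrow> val P h = \<alpha> P + \<beta> P"
    and vd: "\<And>P. P \<in> over p \<Longrightarrow> val P d = \<alpha> P + \<delta> P"
    and nn: "\<And>P. P \<in> over p \<Longrightarrow> 0 \<le> \<alpha> P \<and> 0 \<le> \<beta> P \<and> 0 \<le> \<delta> P"
    and supp: "{P \<in> over p. 0 < \<beta> P} = {P \<in> over p. 0 < \<delta> P}"
    and u: "\<forall>P\<in>over p. \<beta> P = 0 \<Longrightarrow> inv h \<otimes> d \<in> U p"
  shows "d \<in> L p"
proof (cases "\<forall>P\<in>over p. \<beta> P = 0")
  case True
  have "h \<otimes> (inv h \<otimes> d) \<in> L p" by (rule L_mult[OF prime[OF p] h U_sub_L[OF prime[OF p] u[OF True]]])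
  then show ?thesis using L_carrier[OF h] d by (simp add: cancel_simps)
next
  case False
  then obtain P where P: "P \<in> over p" "\<beta> P \<noteq> 0" by blast
  have "val P h \<noteq> 0" using vh[OF P(1)] nn[OF P(1)] P(2) by linarith
  then have nu: "h \<notin> U p" using U_val[OF p _ P(1)] by blast
  show ?thesis
  proof (rule L_pos_val(1)[OF p d])
    fix P' assume P': "P' \<in> over p"
    have "0 < val P' h" by (rule L_nonunit_val[OF p h nu P'])
    then have "0 < \<alpha> P' \<or> 0 < \<beta> P'" using vh[OF P'] by linarith
    moreover have "0 < \<beta> P' \<longleftrightarrow> 0 < \<delta> P'" using supp P' by blast
    ultimately show "0 < val P' d" using vd[OF P'] nn[OF P'] by linarith
  qed
qed

text \<open>A non-unit has positive value at each prime above \<open>p\<close>, and there is at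
  least one such prime.\<close>

lemma val_zero_U:
  assumes "p \<in> X" "x \<in> L p" "\<And>P. P \<in> over p \<Longrightarrow> val P x = 0" shows "x \<in> U p"
  using L_nonunit_val[OF assms(1,2)] over_nonempty[OF assms(1)] assms(3) by fastforce

lemma cosets_pos_iff:
  assumes x: "fam x" shows "cosets x \<in> {cosets y | y. pos y} \<longleftrightarrow> pos x"
proof
  assume "cosets x \<in> {cosets y | y. pos y}"
  then obtain y where y: "pos y" "cosets x = cosets y" by blast
  have u: "\<forall>p\<in>X. inv (y p) \<otimes> x p \<in> U p" using cosets_fam_eq_iff[OF pos_fam[OF y(1)] x] y(2) by simp
  have "x p \<in> L p" if p: "p \<in> X" for p
  proof -
    have "y p \<in> L p" using y(1) p by (simp add: pos_def)
    then have "y p \<otimes> (inv (y p) \<otimes> x p) \<in> L p"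
      using L_mult[OF prime[OF p] _ U_sub_L[OF prime[OF p]]] u p by blast
    then show ?thesis using fam_carrier[OF x p] fam_carrier[OF pos_fam[OF y(1)] p] by (simp add: cancel_simps)
  qed
  then show "pos x" using x by (simp add: pos_def)
qed blast

text \<open>A valuation of the closure carried over to the divisors of \<open>H\<close>. Local units
  have value 0, so the choice of the representing family does not matter.\<close>

definition div_val :: "'a set \<Rightarrow> ('a set \<Rightarrow> 'a set) \<Rightarrow> int" where
  "div_val P f = val P ((SOME x. fam x \<and> f = cosets x) (P \<inter> H))"

lemma div_val_cosets:
  assumes x: "fam x" and P: "P \<in> K.X" shows "div_val P (cosets x) = val P (x (P \<inter> H))"
proof -
  let ?y = "SOME y. fam y \<and> cosets x = cosets y"
  have y: "fam ?y \<and> cosets x = cosets ?y"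
    by (rule someI[of "\<lambda>y. fam y \<and> cosets x = cosets y" x]) (simp add: x)
  then have "inv (x (P \<inter> H)) \<otimes> ?y (P \<inter> H) \<in> U (P \<inter> H)"
    using cosets_fam_eq_iff[OF x, of ?y] contraction[OF P] by blast
  then have "val P (inv (x (P \<inter> H)) \<otimes> ?y (P \<inter> H)) = 0"
    by (rule U_val[OF contraction[OF P] _ over_contraction[OF P]])
  then have "val P (?y (P \<inter> H)) = val P (x (P \<inter> H))"
    using fam_carrier[OF x contraction[OF P]] fam_carrier[of ?y, OF _ contraction[OF P]] y
    by (simp add: valD(1,4)[OF P])
  then show ?thesis unfolding div_val_def .
qed

text \<open>The factorial overmonoid consists of the divisors of \<open>H\<close> that are
  non-negative at all \<open>P\<close>; independence supplies the divisors of value 1 at a single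
  \<open>P\<close> that the criterion asks for.\<close>

lemma c_monoid_Inv:
  assumes ind: "\<And>p. p \<in> X \<Longrightarrow> independent p"
    and fin: "\<And>p. p \<in> Pstar \<Longrightarrow> finite (carrier (loc_grp p))"
  shows "c_monoid Inv"
proof -
  obtain \<phi> where \<phi>: "\<phi> \<in> iso (quot_group Inv) Div"
    and \<phi>emb: "\<forall>x. pos x \<longrightarrow> \<phi> (quot_embed Inv (ideal_of x)) = cosets x"
    using quot_Inv_structure by metis
  interpret D: comm_group Div by (rule group_Div)
  interpret I: comm_monoid_cancel Inv by (rule Inv_cancel)
  define h where "h A = \<phi> (quot_embed Inv A)" for A
  have h: "h (ideal_of x) = cosets x" if "pos x" for x unfolding h_def using \<phi>emb that by blast
  define S where "S = {cosets x | x. pos x}"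
  have S_iff: "cosets x \<in> S \<longleftrightarrow> pos x" if "fam x" for x unfolding S_def by (rule cosets_pos_iff[OF that])
  have pos_mult: "pos (\<lambda>p. x p \<otimes> y p)" if "pos x" "pos y" for x y
    using that fam_mult L_mult[OF prime] by (simp add: pos_def)
  have mult: "div_val P (f \<otimes>\<^bsub>Div\<^esub> g) = div_val P f + div_val P g"
    if m: "P \<in> K.X" "f \<in> carrier Div" "g \<in> carrier Div" for P f g
  proof -
    obtain x y where xy: "fam x" "f = cosets x" "fam y" "g = cosets y" using m unfolding carrier_Div by blast
    have "div_val P (cosets (\<lambda>p. x p \<otimes> y p)) = val P (x (P \<inter> H)) + val P (y (P \<inter> H))"
      using div_val_cosets[OF fam_mult[OF xy(1,3)] m(1)] valD(1)[OF m(1)]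
        fam_carrier[OF xy(1) contraction[OF m(1)]] fam_carrier[OF xy(3) contraction[OF m(1)]] by simp
    then show ?thesis unfolding xy(2,4) mult_Div_fam[OF xy(1,3)]
      using div_val_cosets[OF xy(1) m(1)] div_val_cosets[OF xy(3) m(1)] by simp
  qed
  have finval: "finite {P \<in> K.X. div_val P f \<noteq> 0}" if m: "f \<in> carrier Div" for f
  proof -
    obtain x where x: "fam x" "f = cosets x" using m unfolding carrier_Div by blast
    have "{P \<in> K.X. div_val P f \<noteq> 0} \<subseteq> {P \<in> K.X. x (P \<inter> H) \<notin> K.U P}"
      unfolding x(2) using div_val_cosets[OF x(1)] KU_iff by auto
    moreover have "finite {P \<in> K.X. x (P \<inter> H) \<notin> K.U P}" using fam_contract[OF x(1)] by (simp add: K.fam_def)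
    ultimately show ?thesis using finite_subset by blast
  qed
  have "\<exists>c. c \<in> carrier Q \<and> val P c = 1 \<and> (\<forall>P'\<in>over (P \<inter> H). P' \<noteq> P \<longrightarrow> val P' c = 0)" if "P \<in> K.X" for P
    using ind[OF contraction[OF that]] over_contraction[OF that] unfolding independent_def by blast
  then obtain c where c: "\<And>P. P \<in> K.X \<Longrightarrow>
      c P \<in> carrier Q \<and> val P (c P) = 1 \<and> (\<forall>P'\<in>over (P \<inter> H). P' \<noteq> P \<longrightarrow> val P' (c P) = 0)" by metis
  define cc where "cc P p = (if p = P \<inter> H then c P else \<one>)" for P p
  have fcc: "fam (cc P)" if "P \<in> K.X" for P
    by (rule fam_finite_support[of "{P \<inter> H}"]) (use c[OF that] prime in \<open>auto simp: cc_def\<close>)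
  have vcc: "div_val P' (cosets (cc P)) = (if P = P' then 1 else 0)" if "P \<in> K.X" "P' \<in> K.X" for P P'
    unfolding div_val_cosets[OF fcc[OF that(1)] that(2)]
    using c[OF that(1)] that valD(3)[OF that(2)] by (auto simp: cc_def over_def)
  define F where "F = {f \<in> carrier Div. \<forall>P\<in>K.X. 0 \<le> div_val P f}"
  have FD: "\<exists>x. fam x \<and> f = cosets x \<and> (\<forall>P\<in>K.X. div_val P f = val P (x (P \<inter> H)) \<and> 0 \<le> val P (x (P \<inter> H)))"
    if m: "f \<in> F" for f
  proof -
    obtain x where x: "fam x" "f = cosets x" using m unfolding F_def carrier_Div by blast
    then show ?thesis using m div_val_cosets[OF x(1)] unfolding F_def by auto
  qed
  have sub: "submonoid S Div"
  proof
    show "S \<subseteq> carrier Div" unfolding S_def using cosets_Div[OF pos_fam] by blast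
    show "\<one>\<^bsub>Div\<^esub> \<in> S" unfolding one_Div S_def using pos_one by blast
    fix f g assume "f \<in> S" "g \<in> S"
    then obtain x y where "pos x" "f = cosets x" "pos y" "g = cosets y" unfolding S_def by blast
    then show "f \<otimes>\<^bsub>Div\<^esub> g \<in> S" using mult_Div_fam[OF pos_fam pos_fam] pos_mult unfolding S_def by auto
  qed
  have SF: "S \<subseteq> F"
  proof
    fix f assume "f \<in> S"
    then obtain x where x: "pos x" "f = cosets x" unfolding S_def by blast
    have "0 \<le> val P (x (P \<inter> H))" if P: "P \<in> K.X" for P
    proof -
      have "x (P \<inter> H) \<in> L (P \<inter> H)" using x(1) contraction[OF P] by (simp add: pos_def)
      then have "x (P \<inter> H) \<in> KL (P \<inter> H)" using L_sub_KL by blast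
      then show ?thesis using KL_iff[OF contraction[OF P]] over_contraction[OF P] by blast
    qed
    then show "f \<in> F" unfolding F_def x(2) using cosets_Div[OF pos_fam[OF x(1)]] div_val_cosets[OF pos_fam[OF x(1)]] by simp
  qed
  have S_units: "inv\<^bsub>Div\<^esub> f \<in> S" if f: "f \<in> S" "\<forall>P\<in>K.X. div_val P f = 0" for f
  proof -
    obtain x where x: "pos x" "f = cosets x" using f(1) unfolding S_def by blast
    have "inv (x p) \<in> L p" if p: "p \<in> X" for p
    proof -
      have "val P (x p) = 0" if P: "P \<in> over p" for P
        using f(2) div_val_cosets[OF pos_fam[OF x(1)] overD(1)[OF P]] overD[OF P] x(2) by simp
      then have "x p \<in> U p" using val_zero_U[OF p] x(1) p by (simp add: pos_def)
      then show ?thesis using U_iff[OF prime[OF p]] by blast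
    qed
    then show ?thesis
      unfolding x(2) inv_Div[OF pos_fam[OF x(1)]] S_def using fam_inv[OF pos_fam[OF x(1)]] by (auto simp: pos_def)
  qed
  have hiso: "h \<in> iso Inv (Div\<lparr>carrier := S\<rparr>)"
  proof (rule isoI)
    show "h \<in> hom Inv (Div\<lparr>carrier := S\<rparr>)"
    proof (rule homI)
      fix A assume "A \<in> carrier Inv"
      then obtain x where x: "pos x" "A = ideal_of x" unfolding carrier_Inv by blast
      show "h A \<in> carrier (Div\<lparr>carrier := S\<rparr>)" unfolding x(2) h[OF x(1)] S_def using x(1) by auto
      fix B assume "B \<in> carrier Inv"
      then obtain y where y: "pos y" "B = ideal_of y" unfolding carrier_Inv by blast
      show "h (A \<otimes>\<^bsub>Inv\<^esub> B) = h A \<otimes>\<^bsub>Div\<lparr>carrier := S\<rparr>\<^esub> h B"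
        unfolding x(2) y(2) mult_v_inv_monoid[OF pos_fam[OF x(1)] pos_fam[OF y(1)]]
          h[OF x(1)] h[OF y(1)] h[OF pos_mult[OF x(1) y(1)]]
        by (simp add: mult_Div_fam[OF pos_fam[OF x(1)] pos_fam[OF y(1)]])
    qed
    have "inj_on h (carrier Inv)"
    proof (rule inj_onI)
      fix A B assume "A \<in> carrier Inv" "B \<in> carrier Inv" and e: "h A = h B"
      then obtain x y where xy: "pos x" "A = ideal_of x" "pos y" "B = ideal_of y" unfolding carrier_Inv by blast
      then have "cosets x = cosets y" using e h by simp
      then show "A = B" unfolding xy(2,4) cosets_fam_eq_iff[OF pos_fam[OF xy(1)] pos_fam[OF xy(3)]]
          ideal_of_eq_iff[OF pos_fam[OF xy(1)] pos_fam[OF xy(3)]] .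
    qed
    moreover have "h ` carrier Inv = S"
    proof (intro equalityI subsetI)
      fix f assume "f \<in> S"
      then obtain x where x: "pos x" "f = cosets x" unfolding S_def by blast
      then show "f \<in> h ` carrier Inv" using h[OF x(1)] ideal_of_Inv[OF x(1)] by (metis imageI)
    next
      fix f assume "f \<in> h ` carrier Inv"
      then obtain x where "pos x" "f = h (ideal_of x)" unfolding carrier_Inv by blast
      then show "f \<in> S" unfolding S_def using h by auto
    qed
    ultimately show "bij_betw h (carrier Inv) (carrier (Div\<lparr>carrier := S\<rparr>))" by (simp add: bij_betw_def)
  qed
  have bij: "bij_betw \<phi> (carrier (quot_group Inv)) (carrier Div)" using \<phi> by (simp add: iso_def)
  \<comment> \<open>The inverse of \<open>\<phi>\<close> brings divisors to the required type,
    because fractions of ideals are sets of pairs of ideals.\<close>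
  have \<iota>: "inj_on (inv_into (carrier (quot_group Inv)) \<phi>) F"
    using bij_betw_inv_into[OF bij] unfolding bij_betw_def F_def by (auto intro: inj_on_subset)
  \<comment> \<open>At an exceptional prime the coset is recorded only if all values vanish;
    otherwise, by \<open>L_transfer\<close>, the support of the values decides, and the dummy
    \<open>{}\<close> keeps the range of \<open>\<tau>\<close> finite.\<close>
  define \<tau> where "\<tau> f = (\<lambda>p\<in>Pstar. ({P \<in> over p. 0 < div_val P f}, if \<forall>P\<in>over p. div_val P f = 0 then f p else {}))" for f
  show ?thesis
  proof (rule c_monoid_from_valuations[where w = div_val and V = K.X and c = "\<lambda>P. cosets (cc P)" and K = S
        and \<tau> = \<tau>, OF group_Div mult finval cosets_Div[OF fcc] vcc F_def sub SF S_units I.monoid_axioms hiso \<iota>])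
    have "\<tau> ` F \<subseteq> (\<Pi>\<^sub>E p\<in>Pstar. Pow (over p) \<times> (carrier (loc_grp p) \<union> {{}}))"
    proof
      fix t assume "t \<in> \<tau> ` F"
      then obtain f where f: "f \<in> F" "t = \<tau> f" by blast
      obtain x where x: "fam x" "f = cosets x" "\<forall>P\<in>K.X. div_val P f = val P (x (P \<inter> H)) \<and> 0 \<le> val P (x (P \<inter> H))"
        using FD[OF f(1)] by blast
      have "f p \<in> carrier (loc_grp p)" if p: "p \<in> Pstar" and z: "\<forall>P\<in>over p. div_val P f = 0" for p
      proof -
        have "x p \<in> V p"
          unfolding V_iff[OF PstarD[OF p]] using z x(3) overD fam_carrier[OF x(1) PstarD[OF p]] by auto
        then show ?thesis unfolding x(2) cosets_apply[OF PstarD[OF p]] carrier_FactGroup by auto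
      qed
      then show "t \<in> (\<Pi>\<^sub>E p\<in>Pstar. Pow (over p) \<times> (carrier (loc_grp p) \<union> {{}}))"
        unfolding f(2) \<tau>_def by auto
    qed
    then show "finite (\<tau> ` F)"
      by (rule finite_subset) (use finite_Pstar finite_over PstarD fin in \<open>auto intro!: finite_PiE\<close>)
  next
    fix f f' g assume f: "f \<in> F" "f' \<in> F" "g \<in> F" and t: "\<tau> f = \<tau> f'" and gf: "g \<otimes>\<^bsub>Div\<^esub> f \<in> S"
    obtain b where b: "fam b" "f = cosets b" "\<forall>P\<in>K.X. div_val P f = val P (b (P \<inter> H)) \<and> 0 \<le> val P (b (P \<inter> H))"
      using FD[OF f(1)] by blast
    obtain d where d: "fam d" "f' = cosets d" "\<forall>P\<in>K.X. div_val P f' = val P (d (P \<inter> H)) \<and> 0 \<le> val P (d (P \<inter> H))"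
      using FD[OF f(2)] by blast
    obtain a where a: "fam a" "g = cosets a" "\<forall>P\<in>K.X. div_val P g = val P (a (P \<inter> H)) \<and> 0 \<le> val P (a (P \<inter> H))"
      using FD[OF f(3)] by blast
    have ab: "a p \<otimes> b p \<in> L p" if "p \<in> X" for p
      using gf S_iff[OF fam_mult[OF a(1) b(1)]] that unfolding a(2) b(2) mult_Div_fam[OF a(1) b(1)] by (simp add: pos_def)
    have "a p \<otimes> d p \<in> L p" if p: "p \<in> X" for p
    proof -
      have Qs: "a p \<in> carrier Q" "b p \<in> carrier Q" "d p \<in> carrier Q"
        using fam_carrier[OF a(1) p] fam_carrier[OF b(1) p] fam_carrier[OF d(1) p] .
      have v: "div_val P g = val P (a p) \<and> 0 \<le> val P (a p)" "div_val P f = val P (b p) \<and> 0 \<le> val P (b p)"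
        "div_val P f' = val P (d p) \<and> 0 \<le> val P (d p)" if "P \<in> over p" for P
        using a(3) b(3) d(3) overD[OF that] by auto
      have adQ: "a p \<otimes> d p \<in> carrier Q" using Qs by simp
      show ?thesis
      proof (cases "p \<in> Pstar")
        case True
        have tp: "{P \<in> over p. 0 < div_val P f} = {P \<in> over p. 0 < div_val P f'}"
          "(if \<forall>P\<in>over p. div_val P f = 0 then f p else {}) = (if \<forall>P\<in>over p. div_val P f' = 0 then f' p else {})"
          using fun_cong[OF t, of p] True by (simp_all add: \<tau>_def)
        show ?thesis
        proof (rule L_transfer[OF p ab[OF p] adQ, where \<alpha> = "\<lambda>P. val P (a p)" and \<beta> = "\<lambda>P. val P (b p)" and \<delta> = "\<lambda>P. val P (d p)"])
          show "val P (a p \<otimes> b p) = val P (a p) + val P (b p)" if "P \<in> over p" for P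
            using valD(1)[OF overD(1)[OF that]] Qs by blast
          show "val P (a p \<otimes> d p) = val P (a p) + val P (d p)" if "P \<in> over p" for P
            using valD(1)[OF overD(1)[OF that]] Qs by blast
          show "0 \<le> val P (a p) \<and> 0 \<le> val P (b p) \<and> 0 \<le> val P (d p)" if "P \<in> over p" for P
            using v[OF that] by blast
          show s: "{P \<in> over p. 0 < val P (b p)} = {P \<in> over p. 0 < val P (d p)}"
            using tp(1) v(2,3) by (simp cong: conj_cong)
          assume z: "\<forall>P\<in>over p. val P (b p) = 0"
          have "\<forall>P\<in>over p. val P (d p) = 0"
          proof
            fix P assume P: "P \<in> over p"
            then have "\<not> 0 < val P (d p)" using s z by fastforce
            then show "val P (d p) = 0" using v(3)[OF P] by linarith
          qed
          then have "f p = f' p" using tp(2) z v(2,3) by simp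
          then have "U p #> b p = U p #> d p" unfolding b(2) d(2) cosets_apply[OF p] .
          then have "inv (b p) \<otimes> d p \<in> U p" using rcos_eq_iff[OF U_subgroup[OF prime[OF p]] Qs(2,3)] by blast
          moreover have "inv (a p \<otimes> b p) \<otimes> (a p \<otimes> d p) = inv (b p) \<otimes> d p" using Qs by (simp add: inv_mult gsimps cancel_simps)
          ultimately show "inv (a p \<otimes> b p) \<otimes> (a p \<otimes> d p) \<in> U p" by simp
        qed
      next
        case False
        show ?thesis
        proof (rule L_of_val_nonneg[OF p False adQ])
          show "0 \<le> val P (a p \<otimes> d p)" if P: "P \<in> over p" for P
            using v[OF P] valD(1)[OF overD(1)[OF P] Qs(1,3)] by simp
        qed
      qed
    qed
    then have "pos (\<lambda>p. a p \<otimes> d p)" using fam_mult[OF a(1) d(1)] by (simp add: pos_def)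
    then show "g \<otimes>\<^bsub>Div\<^esub> f' \<in> S" unfolding a(2) d(2) mult_Div_fam[OF a(1) d(1)] S_def by blast
  qed
qed

section \<open>Divisors of the complete integral closure and the C-monoid property of
  \<open>H\<close>\<close>

definition hat_div_val :: "'a set \<Rightarrow> ('a set \<Rightarrow> 'a set) \<Rightarrow> int" where
  "hat_div_val P f = val P ((SOME x. K.fam x \<and> f = K.cosets x) P)"

lemma hat_cosets_eq_iff:
  assumes x: "K.fam x" and y: "K.fam y"
  shows "K.cosets x = K.cosets y \<longleftrightarrow> (\<forall>P\<in>K.X. val P (x P) = val P (y P))"
proof -
  have "inv (x P) \<otimes> y P \<in> K.U P \<longleftrightarrow> val P (x P) = val P (y P)" if P: "P \<in> K.X" for P
    using KU_iff[OF P, of "inv (x P) \<otimes> y P"] K.fam_carrier[OF x P] K.fam_carrier[OF y P]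
    by (auto simp: valD(1,4)[OF P])
  then show ?thesis unfolding K.cosets_fam_eq_iff[OF x y] by blast
qed

lemma hat_div_val_cosets:
  assumes x: "K.fam x" and P: "P \<in> K.X" shows "hat_div_val P (K.cosets x) = val P (x P)"
proof -
  let ?y = "SOME y. K.fam y \<and> K.cosets x = K.cosets y"
  have y: "K.fam ?y \<and> K.cosets x = K.cosets ?y"
    by (rule someI[of "\<lambda>y. K.fam y \<and> K.cosets x = K.cosets y" x]) (simp add: x)
  then have "val P (x P) = val P (?y P)"
    using hat_cosets_eq_iff[OF x, of ?y] P by blast
  then show ?thesis unfolding hat_div_val_def by simp
qed

lemma hat_div_val_mult:
  assumes P: "P \<in> K.X" and f: "f \<in> carrier K.Div" "g \<in> carrier K.Div"
  shows "hat_div_val P (f \<otimes>\<^bsub>K.Div\<^esub> g) = hat_div_val P f + hat_div_val P g"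
proof -
  obtain x y where xy: "K.fam x" "f = K.cosets x" "K.fam y" "g = K.cosets y"
    using f unfolding K.carrier_Div by blast
  show ?thesis unfolding xy(2,4) K.mult_Div_fam[OF xy(1,3)]
    using hat_div_val_cosets[OF K.fam_mult[OF xy(1,3)] P] valD(1)[OF P]
      K.fam_carrier[OF xy(1) P] K.fam_carrier[OF xy(3) P]
      hat_div_val_cosets[OF xy(1) P] hat_div_val_cosets[OF xy(3) P] by simp
qed

lemma hat_div_eqI:
  assumes f: "f \<in> carrier K.Div" "g \<in> carrier K.Div" and "\<forall>P\<in>K.X. hat_div_val P f = hat_div_val P g"
  shows "f = g"
proof -
  obtain x y where xy: "K.fam x" "f = K.cosets x" "K.fam y" "g = K.cosets y"
    using f unfolding K.carrier_Div by blast
  then show ?thesis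
    using assms(3) hat_cosets_eq_iff[OF xy(1,3)] hat_div_val_cosets[OF xy(1)] hat_div_val_cosets[OF xy(3)] by simp
qed

lemma finite_hat_div_val:
  assumes f: "f \<in> carrier K.Div" shows "finite {P \<in> K.X. hat_div_val P f \<noteq> 0}"
proof -
  obtain x where x: "K.fam x" "f = K.cosets x" using f unfolding K.carrier_Div by blast
  have "{P \<in> K.X. hat_div_val P f \<noteq> 0} \<subseteq> {P \<in> K.X. x P \<notin> K.U P}"
    unfolding x(2) using hat_div_val_cosets[OF x(1)] KU_iff by auto
  moreover have "finite {P \<in> K.X. x P \<notin> K.U P}" using x(1) by (simp add: K.fam_def)
  ultimately show ?thesis using finite_subset by blast
qed

text \<open>By the end of the exact sequence the class group of the closure is an image of that of
  \<open>H\<close>.\<close>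

lemma finite_hat_class_group:
  assumes ind: "\<And>p. p \<in> X \<Longrightarrow> independent p" and fin: "finite (carrier (v_class_group Q H))"
  shows "finite (carrier K.WCl)"
proof -
  obtain \<theta> where "\<theta> ` carrier (v_class_group Q H) = carrier (v_class_group Q K)"
    by (rule exact_sequence[OF ind, THEN exE]) (assumption, elim exE conjE, rule that)
  then have "finite (carrier (v_class_group Q K))" using fin by (metis finite_imageI)
  moreover obtain \<psi> where "canonical_class_iso Q K \<psi>" using K.class_iso .
  then have "bij_betw \<psi> (carrier (v_class_group Q K)) (carrier K.WCl)"
    unfolding canonical_class_iso_def iso_def by blast
  ultimately show ?thesis using bij_betw_finite by blast
qed

text \<open>\<open>H\<close> embeds into the product of the units of its complete integral closure and the free abelian
group of divisors, by a retraction onto the units in the first component.\<close>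

lemma c_monoid_H:
  assumes ind: "\<And>p. p \<in> X \<Longrightarrow> independent p"
    and fin: "\<And>p. p \<in> Pstar \<Longrightarrow> finite (carrier (loc_grp p))"
    and fincl: "finite (carrier (v_class_group Q H))"
  shows "c_monoid (Q\<lparr>carrier := H\<rparr>)"
proof -
  obtain r where r': "\<forall>x\<in>carrier Q. r x \<in> {x \<in> carrier Q. \<forall>P\<in>K.X. val P x = 0}"
    "\<forall>x\<in>carrier Q. \<forall>y\<in>carrier Q. r (x \<otimes> y) = r x \<otimes> r y"
    "\<forall>n\<in>{x \<in> carrier Q. \<forall>P\<in>K.X. val P x = 0}. r n = n"
    using valuation_retraction[of K.X val, OF valD(1) val_finite] .
  have UK_val: "x \<in> UK \<longleftrightarrow> x \<in> carrier Q \<and> (\<forall>P\<in>K.X. val P x = 0)" for x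
    unfolding K.Units_H_iff using KU_iff by blast
  have r: "r x \<in> UK" "r (x \<otimes> y) = r x \<otimes> r y" if "x \<in> carrier Q" "y \<in> carrier Q" for x y
    using r' that UK_val by blast+
  have rU: "r u = u" if "u \<in> UK" for u using r'(3) that UK_val by blast
  have UKQ: "u \<in> carrier Q" if "u \<in> UK" for u using that UK_val by blast
  have sK: "subgroup UK Q" by (rule Units_subgroup[OF hat_submonoid])
  interpret UK: comm_group "Q\<lparr>carrier := UK\<rparr>" by (rule subgroup_is_comm_group[OF sK])
  interpret D: comm_group K.Div by (rule K.group_Div)
  define G where "G = Q\<lparr>carrier := UK\<rparr> \<times>\<times> K.Div"
  interpret G: comm_group G unfolding G_def 
  proof (rule group.group_comm_groupI[OF DirProd_group[OF UK.is_group D.is_group]])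
    fix y z assume "y \<in> carrier (Q\<lparr>carrier := UK\<rparr> \<times>\<times> K.Div)" "z \<in> carrier (Q\<lparr>carrier := UK\<rparr> \<times>\<times> K.Div)"
    then show "y \<otimes>\<^bsub>Q\<lparr>carrier := UK\<rparr> \<times>\<times> K.Div\<^esub> z = z \<otimes>\<^bsub>Q\<lparr>carrier := UK\<rparr> \<times>\<times> K.Div\<^esub> y"
      using UKQ by (auto simp: mult_DirProd' m_comm D.m_comm)
  qed
  have Gc: "y \<in> carrier G \<longleftrightarrow> fst y \<in> UK \<and> snd y \<in> carrier K.Div" for y
    unfolding G_def by (simp add: mem_Times_iff)
  have Gm: "y \<otimes>\<^bsub>G\<^esub> z = (fst y \<otimes> fst z, snd y \<otimes>\<^bsub>K.Div\<^esub> snd z)" for y z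
    unfolding G_def by (simp add: mult_DirProd')
  have G1: "\<one>\<^bsub>G\<^esub> = (\<one>, \<one>\<^bsub>K.Div\<^esub>)" unfolding G_def by simp
  define w where "w P y = hat_div_val P (snd y)" for P and y :: "'a \<times> ('a set \<Rightarrow> 'a set)"
  have w: "w P (y \<otimes>\<^bsub>G\<^esub> z) = w P y + w P z" if "P \<in> K.X" "y \<in> carrier G" "z \<in> carrier G" for P y z
    using that unfolding w_def Gm by (simp add: Gc hat_div_val_mult)
  have finw: "finite {P \<in> K.X. w P y \<noteq> 0}" if "y \<in> carrier G" for y
    using that finite_hat_div_val unfolding w_def Gc by blast
  \<comment> \<open>The divisor of \<open>x\<close> forgets units of the closure; the retraction
    \<open>r\<close>, being the identity on these units, restores them and makes \<open>e\<close>
    injective.\<close>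
  define e where "e x = (r x, K.cosets (\<lambda>P. x))" for x
  have eG: "e x \<in> carrier G" if "x \<in> carrier Q" for x
    using that r(1)[OF that that] K.cosets_Div[OF K.fam_const] unfolding Gc e_def by simp
  have em: "e (x \<otimes> y) = e x \<otimes>\<^bsub>G\<^esub> e y" if "x \<in> carrier Q" "y \<in> carrier Q" for x y
    unfolding e_def Gm using that r(2) K.mult_Div_fam[OF K.fam_const K.fam_const] by simp
  have we: "w P (e x) = val P x" if "P \<in> K.X" "x \<in> carrier Q" for P x
    unfolding w_def e_def using hat_div_val_cosets[OF K.fam_const] that by simp
  have G_eqI: "y = z" if "y \<in> carrier G" "z \<in> carrier G" "fst y = fst z" "\<forall>P\<in>K.X. w P y = w P z" for y z
    using that hat_div_eqI[of "snd y" "snd z"] unfolding w_def Gc by (simp add: prod_eq_iff)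
  have e_inj: "x = y" if xy: "x \<in> carrier Q" "y \<in> carrier Q" and eq: "e x = e y" for x y
  proof -
    have "val P (inv x \<otimes> y) = 0" if P: "P \<in> K.X" for P
      using we[OF P xy(1)] we[OF P xy(2)] eq xy by (simp add: valD(1,4)[OF P])
    then have "inv x \<otimes> y \<in> UK" using UK_val xy by simp
    then have "r (inv x \<otimes> y) = inv x \<otimes> y" by (rule rU)
    moreover have "r y = r x \<otimes> r (inv x \<otimes> y)" using r(2)[OF xy(1), of "inv x \<otimes> y"] xy by (simp add: cancel_simps)
    moreover have "r x = r y" using eq by (simp add: e_def)
    moreover have "r x \<in> carrier Q" using r(1)[OF xy] UKQ by blast
    ultimately have e: "r x = r x \<otimes> (inv x \<otimes> y)" and rxQ: "r x \<in> carrier Q" by simp_all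
    have "inv (r x) \<otimes> r x = inv (r x) \<otimes> (r x \<otimes> (inv x \<otimes> y))" using arg_cong[OF e] .
    then have "inv x \<otimes> y = \<one>" using rxQ xy by (simp add: cancel_simps)
    then have "x \<otimes> (inv x \<otimes> y) = x" using xy by simp
    then show ?thesis using xy by (simp add: cancel_simps)
  qed
  have "\<exists>c. c \<in> carrier Q \<and> val P c = 1" if "P \<in> K.X" for P
    using ind[OF contraction[OF that]] over_contraction[OF that] unfolding independent_def by blast
  then obtain c where c: "\<And>P. P \<in> K.X \<Longrightarrow> c P \<in> carrier Q \<and> val P (c P) = 1" by metis
  define cc where "cc P P' = (if P' = P then c P else \<one>)" for P P'
  have fcc: "K.fam (cc P)" if "P \<in> K.X" for P
    by (rule K.fam_finite_support[of "{P}"]) (use c[OF that] K.prime in \<open>auto simp: cc_def\<close>)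
  have ccG: "(\<one>, K.cosets (cc P)) \<in> carrier G" if "P \<in> K.X" for P
    using K.cosets_Div[OF fcc[OF that]] subgroup.one_closed[OF sK] by (simp add: Gc)
  have wcc: "w P' (\<one>, K.cosets (cc P)) = (if P = P' then 1 else 0)" if "P \<in> K.X" "P' \<in> K.X" for P P'
    using c[OF that(1)] hat_div_val_cosets[OF fcc[OF that(1)] that(2)] valD(3)[OF that(2)] by (auto simp: w_def cc_def)
  define F where "F = {y \<in> carrier G. \<forall>P\<in>K.X. 0 \<le> w P y}"
  have FG: "y \<in> carrier G" if "y \<in> F" for y using that by (simp add: F_def)
  have Fw: "0 \<le> w P y" if "y \<in> F" "P \<in> K.X" for y P using that by (simp add: F_def)
  have e1: "e \<one> = \<one>\<^bsub>G\<^esub>" unfolding e_def G1 using rU[of \<one>] subgroup.one_closed[OF sK] by (simp add: K.one_Div)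
  have eh: "group_hom Q G e" by unfold_locales (auto intro!: homI eG em)
  interpret e: group_hom Q G e by (rule eh)
  have sub: "submonoid (e ` H) G"
  proof
    show "e ` H \<subseteq> carrier G" using eG by auto
    show "\<one>\<^bsub>G\<^esub> \<in> e ` H" using e1 H_one by (metis imageI)
    fix y z assume "y \<in> e ` H" "z \<in> e ` H"
    then obtain a b where ab: "a \<in> H" "y = e a" "b \<in> H" "z = e b" by blast
    have "y \<otimes>\<^bsub>G\<^esub> z = e (a \<otimes> b)" unfolding ab(2,4) using em ab(1,3) by simp
    then show "y \<otimes>\<^bsub>G\<^esub> z \<in> e ` H" using ab(1,3) by blast
  qed
  have SF: "e ` H \<subseteq> F"
    unfolding F_def using eG we mem_K_iff H_sub_hat by auto
  have S_units: "inv\<^bsub>G\<^esub> y \<in> e ` H" if y: "y \<in> e ` H" "\<forall>P\<in>K.X. w P y = 0" for y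
  proof -
    obtain a where a: "a \<in> H" "y = e a" using y(1) by blast
    have aQ: "a \<in> carrier Q" using a(1) by simp
    have "inv a \<in> L p" if p: "p \<in> X" for p
    proof -
      have "val P a = 0" if P: "P \<in> over p" for P using y(2) overD(1)[OF P] we aQ a(2) by simp
      then have "a \<in> U p" using val_zero_U[OF p] H_sub_L[OF prime[OF p]] a(1) by blast
      then show ?thesis using U_iff[OF prime[OF p]] by blast
    qed
    then have "inv a \<in> H" using mem_H_iff aQ by simp
    moreover have "inv\<^bsub>G\<^esub> y = e (inv a)" unfolding a(2) using e.hom_inv[OF aQ] by simp
    ultimately show ?thesis by blast
  qed
  have eiso: "e \<in> iso (Q\<lparr>carrier := H\<rparr>) (G\<lparr>carrier := e ` H\<rparr>)"
  proof (rule isoI)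
    show "e \<in> hom (Q\<lparr>carrier := H\<rparr>) (G\<lparr>carrier := e ` H\<rparr>)" by (rule homI) (simp_all add: em)
    show "bij_betw e (carrier (Q\<lparr>carrier := H\<rparr>)) (carrier (G\<lparr>carrier := e ` H\<rparr>))"
      unfolding bij_betw_def by (simp add: inj_on_def) (use e_inj in_carrier in blast)
  qed
  \<comment> \<open>The required type consists of sets of pairs: a unit and a divisor are coded as
    the product of a singleton with the ideal of the divisor. Decoding is possible because this
    ideal is not empty.\<close>
  define \<iota> where "\<iota> y = {fst y} \<times> K.ideal_of (SOME x. K.fam x \<and> snd y = K.cosets x)" for y :: "'a \<times> ('a set \<Rightarrow> 'a set)"
  have \<iota>: "inj_on \<iota> F"
  proof (rule inj_onI)
    fix y z assume yz: "y \<in> F" "z \<in> F" and eq: "\<iota> y = \<iota> z"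
    define ry where "ry = (SOME x. K.fam x \<and> snd y = K.cosets x)"
    define rz where "rz = (SOME x. K.fam x \<and> snd z = K.cosets x)"
    have ex: "\<exists>x. K.fam x \<and> snd y = K.cosets x" "\<exists>x. K.fam x \<and> snd z = K.cosets x"
      using FG[OF yz(1)] FG[OF yz(2)] unfolding Gc K.carrier_Div by blast+
    have rep: "K.fam ry \<and> snd y = K.cosets ry" "K.fam rz \<and> snd z = K.cosets rz"
      unfolding ry_def rz_def using someI_ex[OF ex(1)] someI_ex[OF ex(2)] .
    obtain P where P: "P \<in> K.X" using K.X_nonempty by blast
    have "K.ideal_of ry \<noteq> {}" using K.approximation[of ry P] rep P by blast
    then have "fst y = fst z" "K.ideal_of ry = K.ideal_of rz"
      using eq unfolding \<iota>_def ry_def[symmetric] rz_def[symmetric] by (auto simp: times_eq_iff)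
    then show "y = z"
      using rep K.ideal_of_eq_iff[of ry rz] K.cosets_fam_eq_iff[of ry rz] by (simp add: prod_eq_iff)
  qed
  \<comment> \<open>\<open>\<sigma>\<close> records the class and the supports above the conductor,
    but not yet the cosets of local units; for these a common origin is chosen next.\<close>
  define \<sigma> where "\<sigma> y = (weak_class Q K (snd y), \<lambda>p\<in>Pstar. {P \<in> over p. 0 < w P y})" for y
  \<comment> \<open>A reference element for each value of \<open>\<sigma>\<close>. Elements with the
    same \<open>\<sigma>\<close> have the same class, so \<open>y\<close> differs from its reference
    element by the image of some \<open>q y\<close> in \<open>Q\<close>, and this element has
    cosets.\<close>
  define b where "b t = (SOME y. y \<in> F \<and> \<sigma> y = t)" for t
  have b: "b (\<sigma> y) \<in> F" "\<sigma> (b (\<sigma> y)) = \<sigma> y" if "y \<in> F" for y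
    using someI[of "\<lambda>z. z \<in> F \<and> \<sigma> z = \<sigma> y" y] that unfolding b_def by blast+
  define q where "q y = (SOME x. x \<in> carrier Q \<and> y = b (\<sigma> y) \<otimes>\<^bsub>G\<^esub> e x)" for y
  have q: "q y \<in> carrier Q \<and> y = b (\<sigma> y) \<otimes>\<^bsub>G\<^esub> e (q y)" if y: "y \<in> F" for y
  proof -
    define z where "z = b (\<sigma> y)"
    have z: "z \<in> F" "\<sigma> z = \<sigma> y" using b[OF y] by (simp_all add: z_def)
    have yD: "fst y \<in> UK" "snd y \<in> carrier K.Div" using FG[OF y] by (simp_all add: Gc)
    have zD: "fst z \<in> UK" "snd z \<in> carrier K.Div" using FG[OF z(1)] by (simp_all add: Gc)
    have "weak_class Q K (snd z) = weak_class Q K (snd y)" using z(2) by (simp add: \<sigma>_def)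
    then have "inv\<^bsub>K.Div\<^esub> snd z \<otimes>\<^bsub>K.Div\<^esub> snd y \<in> principal_weak_divisors Q K"
      unfolding weak_class_def using D.rcos_eq_iff[OF K.subgroup_principal zD(2) yD(2)] by blast
    then obtain x where x: "x \<in> carrier Q" "inv\<^bsub>K.Div\<^esub> snd z \<otimes>\<^bsub>K.Div\<^esub> snd y = K.cosets (\<lambda>P. x)"
      unfolding principal_weak_divisors_def by blast
    have sy: "snd y = snd z \<otimes>\<^bsub>K.Div\<^esub> K.cosets (\<lambda>P. x)"
      unfolding x(2)[symmetric] using yD(2) zD(2) by (simp add: D.cancel_simps)
    \<comment> \<open>The principal divisor fixes \<open>x\<close> only up to units of the closure.
      The unit \<open>v\<close> is what \<open>x\<close> lacks for the first components to agree,
      and it leaves all values unchanged.\<close>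
    define v where "v = inv (fst z \<otimes> r x) \<otimes> fst y"
    have v: "v \<in> UK" unfolding v_def
      using subgroup.m_closed[OF sK] subgroup.m_inv_closed[OF sK] zD(1) yD(1) r(1)[OF x(1) x(1)] by blast
    have Qs: "fst z \<in> carrier Q" "r x \<in> carrier Q" "fst y \<in> carrier Q" "v \<in> carrier Q"
      using UKQ zD(1) yD(1) v r(1)[OF x(1) x(1)] by blast+
    have "y = z \<otimes>\<^bsub>G\<^esub> e (x \<otimes> v)"
    proof (rule G_eqI)
      show "y \<in> carrier G" by (rule FG[OF y])
      show "z \<otimes>\<^bsub>G\<^esub> e (x \<otimes> v) \<in> carrier G" using FG[OF z(1)] eG x(1) Qs(4) by simp
      have "fst y = fst z \<otimes> (r x \<otimes> v)" unfolding v_def using Qs by (simp add: inv_mult gsimps cancel_simps)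
      then show "fst y = fst (z \<otimes>\<^bsub>G\<^esub> e (x \<otimes> v))"
        unfolding Gm e_def fst_conv r(2)[OF x(1) Qs(4)] rU[OF v] .
      show "\<forall>P\<in>K.X. w P y = w P (z \<otimes>\<^bsub>G\<^esub> e (x \<otimes> v))"
      proof
        fix P assume P: "P \<in> K.X"
        have "w P y = w P z + val P x"
          unfolding w_def sy using hat_div_val_mult[OF P zD(2) K.cosets_Div[OF K.fam_const[OF x(1)]]]
            hat_div_val_cosets[OF K.fam_const[OF x(1)] P] by simp
        moreover have "val P v = 0" using v UK_val P by blast
        ultimately show "w P y = w P (z \<otimes>\<^bsub>G\<^esub> e (x \<otimes> v))"
          using w[OF P FG[OF z(1)] eG[of "x \<otimes> v"]] we[OF P, of "x \<otimes> v"] x(1) Qs(4) valD(1)[OF P x(1) Qs(4)] by simp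
      qed
    qed
    then have "x \<otimes> v \<in> carrier Q \<and> y = b (\<sigma> y) \<otimes>\<^bsub>G\<^esub> e (x \<otimes> v)" using x(1) Qs(4) by (simp add: z_def)
    then show ?thesis unfolding q_def by (rule someI)
  qed
  \<comment> \<open>Where all values of \<open>y\<close> vanish, those of its reference element
    vanish too, having the same support; so \<open>q y\<close> is a unit of the localized closure
    and finitely many cosets occur.\<close>
  define \<tau> where "\<tau> y = (\<sigma> y, \<lambda>p\<in>Pstar. if \<forall>P\<in>over p. w P y = 0 then U p #> q y else {})" for y
  have supp: "{P \<in> over p. 0 < w P y} = {P \<in> over p. 0 < w P z}" if "\<sigma> y = \<sigma> z" "p \<in> Pstar" for y z p
    using fun_cong[OF arg_cong[OF that(1), of snd], of p] that(2) by (simp add: \<sigma>_def)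
  have zero: "\<forall>P\<in>over p. w P z = 0"
    if "\<sigma> y = \<sigma> z" "p \<in> Pstar" "\<forall>P\<in>over p. w P y = 0" "z \<in> F" for y z p
  proof
    fix P assume P: "P \<in> over p"
    then have "\<not> 0 < w P z" using supp[OF that(1,2)] that(3) by fastforce
    then show "w P z = 0" using Fw[OF that(4) overD(1)[OF P]] by linarith
  qed
  show ?thesis
  proof (rule c_monoid_from_valuations[where w = w and V = K.X and c = "\<lambda>P. (\<one>, K.cosets (cc P))" and K = "e ` H"
        and \<tau> = \<tau>, OF G.comm_group_axioms w finw ccG wcc F_def sub SF S_units _ eiso \<iota>])
    show "monoid (Q\<lparr>carrier := H\<rparr>)" by (rule submonoid_is_monoid) (rule monoid_axioms)
    let ?A = "carrier K.WCl \<times> (\<Pi>\<^sub>E p\<in>Pstar. Pow (over p))"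
    let ?B = "\<Pi>\<^sub>E p\<in>Pstar. (carrier (loc_grp p) \<union> {{}})"
    have "\<tau> ` F \<subseteq> ?A \<times> ?B"
    proof
      fix t assume "t \<in> \<tau> ` F"
      then obtain y where y: "y \<in> F" "t = \<tau> y" by blast
      have "weak_class Q K (snd y) \<in> carrier K.WCl"
        unfolding K.carrier_WCl using FG[OF y(1)] by (simp add: Gc)
      then have "\<sigma> y \<in> ?A" unfolding \<sigma>_def by auto
      moreover have "U p #> q y \<in> carrier (loc_grp p)"
        if p: "p \<in> Pstar" and z: "\<forall>P\<in>over p. w P y = 0" for p
      proof -
        have bz: "\<forall>P\<in>over p. w P (b (\<sigma> y)) = 0" by (rule zero[OF b(2)[OF y(1), symmetric] p z b(1)[OF y(1)]])
        have "val P (q y) = 0" if P: "P \<in> over p" for P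
        proof -
          have "w P y = w P (b (\<sigma> y)) + val P (q y)"
            using q[OF y(1)] w[OF overD(1)[OF P] FG[OF b(1)[OF y(1)]] eG[of "q y"]] we[OF overD(1)[OF P], of "q y"] by simp
          then show ?thesis using z bz P by simp
        qed
        then have "q y \<in> V p" using V_iff[OF PstarD[OF p]] q[OF y(1)] by blast
        then show ?thesis unfolding carrier_FactGroup by auto
      qed
      then have "(\<lambda>p\<in>Pstar. if \<forall>P\<in>over p. w P y = 0 then U p #> q y else {}) \<in> ?B" by auto
      ultimately show "t \<in> ?A \<times> ?B" unfolding y(2) \<tau>_def by blast
    qed
    moreover have "finite (?A \<times> ?B)"
      using finite_hat_class_group[OF ind fincl] finite_Pstar finite_over PstarD fin
      by (intro finite_cartesian_product finite_PiE) auto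
    ultimately show "finite (\<tau> ` F)" by (rule finite_subset)
  next
    fix y z x assume yzx: "y \<in> F" "z \<in> F" "x \<in> F" and t: "\<tau> y = \<tau> z" and xy: "x \<otimes>\<^bsub>G\<^esub> y \<in> e ` H"
    have st: "\<sigma> y = \<sigma> z" using t by (simp add: \<tau>_def)
    obtain h where h: "h \<in> H" "x \<otimes>\<^bsub>G\<^esub> y = e h" using xy by blast
    have hQ: "h \<in> carrier Q" using h(1) by simp
    note qy = q[OF yzx(1)] and qz = q[OF yzx(2), folded st]
    have qyQ: "q y \<in> carrier Q" "q z \<in> carrier Q" using qy qz by blast+
    \<comment> \<open>As \<open>y\<close> and \<open>z\<close> share their reference element,
      replacing \<open>y\<close> by \<open>z\<close> amounts to multiplication by
      \<open>q z / q y\<close>.\<close>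
    define d where "d = h \<otimes> (inv (q y) \<otimes> q z)"
    have dQ: "d \<in> carrier Q" using hQ qy qz by (simp add: d_def)
    have bG: "b (\<sigma> y) \<in> carrier G" by (rule FG[OF b(1)[OF yzx(1)]])
    have xG: "x \<in> carrier G" by (rule FG[OF yzx(3)])
    have "e d = (x \<otimes>\<^bsub>G\<^esub> (b (\<sigma> y) \<otimes>\<^bsub>G\<^esub> e (q y))) \<otimes>\<^bsub>G\<^esub> (inv\<^bsub>G\<^esub> e (q y) \<otimes>\<^bsub>G\<^esub> e (q z))"
      unfolding d_def conjunct2[OF qy, symmetric] using hQ qyQ h(2) by (simp add: em)
    also have "\<dots> = x \<otimes>\<^bsub>G\<^esub> (b (\<sigma> y) \<otimes>\<^bsub>G\<^esub> e (q z))"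
      using bG xG eG[OF qyQ(1)] eG[OF qyQ(2)] by (simp add: G.gsimps G.cancel_simps)
    also have "\<dots> = x \<otimes>\<^bsub>G\<^esub> z" using conjunct2[OF qz] by simp
    finally have ed: "e d = x \<otimes>\<^bsub>G\<^esub> z" .
    have vh: "val P h = w P x + w P y" "val P d = w P x + w P z" if P: "P \<in> K.X" for P
      using we[OF P hQ] we[OF P dQ] h(2) ed w[OF P xG FG[OF yzx(1)]] w[OF P xG FG[OF yzx(2)]] by simp_all
    have "d \<in> L p" if p: "p \<in> X" for p
    proof (cases "p \<in> Pstar")
      case True
      have nn: "0 \<le> w P x \<and> 0 \<le> w P y \<and> 0 \<le> w P z" if "P \<in> over p" for P
        using Fw yzx overD(1)[OF that] by blast
      show ?thesis
      proof (rule L_transfer[OF p _ dQ vh(1) vh(2) nn supp[OF st True]])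
        show "h \<in> L p" using H_sub_L[OF prime[OF p]] h(1) by blast
        assume z0: "\<forall>P\<in>over p. w P y = 0"
        have "U p #> q y = U p #> q z"
          using fun_cong[OF arg_cong[OF t, of snd], of p] True z0 zero[OF st True z0 yzx(2)] by (simp add: \<tau>_def)
        then have "inv (q y) \<otimes> q z \<in> U p" using rcos_eq_iff[OF U_subgroup[OF prime[OF p]]] qy qz by blast
        then show "inv h \<otimes> d \<in> U p" unfolding d_def using hQ qy qz by (simp add: cancel_simps)
      qed (use overD(1) in blast)+
    next
      case False
      show ?thesis
      proof (rule L_of_val_nonneg[OF p False dQ])
        show "0 \<le> val P d" if P: "P \<in> over p" for P
          using vh(2)[OF overD(1)[OF P]] Fw yzx overD(1)[OF P] by (metis add_nonneg_nonneg)
      qed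
    qed
    then have "d \<in> H" using mem_H_iff dQ by blast
    then show "x \<otimes>\<^bsub>G\<^esub> z \<in> e ` H" unfolding ed[symmetric] by blast
  qed
qed

section \<open>The three parts of the theorem put together\<close>

lemma outside_Pstar: "p \<in> X - Pstar \<Longrightarrow> \<exists>v. discrete_val (L p) v"
  by (rule outside_conductor_discrete_val[OF v_noeth]) (auto simp: Pstar_def)

lemma localizations:
  "\<forall>p\<in>X - Pstar. discrete_valuation_monoid (Q\<lparr>carrier := L p\<rparr>)"
  "\<forall>p\<in>X. seminormal Q (L p) \<and> v_noetherian Q (L p) \<and> primary_monoid (Q\<lparr>carrier := L p\<rparr>)"
proof -
  show "\<forall>p\<in>X - Pstar. discrete_valuation_monoid (Q\<lparr>carrier := L p\<rparr>)"
    using outside_Pstar discrete_valuation_monoid_of_val by (metis (no_types))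
  show "\<forall>p\<in>X. seminormal Q (L p) \<and> v_noetherian Q (L p) \<and> primary_monoid (Q\<lparr>carrier := L p\<rparr>)"
  proof (intro ballI conjI)
    fix p assume p: "p \<in> X"
    show "seminormal Q (L p)" by (rule seminormal_L[OF semi prime[OF p]])
    show "v_noetherian Q (L p)" by (rule v_noetherian_L[OF v_noeth prime[OF p]])
    show "primary_monoid (Q\<lparr>carrier := L p\<rparr>)" by (rule primary_monoid_L[OF p])
  qed
qed

lemma finitely_primary_of_domain:
  fixes R :: "('r, 'n) ring_scheme"
  assumes "domain R" "mult_of R \<cong> Q\<lparr>carrier := H\<rparr>" and p: "p \<in> X"
  shows "finitely_primary Q (L p)"
proof -
  interpret R: domain R by fact
  obtain \<phi> where \<phi>: "\<phi> \<in> iso (mult_of R) (Q\<lparr>carrier := H\<rparr>)" using assms(2) unfolding is_iso_def by blast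
  interpret D: seminormal_weakly_krull_domain Q H R \<phi> by unfold_locales (rule \<phi>)
  show ?thesis by (rule independent_finitely_primary[OF p D.independent_domain[OF p]])
qed

lemma Inv_structure:
  "X - Pstar \<subseteq> carrier Inv"
  "\<exists>\<chi>\<in>iso Inv (free_abelian_monoid (X - Pstar) \<times>\<times> product_group Pstar (\<lambda>p. monoid_red (Q\<lparr>carrier := L p\<rparr>))).
    \<forall>p\<in>X - Pstar. \<chi> p = ({#p#}, \<one>\<^bsub>product_group Pstar (\<lambda>p. monoid_red (Q\<lparr>carrier := L p\<rparr>))\<^esub>)"
proof -
  show "X - Pstar \<subseteq> carrier Inv"
  proof
    fix p assume p: "p \<in> X - Pstar"
    obtain v where v: "discrete_val (L p) v" using outside_Pstar[OF p] by blast
    obtain c where c: "c \<in> carrier Q" "v c = 1" using discrete_val_one[OF v] by blast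
    have pX: "p \<in> X" using p by blast
    note ideal = min_prime_ideal_of[OF pX v c]
    show "p \<in> carrier Inv" by (subst ideal(1)) (rule ideal_of_Inv[OF ideal(2)])
  qed
  show "\<exists>\<chi>\<in>iso Inv (free_abelian_monoid (X - Pstar) \<times>\<times> product_group Pstar (\<lambda>p. monoid_red (Q\<lparr>carrier := L p\<rparr>))).
    \<forall>p\<in>X - Pstar. \<chi> p = ({#p#}, \<one>\<^bsub>product_group Pstar (\<lambda>p. monoid_red (Q\<lparr>carrier := L p\<rparr>))\<^esub>)"
  proof (rule Inv_iso_product)
    show "X = (X - Pstar) \<union> Pstar" using PstarD by blast
  qed (use finite_Pstar outside_Pstar in auto)
qed

lemma class_groups_iso: "v_class_group Q H \<cong> weak_class_group Q H"
proof -
  obtain \<psi> where "canonical_class_iso Q H \<psi>" using class_iso .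
  then show ?thesis unfolding canonical_class_iso_def by (blast intro: is_isoI)
qed

end

theorem theorem5p5:
  fixes Q :: "('a, 'm) monoid_scheme" and H :: "'a set"
    and R :: "('r, 'n) ring_scheme"
  defines "Hc \<equiv> complete_int_closure Q H"
  defines "f \<equiv> colon Q H Hc"
  defines "X \<equiv> min_primes Q H"
  defines "Pstar \<equiv> {p \<in> X. f \<subseteq> p}"
  defines "P \<equiv> X - Pstar"
  defines "Hloc \<equiv> (\<lambda>p. localize Q H p H)"
  defines "Hloc_mon \<equiv> (\<lambda>p. Q\<lparr>carrier := Hloc p\<rparr>)"
  defines "Hc_grp \<equiv> Q\<lparr>carrier := Units (Q\<lparr>carrier := Hc\<rparr>)\<rparr> Mod Units (Q\<lparr>carrier := H\<rparr>)"
  defines "loc_grp \<equiv> (\<lambda>p. Q\<lparr>carrier := Units (Q\<lparr>carrier := localize Q H p Hc\<rparr>)\<rparr> Mod Units (Hloc_mon p))"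
  defines "I \<equiv> v_inv_monoid Q H"
  assumes "quotient_group_of Q H"
    and "seminormal Q H" and "v_noetherian Q H" and "weakly_krull Q H"
    and "f \<noteq> {}" and "f \<subset> H"
  shows
    "(krull Q Hc \<and> finite Pstar \<and> (\<forall>p\<in>P. discrete_valuation_monoid (Hloc_mon p)) \<and>
      (\<forall>p\<in>X. seminormal Q (Hloc p) \<and> v_noetherian Q (Hloc p) \<and> primary_monoid (Hloc_mon p)) \<and>
      (domain R \<and> mult_of R \<cong> Q\<lparr>carrier := H\<rparr> \<longrightarrow> (\<forall>p\<in>X. finitely_primary Q (Hloc p)))) \<and>

     (P \<subseteq> carrier I \<and>
      (\<exists>\<chi> \<in> iso I (free_abelian_monoid P \<times>\<times> product_group Pstar (\<lambda>p. monoid_red (Hloc_mon p))).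
        \<forall>p\<in>P. \<chi> p = ({#p#}, \<one>\<^bsub>product_group Pstar (\<lambda>p. monoid_red (Hloc_mon p))\<^esub>)) \<and>
      seminormal (quot_group I) (quot_embed I ` carrier I) \<and>
      v_noetherian (quot_group I) (quot_embed I ` carrier I) \<and>
      weakly_factorial I \<and>
      v_class_group Q H \<cong> weak_class_group Q H) \<and>

     ((\<forall>p\<in>X. finitely_primary Q (Hloc p)) \<longrightarrow>
      (\<exists>\<iota> \<psi> \<epsilon> \<theta>.
        canonical_class_iso Q H \<psi> \<and>
        \<iota> \<in> hom Hc_grp (sum_group X loc_grp) \<and>
        \<epsilon> \<in> hom (sum_group X loc_grp) (v_class_group Q H) \<and>
        \<theta> \<in> hom (v_class_group Q H) (v_class_group Q Hc) \<and>
        (\<forall>u\<in>Units (Q\<lparr>carrier := Hc\<rparr>).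
          \<iota> (Units (Q\<lparr>carrier := H\<rparr>) #>\<^bsub>Q\<^esub> u) = local_unit_cosets Q H (\<lambda>p. u)) \<and>
        (\<forall>y\<in>carrier (sum_group X loc_grp).
          y \<in> carrier (weak_divisors Q H) \<and> \<psi> (\<epsilon> y) = weak_class Q H y) \<and>
        (\<forall>A\<in>carrier I. v_closure Q Hc A \<in> carrier (v_inv_monoid Q Hc) \<and>
          \<theta> (v_class Q H A) = v_class Q Hc (v_closure Q Hc A)) \<and>
        inj_on \<iota> (carrier Hc_grp) \<and>
        \<iota> ` carrier Hc_grp = kernel (sum_group X loc_grp) (v_class_group Q H) \<epsilon> \<and>
        \<epsilon> ` carrier (sum_group X loc_grp) = kernel (v_class_group Q H) (v_class_group Q Hc) \<theta> \<and>
        \<theta> ` carrier (v_class_group Q H) = carrier (v_class_group Q Hc)) \<and>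
      ((\<forall>p\<in>Pstar. finite (carrier (loc_grp p))) \<longrightarrow>
        c_monoid I \<and>
        (finite (carrier (v_class_group Q H)) \<longrightarrow> c_monoid (Q\<lparr>carrier := H\<rparr>))))"
proof -
  interpret quotient_group_of Q H by fact
  have cond: "colon Q H (complete_int_closure Q H) \<noteq> {}" "colon Q H (complete_int_closure Q H) \<subset> H"
    using assms(15,16) unfolding f_def Hc_def by blast+
  \<comment> \<open>If \<open>H\<close> were all of \<open>Q\<close>, then so would be its closure,
    against \<open>hat_proper\<close>.\<close>
  have "H \<noteq> carrier Q" using hat_proper[OF cond] H_sub_hat hat_carrier by blast
  then interpret S: seminormal_weakly_krull Q H
    by (intro seminormal_weakly_krull.intro mori_weakly_krull.intro mori_weakly_krull_axioms.intro
        seminormal_weakly_krull_axioms.intro quotient_group_of_axioms cond assms(12,13,14))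
  note Ps = S.Pstar_def
  have part1: "krull Q Hc \<and> finite Pstar \<and> (\<forall>p\<in>P. discrete_valuation_monoid (Hloc_mon p)) \<and>
      (\<forall>p\<in>X. seminormal Q (Hloc p) \<and> v_noetherian Q (Hloc p) \<and> primary_monoid (Hloc_mon p)) \<and>
      (domain R \<and> mult_of R \<cong> Q\<lparr>carrier := H\<rparr> \<longrightarrow> (\<forall>p\<in>X. finitely_primary Q (Hloc p)))"
    unfolding assms(1-10) Ps[symmetric]
    using S.K_krull S.finite_Pstar S.localizations S.finitely_primary_of_domain[of R] by blast
  have part2: "P \<subseteq> carrier I \<and>
      (\<exists>\<chi> \<in> iso I (free_abelian_monoid P \<times>\<times> product_group Pstar (\<lambda>p. monoid_red (Hloc_mon p))).
        \<forall>p\<in>P. \<chi> p = ({#p#}, \<one>\<^bsub>product_group Pstar (\<lambda>p. monoid_red (Hloc_mon p))\<^esub>)) \<and>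
      seminormal (quot_group I) (quot_embed I ` carrier I) \<and>
      v_noetherian (quot_group I) (quot_embed I ` carrier I) \<and>
      weakly_factorial I \<and> v_class_group Q H \<cong> weak_class_group Q H"
    unfolding assms(1-10) Ps[symmetric]
    by (intro conjI S.Inv_structure S.seminormal_Inv S.v_noetherian_Inv S.weakly_factorial_Inv S.class_groups_iso S.semi)
  \<comment> \<open>Finite primariness enters the third part through the independence of the
    values.\<close>
  have ind: "S.independent p" if "\<forall>p\<in>X. finitely_primary Q (Hloc p)" "p \<in> min_primes Q H" for p
    using that S.finitely_primary_independent[of p] unfolding assms(1-10) by blast
  show ?thesis
  proof (intro conjI[OF part1] conjI[OF part2] impI conjI)
    assume fp: "\<forall>p\<in>X. finitely_primary Q (Hloc p)"
    note i = ind[OF fp]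
    show "\<exists>\<iota> \<psi> \<epsilon> \<theta>.
        canonical_class_iso Q H \<psi> \<and>
        \<iota> \<in> hom Hc_grp (sum_group X loc_grp) \<and>
        \<epsilon> \<in> hom (sum_group X loc_grp) (v_class_group Q H) \<and>
        \<theta> \<in> hom (v_class_group Q H) (v_class_group Q Hc) \<and>
        (\<forall>u\<in>Units (Q\<lparr>carrier := Hc\<rparr>).
          \<iota> (Units (Q\<lparr>carrier := H\<rparr>) #>\<^bsub>Q\<^esub> u) = local_unit_cosets Q H (\<lambda>p. u)) \<and>
        (\<forall>y\<in>carrier (sum_group X loc_grp).
          y \<in> carrier (weak_divisors Q H) \<and> \<psi> (\<epsilon> y) = weak_class Q H y) \<and>
        (\<forall>A\<in>carrier I. v_closure Q Hc A \<in> carrier (v_inv_monoid Q Hc) \<and>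
          \<theta> (v_class Q H A) = v_class Q Hc (v_closure Q Hc A)) \<and>
        inj_on \<iota> (carrier Hc_grp) \<and>
        \<iota> ` carrier Hc_grp = kernel (sum_group X loc_grp) (v_class_group Q H) \<epsilon> \<and>
        \<epsilon> ` carrier (sum_group X loc_grp) = kernel (v_class_group Q H) (v_class_group Q Hc) \<theta> \<and>
        \<theta> ` carrier (v_class_group Q H) = carrier (v_class_group Q Hc)"
      unfolding assms(1-10) by (rule S.exact_sequence[OF i])
    assume fin: "\<forall>p\<in>Pstar. finite (carrier (loc_grp p))"
    then have fin': "finite (carrier (S.loc_grp p))" if "p \<in> S.Pstar" for p
      using that unfolding assms(1-10) Ps by blast
    show "c_monoid I" unfolding I_def by (rule S.c_monoid_Inv[OF i fin'])
    assume "finite (carrier (v_class_group Q H))"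
    then show "c_monoid (Q\<lparr>carrier := H\<rparr>)" by (rule S.c_monoid_H[OF i fin', rotated -1])
  qed
qed

end
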